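(* Let $\theta\in[0,1]$ and assume that $m_\lambda(p)=\int_{\mathbb R}|z|^p\lambda(dz)<\infty$ for all $p\in[1,3)$ and that the step sizes $(n,\tau)$ satisfy the step-size condition (S) stated in the context. Then there exists a unique mild solution $u^{n,\tau}$ of the fully discrete scheme, and for every $p\in[1,3)$ there is a constant $C>0$, independent of $i$, $n$ and $\tau$, such that $$\sup_{x\in[0,1]}\mathbb E\big[|u^{n,\tau}(t_i,\kappa_n(x))|^p\big]\le Ce^{Ct_i},\qquad i\ge 1 .$$ If in addition $L_\sigma:=\sup_{x\ne y}\big|\frac{\sigma(x)-\sigma(y)}{x-y}\big|>0$, $J_0:=\inf_{x\in\mathbb R\setminus\{0\}}\big|\frac{\sigma(x)}{x}\big|>0$, $u_0\equiv c$ for a constant $c>0$, and $b=-\int_{\{|z|>1\}}z\,\lambda(dz)$, then the fully discrete scheme is weakly intermittent of order $p$ for every $p\in(1,3)$, i.e. $$0<\underline\gamma^{n,\tau}(p)\le\bar\gamma^{n,\tau}(p)<\infty,\qquad p\in(1,3),$$ where $$\bar\gamma^{n,\tau}(p):=\limsup_{i\to\infty}\frac{\sup_{x\in[0,1]}\log\mathbb E[|u^{n,\tau}(t_i,\kappa_n(x))|^p]}{t_i},\qquad \underline\gamma^{n,\tau}(p):=\liminf_{i\to\infty}\frac{\inf_{x\in[0,1]}\log\mathbb E[|u^{n,\tau}(t_i,\kappa_n(x))|^p]}{t_i}.$$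
   Context: Equation. The scheme discretizes the stochastic heat equation $\partial_tu=\partial_x^2u+\sigma(u)\dot\Lambda$ on $[0,1]$ with periodic boundary condition and $u(0,\cdot)=u_0$, where $\sigma:\mathbb R\to\mathbb R$ is globally Lipschitz and $u_0:[0,1]\to\mathbb R$ is bounded, non-negative, non-random and measurable. Noise. On a complete filtered probability space, $$\Lambda(dt,dx)=b\,dt\,dx+\int_{\{|z|\le1\}}z\,\tilde\mu(dt,dx,dz)+\int_{\{|z|>1\}}z\,\mu(dt,dx,dz),$$ where $b\in\mathbb R$, $\mu$ is a Poisson random measure on $(0,\infty)\times[0,1]\times\mathbb R$ with intensity measure $dt\,dx\,\lambda(dz)$, $\tilde\mu$ is its compensated version, and $\lambda$ is a Lévy measure on $\mathbb R$ that is not identically zero: $\lambda(\{0\})=0$, $\int_{\mathbb R}(1\wedge|z|^2)\lambda(dz)<\infty$. Scheme. Let $n\ge3$ be an integer, $\tau\in(0,\frac12)$, $t_i=i\tau$, $x_j=\frac jn$, $\kappa_\tau(s)=[\frac s\tau]\tau$, $\kappa_n(y)=\frac{[ny]}n$ ($[\cdot]$ is the greatest integer function). The fully discrete scheme is $$u^{n,\tau}(t_{i+1},x_j)=u^{n,\tau}(t_i,x_j)+(1-\theta)\tau\Delta_nu^{n,\tau}(t_i,\cdot)(x_j)+\theta\tau\Delta_nu^{n,\tau}(t_{i+1},\cdot)(x_j)+n\,\sigma(u^{n,\tau}(t_i,x_j))\,\Lambda([t_i,t_{i+1})\times[x_j,x_{j+1})),$$ $j=0,\dots,n-1$, with $u^{n,\tau}(t_i,0)=u^{n,\tau}(t_i,1)$,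 $u^{n,\tau}(t_i,-\frac1n)=u^{n,\tau}(t_i,\frac{n-1}n)$, $u^{n,\tau}(0,x_j)=u_0(x_j)$, and $\Delta_nv(x_j)=n^2(v(x_{j+1})-2v(x_j)+v(x_{j-1}))$. Its mild form, for $t=i\tau$, $i\ge1$, $x\in[0,1]$, is $$u^{n,\tau}(t,x)=\int_0^1G^{n,\tau}_1(t,x,y)u_0(\kappa_n(y))dy+\int_0^t\int_0^1G^{n,\tau}_2(t-\kappa_\tau(s)-\tau,x,y)\sigma(u^{n,\tau}(\kappa_\tau(s),\kappa_n(y)))\Lambda(ds,dy)\quad\text{a.s.},$$ where, with $e_l(x)=e^{2\pi\mathbf ilx}$, $\lambda^n_l=-4n^2\sin^2(\frac{l\pi}n)$, $R_{1,l}=(1-\theta\tau\lambda^n_l)^{-1}$, $R_{2,l}=1+(1-\theta)\tau\lambda^n_l$, $$G^{n,\tau}_1(t,x,y)=\sum_{l=0}^{n-1}(R_{1,l}R_{2,l})^{[\frac t\tau]}e_l(\kappa_n(x))\bar e_l(\kappa_n(y))\mathbf 1_{\{t\ge0\}},\quad G^{n,\tau}_2(t,x,y)=\sum_{l=0}^{n-1}(R_{1,l}R_{2,l})^{[\frac t\tau]}R_{1,l}e_l(\kappa_n(x))\bar e_l(\kappa_n(y))\mathbf 1_{\{t\ge0\}}.$$ Step-size condition (S). (i) If $0\le\theta<\frac12$: $n^2\tau\le\rho<\frac1{2-4\theta}$ for some fixed constant $\rho>0$. (ii) If $\theta=\frac12$: $n^2\tau\le\frac1\epsilon-\frac12$ for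 a fixed $\epsilon\in(0,\frac12)$. (iii) If $\frac12<\theta\le1$: no coupling requirement on $n,\tau$. Constants may depend on $\theta,\rho,\epsilon$, the noise, $\sigma$, $u_0$ and $p$. *)

theory Defs
  imports "HOL-Probability.Probability"
begin

section \<open>The driving noise\<close>

definition levy_measure :: "real measure \<Rightarrow> bool" where
  "levy_measure lam \<longleftrightarrow>
     sets lam = sets borel \<and> emeasure lam {0} = 0 \<and>
     (\<integral>\<^sup>+ z. ennreal (min 1 (\<bar>z\<bar>\<^sup>2)) \<partial>lam) < \<infinity>"

definition abs_moment :: "real measure \<Rightarrow> real \<Rightarrow> ennreal" where
  "abs_moment lam p = (\<integral>\<^sup>+ z. ennreal (\<bar>z\<bar> powr p) \<partial>lam)"

text \<open>
  The filtration is indexed by all reals, as a filtration on \<open>[0, \<infinity>)\<close> may be extended by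
  \<open>F t = F 0\<close> for \<open>t < 0\<close>; only \<open>t \<ge> 0\<close> is used below.
\<close>

definition complete_filtered_prob_space :: "'a measure \<Rightarrow> (real \<Rightarrow> 'a measure) \<Rightarrow> bool" where
  "complete_filtered_prob_space M F \<longleftrightarrow>
     prob_space M \<and> complete_measure M \<and> filtration (space M) F \<and>
     (\<forall>t. subalgebra M (F t)) \<and> null_sets M \<subseteq> sets (F 0)"

definition poisson_random_measure ::
    "'a measure \<Rightarrow> 'b measure \<Rightarrow> ('a \<Rightarrow> 'b measure) \<Rightarrow> bool" where
  "poisson_random_measure M N mu \<longleftrightarrow>
     (\<forall>\<omega>\<in>space M. sets (mu \<omega>) = sets N) \<and>
     (\<forall>\<omega>\<in>space M. \<forall>B\<in>sets N. emeasure (mu \<omega>) B \<in> insert \<infinity> (range of_nat)) \<and>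
     (\<forall>B\<in>sets N. (\<lambda>\<omega>. emeasure (mu \<omega>) B) \<in> borel_measurable M) \<and>
     (\<forall>B\<in>sets N. emeasure N B < \<infinity> \<longrightarrow>
        (\<forall>k::nat. measure M {\<omega> \<in> space M. emeasure (mu \<omega>) B = of_nat k}
           = measure N B ^ k / fact k * exp (- measure N B))) \<and>
     (\<forall>B\<in>sets N. emeasure N B = \<infinity> \<longrightarrow> (AE \<omega> in M. emeasure (mu \<omega>) B = \<infinity>)) \<and>
     (\<forall>B :: nat \<Rightarrow> 'b set. range B \<subseteq> sets N \<longrightarrow> disjoint_family B \<longrightarrow>
        prob_space.indep_vars M (\<lambda>_. borel) (\<lambda>i \<omega>. emeasure (mu \<omega>) (B i)) UNIV)"

text \<open>The measure \<open>dt dx lam(dz)\<close> on \<open>(0,\<infinity>) \<times> [0,1] \<times> \<real>\<close>.\<close>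

definition noise_intensity :: "real measure \<Rightarrow> (real \<times> real \<times> real) measure" where
  "noise_intensity lam =
     restrict_space lborel {0<..} \<Otimes>\<^sub>M (restrict_space lborel {0..1} \<Otimes>\<^sub>M lam)"

text \<open>
  Poisson random measure relative to the filtration: what happens up to time \<open>t\<close> is
  \<open>F t\<close>-measurable, and the sigma-algebra generated by what happens after time \<open>t\<close> is
  independent of \<open>F t\<close>.
\<close>

definition levy_noise_jumps ::
    "'a measure \<Rightarrow> (real \<Rightarrow> 'a measure) \<Rightarrow> real measure \<Rightarrow>
      ('a \<Rightarrow> (real \<times> real \<times> real) measure) \<Rightarrow> bool" where
  "levy_noise_jumps M F lam mu \<longleftrightarrow>
     poisson_random_measure M (noise_intensity lam) mu \<and>
     (\<forall>t\<ge>0. \<forall>B\<in>sets (noise_intensity lam). B \<subseteq> {0<..t} \<times> UNIV \<longrightarrow>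
        (\<lambda>\<omega>. emeasure (mu \<omega>) B) \<in> borel_measurable (F t)) \<and>
     (\<forall>t\<ge>0. prob_space.indep_set M (sets (F t))
        (sigma_sets (space M)
          {(\<lambda>\<omega>. emeasure (mu \<omega>) B) -` A \<inter> space M | A B.
             A \<in> sets borel \<and> B \<in> sets (noise_intensity lam) \<and> B \<subseteq> {t<..} \<times> UNIV}))"


section \<open>Integration against the noise\<close>

definition converges_in_probability ::
    "'a measure \<Rightarrow> ('i \<Rightarrow> 'a \<Rightarrow> complex) \<Rightarrow> ('a \<Rightarrow> complex) \<Rightarrow> 'i filter \<Rightarrow> bool" where
  "converges_in_probability M X Y Fl \<longleftrightarrow>
     (\<forall>\<^sub>F i in Fl. X i \<in> borel_measurable M) \<and> Y \<in> borel_measurable M \<and>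
     (\<forall>\<delta>>0. ((\<lambda>i. measure M {\<omega> \<in> space M. \<delta> < norm (X i \<omega> - Y \<omega>)}) \<longlongrightarrow> 0) Fl)"

text \<open>
  The integral of \<open>z H(s,y)\<close> against \<open>mu\<close> over \<open>(0,T] \<times> [0,1] \<times> Z\<close>, that is, over the jumps
  with size in \<open>Z\<close>.
\<close>

definition jump_integrable ::
    "('a \<Rightarrow> (real \<times> real \<times> real) measure) \<Rightarrow> real \<Rightarrow> real set \<Rightarrow>
      (real \<Rightarrow> real \<Rightarrow> 'a \<Rightarrow> complex) \<Rightarrow> 'a \<Rightarrow> bool" where
  "jump_integrable mu T Z H \<omega> \<longleftrightarrow>
     set_integrable (mu \<omega>) ({0<..T} \<times> {0..1} \<times> Z) (\<lambda>(s, y, z). z *\<^sub>R H s y \<omega>)"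

definition jump_integral ::
    "('a \<Rightarrow> (real \<times> real \<times> real) measure) \<Rightarrow> real \<Rightarrow> real set \<Rightarrow>
      (real \<Rightarrow> real \<Rightarrow> 'a \<Rightarrow> complex) \<Rightarrow> 'a \<Rightarrow> complex" where
  "jump_integral mu T Z H \<omega> =
     set_lebesgue_integral (mu \<omega>) ({0<..T} \<times> {0..1} \<times> Z) (\<lambda>(s, y, z). z *\<^sub>R H s y \<omega>)"

definition drift_integral ::
    "real \<Rightarrow> (real \<Rightarrow> real \<Rightarrow> 'a \<Rightarrow> complex) \<Rightarrow> 'a \<Rightarrow> complex" where
  "drift_integral T H \<omega> =
     set_lebesgue_integral lborel ({0<..T} \<times> {0..1}) (\<lambda>(s, y). H s y \<omega>)"

text \<open>
  \<open>has_noise_integral M lam mu b H T I\<close> says that almost surely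
  \<open>I = \<integral>\<^sub>0\<^sup>T \<integral>\<^sub>0\<^sup>1 H(s,y) \<Lambda>(ds,dy)\<close> for the noise
  \<open>\<Lambda>(ds,dy) = b ds dy + \<integral>\<^bsub>|z| \<le> 1\<^esub> z (mu - ds dy lam)(ds,dy,dz) + \<integral>\<^bsub>|z| > 1\<^esub> z mu(ds,dy,dz)\<close>,
  where \<open>H\<close> is a predictable integrand.  The drift and the large jumps are integrated
  pathwise.  The compensated small jumps are the limit in probability, as \<open>e\<close> decreases
  to \<open>0\<close>, of the compensated integrals over \<open>e < |z| \<le> 1\<close>; this is the usual stochastic
  integral, and the limit also holds in \<open>L\<^sup>2\<close> when \<open>H\<close> is square integrable.
  Integrability is required explicitly since non-integrable functions have integral \<open>0\<close>.
\<close>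

definition has_noise_integral ::
    "'a measure \<Rightarrow> real measure \<Rightarrow> ('a \<Rightarrow> (real \<times> real \<times> real) measure) \<Rightarrow> real \<Rightarrow>
      (real \<Rightarrow> real \<Rightarrow> 'a \<Rightarrow> complex) \<Rightarrow> real \<Rightarrow> ('a \<Rightarrow> complex) \<Rightarrow> bool" where
  "has_noise_integral M lam mu b H T I \<longleftrightarrow>
     (AE \<omega> in M. set_integrable lborel ({0<..T} \<times> {0..1}) (\<lambda>(s, y). H s y \<omega>)) \<and>
     (AE \<omega> in M. jump_integrable mu T {z. 1 < \<bar>z\<bar>} H \<omega>) \<and>
     (\<forall>e\<in>{0<..<1}. AE \<omega> in M. jump_integrable mu T {z. e < \<bar>z\<bar> \<and> \<bar>z\<bar> \<le> 1} H \<omega>) \<and>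
     (\<exists>S. converges_in_probability M
            (\<lambda>e \<omega>. jump_integral mu T {z. e < \<bar>z\<bar> \<and> \<bar>z\<bar> \<le> 1} H \<omega>
                   - (LINT z:{z. e < \<bar>z\<bar> \<and> \<bar>z\<bar> \<le> 1}|lam. z) *\<^sub>R drift_integral T H \<omega>)
            S (at_right 0) \<and>
          (AE \<omega> in M. I \<omega> = b *\<^sub>R drift_integral T H \<omega> + S \<omega>
                             + jump_integral mu T {z. 1 < \<bar>z\<bar>} H \<omega>))"


section \<open>The fully discrete scheme in mild form\<close>

definition kappa_time :: "real \<Rightarrow> real \<Rightarrow> real" where
  "kappa_time \<tau> s = of_int \<lfloor>s / \<tau>\<rfloor> * \<tau>"

definition kappa_space :: "nat \<Rightarrow> real \<Rightarrow> real" where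
  "kappa_space n y = of_int \<lfloor>real n * y\<rfloor> / real n"

definition e_fun :: "nat \<Rightarrow> real \<Rightarrow> complex" where
  "e_fun l x = exp (2 * of_real pi * \<i> * of_nat l * of_real x)"

definition lambda_disc :: "nat \<Rightarrow> nat \<Rightarrow> real" where
  "lambda_disc n l = - 4 * (real n)\<^sup>2 * (sin (real l * pi / real n))\<^sup>2"

definition R1 :: "real \<Rightarrow> nat \<Rightarrow> real \<Rightarrow> nat \<Rightarrow> real" where
  "R1 \<theta> n \<tau> l = inverse (1 - \<theta> * \<tau> * lambda_disc n l)"

definition R2 :: "real \<Rightarrow> nat \<Rightarrow> real \<Rightarrow> nat \<Rightarrow> real" where
  "R2 \<theta> n \<tau> l = 1 + (1 - \<theta>) * \<tau> * lambda_disc n l"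

definition G1 :: "real \<Rightarrow> nat \<Rightarrow> real \<Rightarrow> real \<Rightarrow> real \<Rightarrow> real \<Rightarrow> complex" where
  "G1 \<theta> n \<tau> t x y =
     (\<Sum>l<n. of_real ((R1 \<theta> n \<tau> l * R2 \<theta> n \<tau> l) ^ nat \<lfloor>t / \<tau>\<rfloor>)
        * e_fun l (kappa_space n x) * cnj (e_fun l (kappa_space n y)) * indicator {0..} t)"

definition G2 :: "real \<Rightarrow> nat \<Rightarrow> real \<Rightarrow> real \<Rightarrow> real \<Rightarrow> real \<Rightarrow> complex" where
  "G2 \<theta> n \<tau> t x y =
     (\<Sum>l<n. of_real ((R1 \<theta> n \<tau> l * R2 \<theta> n \<tau> l) ^ nat \<lfloor>t / \<tau>\<rfloor> * R1 \<theta> n \<tau> l)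
        * e_fun l (kappa_space n x) * cnj (e_fun l (kappa_space n y)) * indicator {0..} t)"

text \<open>
  The kernels are written as complex sums, so the mild equation is an equation between
  complex numbers; the solution itself is real.  A random field is only constrained at the
  times \<open>i \<tau>\<close> and on \<open>[0,1]\<close>.  At time \<open>0\<close> it is the step function with the
  values \<open>u\<^sub>0(j/n)\<close>, \<open>j < n\<close>, and, by periodicity, the value \<open>u\<^sub>0(0)\<close> at \<open>x = 1\<close>.
\<close>

definition mild_solution ::
    "'a measure \<Rightarrow> (real \<Rightarrow> 'a measure) \<Rightarrow> real measure \<Rightarrow>
      ('a \<Rightarrow> (real \<times> real \<times> real) measure) \<Rightarrow> real \<Rightarrow> (real \<Rightarrow> real) \<Rightarrow> (real \<Rightarrow> real) \<Rightarrow>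
      real \<Rightarrow> nat \<Rightarrow> real \<Rightarrow> (real \<Rightarrow> real \<Rightarrow> 'a \<Rightarrow> real) \<Rightarrow> bool" where
  "mild_solution M F lam mu b \<sigma> u0 \<theta> n \<tau> u \<longleftrightarrow>
     (\<forall>i::nat. \<forall>x\<in>{0..1}. u (real i * \<tau>) x \<in> borel_measurable (F (real i * \<tau>))) \<and>
     (\<forall>x\<in>{0..<1}. AE \<omega> in M. u 0 x \<omega> = u0 (kappa_space n x)) \<and>
     (AE \<omega> in M. u 0 1 \<omega> = u0 0) \<and>
     (\<forall>i\<ge>1. \<forall>x\<in>{0..1}. let t = real i * \<tau> in
        \<exists>I. has_noise_integral M lam mu b
              (\<lambda>s y \<omega>. G2 \<theta> n \<tau> (t - kappa_time \<tau> s - \<tau>) x y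
                 * of_real (\<sigma> (u (kappa_time \<tau> s) (kappa_space n y) \<omega>))) t I \<and>
            (AE \<omega> in M. complex_of_real (u t x \<omega>) =
               (LINT y:{0..1}|lborel. G1 \<theta> n \<tau> t x y * of_real (u0 (kappa_space n y))) + I \<omega>))"

text \<open>
  The standing range of \<open>n\<close> and \<open>\<tau>\<close> together with the coupling of the two;
  \<open>\<rho>\<close> matters only for \<open>\<theta> < 1/2\<close> and \<open>\<epsilon>\<close> only for \<open>\<theta> = 1/2\<close>.
\<close>

definition step_size_condition :: "real \<Rightarrow> real \<Rightarrow> real \<Rightarrow> nat \<Rightarrow> real \<Rightarrow> bool" where
  "step_size_condition \<theta> \<rho> \<epsilon> n \<tau> \<longleftrightarrow>
     n \<ge> 3 \<and> 0 < \<tau> \<and> \<tau> < 1 / 2 \<and>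
     (\<theta> < 1 / 2 \<longrightarrow> 0 < \<rho> \<and> (real n)\<^sup>2 * \<tau> \<le> \<rho> \<and> \<rho> < 1 / (2 - 4 * \<theta>)) \<and>
     (\<theta> = 1 / 2 \<longrightarrow> 0 < \<epsilon> \<and> \<epsilon> < 1 / 2 \<and> (real n)\<^sup>2 * \<tau> \<le> 1 / \<epsilon> - 1 / 2)"


section \<open>Moments and intermittency\<close>

definition moment ::
    "'a measure \<Rightarrow> (real \<Rightarrow> real \<Rightarrow> 'a \<Rightarrow> real) \<Rightarrow> real \<Rightarrow> real \<Rightarrow> real \<Rightarrow> ennreal" where
  "moment M u p t x = (\<integral>\<^sup>+ \<omega>. ennreal (\<bar>u t x \<omega>\<bar> powr p) \<partial>M)"

definition ln_ennreal :: "ennreal \<Rightarrow> ereal" where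
  "ln_ennreal a = (if a = 0 then - \<infinity> else if a = \<infinity> then \<infinity> else ereal (ln (enn2real a)))"

definition upper_moment_exponent ::
    "'a measure \<Rightarrow> (real \<Rightarrow> real \<Rightarrow> 'a \<Rightarrow> real) \<Rightarrow> nat \<Rightarrow> real \<Rightarrow> real \<Rightarrow> ereal" where
  "upper_moment_exponent M u n \<tau> p =
     limsup (\<lambda>i. (SUP x\<in>{0..1}. ln_ennreal (moment M u p (real i * \<tau>) (kappa_space n x)))
                 / ereal (real i * \<tau>))"

definition lower_moment_exponent ::
    "'a measure \<Rightarrow> (real \<Rightarrow> real \<Rightarrow> 'a \<Rightarrow> real) \<Rightarrow> nat \<Rightarrow> real \<Rightarrow> real \<Rightarrow> ereal" where
  "lower_moment_exponent M u n \<tau> p =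
     liminf (\<lambda>i. (INF x\<in>{0..1}. ln_ennreal (moment M u p (real i * \<tau>) (kappa_space n x)))
                 / ereal (real i * \<tau>))"

definition weakly_intermittent ::
    "'a measure \<Rightarrow> (real \<Rightarrow> real \<Rightarrow> 'a \<Rightarrow> real) \<Rightarrow> nat \<Rightarrow> real \<Rightarrow> real \<Rightarrow> bool" where
  "weakly_intermittent M u n \<tau> p \<longleftrightarrow>
     0 < lower_moment_exponent M u n \<tau> p \<and>
     lower_moment_exponent M u n \<tau> p \<le> upper_moment_exponent M u n \<tau> p \<and>
     upper_moment_exponent M u n \<tau> p < \<infinity>"

definition L_const :: "(real \<Rightarrow> real) \<Rightarrow> real" where
  "L_const \<sigma> = (SUP (x, y)\<in>{(x, y). x \<noteq> y}. \<bar>(\<sigma> x - \<sigma> y) / (x - y)\<bar>)"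

definition J_const :: "(real \<Rightarrow> real) \<Rightarrow> real" where
  "J_const \<sigma> = (INF x\<in>- {0}. \<bar>\<sigma> x / x\<bar>)"

end

theory Submission
  imports Defs
begin

text \<open>
  Against the integrands of the scheme, which are constant on grid cells, the stochastic integral is
  a finite sum of noise increments, so the mild equation is an explicit recursion in time; this gives
  existence and uniqueness.

  For the moment bound, a linear combination of increments is dominated by a weighted sum of the
  numbers of jumps in dyadic shells, which are independent Poisson variables.  The Mecke formula
  \<open>E[X g(W + cX)] = r E[g(W + c(X + 1))]\<close> bounds its moments of order \<open>2 \<le> p < 3\<close> by the time step times
  the averaged \<open>p\<close>-th powers of the coefficients.  The Fourier multipliers of the scheme decay like
  \<open>1 / (1 - c t \<lambda>\<^sub>l)\<close>, so the \<open>p\<close>-th power of the kernel has spatial average of order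
  \<open>1 + t powr (- (p - 1) / 2)\<close>.  Since \<open>(p - 1) / 2 < 1\<close>, the moments satisfy a Volterra inequality with
  integrable singularity, and they grow at most exponentially.

  If the noise is centered and the initial value is a constant, the spatial average of the solution
  is a martingale.  Its increment over a time step involves some \<open>\<sigma>(u)\<close> with
  \<open>|\<sigma>(u)|\<close> at least \<open>J\<^sub>0\<close> times the modulus of the average, so by strict convexity of
  \<open>|x|\<^sup>p\<close> each time step multiplies its \<open>p\<close>-th moment by at least \<open>1 + \<delta>\<close>.  After a fixed number of steps
  the kernel is at least \<open>1/2\<close> everywhere, which transfers this growth to every point.
\<close>

section \<open>The amplification factors\<close>

lemma one_minus_power_le:
  fixes x :: real
  assumes "0 \<le> x" "x \<le> 1"
  shows "(1 - x) ^ k \<le> 1 / (1 + real k * x)"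
proof -
  have "(1 - x) ^ k * (1 + real k * x) \<le> (1 - x) ^ k * (1 + x) ^ k"
    using assms Bernoulli_inequality[of x k] by (intro mult_left_mono) auto
  also have "\<dots> = (1 - x\<^sup>2) ^ k"
    by (simp add: power_mult_distrib[symmetric] power2_eq_square algebra_simps)
  also have "\<dots> \<le> 1"
    using assms by (intro power_le_one) (auto simp: power_le_one)
  finally show ?thesis
    using assms by (subst pos_le_divide_eq) (auto intro: add_pos_nonneg)
qed

lemma abs_ratio_le:
  fixes \<theta> a c :: real
  assumes "0 \<le> \<theta>" "\<theta> \<le> 1" "0 \<le> a" "0 < c" "c \<le> 1" "c * (1 + \<theta> * a) \<le> 2 - (1 - 2 * \<theta>) * a"
  shows "\<bar>(1 - (1 - \<theta>) * a) / (1 + \<theta> * a)\<bar> \<le> 1 - c * (a / (1 + a))"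
proof -
  have pos: "1 + \<theta> * a > 0" using assms by (simp add: add_pos_nonneg)
  have "\<theta> * a \<le> a" using assms by (simp add: mult_left_le_one_le)
  then have 1: "a / (1 + a) \<le> a / (1 + \<theta> * a)"
    using assms pos by (intro divide_left_mono) (auto intro!: mult_pos_pos)
  have frac: "0 \<le> a / (1 + a)" "a / (1 + a) \<le> 1" using assms by (auto simp: field_simps)
  have "c * (a / (1 + a)) \<le> 1 * (a / (1 + a))" by (rule mult_right_mono) (use assms frac in auto)
  also note 1
  also have "1 * (a / (1 + \<theta> * a)) = 1 - (1 - (1 - \<theta>) * a) / (1 + \<theta> * a)"
    using pos by (simp add: field_simps)
  finally have A: "(1 - (1 - \<theta>) * a) / (1 + \<theta> * a) \<le> 1 - c * (a / (1 + a))"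
    using pos by (auto simp: field_simps)
  have "c * (a / (1 + a)) \<le> c * 1" by (rule mult_left_mono) (use assms frac in auto)
  also have "c * 1 \<le> (2 - (1 - 2 * \<theta>) * a) / (1 + \<theta> * a)" using assms pos by (simp add: field_simps)
  also have "\<dots> = 1 + (1 - (1 - \<theta>) * a) / (1 + \<theta> * a)" using pos by (simp add: field_simps)
  finally have B: "- ((1 - (1 - \<theta>) * a) / (1 + \<theta> * a)) \<le> 1 - c * (a / (1 + a))" by simp
  from A B show ?thesis by linarith
qed

lemma abs_ratio_power_le:
  fixes \<theta> a c :: real
  assumes "0 \<le> \<theta>" "\<theta> \<le> 1" "0 \<le> a" "0 < c" "c \<le> 1" "c * (1 + \<theta> * a) \<le> 2 - (1 - 2 * \<theta>) * a"
  shows "\<bar>(1 - (1 - \<theta>) * a) / (1 + \<theta> * a)\<bar> ^ k \<le> 1 / (1 + real k * (c * (a / (1 + a))))"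
proof -
  have frac: "0 \<le> a / (1 + a)" "a / (1 + a) \<le> 1" using assms by (auto simp: field_simps)
  have "\<bar>(1 - (1 - \<theta>) * a) / (1 + \<theta> * a)\<bar> ^ k \<le> (1 - c * (a / (1 + a))) ^ k"
    by (intro power_mono abs_ratio_le assms) auto
  also have "\<dots> \<le> 1 / (1 + real k * (c * (a / (1 + a))))"
    using frac assms mult_le_one[of c "a / (1 + a)"] by (intro one_minus_power_le) auto
  finally show ?thesis .
qed

lemma resolvent_decay_bounded:
  fixes \<theta> a c A :: real
  assumes "0 \<le> \<theta>" "\<theta> \<le> 1" "0 \<le> a" "a \<le> A" "0 < c" "c \<le> 1" "c * (1 + \<theta> * a) \<le> 2 - (1 - 2 * \<theta>) * a"
  shows "\<bar>(1 - (1 - \<theta>) * a) / (1 + \<theta> * a)\<bar> ^ k \<le> (1 + A) / (1 + c / (1 + A) * real (k + 1) * a)"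
proof -
  define d where "d = c / (1 + A)"
  have A: "0 \<le> A" using assms by linarith
  have d: "0 < d" "d \<le> 1" using assms A by (auto simp: d_def field_simps)
  have "d * a \<le> c * (a / (1 + a))"
    using assms A by (auto simp: d_def intro!: divide_left_mono mult_pos_pos)
  then have "1 + real k * (d * a) \<le> 1 + real k * (c * (a / (1 + a)))"
    by (intro add_left_mono mult_left_mono) auto
  then have "1 / (1 + real k * (c * (a / (1 + a)))) \<le> 1 / (1 + real k * (d * a))"
    using d assms by (intro divide_left_mono) (auto intro!: mult_pos_pos add_pos_nonneg)
  also have "\<dots> \<le> (1 + A) / (1 + d * real (k + 1) * a)"
  proof -
    have "d * a \<le> 1 * A" by (rule mult_mono) (use d assms A in auto)
    moreover have "0 \<le> A * (real k * (d * a))" using d assms A by simp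
    ultimately have "1 + d * real (k + 1) * a \<le> (1 + A) * (1 + real k * (d * a))"
      by (simp add: algebra_simps)
    moreover have "0 < 1 + d * real (k + 1) * a" "0 < 1 + real k * (d * a)"
      using d assms by (auto intro!: add_pos_nonneg)
    ultimately show ?thesis by (simp add: pos_divide_le_eq pos_le_divide_eq)
  qed
  finally show ?thesis using abs_ratio_power_le[OF assms(1-3,5-7), of k] unfolding d_def by linarith
qed

lemma resolvent_decay_unbounded:
  fixes \<theta> a :: real
  assumes "1 / 2 < \<theta>" "\<theta> \<le> 1" "0 \<le> a"
  shows "\<bar>(1 - (1 - \<theta>) * a) / (1 + \<theta> * a)\<bar> ^ k * inverse (1 + \<theta> * a)
     \<le> 1 / (1 + (2 * \<theta> - 1) / 2 * real (k + 1) * a)"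
proof -
  define c where "c = 2 * \<theta> - 1"
  have c: "0 < c" "c \<le> 1" using assms by (auto simp: c_def)
  have cc: "c * (1 + \<theta> * a) \<le> 2 - (1 - 2 * \<theta>) * a"
  proof -
    have "\<theta> * a \<le> a" using assms by (simp add: mult_left_le_one_le)
    then have "c * (\<theta> * a) \<le> c * a" using c by simp
    then show ?thesis using c by (simp add: c_def algebra_simps)
  qed
  define y where "y = real k * (c * (a / (1 + a)))"
  have y: "0 \<le> y" using assms c by (simp add: y_def)
  have "\<bar>(1 - (1 - \<theta>) * a) / (1 + \<theta> * a)\<bar> ^ k \<le> 1 / (1 + y)"
    unfolding y_def by (rule abs_ratio_power_le) (use assms c cc in auto)
  moreover have "inverse (1 + \<theta> * a) \<le> 1 / (1 + a / 2)"
    using assms mult_right_mono[of 1 "2 * \<theta>" a] by (simp add: divide_simps)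
  ultimately have "\<bar>(1 - (1 - \<theta>) * a) / (1 + \<theta> * a)\<bar> ^ k * inverse (1 + \<theta> * a) \<le> 1 / (1 + y) * (1 / (1 + a / 2))"
    by (rule mult_mono) (use assms y in auto)
  also have "\<dots> = 1 / ((1 + y) * (1 + a / 2))" by simp
  also have "\<dots> \<le> 1 / (1 + c / 2 * real (k + 1) * a)"
  proof -
    have "(1 + y) * (1 + a / 2) = 1 + a / 2 + y * (1 + a / 2)" by (simp add: algebra_simps)
    moreover have "real k * (c * (a / 2)) \<le> y * (1 + a / 2)"
    proof -
      have "a / 2 \<le> a / (1 + a) * (1 + a / 2)" using assms by (simp add: field_simps)
      then have "real k * c * (a / 2) \<le> real k * c * (a / (1 + a) * (1 + a / 2))"
        by (rule mult_left_mono) (use c in auto)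
      then show ?thesis by (simp add: y_def mult.assoc)
    qed
    moreover have "c * (a / 2) \<le> a / 2" using c assms by (simp add: mult_left_le_one_le)
    ultimately have "1 + c / 2 * real (k + 1) * a \<le> (1 + y) * (1 + a / 2)"
      by (simp add: field_simps)
    then show ?thesis using c assms y
      by (intro divide_left_mono) (auto intro!: mult_pos_pos add_pos_nonneg)
  qed
  finally show ?thesis by (simp add: c_def)
qed

lemma power_diff_decay:
  fixes r e R K c a :: real
  assumes re: "\<bar>r - e\<bar> \<le> D * R" and R: "0 \<le> R" and e: "\<bar>e\<bar> < 1" and D: "0 \<le> D"
    and dec: "\<And>m. \<bar>r\<bar> ^ m * R \<le> K / (1 + c * real (m + 1) * a)"
    and K: "0 \<le> K" and ca: "0 \<le> c" "0 \<le> a"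
  shows "\<bar>r ^ (k + 1) - e ^ (k + 1)\<bar> \<le> D * K * (\<Sum>q. real (q + 1) * \<bar>e\<bar> ^ q) / (1 + c * real (k + 1) * a)"
proof -
  have summ: "summable (\<lambda>q. real (q + 1) * \<bar>e\<bar> ^ q)"
    using geometric_deriv_sums[of "\<bar>e\<bar>"] e by (auto simp: sums_iff)
  have term_le: "\<bar>e\<bar> ^ (k - m) * (\<bar>r\<bar> ^ m * R)
       \<le> real (k - m + 1) * \<bar>e\<bar> ^ (k - m) * (K / (1 + c * real (k + 1) * a))" if "m \<le> k" for m
  proof -
    have "1 + c * real (k + 1) * a \<le> real (k - m + 1) * (1 + c * real (m + 1) * a)"
    proof -
      have "real (k + 1) \<le> real (k - m + 1) * real (m + 1)"
      proof -
        have "k + 1 \<le> (k - m + 1) * (m + 1)" using that by (auto simp: algebra_simps le_iff_add)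
        then show ?thesis by (metis of_nat_le_iff of_nat_mult)
      qed
      then have "c * real (k + 1) * a \<le> c * (real (k - m + 1) * real (m + 1)) * a"
        using ca by (intro mult_right_mono mult_left_mono) auto
      then show ?thesis by (simp add: algebra_simps)
    qed
    then have "K / (1 + c * real (m + 1) * a) \<le> real (k - m + 1) * (K / (1 + c * real (k + 1) * a))"
    proof -
      assume *: "1 + c * real (k + 1) * a \<le> real (k - m + 1) * (1 + c * real (m + 1) * a)"
      have "0 < 1 + c * real (m + 1) * a" "0 < 1 + c * real (k + 1) * a"
        using ca by (auto intro!: add_pos_nonneg)
      then have "1 / (1 + c * real (m + 1) * a) \<le> real (k - m + 1) / (1 + c * real (k + 1) * a)"
        using * by (simp add: divide_simps mult.commute)
      from mult_left_mono[OF this K] show ?thesis by (simp add: mult_ac)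
    qed
    with dec[of m] have "\<bar>r\<bar> ^ m * R \<le> real (k - m + 1) * (K / (1 + c * real (k + 1) * a))" by linarith
    from mult_left_mono[OF this, of "\<bar>e\<bar> ^ (k - m)"] show ?thesis by (simp add: mult_ac)
  qed
  have "\<bar>r ^ (k + 1) - e ^ (k + 1)\<bar> = \<bar>r - e\<bar> * \<bar>\<Sum>m<k+1. e ^ (k - m) * r ^ m\<bar>"
    using power_diff_sumr2[of r "k + 1" e] by (simp add: abs_mult)
  also have "\<dots> \<le> (D * R) * (\<Sum>m<k+1. \<bar>e\<bar> ^ (k - m) * \<bar>r\<bar> ^ m)"
    using D R by (intro mult_mono re order.trans[OF sum_abs]) (auto simp: abs_mult power_abs)
  also have "\<dots> = D * (\<Sum>m<k+1. \<bar>e\<bar> ^ (k - m) * (\<bar>r\<bar> ^ m * R))"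
    by (simp only: sum_distrib_left mult_ac)
  also have "\<dots> \<le> D * (\<Sum>m<k+1. real (k - m + 1) * \<bar>e\<bar> ^ (k - m) * (K / (1 + c * real (k + 1) * a)))"
    by (intro mult_left_mono sum_mono term_le D) auto
  also have "\<dots> = D * (K / (1 + c * real (k + 1) * a)) * (\<Sum>m<k+1. real (k - m + 1) * \<bar>e\<bar> ^ (k - m))"
    by (subst sum_distrib_right[symmetric]) (simp only: mult_ac)
  also have "(\<Sum>m<k+1. real (k - m + 1) * \<bar>e\<bar> ^ (k - m)) = (\<Sum>q<k+1. real (q + 1) * \<bar>e\<bar> ^ q)"
    using sum.nat_diff_reindex[of "\<lambda>q. real (q + 1) * \<bar>e\<bar> ^ q" "k + 1"] by simp
  also have "D * (K / (1 + c * real (k + 1) * a)) * \<dots>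
      \<le> D * (K / (1 + c * real (k + 1) * a)) * (\<Sum>q. real (q + 1) * \<bar>e\<bar> ^ q)"
    using D K ca by (intro mult_left_mono sum_le_suminf summ) auto
  finally show ?thesis by simp
qed

lemma R1_conv: "R1 \<theta> n \<tau> l = inverse (1 + \<theta> * (- (\<tau> * lambda_disc n l)))"
  by (simp add: R1_def mult.assoc)

lemma R2_conv: "R2 \<theta> n \<tau> l = 1 - (1 - \<theta>) * (- (\<tau> * lambda_disc n l))"
  by (simp add: R2_def mult.assoc)

lemma R1R2_conv:
  "R1 \<theta> n \<tau> l * R2 \<theta> n \<tau> l =
     (1 - (1 - \<theta>) * (- (\<tau> * lambda_disc n l))) / (1 + \<theta> * (- (\<tau> * lambda_disc n l)))"
  by (simp only: R1_conv R2_conv divide_inverse mult.commute)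

lemma scaled_eigenvalue_nonneg: "0 \<le> \<tau> \<Longrightarrow> 0 \<le> - (\<tau> * lambda_disc n l)"
  by (auto simp: lambda_disc_def mult_nonneg_nonpos)

lemma R1_bounds:
  assumes "0 \<le> \<theta>" "0 \<le> \<tau>"
  shows "0 < R1 \<theta> n \<tau> l" "R1 \<theta> n \<tau> l \<le> 1"
proof -
  have "0 \<le> \<theta> * (- (\<tau> * lambda_disc n l))"
    using assms scaled_eigenvalue_nonneg[of \<tau> n l] by (intro mult_nonneg_nonneg) auto
  then show "0 < R1 \<theta> n \<tau> l" "R1 \<theta> n \<tau> l \<le> 1"
    unfolding R1_conv by (auto intro!: inverse_le_1_iff[THEN iffD2])
qed

lemma multiplier_decay:
  assumes \<theta>: "0 \<le> \<theta>" "\<theta> \<le> 1"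
  obtains K c e :: real where "1 \<le> K" "0 < c" "\<bar>e\<bar> \<le> 1"
    and "\<And>n \<tau> l. step_size_condition \<theta> \<rho> \<epsilon> n \<tau> \<Longrightarrow> \<bar>R1 \<theta> n \<tau> l * R2 \<theta> n \<tau> l\<bar> \<le> 1"
    and "\<And>n \<tau> l k. step_size_condition \<theta> \<rho> \<epsilon> n \<tau> \<Longrightarrow>
      \<bar>R1 \<theta> n \<tau> l * R2 \<theta> n \<tau> l\<bar> ^ k * R1 \<theta> n \<tau> l
        \<le> K / (1 + c * real (k + 1) * (- (\<tau> * lambda_disc n l)))"
    and "\<And>n \<tau> l k. step_size_condition \<theta> \<rho> \<epsilon> n \<tau> \<Longrightarrow>
      \<bar>(R1 \<theta> n \<tau> l * R2 \<theta> n \<tau> l) ^ (k + 1) - e ^ (k + 1)\<bar>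
        \<le> K / (1 + c * real (k + 1) * (- (\<tau> * lambda_disc n l)))"
proof (cases "1 / 2 < \<theta>")
  case True
  define e where "e = - (1 - \<theta>) / \<theta>"
  define c where "c = (2 * \<theta> - 1) / 2"
  define K where "K = max 1 (1 / \<theta> * 1 * (\<Sum>q. real (q + 1) * \<bar>e\<bar> ^ q))"
  have e: "\<bar>e\<bar> < 1" using True \<theta> by (simp add: e_def field_simps)
  have pos: "0 < 1 + \<theta> * (- (\<tau> * lambda_disc n l))" if "0 \<le> \<tau>" for n \<tau> l
    using \<theta> scaled_eigenvalue_nonneg[OF that, of n l] by (intro add_pos_nonneg mult_nonneg_nonneg) auto
  have dec: "\<bar>R1 \<theta> n \<tau> l * R2 \<theta> n \<tau> l\<bar> ^ k * R1 \<theta> n \<tau> l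
        \<le> 1 / (1 + c * real (k + 1) * (- (\<tau> * lambda_disc n l)))"
    if "step_size_condition \<theta> \<rho> \<epsilon> n \<tau>" for n \<tau> l k
    unfolding R1R2_conv unfolding R1_conv c_def
    using that by (intro resolvent_decay_unbounded True \<theta> scaled_eigenvalue_nonneg)
      (auto simp: step_size_condition_def)
  have nn: "0 \<le> c * real (k + 1) * (- (\<tau> * lambda_disc n l))" if "0 \<le> \<tau>" for k n \<tau> l
    using True scaled_eigenvalue_nonneg[OF that, of n l] by (intro mult_nonneg_nonneg) (auto simp: c_def)
  show ?thesis
  proof (rule that[of K c e])
    show "1 \<le> K" "0 < c" "\<bar>e\<bar> \<le> 1" using True e by (auto simp: K_def c_def)
  next
    fix n \<tau> l assume S: "step_size_condition \<theta> \<rho> \<epsilon> n \<tau>"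
    then have \<tau>: "0 \<le> \<tau>" by (simp add: step_size_condition_def)
    have "\<theta> * (- (\<tau> * lambda_disc n l)) \<ge> 0"
      using \<theta> scaled_eigenvalue_nonneg[OF \<tau>, of n l] by (intro mult_nonneg_nonneg) auto
    moreover have "(1 - \<theta>) * (- (\<tau> * lambda_disc n l)) \<le> \<theta> * (- (\<tau> * lambda_disc n l))"
      using True scaled_eigenvalue_nonneg[OF \<tau>, of n l] by (intro mult_right_mono) auto
    moreover have "(1 - \<theta>) * (- (\<tau> * lambda_disc n l)) \<ge> 0"
      using \<theta> scaled_eigenvalue_nonneg[OF \<tau>, of n l] by (intro mult_nonneg_nonneg) auto
    ultimately show "\<bar>R1 \<theta> n \<tau> l * R2 \<theta> n \<tau> l\<bar> \<le> 1"
      unfolding R1R2_conv by (subst abs_divide, subst divide_le_eq_1) linarith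
  next
    fix n \<tau> l k assume S: "step_size_condition \<theta> \<rho> \<epsilon> n \<tau>"
    then have \<tau>: "0 \<le> \<tau>" by (simp add: step_size_condition_def)
    show "\<bar>R1 \<theta> n \<tau> l * R2 \<theta> n \<tau> l\<bar> ^ k * R1 \<theta> n \<tau> l
        \<le> K / (1 + c * real (k + 1) * (- (\<tau> * lambda_disc n l)))"
      using nn[OF \<tau>, of k n l]
      by (intro order.trans[OF dec[OF S]] divide_right_mono) (auto simp: K_def)
    have "R1 \<theta> n \<tau> l * R2 \<theta> n \<tau> l - e = 1 / \<theta> * R1 \<theta> n \<tau> l"
      unfolding R1R2_conv unfolding R1_conv e_def using True pos[OF \<tau>, of n l] by (simp add: field_simps)
    then have re: "\<bar>R1 \<theta> n \<tau> l * R2 \<theta> n \<tau> l - e\<bar> \<le> 1 / \<theta> * R1 \<theta> n \<tau> l"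
      using R1_bounds(1)[OF \<theta>(1) \<tau>, of n l] True by simp
    have "\<bar>(R1 \<theta> n \<tau> l * R2 \<theta> n \<tau> l) ^ (k + 1) - e ^ (k + 1)\<bar>
       \<le> 1 / \<theta> * 1 * (\<Sum>q. real (q + 1) * \<bar>e\<bar> ^ q) / (1 + c * real (k + 1) * (- (\<tau> * lambda_disc n l)))"
      using True R1_bounds(1)[OF \<theta>(1) \<tau>, of n l]
      by (intro power_diff_decay[OF re _ e _ dec[OF S]] scaled_eigenvalue_nonneg \<tau>) (auto simp: c_def)
    also have "\<dots> \<le> K / (1 + c * real (k + 1) * (- (\<tau> * lambda_disc n l)))"
      using nn[OF \<tau>, of k n l] by (intro divide_right_mono) (auto simp: K_def)
    finally show "\<bar>(R1 \<theta> n \<tau> l * R2 \<theta> n \<tau> l) ^ (k + 1) - e ^ (k + 1)\<bar>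
       \<le> K / (1 + c * real (k + 1) * (- (\<tau> * lambda_disc n l)))" .
  qed
next
  case False
  define A where "A = (if \<theta> < 1 / 2 then 4 * \<rho> else 4 * (1 / \<epsilon> - 1 / 2))"
  define d where "d = min 1 ((2 - (1 - 2 * \<theta>) * A) / (1 + A))"
  define c where "c = d / (1 + A)"
  have *: "0 \<le> A \<and> 0 < d \<and> - (\<tau> * lambda_disc n l) \<le> A \<and>
      d * (1 + \<theta> * (- (\<tau> * lambda_disc n l))) \<le> 2 - (1 - 2 * \<theta>) * (- (\<tau> * lambda_disc n l))"
    if S: "step_size_condition \<theta> \<rho> \<epsilon> n \<tau>" for n \<tau> l
  proof -
    have A0: "0 \<le> A" and A2: "(1 - 2 * \<theta>) * A < 2" and nA: "4 * ((real n)\<^sup>2 * \<tau>) \<le> A"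
    proof -
      have "0 \<le> A \<and> (1 - 2 * \<theta>) * A < 2 \<and> 4 * ((real n)\<^sup>2 * \<tau>) \<le> A"
      proof (cases "\<theta> < 1 / 2")
        case True
        then have "\<rho> * (2 - 4 * \<theta>) < 1"
          using S pos_less_divide_eq[of "2 - 4 * \<theta>" \<rho> 1] by (auto simp: step_size_condition_def)
        with True S show ?thesis by (auto simp: A_def step_size_condition_def algebra_simps)
      next
        case f: False
        then have "\<theta> = 1 / 2" using False by simp
        then have S': "0 < \<epsilon>" "\<epsilon> < 1 / 2" "(real n)\<^sup>2 * \<tau> \<le> 1 / \<epsilon> - 1 / 2" "\<theta> = 1 / 2"
          using S by (auto simp: step_size_condition_def)
        have "1 / \<epsilon> > 2" using S' by (simp add: field_simps)
        moreover have "A = 4 * (1 / \<epsilon> - 1 / 2)" using f by (simp add: A_def)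
        ultimately show ?thesis unfolding S'(4) using S' by simp
      qed
      then show "0 \<le> A" "(1 - 2 * \<theta>) * A < 2" "4 * ((real n)\<^sup>2 * \<tau>) \<le> A" by auto
    qed
    have d0: "0 < d" using A0 A2 by (simp add: d_def)
    have "- (\<tau> * lambda_disc n l) = 4 * ((real n)\<^sup>2 * \<tau>) * (sin (real l * pi / real n))\<^sup>2"
      by (simp add: lambda_disc_def)
    also have "\<dots> \<le> 4 * ((real n)\<^sup>2 * \<tau>) * 1"
      using S by (intro mult_left_mono) (auto simp: step_size_condition_def abs_square_le_1)
    finally have aA: "- (\<tau> * lambda_disc n l) \<le> A" using nA by simp
    have "d * (1 + \<theta> * (- (\<tau> * lambda_disc n l))) \<le> d * (1 + 1 * A)"
      using d0 aA A0 \<theta> S scaled_eigenvalue_nonneg[of \<tau> n l]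
      by (intro mult_left_mono add_left_mono mult_mono) (auto simp: step_size_condition_def)
    also have "\<dots> \<le> (2 - (1 - 2 * \<theta>) * A) / (1 + A) * (1 + 1 * A)"
      using A0 by (intro mult_right_mono) (auto simp: d_def)
    also have "\<dots> = 2 - (1 - 2 * \<theta>) * A" using A0 by (simp add: field_simps)
    also have "\<dots> \<le> 2 - (1 - 2 * \<theta>) * (- (\<tau> * lambda_disc n l))"
      using False aA by (intro diff_left_mono mult_left_mono) auto
    finally show ?thesis using A0 d0 aA by simp
  qed
  have d1: "d \<le> 1" by (simp add: d_def)
  show ?thesis
  proof (cases "\<exists>n \<tau>. step_size_condition \<theta> \<rho> \<epsilon> n \<tau>")
    case no: False
    show ?thesis by (rule that[of 1 1 0]) (use no in auto)
  next
    case True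
    then have Ad: "0 \<le> A" "0 < d" using * by blast+
    have dec: "\<bar>R1 \<theta> n \<tau> l * R2 \<theta> n \<tau> l\<bar> ^ k
        \<le> (1 + A) / (1 + c * real (k + 1) * (- (\<tau> * lambda_disc n l)))"
      if S: "step_size_condition \<theta> \<rho> \<epsilon> n \<tau>" for n \<tau> l k
      unfolding R1R2_conv c_def
      using *[OF S] d1 \<theta> S scaled_eigenvalue_nonneg[of \<tau> n l]
      by (intro resolvent_decay_bounded) (auto simp: step_size_condition_def)
    have le1: "\<bar>R1 \<theta> n \<tau> l * R2 \<theta> n \<tau> l\<bar> \<le> 1" if S: "step_size_condition \<theta> \<rho> \<epsilon> n \<tau>" for n \<tau> l
    proof -
      have a: "0 \<le> - (\<tau> * lambda_disc n l)" using S by (intro scaled_eigenvalue_nonneg) (auto simp: step_size_condition_def)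
      have "\<bar>R1 \<theta> n \<tau> l * R2 \<theta> n \<tau> l\<bar> \<le> 1 - d * ((- (\<tau> * lambda_disc n l)) / (1 + (- (\<tau> * lambda_disc n l))))"
        unfolding R1R2_conv using *[OF S] d1 \<theta> a by (intro abs_ratio_le) auto
      moreover have "0 \<le> d * ((- (\<tau> * lambda_disc n l)) / (1 + (- (\<tau> * lambda_disc n l))))"
        using a Ad by (intro mult_nonneg_nonneg divide_nonneg_nonneg) auto
      ultimately show ?thesis by linarith
    qed
    show ?thesis
    proof (rule that[of "1 + A" c 0])
      show "1 \<le> 1 + A" "0 < c" "\<bar>0 :: real\<bar> \<le> 1" using Ad by (auto simp: c_def)
    next
      fix n \<tau> l assume "step_size_condition \<theta> \<rho> \<epsilon> n \<tau>"
      then show "\<bar>R1 \<theta> n \<tau> l * R2 \<theta> n \<tau> l\<bar> \<le> 1" by (rule le1)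
    next
      fix n \<tau> l k assume S: "step_size_condition \<theta> \<rho> \<epsilon> n \<tau>"
      have "\<bar>R1 \<theta> n \<tau> l * R2 \<theta> n \<tau> l\<bar> ^ k * R1 \<theta> n \<tau> l \<le> \<bar>R1 \<theta> n \<tau> l * R2 \<theta> n \<tau> l\<bar> ^ k"
        using R1_bounds[OF \<theta>(1), of \<tau> n l] S by (intro mult_right_le_one_le) (auto simp: step_size_condition_def)
      with dec[OF S, of l k] show "\<bar>R1 \<theta> n \<tau> l * R2 \<theta> n \<tau> l\<bar> ^ k * R1 \<theta> n \<tau> l
        \<le> (1 + A) / (1 + c * real (k + 1) * (- (\<tau> * lambda_disc n l)))" by linarith
      have "\<bar>R1 \<theta> n \<tau> l * R2 \<theta> n \<tau> l\<bar> ^ (k + 1) \<le> \<bar>R1 \<theta> n \<tau> l * R2 \<theta> n \<tau> l\<bar> ^ k"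
        using le1[OF S, of l] by (intro power_decreasing) auto
      with dec[OF S, of l k] show "\<bar>(R1 \<theta> n \<tau> l * R2 \<theta> n \<tau> l) ^ (k + 1) - 0 ^ (k + 1)\<bar>
        \<le> (1 + A) / (1 + c * real (k + 1) * (- (\<tau> * lambda_disc n l)))"
        by (simp add: power_abs abs_mult)
    qed
  qed
qed

section \<open>Discrete Fourier analysis and kernel bounds\<close>

lemma sum_inverse_quadratic_le:
  assumes "0 < s"
  shows "(\<Sum>l=1..n. 1 / (1 + s * (real l)\<^sup>2)) \<le> pi / (2 * sqrt s)"
proof -
  have step: "1 / (1 + s * (real (Suc n))\<^sup>2) \<le> (arctan (sqrt s * real (Suc n)) - arctan (sqrt s * real n)) / sqrt s" for n
  proof -
    have "sqrt s * real n < sqrt s * real (Suc n)" using assms by simp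
    then obtain z where z: "sqrt s * real n < z" "z < sqrt s * real (Suc n)"
      "arctan (sqrt s * real (Suc n)) - arctan (sqrt s * real n)
        = (sqrt s * real (Suc n) - sqrt s * real n) * inverse (1 + z\<^sup>2)"
      using MVT2[of "sqrt s * real n" "sqrt s * real (Suc n)" arctan "\<lambda>x. inverse (1 + x\<^sup>2)"] DERIV_arctan
      by blast
    have "0 \<le> sqrt s * real n" using assms by simp
    then have "z\<^sup>2 \<le> (sqrt s * real (Suc n))\<^sup>2" using z by (intro power_mono) auto
    also have "\<dots> = s * (real (Suc n))\<^sup>2" using assms by (simp add: power_mult_distrib)
    finally have "1 / (1 + s * (real (Suc n))\<^sup>2) \<le> 1 / (1 + z\<^sup>2)"
      using assms by (intro divide_left_mono) (auto intro!: mult_pos_pos add_pos_nonneg)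
    also have "\<dots> = (arctan (sqrt s * real (Suc n)) - arctan (sqrt s * real n)) / sqrt s"
    proof -
      have "sqrt s * real (Suc n) - sqrt s * real n = sqrt s" by (simp add: algebra_simps)
      then show ?thesis using z(3) assms by (simp add: divide_inverse)
    qed
    finally show ?thesis .
  qed
  have "(\<Sum>l=1..n. 1 / (1 + s * (real l)\<^sup>2)) \<le> arctan (sqrt s * real n) / sqrt s"
  proof (induction n)
    case (Suc n)
    then show ?case using step[of n] by (simp add: diff_divide_distrib)
  qed simp
  also have "\<dots> \<le> (pi / 2) / sqrt s"
    using assms arctan_ubound[of "sqrt s * real n"] by (intro divide_right_mono) auto
  finally show ?thesis by simp
qed

lemma sin_ge_linear:
  assumes "0 \<le> x" "x \<le> pi / 2"
  shows "2 / pi * x \<le> sin x"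
proof -
  have "convex_on {0..pi / 2} (\<lambda>x. - sin x)"
    by (rule f''_ge0_imp_convex[where f' = "\<lambda>x. - cos x" and f'' = sin])
       (auto intro!: derivative_eq_intros sin_ge_zero)
  from convex_onD[OF this, of "2 * x / pi" 0 "pi / 2"] assms
  show ?thesis by (auto simp: field_simps)
qed

lemma neg_lambda_disc_ge:
  assumes "0 < n" "l \<le> n"
  shows "16 * (real (min l (n - l)))\<^sup>2 \<le> - lambda_disc n l"
proof -
  define m where "m = min l (n - l)"
  have sin_eq: "sin (real m * pi / real n) = sin (real l * pi / real n)"
  proof (cases "l \<le> n - l")
    case False
    then have "real m * pi / real n = pi - real l * pi / real n"
      using assms by (simp add: m_def min_def field_simps of_nat_diff)
    then show ?thesis by simp
  qed (simp add: m_def)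
  have "m * 2 \<le> n" using assms by (auto simp: m_def min_def)
  then have "real m * 2 \<le> real n" by linarith
  then have "real m * pi / real n \<le> pi / 2" using assms by (simp add: field_simps)
  then have "2 / pi * (real m * pi / real n) \<le> sin (real m * pi / real n)"
    by (intro sin_ge_linear) auto
  then have "2 * real m / real n \<le> sin (real l * pi / real n)"
    by (simp add: sin_eq)
  then have "(2 * real m / real n)\<^sup>2 \<le> (sin (real l * pi / real n))\<^sup>2"
    by (intro power_mono) auto
  then have "4 * (real n)\<^sup>2 * (2 * real m / real n)\<^sup>2 \<le> 4 * (real n)\<^sup>2 * (sin (real l * pi / real n))\<^sup>2"
    by (intro mult_left_mono) auto
  then show ?thesis using assms
    by (simp add: lambda_disc_def m_def[symmetric] power_divide power_mult_distrib)
qed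

lemma neg_lambda_disc_nonneg: "0 \<le> - lambda_disc n l"
  by (simp add: lambda_disc_def)

lemma sum_spectral_decay_le:
  assumes "0 < s" "0 < n"
  shows "(\<Sum>l<n. 1 / (1 + s * (- lambda_disc n l))) \<le> 1 + 1 / sqrt s"
proof -
  define f where "f m = 1 / (1 + 16 * s * (real m)\<^sup>2)" for m
  have f0: "0 \<le> f m" for m using assms by (simp add: f_def)
  have *: "1 / (1 + s * (- lambda_disc n l)) \<le> f l + f (n - l)" if "l < n" for l
  proof -
    have "1 / (1 + s * (- lambda_disc n l)) \<le> f (min l (n - l))"
    proof -
      have "s * (16 * (real (min l (n - l)))\<^sup>2) \<le> s * (- lambda_disc n l)"
        using neg_lambda_disc_ge[of n l] that assms by (intro mult_left_mono) auto
      then show ?thesis unfolding f_def using assms mult_nonneg_nonneg[OF less_imp_le[OF assms(1)] neg_lambda_disc_nonneg[of n l]]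
        by (intro divide_left_mono) (auto intro!: mult_pos_pos add_pos_nonneg)
    qed
    also have "\<dots> \<le> f l + f (n - l)" using f0[of l] f0[of "n - l"] by (auto simp: min_def)
    finally show ?thesis .
  qed
  have S: "(\<Sum>l=1..n. f l) \<le> pi / (2 * sqrt (16 * s))"
    unfolding f_def by (rule sum_inverse_quadratic_le) (use assms in auto)
  have "(\<Sum>l<n. 1 / (1 + s * (- lambda_disc n l))) \<le> (\<Sum>l<n. f l + f (n - l))"
    by (intro sum_mono *) auto
  also have "\<dots> = (\<Sum>l<n. f l) + (\<Sum>l<n. f (n - l))" by (rule sum.distrib)
  also have "(\<Sum>l<n. f (n - l)) = (\<Sum>l=1..n. f l)"
    by (rule sum.reindex_bij_witness[of _ "\<lambda>l. n - l" "\<lambda>l. n - l"]) auto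
  also have "(\<Sum>l<n. f l) \<le> (\<Sum>l=0..n. f l)"
    by (intro sum_mono2) (auto simp: f0)
  also have "\<dots> = 1 + (\<Sum>l=1..n. f l)"
    by (simp add: sum.atLeast_Suc_atMost f_def)
  finally have "(\<Sum>l<n. 1 / (1 + s * (- lambda_disc n l))) \<le> 1 + 2 * (pi / (2 * sqrt (16 * s)))"
    using S by linarith
  also have "2 * (pi / (2 * sqrt (16 * s))) = (pi / 4) / sqrt s"
    using assms by (simp add: real_sqrt_mult)
  also have "\<dots> \<le> 1 / sqrt s" using pi_less_4 assms by (intro divide_right_mono) auto
  finally show ?thesis by simp
qed

lemma e_fun_power: "e_fun l a = e_fun 1 a ^ l"
  by (simp add: e_fun_def exp_of_nat_mult[symmetric] mult_ac)

lemma norm_e_fun [simp]: "norm (e_fun l a) = 1"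
  by (simp add: e_fun_def norm_exp_eq_Re)

lemma e_fun_grid_power:
  assumes "0 < n"
  shows "e_fun 1 (real j / real n) ^ n = 1"
proof -
  have "e_fun 1 (real j / real n) ^ n = exp (of_nat n * (2 * of_real pi * \<i> * of_nat 1 * of_real (real j / real n)))"
    by (simp only: e_fun_def exp_of_nat_mult)
  also have "of_nat n * (2 * of_real pi * \<i> * of_nat 1 * of_real (real j / real n)) = 2 * of_real pi * \<i> * of_nat j"
    using assms by simp
  also have "exp (2 * of_real pi * \<i> * of_nat j) = 1"
    using exp_integer_2pi[of "of_nat j"] by (simp add: mult_ac)
  finally show ?thesis .
qed

lemma sum_e_fun_orthogonal:
  assumes n: "0 < n" and "l < n" "l' < n"
  shows "(\<Sum>j<n. e_fun l (real j / real n) * cnj (e_fun l' (real j / real n))) = (if l = l' then of_nat n else 0)"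
proof (cases "l = l'")
  case True
  then show ?thesis by (simp add: complex_norm_square[symmetric])
next
  case False
  define z where "z = e_fun l (1 / real n) * cnj (e_fun l' (1 / real n))"
  have pw: "e_fun l (real j / real n) = e_fun l (1 / real n) ^ j" for l j
    by (simp add: e_fun_def exp_of_nat_mult[symmetric] mult_ac)
  have zn: "z ^ n = 1"
    using e_fun_grid_power[OF n, of l] e_fun_grid_power[OF n, of l'] pw[of _ n] n
    by (simp add: z_def power_mult_distrib complex_cnj_power[symmetric] pw[symmetric] e_fun_def exp_Reals_eq)
  have "z \<noteq> 1"
  proof
    assume "z = 1"
    then have "z * e_fun l' (1 / real n) = e_fun l' (1 / real n)" by simp
    moreover have "z * e_fun l' (1 / real n) = e_fun l (1 / real n)"
      by (simp add: z_def mult.assoc) (simp add: mult.commute complex_norm_square[symmetric])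
    ultimately have "exp (2 * of_real pi * \<i> * of_nat l / of_nat n) = exp (2 * of_real pi * \<i> * of_nat l' / of_nat n)"
      by (simp add: e_fun_def)
    then show False using complex_root_unity_eq[of n l l'] n assms False by simp
  qed
  moreover have "(\<Sum>j<n. e_fun l (real j / real n) * cnj (e_fun l' (real j / real n))) = (\<Sum>j<n. z ^ j)"
    by (simp add: z_def power_mult_distrib pw)
  ultimately show ?thesis using zn False by (simp add: sum_gp_strict)
qed

lemma discrete_parseval:
  assumes n: "0 < n"
  shows "(\<Sum>j<n. (norm (\<Sum>l<n. c l * cnj (e_fun l (real j / real n))))\<^sup>2) = real n * (\<Sum>l<n. (norm (c l))\<^sup>2)"
proof -
  let ?e = "\<lambda>l j. e_fun l (real j / real n)"
  have "complex_of_real (\<Sum>j<n. (norm (\<Sum>l<n. c l * cnj (?e l j)))\<^sup>2)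
     = (\<Sum>j<n. (\<Sum>l<n. c l * cnj (?e l j)) * cnj (\<Sum>l<n. c l * cnj (?e l j)))"
    by (simp only: of_real_sum complex_norm_square)
  also have "\<dots> = (\<Sum>j<n. \<Sum>l<n. \<Sum>l'<n. c l * cnj (c l') * (?e l' j * cnj (?e l j)))"
    by (simp add: sum_product mult_ac)
  also have "\<dots> = (\<Sum>l<n. \<Sum>j<n. \<Sum>l'<n. c l * cnj (c l') * (?e l' j * cnj (?e l j)))"
    by (rule sum.swap)
  also have "\<dots> = (\<Sum>l<n. \<Sum>l'<n. \<Sum>j<n. c l * cnj (c l') * (?e l' j * cnj (?e l j)))"
    by (intro sum.cong refl sum.swap)
  also have "\<dots> = (\<Sum>l<n. \<Sum>l'<n. c l * cnj (c l') * (\<Sum>j<n. ?e l' j * cnj (?e l j)))"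
    by (simp add: sum_distrib_left)
  also have "\<dots> = (\<Sum>l<n. \<Sum>l'<n. c l * cnj (c l') * (if l' = l then of_nat n else 0))"
    by (intro sum.cong refl) (simp add: sum_e_fun_orthogonal n)
  also have "\<dots> = (\<Sum>l<n. c l * cnj (c l) * of_nat n)"
    by (simp add: if_distrib[of "\<lambda>x. _ * x"] cong: if_cong)
  also have "\<dots> = complex_of_real (real n * (\<Sum>l<n. (norm (c l))\<^sup>2))"
    by (simp only: of_real_mult of_real_sum complex_norm_square sum_distrib_left of_real_of_nat_eq mult_ac)
  finally show ?thesis by (simp only: of_real_eq_iff)
qed

lemma powr_add_le:
  fixes x y q :: real
  assumes "0 \<le> x" "0 \<le> y" "0 \<le> q"
  shows "(x + y) powr q \<le> 2 powr q * (x powr q + y powr q)"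
proof -
  have "(x + y) powr q \<le> (2 * max x y) powr q" using assms by (intro powr_mono2) auto
  also have "\<dots> = 2 powr q * (max x y powr q)" using assms by (simp add: powr_mult)
  also have "\<dots> \<le> 2 powr q * (x powr q + y powr q)" by (intro mult_left_mono) (auto simp: max_def)
  finally show ?thesis .
qed

lemma kappa_space_grid [simp]: "0 < n \<Longrightarrow> kappa_space n (real j / real n) = real j / real n"
  by (simp add: kappa_space_def)

lemma kappa_space_eq_grid:
  assumes "0 < n" "x \<in> {0..1}"
  obtains q where "q \<le> n" "kappa_space n x = real q / real n"
proof
  have "real n * x \<le> real n" using assms by (simp add: mult_left_le)
  then have "\<lfloor>real n * x\<rfloor> \<le> int n" by linarith
  moreover have "0 \<le> \<lfloor>real n * x\<rfloor>" using assms by simp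
  ultimately show "nat \<lfloor>real n * x\<rfloor> \<le> n" "kappa_space n x = real (nat \<lfloor>real n * x\<rfloor>) / real n"
    by (auto simp: kappa_space_def)
qed

lemma kappa_space_unit:
  assumes "0 < n" "x \<in> {0..1}"
  shows "kappa_space n x \<in> {0..1}"
proof -
  obtain q where "q \<le> n" "kappa_space n x = real q / real n" using kappa_space_eq_grid[OF assms] by blast
  then show ?thesis using assms by simp
qed

lemma G1_grid:
  assumes "0 < n" "0 < \<tau>"
  shows "G1 \<theta> n \<tau> (real k * \<tau>) x (real j / real n) =
    (\<Sum>l<n. of_real ((R1 \<theta> n \<tau> l * R2 \<theta> n \<tau> l) ^ k) * e_fun l (kappa_space n x) * cnj (e_fun l (real j / real n)))"
  using assms by (simp add: G1_def)

lemma G2_grid: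
  assumes "0 < n" "0 < \<tau>"
  shows "G2 \<theta> n \<tau> (real k * \<tau>) x (real j / real n) =
    (\<Sum>l<n. of_real ((R1 \<theta> n \<tau> l * R2 \<theta> n \<tau> l) ^ k * R1 \<theta> n \<tau> l) * e_fun l (kappa_space n x)
       * cnj (e_fun l (real j / real n)))"
  using assms by (simp add: G2_def)

text \<open>Cauchy-Schwarz against the weight \<open>v j\<close>, which grows quadratically in the distance of \<open>j\<close> from \<open>q\<close>;
  multiplying the kernel by this distance differentiates the symbol.\<close>

lemma kernel_l1_bound:
  fixes c :: "nat \<Rightarrow> real"
  assumes n: "0 < n" and q: "q \<le> n" and Q: "0 < Q" "Q \<le> real n" and per: "c n = c 0"
  shows "((\<Sum>j<n. norm (\<Sum>l<n. of_real (c l) * e_fun l (real q / real n) * cnj (e_fun l (real j / real n)))) / real n)\<^sup>2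
     \<le> 5 * ((\<Sum>l<n. (c l)\<^sup>2) / Q + Q * (\<Sum>l<n. (c (Suc l) - c l)\<^sup>2))"
proof -
  define \<zeta> where "\<zeta> j = e_fun 1 (real q / real n) * cnj (e_fun 1 (real j / real n))" for j
  define F where "F b j = (\<Sum>l<n. of_real (b l) * e_fun l (real q / real n) * cnj (e_fun l (real j / real n)))"
    for b :: "nat \<Rightarrow> real" and j
  define \<delta> where "\<delta> j = (if j \<le> q then q - j else j - q)" for j
  define s where "s = Q\<^sup>2 / (real n)\<^sup>2"
  define v where "v j = 1 + s * (- lambda_disc n (\<delta> j))" for j
  have s: "0 < s" using n Q by (simp add: s_def)
  have v: "1 \<le> v j" for j using s neg_lambda_disc_nonneg[of n "\<delta> j"] by (simp add: v_def mult_nonneg_nonpos)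
  have F_pow: "F b j = (\<Sum>l<n. of_real (b l) * \<zeta> j ^ l)" for b j
    unfolding F_def \<zeta>_def
  proof (rule sum.cong[OF refl])
    fix l
    show "of_real (b l) * e_fun l (real q / real n) * cnj (e_fun l (real j / real n))
      = of_real (b l) * (e_fun 1 (real q / real n) * cnj (e_fun 1 (real j / real n))) ^ l"
      by (subst (1 2) e_fun_power[of l]) (simp add: power_mult_distrib)
  qed
  have \<zeta>n: "\<zeta> j ^ n = 1" for j
  proof -
    have "cnj (e_fun 1 (real j / real n)) ^ n = cnj (e_fun 1 (real j / real n) ^ n)" by simp
    also have "\<dots> = 1" by (simp only: e_fun_grid_power[OF n] complex_cnj_one)
    finally show ?thesis by (simp only: \<zeta>_def power_mult_distrib e_fun_grid_power[OF n] mult_1)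
  qed
  have norm_\<zeta>: "norm (\<zeta> j) = 1" for j by (simp add: \<zeta>_def norm_mult)
  have one_minus: "Q\<^sup>2 * (norm (1 - \<zeta> j))\<^sup>2 = s * (- lambda_disc n (\<delta> j))" for j
  proof -
    define \<phi> where "\<phi> = (real q - real j) * pi / real n"
    have e_cis: "e_fun 1 a = cis (2 * pi * a)" for a
      by (simp add: e_fun_def cis_conv_exp mult_ac)
    have "2 * pi * (real q / real n) + - (2 * pi * (real j / real n)) = 2 * \<phi>"
      by (simp add: \<phi>_def diff_divide_distrib algebra_simps)
    then have "\<zeta> j = cis (2 * \<phi>)"
      by (simp only: \<zeta>_def e_cis cis_cnj cis_mult)
    then have "(norm (1 - \<zeta> j))\<^sup>2 = (1 - cos (2 * \<phi>))\<^sup>2 + (sin (2 * \<phi>))\<^sup>2"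
      by (simp add: cmod_power2)
    also have "\<dots> = 4 * (sin \<phi>)\<^sup>2"
    proof -
      have "(sin (2 * \<phi>))\<^sup>2 = 1 - (cos (2 * \<phi>))\<^sup>2" by (rule sin_squared_eq)
      moreover have "cos (2 * \<phi>) = 1 - 2 * (sin \<phi>)\<^sup>2" by (rule cos_double_sin)
      moreover have "(1 - (1 - 2 * S))\<^sup>2 + (1 - (1 - 2 * S)\<^sup>2) = 4 * S" for S :: real
        by (simp add: power2_eq_square algebra_simps)
      ultimately show ?thesis by (simp only:)
    qed
    also have "(sin \<phi>)\<^sup>2 = (sin (real (\<delta> j) * pi / real n))\<^sup>2"
    proof (cases "j \<le> q")
      case False
      then have "real (\<delta> j) * pi / real n = - \<phi>"
        using n by (simp add: \<phi>_def \<delta>_def of_nat_diff field_simps)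
      then show ?thesis by simp
    qed (simp add: \<phi>_def \<delta>_def of_nat_diff)
    finally show ?thesis using n by (simp add: s_def lambda_disc_def)
  qed
  have diffF: "norm (F (\<lambda>l. c (Suc l) - c l) j) = norm (1 - \<zeta> j) * norm (F c j)" for j
  proof -
    have "\<zeta> j * (\<Sum>l<n. of_real (c (Suc l)) * \<zeta> j ^ l) = (\<Sum>l<n. of_real (c (Suc l)) * \<zeta> j ^ Suc l)"
      by (simp add: sum_distrib_left mult_ac)
    also have "\<dots> = (\<Sum>l<n. of_real (c l) * \<zeta> j ^ l)"
      using sum.lessThan_Suc_shift[of "\<lambda>l. of_real (c l) * \<zeta> j ^ l" n] per
      by (simp add: \<zeta>n)
    finally have *: "\<zeta> j * (\<Sum>l<n. of_real (c (Suc l)) * \<zeta> j ^ l) = F c j" by (simp add: F_pow)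
    have D: "F (\<lambda>l. c (Suc l) - c l) j = (\<Sum>l<n. of_real (c (Suc l)) * \<zeta> j ^ l) - F c j"
      by (simp add: F_pow sum_subtractf algebra_simps)
    have "\<zeta> j * F (\<lambda>l. c (Suc l) - c l) j = (1 - \<zeta> j) * F c j"
      by (simp only: D right_diff_distrib left_diff_distrib * mult_1)
    from arg_cong[OF this, of norm] show ?thesis by (simp add: norm_mult norm_\<zeta>)
  qed
  have parseval: "(\<Sum>j<n. (norm (F b j))\<^sup>2) = real n * (\<Sum>l<n. (b l)\<^sup>2)" for b
    unfolding F_def using discrete_parseval[OF n, of "\<lambda>l. of_real (b l) * e_fun l (real q / real n)"]
    by (simp add: norm_mult)
  define g where "g m = 1 / (1 + s * (- lambda_disc n m))" for m
  have g0: "0 \<le> g m" for m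
    using mult_nonneg_nonneg[OF less_imp_le[OF s] neg_lambda_disc_nonneg[of n m]] by (simp add: g_def)
  have g: "(\<Sum>m<n. g m) \<le> 1 + real n / Q"
  proof -
    have "sqrt s = Q / real n" using Q by (simp add: s_def real_sqrt_divide)
    then show ?thesis using sum_spectral_decay_le[OF s n] by (simp add: g_def)
  qed
  have "(\<Sum>j<n. 1 / v j) = (\<Sum>j\<in>{..<n} \<inter> {..q}. g (\<delta> j)) + (\<Sum>j\<in>{..<n} - {..q}. g (\<delta> j))"
    by (subst sum.Int_Diff[of _ _ "{..q}"]) (auto simp: v_def g_def)
  also have "(\<Sum>j\<in>{..<n} \<inter> {..q}. g (\<delta> j)) = (\<Sum>m\<in>(\<lambda>j. q - j) ` ({..<n} \<inter> {..q}). g m)"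
    by (subst sum.reindex) (auto simp: inj_on_def \<delta>_def)
  also have "\<dots> \<le> (\<Sum>m\<le>n. g m)"
    using q by (intro sum_mono2) (auto simp: g0)
  also have "(\<Sum>j\<in>{..<n} - {..q}. g (\<delta> j)) = (\<Sum>m\<in>(\<lambda>j. j - q) ` ({..<n} - {..q}). g m)"
    by (subst sum.reindex) (auto simp: inj_on_def \<delta>_def)
  also have "\<dots> \<le> (\<Sum>m<n. g m)"
    by (intro sum_mono2) (auto simp: g0)
  also have "(\<Sum>m\<le>n. g m) = (\<Sum>m<n. g m) + 1"
  proof -
    have "{..n} = insert n {..<n}" by auto
    moreover have "g n = 1" using n by (simp add: g_def lambda_disc_def)
    ultimately show ?thesis by simp
  qed
  finally have "(\<Sum>j<n. 1 / v j) \<le> 3 + 2 * (real n / Q)" using g by simp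
  also have "\<dots> \<le> 5 * (real n / Q)" using Q by (simp add: field_simps)
  finally have V: "(\<Sum>j<n. 1 / v j) \<le> 5 * (real n / Q)" .
  have W: "(\<Sum>j<n. v j * (norm (F c j))\<^sup>2) = real n * ((\<Sum>l<n. (c l)\<^sup>2) + Q\<^sup>2 * (\<Sum>l<n. (c (Suc l) - c l)\<^sup>2))"
  proof -
    have "v j * (norm (F c j))\<^sup>2 = (norm (F c j))\<^sup>2 + Q\<^sup>2 * (norm (F (\<lambda>l. c (Suc l) - c l) j))\<^sup>2" for j
      unfolding v_def one_minus[symmetric] diffF by (simp add: algebra_simps power_mult_distrib)
    then show ?thesis
      by (simp add: sum.distrib sum_distrib_left[symmetric] parseval algebra_simps)
  qed
  have "(\<Sum>j<n. norm (F c j))\<^sup>2 = (\<Sum>j<n. (1 / sqrt (v j)) * (sqrt (v j) * norm (F c j)))\<^sup>2"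
  proof -
    have "sqrt (v j) \<noteq> 0" for j using v[of j] by simp
    then show ?thesis by simp
  qed
  also have "\<dots> \<le> (\<Sum>j<n. (1 / sqrt (v j))\<^sup>2) * (\<Sum>j<n. (sqrt (v j) * norm (F c j))\<^sup>2)"
    by (rule Cauchy_Schwarz_ineq_sum)
  also have "\<dots> = (\<Sum>j<n. 1 / v j) * (\<Sum>j<n. v j * (norm (F c j))\<^sup>2)"
  proof -
    have "0 \<le> v j" for j using v[of j] by simp
    then show ?thesis by (simp add: power_divide power_mult_distrib)
  qed
  also have "\<dots> \<le> 5 * (real n / Q) * (\<Sum>j<n. v j * (norm (F c j))\<^sup>2)"
  proof (rule mult_right_mono[OF V])
    have "0 \<le> v j" for j using v[of j] by simp
    then show "0 \<le> (\<Sum>j<n. v j * (norm (F c j))\<^sup>2)" by (intro sum_nonneg mult_nonneg_nonneg) auto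
  qed
  finally have "(\<Sum>j<n. norm (F c j))\<^sup>2 \<le> 5 * (real n / Q) * (real n * ((\<Sum>l<n. (c l)\<^sup>2) + Q\<^sup>2 * (\<Sum>l<n. (c (Suc l) - c l)\<^sup>2)))"
    unfolding W .
  also have "\<dots> = (real n)\<^sup>2 * (5 * ((\<Sum>l<n. (c l)\<^sup>2) / Q + Q * (\<Sum>l<n. (c (Suc l) - c l)\<^sup>2)))"
    using Q by (simp add: field_simps power2_eq_square)
  finally show ?thesis using n
    unfolding F_def[symmetric] by (simp add: power_divide pos_divide_le_eq mult.commute)
qed

lemma kernel_lp_bound:
  assumes \<theta>: "0 \<le> \<theta>" "\<theta> \<le> 1" and p: "2 \<le> p"
  obtains C where "0 < C"
    and "\<And>n \<tau> k x. step_size_condition \<theta> \<rho> \<epsilon> n \<tau> \<Longrightarrow>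
      (\<Sum>j<n. norm (G2 \<theta> n \<tau> (real k * \<tau>) x (real j / real n)) powr p) / real n
        \<le> C * (1 + (real (k + 1) * \<tau>) powr (- ((p - 1) / 2)))"
proof -
  obtain K c e where K: "1 \<le> K" "0 < c"
    and r1: "\<And>n \<tau> l. step_size_condition \<theta> \<rho> \<epsilon> n \<tau> \<Longrightarrow> \<bar>R1 \<theta> n \<tau> l * R2 \<theta> n \<tau> l\<bar> \<le> 1"
    and dec: "\<And>n \<tau> l k. step_size_condition \<theta> \<rho> \<epsilon> n \<tau> \<Longrightarrow>
      \<bar>R1 \<theta> n \<tau> l * R2 \<theta> n \<tau> l\<bar> ^ k * R1 \<theta> n \<tau> l
        \<le> K / (1 + c * real (k + 1) * (- (\<tau> * lambda_disc n l)))"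
    using multiplier_decay[OF \<theta>, of \<rho> \<epsilon>] by metis
  define D where "D = max 1 (1 / sqrt c)"
  define C where "C = (K * D) powr (p - 1) * 2 powr (p - 1)"
  show thesis
  proof (rule that[of C])
    show "0 < C" using K by (simp add: C_def D_def)
  next
    fix n \<tau> k x assume S: "step_size_condition \<theta> \<rho> \<epsilon> n \<tau>"
    then have n: "0 < n" and \<tau>: "0 < \<tau>" by (auto simp: step_size_condition_def)
    define t where "t = real (k + 1) * \<tau>"
    have t: "0 < t" using \<tau> by (simp add: t_def)
    define w where "w l = (R1 \<theta> n \<tau> l * R2 \<theta> n \<tau> l) ^ k * R1 \<theta> n \<tau> l" for l
    define G where "G j = G2 \<theta> n \<tau> (real k * \<tau>) x (real j / real n)" for j
    define \<Gamma> where "\<Gamma> = (\<Sum>l<n. \<bar>w l\<bar>)"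
    have G: "G j = (\<Sum>l<n. of_real (w l) * e_fun l (kappa_space n x) * cnj (e_fun l (real j / real n)))" for j
      unfolding G_def w_def by (rule G2_grid[OF n \<tau>])
    have w_abs: "\<bar>w l\<bar> = \<bar>R1 \<theta> n \<tau> l * R2 \<theta> n \<tau> l\<bar> ^ k * R1 \<theta> n \<tau> l" for l
      using R1_bounds(1)[OF \<theta>(1), of \<tau> n l] \<tau> by (simp add: w_def abs_mult power_abs)
    have w1: "\<bar>w l\<bar> \<le> 1" for l
      unfolding w_abs using R1_bounds[OF \<theta>(1), of \<tau> n l] \<tau> r1[OF S, of l]
      by (intro mult_le_one power_le_one) auto
    have \<Gamma>0: "0 \<le> \<Gamma>" by (simp add: \<Gamma>_def sum_nonneg)
    have "\<Gamma> \<le> (\<Sum>l<n. K * (1 / (1 + (c * t) * (- lambda_disc n l))))"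
      unfolding \<Gamma>_def w_abs using dec[OF S, of _ k] by (intro sum_mono) (simp add: t_def mult_ac)
    also have "\<dots> \<le> K * (1 + 1 / sqrt (c * t))"
      unfolding sum_distrib_left[symmetric]
      using K t by (intro mult_left_mono sum_spectral_decay_le n) auto
    also have "1 / sqrt (c * t) = 1 / sqrt c * t powr (- (1 / 2))"
    proof -
      have "t powr (- (1 / 2)) = 1 / sqrt t" using t by (simp add: powr_minus_divide powr_half_sqrt)
      then show ?thesis by (simp add: real_sqrt_mult)
    qed
    also have "K * (1 + 1 / sqrt c * t powr (- (1 / 2))) \<le> K * (D * 1 + D * t powr (- (1 / 2)))"
      using K by (intro mult_left_mono add_mono mult_right_mono) (auto simp: D_def)
    also have "\<dots> = K * D * (1 + t powr (- (1 / 2)))" by (simp add: algebra_simps)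
    finally have \<Gamma>: "\<Gamma> \<le> K * D * (1 + t powr (- (1 / 2)))" .
    have G_le: "norm (G j) \<le> \<Gamma>" for j
      unfolding G \<Gamma>_def by (rule order.trans[OF norm_sum]) (simp add: norm_mult)
    have "(\<Sum>j<n. (norm (G j))\<^sup>2) = real n * (\<Sum>l<n. (w l)\<^sup>2)"
      unfolding G using discrete_parseval[OF n, of "\<lambda>l. of_real (w l) * e_fun l (kappa_space n x)"]
      by (simp add: norm_mult)
    moreover have "(\<Sum>l<n. (w l)\<^sup>2) \<le> \<Gamma>"
      unfolding \<Gamma>_def
    proof (rule sum_mono)
      fix l
      have "\<bar>w l\<bar> * \<bar>w l\<bar> \<le> 1 * \<bar>w l\<bar>" by (rule mult_right_mono[OF w1]) auto
      then show "(w l)\<^sup>2 \<le> \<bar>w l\<bar>" by (simp add: power2_eq_square)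
    qed
    ultimately have L2: "(\<Sum>j<n. (norm (G j))\<^sup>2) \<le> real n * \<Gamma>" by (simp add: mult_left_mono)
    have "norm (G j) powr p \<le> \<Gamma> powr (p - 2) * (norm (G j))\<^sup>2" for j
    proof (cases "G j = 0")
      case False
      then have "norm (G j) powr p = norm (G j) powr (p - 2) * norm (G j) powr 2"
        by (simp only: powr_add[symmetric]) simp
      also have "\<dots> \<le> \<Gamma> powr (p - 2) * norm (G j) powr 2"
        using p by (intro mult_right_mono powr_mono2 G_le) auto
      finally show ?thesis using False by simp
    qed simp
    then have "(\<Sum>j<n. norm (G j) powr p) \<le> \<Gamma> powr (p - 2) * (\<Sum>j<n. (norm (G j))\<^sup>2)"
      unfolding sum_distrib_left by (intro sum_mono) auto
    also have "\<dots> \<le> \<Gamma> powr (p - 2) * (real n * \<Gamma>)"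
      by (intro mult_left_mono L2) auto
    also have "\<dots> = real n * \<Gamma> powr (p - 1)"
    proof (cases "\<Gamma> = 0")
      case False
      then have "\<Gamma> powr (p - 2) * \<Gamma> = \<Gamma> powr (p - 2) * \<Gamma> powr 1" using \<Gamma>0 by simp
      also have "\<dots> = \<Gamma> powr (p - 1)" by (simp only: powr_add[symmetric]) simp
      finally show ?thesis by (simp add: mult_ac)
    qed simp
    finally have sum_le: "(\<Sum>j<n. norm (G j) powr p) \<le> real n * \<Gamma> powr (p - 1)" .
    have "\<Gamma> powr (p - 1) \<le> (K * D * (1 + t powr (- (1 / 2)))) powr (p - 1)"
      using \<Gamma> \<Gamma>0 p by (intro powr_mono2) auto
    also have "\<dots> = (K * D) powr (p - 1) * (1 + t powr (- (1 / 2))) powr (p - 1)"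
      by (simp add: powr_mult)
    also have "\<dots> \<le> (K * D) powr (p - 1) * (2 powr (p - 1) * (1 powr (p - 1) + (t powr (- (1 / 2))) powr (p - 1)))"
      using p by (intro mult_left_mono powr_add_le) auto
    also have "(t powr (- (1 / 2))) powr (p - 1) = t powr (- ((p - 1) / 2))"
      by (simp add: powr_powr)
    finally have "real n * \<Gamma> powr (p - 1) \<le> real n * (C * (1 + t powr (- ((p - 1) / 2))))"
      by (intro mult_left_mono) (simp_all add: C_def mult_ac)
    with sum_le have "(\<Sum>j<n. norm (G j) powr p) \<le> real n * (C * (1 + t powr (- ((p - 1) / 2))))" by linarith
    then show "(\<Sum>j<n. norm (G2 \<theta> n \<tau> (real k * \<tau>) x (real j / real n)) powr p) / real n
        \<le> C * (1 + (real (k + 1) * \<tau>) powr (- ((p - 1) / 2)))"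
      using n unfolding G_def[symmetric] t_def[symmetric] by (simp add: pos_divide_le_eq mult_ac)
  qed
qed

lemma lambda_disc_Suc_diff:
  assumes "0 < n" "l' = l \<or> l' = Suc l"
  shows "\<bar>lambda_disc n (Suc l) - lambda_disc n l\<bar> \<le> 4 * pi * (sqrt (- lambda_disc n l') + pi)"
proof -
  define d where "d m = 2 * real n * \<bar>sin (real m * pi / real n)\<bar>" for m
  have d2: "- lambda_disc n m = (d m)\<^sup>2" for m
    by (simp add: d_def lambda_disc_def power_mult_distrib)
  have sq: "sqrt (- lambda_disc n m) = d m" for m
    unfolding d2 by (simp add: d_def)
  have d0: "0 \<le> d m" for m by (simp add: d_def)
  have "\<bar>sin (real (Suc l) * pi / real n) - sin (real l * pi / real n)\<bar> \<le> \<bar>real (Suc l) * pi / real n - real l * pi / real n\<bar>"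
  proof -
    define a where "a = real (Suc l) * pi / real n"
    define b where "b = real l * pi / real n"
    have "\<bar>sin a - sin b\<bar> = 2 * \<bar>sin ((a - b) / 2)\<bar> * \<bar>cos ((a + b) / 2)\<bar>"
      by (simp add: sin_diff_sin abs_mult)
    also have "\<dots> \<le> 2 * \<bar>(a - b) / 2\<bar> * 1"
      by (intro mult_mono abs_sin_x_le_abs_x) auto
    finally show ?thesis unfolding a_def b_def by simp
  qed
  also have "\<dots> = pi / real n" by (simp add: diff_divide_distrib[symmetric] algebra_simps)
  finally have "\<bar>\<bar>sin (real (Suc l) * pi / real n)\<bar> - \<bar>sin (real l * pi / real n)\<bar>\<bar> \<le> pi / real n" by linarith
  then have "2 * real n * \<bar>\<bar>sin (real (Suc l) * pi / real n)\<bar> - \<bar>sin (real l * pi / real n)\<bar>\<bar> \<le> 2 * real n * (pi / real n)"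
    by (intro mult_left_mono) auto
  moreover have "\<bar>d (Suc l) - d l\<bar> = 2 * real n * \<bar>\<bar>sin (real (Suc l) * pi / real n)\<bar> - \<bar>sin (real l * pi / real n)\<bar>\<bar>"
    unfolding d_def right_diff_distrib[symmetric] abs_mult by simp
  ultimately have dd: "\<bar>d (Suc l) - d l\<bar> \<le> 2 * pi" using assms(1) by simp
  have "\<bar>lambda_disc n (Suc l) - lambda_disc n l\<bar> = \<bar>(d (Suc l))\<^sup>2 - (d l)\<^sup>2\<bar>"
    by (simp flip: d2)
  also have "\<dots> = \<bar>d (Suc l) - d l\<bar> * (d (Suc l) + d l)"
    using d0[of l] d0[of "Suc l"] by (simp add: power2_eq_square square_diff_square_factored abs_mult mult.commute)
  also have "\<dots> \<le> 2 * pi * (2 * d l' + 2 * pi)"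
    using dd assms(2) d0[of l] d0[of "Suc l"] by (intro mult_mono) auto
  also have "\<dots> = 4 * pi * (sqrt (- lambda_disc n l') + pi)" by (simp add: sq algebra_simps)
  finally show ?thesis .
qed

lemma power_diff_le:
  fixes x y :: real
  assumes "\<bar>x\<bar> \<le> m" "\<bar>y\<bar> \<le> m"
  shows "\<bar>x ^ (k + 1) - y ^ (k + 1)\<bar> \<le> real (k + 1) * (m ^ k * \<bar>x - y\<bar>)"
proof -
  have m: "0 \<le> m" using assms by linarith
  have "\<bar>x ^ (k + 1) - y ^ (k + 1)\<bar> = \<bar>x - y\<bar> * \<bar>\<Sum>i<k+1. y ^ (k - i) * x ^ i\<bar>"
    using power_diff_sumr2[of x "k + 1" y] by (simp add: abs_mult)
  moreover have "\<bar>\<Sum>i<k+1. y ^ (k - i) * x ^ i\<bar> \<le> (\<Sum>i<k+1. m ^ k)"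
  proof (rule order.trans[OF sum_abs], rule sum_mono)
    fix i assume "i \<in> {..<k + 1}"
    then have "m ^ k = m ^ (k - i) * m ^ i" by (simp add: power_add[symmetric])
    moreover have "\<bar>y ^ (k - i) * x ^ i\<bar> \<le> m ^ (k - i) * m ^ i"
      unfolding abs_mult power_abs using assms m by (intro mult_mono power_mono) auto
    ultimately show "\<bar>y ^ (k - i) * x ^ i\<bar> \<le> m ^ k" by simp
  qed
  then have "\<bar>x - y\<bar> * \<bar>\<Sum>i<k+1. y ^ (k - i) * x ^ i\<bar> \<le> \<bar>x - y\<bar> * (\<Sum>i<k+1. m ^ k)"
    by (rule mult_left_mono) auto
  ultimately show ?thesis by (simp add: mult_ac)
qed

lemma amplification_diff:
  assumes "0 \<le> \<theta>" "0 \<le> \<tau>"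
  shows "\<bar>R1 \<theta> n \<tau> l * R2 \<theta> n \<tau> l - R1 \<theta> n \<tau> m * R2 \<theta> n \<tau> m\<bar>
    = \<tau> * \<bar>lambda_disc n l - lambda_disc n m\<bar> * (R1 \<theta> n \<tau> l * R1 \<theta> n \<tau> m)"
proof -
  have P: "0 < 1 - \<theta> * \<tau> * lambda_disc n i" for i
    using R1_bounds(1)[OF assms, of n i] by (simp add: R1_def)
  have "R1 \<theta> n \<tau> l * R2 \<theta> n \<tau> l - R1 \<theta> n \<tau> m * R2 \<theta> n \<tau> m
    = \<tau> * (lambda_disc n l - lambda_disc n m) * (R1 \<theta> n \<tau> l * R1 \<theta> n \<tau> m)"
    unfolding R1_def R2_def using P[of l] P[of m] by (simp add: divide_simps) (simp add: algebra_simps)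
  then show ?thesis
    using assms R1_bounds(1)[OF assms, of n l] R1_bounds(1)[OF assms, of n m] by (simp add: abs_mult)
qed

lemma le_one_plus_square: "(x :: real) \<le> 1 + x\<^sup>2"
proof -
  have "0 \<le> (x - 1 / 2)\<^sup>2" by simp
  then show ?thesis by (simp add: power2_eq_square algebra_simps)
qed

text \<open>The high modes of the first kernel need not decay: for \<open>\<theta> > 1/2\<close>, where \<open>n\<^sup>2 \<tau>\<close> is not bounded, the
  multiplier tends to \<open>e = - (1 - \<theta>) / \<theta>\<close> at high frequencies.  Subtracting \<open>e ^ (k + 1)\<close> removes a multiple of the identity.\<close>

lemma kernel_l1_bound_uniform:
  assumes \<theta>: "0 \<le> \<theta>" "\<theta> \<le> 1"
  obtains C where "0 < C"
    and "\<And>n \<tau> k x. step_size_condition \<theta> \<rho> \<epsilon> n \<tau> \<Longrightarrow> x \<in> {0..1} \<Longrightarrow>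
      (\<Sum>j<n. norm (G1 \<theta> n \<tau> (real (k + 1) * \<tau>) x (real j / real n))) / real n
        \<le> C * exp (C * (real (k + 1) * \<tau>))"
proof -
  obtain K c e where K: "1 \<le> K" "0 < c" "\<bar>e\<bar> \<le> 1"
    and dec: "\<And>n \<tau> l k. step_size_condition \<theta> \<rho> \<epsilon> n \<tau> \<Longrightarrow>
      \<bar>R1 \<theta> n \<tau> l * R2 \<theta> n \<tau> l\<bar> ^ k * R1 \<theta> n \<tau> l
        \<le> K / (1 + c * real (k + 1) * (- (\<tau> * lambda_disc n l)))"
    and diff: "\<And>n \<tau> l k. step_size_condition \<theta> \<rho> \<epsilon> n \<tau> \<Longrightarrow>
      \<bar>(R1 \<theta> n \<tau> l * R2 \<theta> n \<tau> l) ^ (k + 1) - e ^ (k + 1)\<bar>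
        \<le> K / (1 + c * real (k + 1) * (- (\<tau> * lambda_disc n l)))"
    using multiplier_decay[OF \<theta>, of \<rho> \<epsilon>] by metis
  define P where "P t = 5 * (K\<^sup>2 + 128 * pi\<^sup>2 * K\<^sup>2 * (1 / c\<^sup>2 + (1 + pi\<^sup>2) / c * t + pi\<^sup>2 * t\<^sup>2))" for t
  define A where "A = 7 + 5 * K\<^sup>2 + 640 * pi\<^sup>2 * K\<^sup>2 * (1 / c\<^sup>2 + (1 + pi\<^sup>2) / c + 2 * pi\<^sup>2)"
  have A: "1 \<le> A" using K by (simp add: A_def add_increasing2)
  show thesis
  proof (rule that[of A])
    show "0 < A" using A by simp
  next
    fix n \<tau> k and x :: real assume S: "step_size_condition \<theta> \<rho> \<epsilon> n \<tau>" and x: "x \<in> {0..1}"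
    then have n: "0 < n" and \<tau>: "0 < \<tau>" by (auto simp: step_size_condition_def)
    obtain q where q: "q \<le> n" "kappa_space n x = real q / real n" using kappa_space_eq_grid[OF n x] .
    define t where "t = real (k + 1) * \<tau>"
    have t: "0 < t" using \<tau> by (simp add: t_def)
    have ct: "0 < c * t" using K t by simp
    define r where "r l = R1 \<theta> n \<tau> l * R2 \<theta> n \<tau> l" for l
    define B where "B l = - lambda_disc n l" for l
    define b where "b l = r l ^ (k + 1) - e ^ (k + 1)" for l
    define g where "g l = 1 / (1 + c * t * B l)" for l
    define h where "h l = t * (4 * pi * (sqrt (B l) + pi)) * (K * g l)" for l
    define Q where "Q = min (real n) (1 + 1 / sqrt (c * t))"
    have B0: "0 \<le> B l" for l unfolding B_def by (rule neg_lambda_disc_nonneg)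
    have den: "1 \<le> 1 + c * t * B l" for l using ct B0[of l] by simp
    have g0: "0 \<le> g l" "g l \<le> 1" for l using den[of l] by (auto simp: g_def)
    have Bn: "lambda_disc n n = lambda_disc n 0" using n by (simp add: lambda_disc_def)
    have rn: "r n = r 0" by (simp add: r_def R1_def R2_def Bn)
    have Q: "0 < Q" "Q \<le> real n" using n ct by (auto simp: Q_def intro!: add_pos_nonneg)
    have sum_g: "(\<Sum>l<n. g l) \<le> Q"
    proof -
      have "(\<Sum>l<n. g l) \<le> (\<Sum>l<n. 1)" by (intro sum_mono g0)
      moreover have "(\<Sum>l<n. g l) \<le> 1 + 1 / sqrt (c * t)"
        unfolding g_def B_def by (rule sum_spectral_decay_le[OF ct n])
      ultimately show ?thesis by (simp add: Q_def)
    qed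
    have decK: "\<bar>r l\<bar> ^ k * R1 \<theta> n \<tau> l \<le> K * g l" for l
      using dec[OF S, of l k] by (simp add: r_def g_def t_def B_def mult_ac)
    have diffK: "\<bar>b l\<bar> \<le> K * g l" for l
      using diff[OF S, of l k] by (simp add: b_def r_def g_def t_def B_def mult_ac)
    have sum_b: "(\<Sum>l<n. (b l)\<^sup>2) \<le> K\<^sup>2 * Q"
    proof -
      have "(b l)\<^sup>2 \<le> K\<^sup>2 * g l" for l
      proof -
        have "(b l)\<^sup>2 \<le> (K * g l)\<^sup>2" using diffK[of l] by (simp add: abs_le_square_iff[symmetric])
        also have "\<dots> = K\<^sup>2 * (g l * g l)" by (simp add: power_mult_distrib power2_eq_square)
        also have "\<dots> \<le> K\<^sup>2 * (1 * g l)" using g0[of l] by (intro mult_left_mono mult_right_mono) auto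
        finally show ?thesis by simp
      qed
      then have "(\<Sum>l<n. (b l)\<^sup>2) \<le> K\<^sup>2 * (\<Sum>l<n. g l)" unfolding sum_distrib_left by (intro sum_mono)
      also have "\<dots> \<le> K\<^sup>2 * Q" by (intro mult_left_mono sum_g) auto
      finally show ?thesis .
    qed
    have h0: "0 \<le> h l" for l using t K g0[of l] B0[of l] by (simp add: h_def)
    have step: "(b (Suc l) - b l)\<^sup>2 \<le> (h l)\<^sup>2 + (h (Suc l))\<^sup>2" for l
    proof -
      obtain l' where l': "l' = l \<or> l' = Suc l" "\<bar>r l\<bar> \<le> \<bar>r l'\<bar>" "\<bar>r (Suc l)\<bar> \<le> \<bar>r l'\<bar>"
        by (metis linear order_refl)
      have "\<bar>b (Suc l) - b l\<bar> \<le> real (k + 1) * (\<bar>r l'\<bar> ^ k * \<bar>r (Suc l) - r l\<bar>)"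
        using power_diff_le[OF l'(3,2), of k] by (simp add: b_def)
      also have "\<bar>r (Suc l) - r l\<bar> = \<tau> * \<bar>lambda_disc n (Suc l) - lambda_disc n l\<bar> * (R1 \<theta> n \<tau> (Suc l) * R1 \<theta> n \<tau> l)"
        unfolding r_def by (rule amplification_diff) (use \<theta> \<tau> in auto)
      also have "real (k + 1) * (\<bar>r l'\<bar> ^ k * (\<tau> * \<bar>lambda_disc n (Suc l) - lambda_disc n l\<bar> * (R1 \<theta> n \<tau> (Suc l) * R1 \<theta> n \<tau> l)))
         = t * \<bar>lambda_disc n (Suc l) - lambda_disc n l\<bar> * (\<bar>r l'\<bar> ^ k * (R1 \<theta> n \<tau> (Suc l) * R1 \<theta> n \<tau> l))"
        by (simp add: t_def mult_ac)
      also have "\<dots> \<le> t * (4 * pi * (sqrt (B l') + pi)) * (K * g l')"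
      proof (rule mult_mono)
        show "t * \<bar>lambda_disc n (Suc l) - lambda_disc n l\<bar> \<le> t * (4 * pi * (sqrt (B l') + pi))"
          unfolding B_def using t by (intro mult_left_mono lambda_disc_Suc_diff[OF n l'(1)]) auto
        have "R1 \<theta> n \<tau> (Suc l) * R1 \<theta> n \<tau> l \<le> R1 \<theta> n \<tau> l'"
          using l'(1) R1_bounds[OF \<theta>(1), of \<tau> n l] R1_bounds[OF \<theta>(1), of \<tau> n "Suc l"] \<tau>
          by (auto intro: mult_left_le mult_left_le_one_le)
        then have "\<bar>r l'\<bar> ^ k * (R1 \<theta> n \<tau> (Suc l) * R1 \<theta> n \<tau> l) \<le> \<bar>r l'\<bar> ^ k * R1 \<theta> n \<tau> l'"
          by (intro mult_left_mono) auto
        also note decK[of l']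
        finally show "\<bar>r l'\<bar> ^ k * (R1 \<theta> n \<tau> (Suc l) * R1 \<theta> n \<tau> l) \<le> K * g l'" .
      qed (use t B0 R1_bounds[OF \<theta>(1), of \<tau> n l] R1_bounds[OF \<theta>(1), of \<tau> n "Suc l"] \<tau> in \<open>auto intro!: mult_nonneg_nonneg\<close>)
      finally have "\<bar>b (Suc l) - b l\<bar> \<le> h l'" by (simp add: h_def)
      then have "(b (Suc l) - b l)\<^sup>2 \<le> (h l')\<^sup>2" using h0[of l'] by (simp add: abs_le_square_iff[symmetric])
      also have "\<dots> \<le> (h l)\<^sup>2 + (h (Suc l))\<^sup>2" using l'(1) by auto
      finally show ?thesis .
    qed
    have h_sq: "(h l)\<^sup>2 \<le> 32 * pi\<^sup>2 * K\<^sup>2 * (t / c + pi\<^sup>2 * t\<^sup>2) * g l" for l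
    proof -
      have "(sqrt (B l) + pi)\<^sup>2 \<le> 2 * (B l + pi\<^sup>2)"
        using sum_squares_bound[of "sqrt (B l)" pi] B0[of l] by (simp add: power2_sum)
      then have "(h l)\<^sup>2 \<le> 16 * pi\<^sup>2 * K\<^sup>2 * (t\<^sup>2 * (g l)\<^sup>2) * (2 * (B l + pi\<^sup>2))"
        unfolding h_def power_mult_distrib
        by (auto simp: mult_ac intro!: mult_left_mono)
      also have "\<dots> = 32 * pi\<^sup>2 * K\<^sup>2 * ((t * B l * g l) * t * g l + pi\<^sup>2 * t\<^sup>2 * (g l * g l))"
        by (simp add: power2_eq_square algebra_simps)
      also have "\<dots> \<le> 32 * pi\<^sup>2 * K\<^sup>2 * ((1 / c) * t * g l + pi\<^sup>2 * t\<^sup>2 * (1 * g l))"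
      proof (intro mult_left_mono add_mono mult_right_mono)
        have "0 < 1 + c * t * B l" using den[of l] by simp
        then show "t * B l * g l \<le> 1 / c" using K by (simp add: g_def field_simps)
      qed (use t g0[of l] in auto)
      finally show ?thesis by (simp add: algebra_simps)
    qed
    have hn: "h n = h 0" by (simp add: h_def g_def B_def Bn)
    have "(\<Sum>l<n. (h l)\<^sup>2) \<le> 32 * pi\<^sup>2 * K\<^sup>2 * (t / c + pi\<^sup>2 * t\<^sup>2) * (\<Sum>l<n. g l)"
      unfolding sum_distrib_left by (intro sum_mono h_sq)
    also have "\<dots> \<le> 32 * pi\<^sup>2 * K\<^sup>2 * (t / c + pi\<^sup>2 * t\<^sup>2) * Q"
      using t K by (intro mult_left_mono sum_g) auto
    finally have sum_h: "(\<Sum>l<n. (h l)\<^sup>2) \<le> 32 * pi\<^sup>2 * K\<^sup>2 * (t / c + pi\<^sup>2 * t\<^sup>2) * Q" .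
    have "(\<Sum>l<n. (b (Suc l) - b l)\<^sup>2) \<le> (\<Sum>l<n. (h l)\<^sup>2) + (\<Sum>l<n. (h (Suc l))\<^sup>2)"
      unfolding sum.distrib[symmetric] by (intro sum_mono step)
    also have "(\<Sum>l<n. (h (Suc l))\<^sup>2) = (\<Sum>l<n. (h l)\<^sup>2)"
      using sum.lessThan_Suc_shift[of "\<lambda>l. (h l)\<^sup>2" n] hn by simp
    finally have sum_diff: "(\<Sum>l<n. (b (Suc l) - b l)\<^sup>2) \<le> 64 * pi\<^sup>2 * K\<^sup>2 * (t / c + pi\<^sup>2 * t\<^sup>2) * Q"
      using sum_h by linarith
    define X where "X b = (\<Sum>j<n. norm (\<Sum>l<n. of_real (b l) * e_fun l (real q / real n) * cnj (e_fun l (real j / real n)))) / real n"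
      for b :: "nat \<Rightarrow> real"
    have "(X b)\<^sup>2 \<le> 5 * ((\<Sum>l<n. (b l)\<^sup>2) / Q + Q * (\<Sum>l<n. (b (Suc l) - b l)\<^sup>2))"
      unfolding X_def by (rule kernel_l1_bound[OF n q(1) Q]) (simp add: b_def rn)
    also have "\<dots> \<le> 5 * (K\<^sup>2 + Q * (64 * pi\<^sup>2 * K\<^sup>2 * (t / c + pi\<^sup>2 * t\<^sup>2) * Q))"
      using sum_b sum_diff Q by (intro mult_left_mono add_mono) (auto simp: pos_divide_le_eq)
    also have "Q * (64 * pi\<^sup>2 * K\<^sup>2 * (t / c + pi\<^sup>2 * t\<^sup>2) * Q) = 64 * pi\<^sup>2 * K\<^sup>2 * (t / c + pi\<^sup>2 * t\<^sup>2) * Q\<^sup>2"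
      by (simp add: power2_eq_square)
    also have "5 * (K\<^sup>2 + 64 * pi\<^sup>2 * K\<^sup>2 * (t / c + pi\<^sup>2 * t\<^sup>2) * Q\<^sup>2)
       \<le> 5 * (K\<^sup>2 + 64 * pi\<^sup>2 * K\<^sup>2 * (t / c + pi\<^sup>2 * t\<^sup>2) * (2 + 2 / (c * t)))"
    proof (intro mult_left_mono add_left_mono)
      have "Q\<^sup>2 \<le> (1 + 1 / sqrt (c * t))\<^sup>2" using Q by (intro power_mono) (auto simp: Q_def)
      also have "\<dots> \<le> 2 + 2 / (c * t)"
        using sum_squares_bound[of 1 "1 / sqrt (c * t)"] ct by (simp add: power2_sum power_divide)
      finally show "Q\<^sup>2 \<le> 2 + 2 / (c * t)" .
    qed (use t K in auto)
    also have "\<dots> = P t"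
      using t K by (simp add: P_def field_simps power2_eq_square)
    finally have Xb: "X b \<le> 1 + P t" using le_one_plus_square[of "X b"] by linarith
    have "(X (\<lambda>_. e ^ (k + 1)))\<^sup>2 \<le> 5 * ((\<Sum>l<n. (e ^ (k + 1))\<^sup>2) / real n + real n * (\<Sum>l<n. (e ^ (k + 1) - e ^ (k + 1))\<^sup>2))"
      unfolding X_def by (rule kernel_l1_bound[OF n q(1)]) (use n in auto)
    also have "\<dots> = 5 * (\<bar>e\<bar> ^ (k + 1))\<^sup>2"
    proof -
      have "(\<bar>e\<bar> ^ (k + 1))\<^sup>2 = (e ^ (k + 1))\<^sup>2" by (simp only: power_abs[symmetric] abs_power2)
      then show ?thesis using n by simp
    qed
    also have "\<dots> \<le> 5" using K by (auto intro!: power_le_one mult_le_one)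
    finally have Xe: "X (\<lambda>_. e ^ (k + 1)) \<le> 6" using le_one_plus_square[of "X (\<lambda>_. e ^ (k + 1))"] by linarith
    have "norm (G1 \<theta> n \<tau> (real (k + 1) * \<tau>) x (real j / real n))
      \<le> norm (\<Sum>l<n. of_real (b l) * e_fun l (real q / real n) * cnj (e_fun l (real j / real n)))
       + norm (\<Sum>l<n. of_real (e ^ (k + 1)) * e_fun l (real q / real n) * cnj (e_fun l (real j / real n)))" for j
    proof -
      have "G1 \<theta> n \<tau> (real (k + 1) * \<tau>) x (real j / real n)
        = (\<Sum>l<n. of_real (b l) * e_fun l (real q / real n) * cnj (e_fun l (real j / real n)))
        + (\<Sum>l<n. of_real (e ^ (k + 1)) * e_fun l (real q / real n) * cnj (e_fun l (real j / real n)))"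
        unfolding G1_grid[OF n \<tau>] q sum.distrib[symmetric]
        by (intro sum.cong refl) (simp add: b_def r_def algebra_simps)
      then show ?thesis by (simp only: norm_triangle_ineq)
    qed
    then have "(\<Sum>j<n. norm (G1 \<theta> n \<tau> (real (k + 1) * \<tau>) x (real j / real n))) / real n \<le> X b + X (\<lambda>_. e ^ (k + 1))"
      unfolding X_def add_divide_distrib[symmetric] sum.distrib[symmetric]
      by (intro divide_right_mono sum_mono) auto
    also have "\<dots> \<le> 7 + P t" using Xb Xe by simp
    also have "\<dots> \<le> A * (1 + t + t\<^sup>2 / 2)"
    proof -
      define a1 where "a1 = 640 * pi\<^sup>2 * K\<^sup>2 * (1 / c\<^sup>2)"
      define a2 where "a2 = 640 * pi\<^sup>2 * K\<^sup>2 * ((1 + pi\<^sup>2) / c)"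
      define a3 where "a3 = 640 * pi\<^sup>2 * K\<^sup>2 * pi\<^sup>2"
      have nn: "0 \<le> a1" "0 \<le> a2" "0 \<le> a3" using K by (auto simp: a1_def a2_def a3_def)
      have PA: "P t = 5 * K\<^sup>2 + a1 + a2 * t + a3 * t\<^sup>2" "A = 7 + 5 * K\<^sup>2 + a1 + a2 + 2 * a3"
        by (simp_all add: P_def A_def a1_def a2_def a3_def algebra_simps)
      define N where "N = 7 + 5 * K\<^sup>2 + a1"
      have N: "0 \<le> N" using nn by (simp add: N_def)
      have "0 \<le> (N + 2 * a3) * t" "0 \<le> (N + a2) * (t\<^sup>2 / 2)" using N nn t by auto
      moreover have "A * (1 + t + t\<^sup>2 / 2) = (7 + P t) + a2 + 2 * a3 + (N + 2 * a3) * t + (N + a2) * (t\<^sup>2 / 2)"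
        by (simp add: PA N_def algebra_simps)
      ultimately show ?thesis using nn by linarith
    qed
    also have "\<dots> \<le> A * exp t" using t A by (intro mult_left_mono exp_lower_Taylor_quadratic) auto
    also have "\<dots> \<le> A * exp (A * t)" using A t by (intro mult_left_mono) auto
    finally show "(\<Sum>j<n. norm (G1 \<theta> n \<tau> (real (k + 1) * \<tau>) x (real j / real n))) / real n
        \<le> A * exp (A * (real (k + 1) * \<tau>))" by (simp only: t_def)
  qed
qed

section \<open>A discrete Volterra inequality\<close>

lemma riemann_step_powr:
  fixes \<alpha> t \<tau> :: real
  assumes "0 < \<alpha>" "\<alpha> < 1" "0 \<le> t" "0 < \<tau>"
  shows "\<tau> * (t + \<tau>) powr (- \<alpha>) \<le> ((t + \<tau>) powr (1 - \<alpha>) - t powr (1 - \<alpha>)) / (1 - \<alpha>)"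
proof (cases "t = 0")
  case True
  have "\<tau> * \<tau> powr (- \<alpha>) = \<tau> powr 1 * \<tau> powr (- \<alpha>)" using assms by simp
  also have "\<dots> = \<tau> powr (1 - \<alpha>)" by (simp only: powr_add[symmetric]) simp
  finally have "\<tau> * \<tau> powr (- \<alpha>) = \<tau> powr (1 - \<alpha>)" .
  moreover have "\<tau> powr (1 - \<alpha>) \<le> \<tau> powr (1 - \<alpha>) / (1 - \<alpha>)"
    using assms by (simp add: pos_le_divide_eq mult_left_le)
  ultimately show ?thesis using True by simp
next
  case False
  have "\<exists>z>t. z < t + \<tau> \<and> (t + \<tau>) powr (1 - \<alpha>) - t powr (1 - \<alpha>) = (t + \<tau> - t) * ((1 - \<alpha>) * z powr (1 - \<alpha> - 1))"
  proof (rule MVT2)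
    fix x assume "t \<le> x" "x \<le> t + \<tau>"
    then show "((\<lambda>x. x powr (1 - \<alpha>)) has_real_derivative (1 - \<alpha>) * x powr (1 - \<alpha> - 1)) (at x)"
      using False assms by (intro has_real_derivative_powr) auto
  qed (use assms in auto)
  then obtain z where z: "t < z" "z < t + \<tau>"
    and eq: "(t + \<tau>) powr (1 - \<alpha>) - t powr (1 - \<alpha>) = \<tau> * ((1 - \<alpha>) * z powr (- \<alpha>))"
    by auto
  have "(t + \<tau>) powr (- \<alpha>) \<le> z powr (- \<alpha>)"
    using z assms by (intro powr_mono2') auto
  then show ?thesis unfolding eq using assms by (simp add: mult_left_mono)
qed

lemma sum_riemann_powr_le:
  fixes \<alpha> \<tau> :: real
  assumes "0 < \<alpha>" "\<alpha> < 1" "0 < \<tau>"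
  shows "(\<Sum>k<N. \<tau> * (real (k + 1) * \<tau>) powr (- \<alpha>)) \<le> (real N * \<tau>) powr (1 - \<alpha>) / (1 - \<alpha>)"
proof (induction N)
  case (Suc N)
  have "\<tau> * (real (N + 1) * \<tau>) powr (- \<alpha>) \<le> ((real (Suc N) * \<tau>) powr (1 - \<alpha>) - (real N * \<tau>) powr (1 - \<alpha>)) / (1 - \<alpha>)"
    using riemann_step_powr[OF assms(1,2) _ assms(3), of "real N * \<tau>"] assms(3) by (simp add: algebra_simps)
  with Suc show ?case by (simp add: diff_divide_distrib)
qed simp

lemma sum_riemann_powr_below_le:
  fixes \<alpha> \<tau> \<delta> :: real
  assumes "0 < \<alpha>" "\<alpha> < 1" "0 < \<tau>" "0 < \<delta>"
  shows "(\<Sum>k<N. if real (k + 1) * \<tau> \<le> \<delta> then \<tau> * (real (k + 1) * \<tau>) powr (- \<alpha>) else 0) \<le> \<delta> powr (1 - \<alpha>) / (1 - \<alpha>)"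
proof -
  let ?f = "\<lambda>k. \<tau> * (real (k + 1) * \<tau>) powr (- \<alpha>)"
  define N' where "N' = min N (nat \<lfloor>\<delta> / \<tau>\<rfloor>)"
  have "(\<Sum>k<N. if real (k + 1) * \<tau> \<le> \<delta> then ?f k else 0) = (\<Sum>k\<in>{k\<in>{..<N}. real (k + 1) * \<tau> \<le> \<delta>}. ?f k)"
    by (rule sum.inter_filter[symmetric]) simp
  also have "{k\<in>{..<N}. real (k + 1) * \<tau> \<le> \<delta>} = {..<N'}"
  proof -
    have "(real (k + 1) * \<tau> \<le> \<delta>) = (k < nat \<lfloor>\<delta> / \<tau>\<rfloor>)" for k
    proof -
      have "(real (k + 1) * \<tau> \<le> \<delta>) = (real_of_int (int k + 1) \<le> \<delta> / \<tau>)"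
        using assms by (simp add: pos_le_divide_eq add.commute)
      also have "\<dots> = (int k + 1 \<le> \<lfloor>\<delta> / \<tau>\<rfloor>)" by (simp only: le_floor_iff)
      also have "\<dots> = (k < nat \<lfloor>\<delta> / \<tau>\<rfloor>)" by linarith
      finally show ?thesis .
    qed
    then show ?thesis unfolding N'_def
      by (intro set_eqI) (simp only: mem_Collect_eq lessThan_iff min_less_iff_conj)
  qed
  also have "(\<Sum>k<N'. ?f k) \<le> (real N' * \<tau>) powr (1 - \<alpha>) / (1 - \<alpha>)"
    by (rule sum_riemann_powr_le[OF assms(1-3)])
  also have "\<dots> \<le> \<delta> powr (1 - \<alpha>) / (1 - \<alpha>)"
  proof (intro divide_right_mono powr_mono2)
    have "real N' \<le> \<delta> / \<tau>"
    proof -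
      have "real N' \<le> real (nat \<lfloor>\<delta> / \<tau>\<rfloor>)" by (simp add: N'_def)
      also have "\<dots> \<le> \<delta> / \<tau>" using assms by simp
      finally show ?thesis .
    qed
    then show "real N' * \<tau> \<le> \<delta>" using assms by (simp add: pos_le_divide_eq)
  qed (use assms in auto)
  finally show ?thesis .
qed

lemma sum_riemann_exp_le:
  fixes \<gamma> \<tau> :: real
  assumes "0 < \<gamma>" "0 < \<tau>"
  shows "(\<Sum>k<N. \<tau> * exp (- \<gamma> * (real (k + 1) * \<tau>))) \<le> 1 / \<gamma>"
proof -
  have "(\<Sum>k<N. \<tau> * exp (- \<gamma> * (real (k + 1) * \<tau>))) \<le> (1 - exp (- \<gamma> * (real N * \<tau>))) / \<gamma>"
  proof (induction N)
    case (Suc N)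
    define a where "a = exp (- \<gamma> * (real (Suc N) * \<tau>))"
    have "a * (1 + \<gamma> * \<tau>) \<le> a * exp (\<gamma> * \<tau>)"
      by (intro mult_left_mono exp_ge_add_one_self) (simp add: a_def)
    also have "\<dots> = exp (- \<gamma> * (real N * \<tau>))"
      by (simp add: a_def exp_add[symmetric] algebra_simps)
    finally have "\<tau> * a \<le> (exp (- \<gamma> * (real N * \<tau>)) - a) / \<gamma>"
      using assms by (simp add: pos_le_divide_eq algebra_simps)
    with Suc show ?case by (simp add: a_def diff_divide_distrib)
  qed simp
  also have "\<dots> \<le> 1 / \<gamma>" using assms by (intro divide_right_mono) auto
  finally show ?thesis .
qed

lemma weighted_sum_small:
  fixes \<alpha> \<kappa> :: real
  assumes "0 < \<alpha>" "\<alpha> < 1" "0 < \<kappa>"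
  obtains \<gamma> where "0 < \<gamma>"
    and "\<And>\<tau> N. 0 < \<tau> \<Longrightarrow>
      (\<Sum>k<N. exp (- \<gamma> * (real (k + 1) * \<tau>)) * (\<tau> * (1 + (real (k + 1) * \<tau>) powr (- \<alpha>)))) \<le> \<kappa>"
proof -
  define \<delta> where "\<delta> = ((1 - \<alpha>) * \<kappa> / 2) powr (1 / (1 - \<alpha>))"
  have \<delta>: "0 < \<delta>" using assms by (simp add: \<delta>_def)
  have \<delta>2: "\<delta> powr (1 - \<alpha>) / (1 - \<alpha>) = \<kappa> / 2"
  proof -
    have "\<delta> powr (1 - \<alpha>) = (1 - \<alpha>) * \<kappa> / 2" using assms by (simp add: \<delta>_def powr_powr)
    then show ?thesis using assms by simp
  qed
  define b where "b = 1 + \<delta> powr (- \<alpha>)"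
  have b: "0 < b" by (simp add: b_def add_pos_nonneg)
  define \<gamma> where "\<gamma> = 2 * b / \<kappa>"
  have \<gamma>: "0 < \<gamma>" using b assms by (simp add: \<gamma>_def)
  show thesis
  proof (rule that[OF \<gamma>])
    fix \<tau> :: real and N assume \<tau>: "0 < \<tau>"
    have "exp (- \<gamma> * (real (k + 1) * \<tau>)) * (\<tau> * (1 + (real (k + 1) * \<tau>) powr (- \<alpha>)))
       \<le> (if real (k + 1) * \<tau> \<le> \<delta> then \<tau> * (real (k + 1) * \<tau>) powr (- \<alpha>) else 0)
         + b * (\<tau> * exp (- \<gamma> * (real (k + 1) * \<tau>)))" for k
    proof -
      define t where "t = real (k + 1) * \<tau>"
      have t: "0 < t" using \<tau> by (simp add: t_def)
      have e: "exp (- \<gamma> * t) \<le> 1" using \<gamma> t by simp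
      have "exp (- \<gamma> * t) * (\<tau> * (1 + t powr (- \<alpha>)))
        \<le> (if t \<le> \<delta> then \<tau> * t powr (- \<alpha>) else 0) + b * (\<tau> * exp (- \<gamma> * t))"
      proof (cases "t \<le> \<delta>")
        case True
        have "exp (- \<gamma> * t) * (\<tau> * t powr (- \<alpha>)) \<le> 1 * (\<tau> * t powr (- \<alpha>))"
          using e \<tau> by (intro mult_right_mono) auto
        moreover have "1 * (\<tau> * exp (- \<gamma> * t)) \<le> b * (\<tau> * exp (- \<gamma> * t))"
          using \<tau> by (intro mult_right_mono) (auto simp: b_def)
        ultimately show ?thesis using True by (simp add: algebra_simps)
      next
        case False
        have "t powr (- \<alpha>) \<le> \<delta> powr (- \<alpha>)" using False \<delta> assms by (intro powr_mono2') auto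
        then have "(1 + t powr (- \<alpha>)) * (\<tau> * exp (- \<gamma> * t)) \<le> b * (\<tau> * exp (- \<gamma> * t))"
          using \<tau> by (intro mult_right_mono) (auto simp: b_def)
        then show ?thesis using False by (simp add: mult_ac)
      qed
      then show ?thesis by (simp only: t_def)
    qed
    then have "(\<Sum>k<N. exp (- \<gamma> * (real (k + 1) * \<tau>)) * (\<tau> * (1 + (real (k + 1) * \<tau>) powr (- \<alpha>))))
      \<le> (\<Sum>k<N. (if real (k + 1) * \<tau> \<le> \<delta> then \<tau> * (real (k + 1) * \<tau>) powr (- \<alpha>) else 0)
         + b * (\<tau> * exp (- \<gamma> * (real (k + 1) * \<tau>))))"
      by (intro sum_mono)
    also have "\<dots> = (\<Sum>k<N. if real (k + 1) * \<tau> \<le> \<delta> then \<tau> * (real (k + 1) * \<tau>) powr (- \<alpha>) else 0)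
         + b * (\<Sum>k<N. \<tau> * exp (- \<gamma> * (real (k + 1) * \<tau>)))"
      by (simp only: sum.distrib sum_distrib_left)
    also have "\<dots> \<le> \<kappa> / 2 + b * (1 / \<gamma>)"
      unfolding \<delta>2[symmetric]
      using b by (intro add_mono mult_left_mono sum_riemann_powr_below_le sum_riemann_exp_le assms \<tau> \<delta> \<gamma>) auto
    also have "\<dots> = \<kappa>" using assms b by (simp add: \<gamma>_def)
    finally show "(\<Sum>k<N. exp (- \<gamma> * (real (k + 1) * \<tau>)) * (\<tau> * (1 + (real (k + 1) * \<tau>) powr (- \<alpha>)))) \<le> \<kappa>" .
  qed
qed

lemma weighted_sum_linear:
  fixes \<alpha> \<tau> :: real
  assumes "0 < \<alpha>" "\<alpha> < 1" "0 < \<tau>"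
  shows "(\<Sum>k<N. \<tau> * (1 + (real (k + 1) * \<tau>) powr (- \<alpha>))) \<le> (1 + 1 / (1 - \<alpha>)) * (1 + real N * \<tau>)"
proof -
  define y where "y = real N * \<tau>"
  have y: "0 \<le> y" using assms by (simp add: y_def)
  have "y powr (1 - \<alpha>) \<le> 1 + y"
  proof (cases "y \<le> 1")
    case True
    then have "y powr (1 - \<alpha>) \<le> 1 powr (1 - \<alpha>)" using y assms by (intro powr_mono2) auto
    then show ?thesis using y by simp
  next
    case False
    then have "y powr (1 - \<alpha>) \<le> y powr 1" using assms by (intro powr_mono) auto
    then show ?thesis using y by simp
  qed
  then have "y powr (1 - \<alpha>) / (1 - \<alpha>) \<le> (1 + y) / (1 - \<alpha>)" using assms by (intro divide_right_mono) auto
  moreover have "(\<Sum>k<N. \<tau> * (1 + (real (k + 1) * \<tau>) powr (- \<alpha>))) \<le> y + y powr (1 - \<alpha>) / (1 - \<alpha>)"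
    using sum_riemann_powr_le[OF assms, of N] by (simp add: distrib_left sum.distrib y_def)
  moreover have "(1 + 1 / (1 - \<alpha>)) * (1 + y) = (1 + y) + (1 + y) / (1 - \<alpha>)"
    by (simp add: distrib_right)
  ultimately show ?thesis unfolding y_def[symmetric] by linarith
qed

lemma linear_recursion_le:
  fixes \<Phi> A B :: "nat \<Rightarrow> real"
  assumes "\<And>m. m < i \<Longrightarrow> \<Phi> (Suc m) \<le> (1 + A m) * \<Phi> m + A m * B m"
    and "\<And>m. m < i \<Longrightarrow> 0 \<le> A m" and "\<And>m. m < i \<Longrightarrow> 0 \<le> B m" and "0 \<le> \<Phi> 0"
  shows "\<Phi> i \<le> exp (\<Sum>m<i. A m) * \<Phi> 0 + (\<Sum>m<i. exp (\<Sum>m'\<in>{Suc m..<i}. A m') * (A m * B m))"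
  using assms
proof (induction i)
  case (Suc i)
  define R where "R = exp (\<Sum>m<i. A m) * \<Phi> 0 + (\<Sum>m<i. exp (\<Sum>m'\<in>{Suc m..<i}. A m') * (A m * B m))"
  have IH: "\<Phi> i \<le> R" unfolding R_def using Suc by simp
  have R0: "0 \<le> R" unfolding R_def using Suc.prems by (intro add_nonneg_nonneg sum_nonneg mult_nonneg_nonneg) auto
  have Ai: "0 \<le> A i" using Suc.prems by simp
  have "\<Phi> (Suc i) \<le> (1 + A i) * \<Phi> i + A i * B i" using Suc.prems by simp
  also have "\<dots> \<le> exp (A i) * R + A i * B i"
  proof -
    have "(1 + A i) * \<Phi> i \<le> (1 + A i) * R" using IH Ai by (intro mult_left_mono) auto
    also have "\<dots> \<le> exp (A i) * R" using R0 by (intro mult_right_mono exp_ge_add_one_self) auto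
    finally show ?thesis by simp
  qed
  also have "exp (A i) * R = exp (\<Sum>m<Suc i. A m) * \<Phi> 0 + (\<Sum>m<i. exp (\<Sum>m'\<in>{Suc m..<Suc i}. A m') * (A m * B m))"
    unfolding R_def distrib_left sum_distrib_left
    by (intro arg_cong2[of _ _ _ _ "(+)"] sum.cong) (auto simp: exp_add mult_ac)
  finally show ?case by simp
qed simp

text \<open>Here \<open>i\<close> is fixed and \<open>\<Phi> m\<close> bounds the \<open>p\<close>-th moment of the partial sum, up to time \<open>m \<tau>\<close>, of the
  mild equation at time \<open>i \<tau>\<close>; hence the weight is singular as \<open>m\<close> approaches \<open>i\<close>.\<close>

lemma volterra_bound:
  fixes \<alpha> c D Q0 :: real
  assumes \<alpha>: "0 < \<alpha>" "\<alpha> < 1" and c: "0 < c" and D: "0 < D"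
  obtains Q \<beta> where "0 < Q" "0 < \<beta>" "Q0 \<le> Q"
    and "\<And>\<tau> i \<Phi>. 0 < \<tau> \<Longrightarrow> 0 \<le> \<Phi> 0 \<Longrightarrow> \<Phi> 0 \<le> D * exp (D * (real i * \<tau>)) \<Longrightarrow>
      (\<And>m. m < i \<Longrightarrow> \<Phi> (Suc m) \<le> (1 + c * (\<tau> * (1 + (real (i - m) * \<tau>) powr (- \<alpha>)))) * \<Phi> m
          + c * (\<tau> * (1 + (real (i - m) * \<tau>) powr (- \<alpha>))) * (Q * exp (\<beta> * (real m * \<tau>)))) \<Longrightarrow>
      1 + \<Phi> i \<le> Q * exp (\<beta> * (real i * \<tau>))"
proof -
  define a where "a = c * (1 + 1 / (1 - \<alpha>))"
  have a: "0 < a" using c \<alpha> by (simp add: a_def add_pos_pos)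
  define \<kappa> where "\<kappa> = 1 / (2 * exp a * c)"
  have \<kappa>: "0 < \<kappa>" using c by (simp add: \<kappa>_def)
  obtain \<gamma> where \<gamma>: "0 < \<gamma>"
    and small: "\<And>\<tau> N. 0 < \<tau> \<Longrightarrow>
      (\<Sum>k<N. exp (- \<gamma> * (real (k + 1) * \<tau>)) * (\<tau> * (1 + (real (k + 1) * \<tau>) powr (- \<alpha>)))) \<le> \<kappa>"
    using weighted_sum_small[OF \<alpha> \<kappa>] by blast
  define \<beta> where "\<beta> = a + \<gamma> + D"
  define Q where "Q = max Q0 (2 * (D * exp a + 1))"
  have Q: "0 < Q" "Q0 \<le> Q" "2 * (D * exp a + 1) \<le> Q"
    using D by (auto simp: Q_def less_max_iff_disj intro!: disjI2 add_pos_pos)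
  have \<beta>: "0 < \<beta>" using a \<gamma> D by (simp add: \<beta>_def)
  show thesis
  proof (rule that[OF Q(1) \<beta> Q(2)])
    fix \<tau> :: real and i :: nat and \<Phi> :: "nat \<Rightarrow> real"
    assume \<tau>: "0 < \<tau>" and \<Phi>0: "0 \<le> \<Phi> 0" "\<Phi> 0 \<le> D * exp (D * (real i * \<tau>))"
      and rec: "\<And>m. m < i \<Longrightarrow> \<Phi> (Suc m) \<le> (1 + c * (\<tau> * (1 + (real (i - m) * \<tau>) powr (- \<alpha>)))) * \<Phi> m
          + c * (\<tau> * (1 + (real (i - m) * \<tau>) powr (- \<alpha>))) * (Q * exp (\<beta> * (real m * \<tau>)))"
    define W where "W k = \<tau> * (1 + (real (k + 1) * \<tau>) powr (- \<alpha>))" for k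
    define A where "A m = c * W (i - Suc m)" for m
    define B where "B m = Q * exp (\<beta> * (real m * \<tau>))" for m
    have W0: "0 \<le> W k" for k using \<tau> by (simp add: W_def add_nonneg_nonneg)
    have AW: "A m = c * (\<tau> * (1 + (real (i - m) * \<tau>) powr (- \<alpha>)))" if "m < i" for m
    proof -
      have "i - Suc m + 1 = i - m" using that by simp
      then show ?thesis by (simp only: A_def W_def)
    qed
    have sumW: "(\<Sum>k<N. c * W k) \<le> a + a * (real N * \<tau>)" for N
    proof -
      have "c * (\<Sum>k<N. W k) \<le> c * ((1 + 1 / (1 - \<alpha>)) * (1 + real N * \<tau>))"
        unfolding W_def using c by (intro mult_left_mono weighted_sum_linear \<alpha> \<tau>) auto
      also have "\<dots> = a + a * (real N * \<tau>)" unfolding a_def by (simp add: algebra_simps)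
      finally show ?thesis by (simp add: sum_distrib_left)
    qed
    have sumA: "(\<Sum>m'\<in>{Suc m..<i}. A m') = (\<Sum>k<i - Suc m. c * W k)" if "m < i" for m
      unfolding A_def
      by (rule sum.reindex_bij_witness[of _ "\<lambda>k. i - Suc k" "\<lambda>m. i - Suc m"]) (use that in auto)
    have "\<Phi> i \<le> exp (\<Sum>m<i. A m) * \<Phi> 0 + (\<Sum>m<i. exp (\<Sum>m'\<in>{Suc m..<i}. A m') * (A m * B m))"
    proof (rule linear_recursion_le)
      fix m assume "m < i"
      then show "\<Phi> (Suc m) \<le> (1 + A m) * \<Phi> m + A m * B m" using rec[of m] by (simp only: AW B_def)
    qed (use c W0 Q(1) \<Phi>0 in \<open>auto simp: A_def B_def\<close>)
    also have "exp (\<Sum>m<i. A m) * \<Phi> 0 \<le> exp (a + a * (real i * \<tau>)) * (D * exp (D * (real i * \<tau>)))"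
    proof (intro mult_mono \<Phi>0)
      have "(\<Sum>m<i. A m) = (\<Sum>k<i. c * W k)"
        unfolding A_def using sum.nat_diff_reindex[of "\<lambda>k. c * W k" i] by simp
      then show "exp (\<Sum>m<i. A m) \<le> exp (a + a * (real i * \<tau>))" using sumW[of i] by simp
    qed (use D \<Phi>0 in auto)
    also have "exp (a + a * (real i * \<tau>)) * (D * exp (D * (real i * \<tau>))) = D * exp a * exp ((a + D) * (real i * \<tau>))"
      by (simp add: exp_add algebra_simps)
    also have "\<dots> \<le> D * exp a * exp (\<beta> * (real i * \<tau>))"
      using D \<gamma> \<tau> by (intro mult_left_mono) (auto simp: \<beta>_def intro!: mult_right_mono)
    also have "(\<Sum>m<i. exp (\<Sum>m'\<in>{Suc m..<i}. A m') * (A m * B m))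
       \<le> (\<Sum>m<i. (Q * exp (\<beta> * (real i * \<tau>)) * (exp a * c)) *
            (exp (- \<gamma> * (real (i - Suc m + 1) * \<tau>)) * W (i - Suc m)))"
    proof (rule sum_mono)
      fix m assume m: "m \<in> {..<i}"
      define s where "s = real (i - Suc m + 1) * \<tau>"
      have s: "0 \<le> s" "real m * \<tau> = real i * \<tau> - s"
        using m \<tau> by (auto simp: s_def of_nat_diff algebra_simps)
      have "(\<Sum>m'\<in>{Suc m..<i}. A m') \<le> a + a * (real (i - Suc m) * \<tau>)"
        using sumA[of m] sumW[of "i - Suc m"] m by simp
      also have "\<dots> \<le> a + a * s" using a \<tau> by (auto simp: s_def intro!: mult_left_mono mult_right_mono)
      finally have "exp (\<Sum>m'\<in>{Suc m..<i}. A m') * (A m * B m) \<le> exp (a + a * s) * (A m * B m)"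
        using c W0 Q(1) by (intro mult_right_mono) (auto simp: A_def B_def)
      also have "\<dots> = (Q * (exp a * c)) * W (i - Suc m) * (exp (a * s) * exp (\<beta> * (real m * \<tau>)))"
        by (simp add: A_def B_def exp_add mult_ac)
      also have "exp (a * s) * exp (\<beta> * (real m * \<tau>)) = exp (\<beta> * (real i * \<tau>)) * exp (- (\<gamma> + D) * s)"
        unfolding s(2) exp_add[symmetric] by (simp add: \<beta>_def algebra_simps)
      also have "(Q * (exp a * c)) * W (i - Suc m) * (exp (\<beta> * (real i * \<tau>)) * exp (- (\<gamma> + D) * s))
        \<le> (Q * (exp a * c)) * W (i - Suc m) * (exp (\<beta> * (real i * \<tau>)) * exp (- \<gamma> * s))"
        using Q(1) c W0 D s(1) by (intro mult_left_mono) (auto simp: algebra_simps)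
      finally show "exp (\<Sum>m'\<in>{Suc m..<i}. A m') * (A m * B m)
        \<le> (Q * exp (\<beta> * (real i * \<tau>)) * (exp a * c)) * (exp (- \<gamma> * (real (i - Suc m + 1) * \<tau>)) * W (i - Suc m))"
        unfolding s_def by (simp add: mult_ac)
    qed
    also have "\<dots> = (Q * exp (\<beta> * (real i * \<tau>)) * (exp a * c)) * (\<Sum>k<i. exp (- \<gamma> * (real (k + 1) * \<tau>)) * W k)"
      unfolding sum_distrib_left[symmetric]
      using sum.nat_diff_reindex[of "\<lambda>k. exp (- \<gamma> * (real (k + 1) * \<tau>)) * W k" i] by simp
    also have "\<dots> \<le> (Q * exp (\<beta> * (real i * \<tau>)) * (exp a * c)) * \<kappa>"
      unfolding W_def using Q(1) c by (intro mult_left_mono small \<tau>) auto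
    also have "\<dots> = Q / 2 * exp (\<beta> * (real i * \<tau>))" using c by (simp add: \<kappa>_def)
    finally have "\<Phi> i \<le> D * exp a * exp (\<beta> * (real i * \<tau>)) + Q / 2 * exp (\<beta> * (real i * \<tau>))" by simp
    moreover have "1 \<le> exp (\<beta> * (real i * \<tau>))" using \<beta> \<tau> by simp
    moreover have "(D * exp a + 1) * exp (\<beta> * (real i * \<tau>)) \<le> Q / 2 * exp (\<beta> * (real i * \<tau>))"
      using Q(3) by (intro mult_right_mono) auto
    moreover have "(D * exp a + 1) * exp (\<beta> * (real i * \<tau>)) = D * exp a * exp (\<beta> * (real i * \<tau>)) + exp (\<beta> * (real i * \<tau>))"
      by (simp add: distrib_right)
    moreover have "Q * exp (\<beta> * (real i * \<tau>)) = Q / 2 * exp (\<beta> * (real i * \<tau>)) + Q / 2 * exp (\<beta> * (real i * \<tau>))"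
      by (simp add: field_simps)
    ultimately show "1 + \<Phi> i \<le> Q * exp (\<beta> * (real i * \<tau>))" by linarith
  qed
qed

section \<open>Moments of sums of independent Poisson variables\<close>

definition poisson_weight :: "real \<Rightarrow> nat \<Rightarrow> real" where
  "poisson_weight r k = r ^ k / fact k * exp (- r)"

lemma poisson_weight_nonneg: "0 \<le> r \<Longrightarrow> 0 \<le> poisson_weight r k"
  by (simp add: poisson_weight_def)

lemma poisson_weight_Suc: "poisson_weight r (Suc k) * real (Suc k) = r * poisson_weight r k"
  by (simp add: poisson_weight_def divide_simps del: of_nat_Suc)

lemma poisson_weight_sums: "poisson_weight r sums 1"
proof -
  have "(\<lambda>k. r ^ k /\<^sub>R fact k) sums exp r" by (rule exp_converges)
  from sums_mult2[OF this, of "exp (- r)"] show ?thesis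
    by (simp add: poisson_weight_def[abs_def] exp_add[symmetric] divide_inverse mult_ac)
qed

lemma (in prob_space) nn_integral_poisson:
  fixes X :: "'a \<Rightarrow> real"
  assumes X[measurable]: "X \<in> borel_measurable M" and r: "0 \<le> r"
    and pois: "\<And>k::nat. prob {\<omega> \<in> space M. X \<omega> = real k} = poisson_weight r k"
    and g[measurable]: "g \<in> borel_measurable borel"
  shows "(\<integral>\<^sup>+\<omega>. g (X \<omega>) \<partial>M) = (\<Sum>k. ennreal (poisson_weight r k) * g (real k))"
proof -
  define A where "A k = {\<omega> \<in> space M. X \<omega> = real k}" for k
  have A[measurable]: "A k \<in> sets M" for k unfolding A_def by measurable
  have disj: "disjoint_family A" by (auto simp: disjoint_family_on_def A_def)
  have "prob (\<Union>k. A k) = 1"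
  proof -
    have "(\<lambda>k. prob (A k)) sums prob (\<Union>k. A k)"
      using disj by (intro finite_measure_UNION) auto
    moreover have "(\<lambda>k. prob (A k)) sums 1"
      using poisson_weight_sums[of r] by (simp add: A_def pois)
    ultimately show ?thesis by (rule sums_unique2)
  qed
  then have AE: "AE \<omega> in M. \<omega> \<in> (\<Union>k. A k)"
    by (subst (asm) prob_eq_1) auto
  have "(\<integral>\<^sup>+\<omega>. g (X \<omega>) \<partial>M) = (\<integral>\<^sup>+\<omega>. (\<Sum>k. g (real k) * indicator (A k) \<omega>) \<partial>M)"
  proof (rule nn_integral_cong_AE, use AE in eventually_elim)
    fix \<omega> assume "\<omega> \<in> (\<Union>k. A k)"
    then obtain k where k: "\<omega> \<in> A k" by auto
    then have "(\<Sum>k. g (real k) * indicator (A k) \<omega>) = (\<Sum>k'\<in>{k}. g (real k') * indicator (A k') \<omega>)"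
      by (intro suminf_finite) (auto simp: A_def)
    also have "\<dots> = g (real k)" using k by simp
    also have "real k = X \<omega>" using k by (simp add: A_def)
    finally show "g (X \<omega>) = (\<Sum>k. g (real k) * indicator (A k) \<omega>)" by (rule sym)
  qed
  also have "\<dots> = (\<Sum>k. \<integral>\<^sup>+\<omega>. g (real k) * indicator (A k) \<omega> \<partial>M)"
    by (rule nn_integral_suminf) auto
  also have "\<dots> = (\<Sum>k. ennreal (poisson_weight r k) * g (real k))"
    using pois by (intro suminf_cong) (simp add: nn_integral_cmult_indicator emeasure_eq_measure A_def mult.commute)
  finally show ?thesis .
qed

lemma suminf_poisson_mecke:
  assumes r: "0 \<le> r"
  shows "(\<Sum>k. ennreal (poisson_weight r k) * (ennreal (real k) * G k)) = ennreal r * (\<Sum>k. ennreal (poisson_weight r k) * G (Suc k))"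
proof -
  have "(\<Sum>k. ennreal (poisson_weight r k) * (ennreal (real k) * G k))
    = (\<Sum>k. ennreal (poisson_weight r (Suc k)) * (ennreal (real (Suc k)) * G (Suc k)))"
    by (subst suminf_offset[where i = 1]) simp_all
  also have "\<dots> = (\<Sum>k. ennreal r * (ennreal (poisson_weight r k) * G (Suc k)))"
  proof (rule suminf_cong)
    fix k
    have "ennreal (poisson_weight r (Suc k)) * ennreal (real (Suc k)) = ennreal r * ennreal (poisson_weight r k)"
      using r poisson_weight_Suc[of r k]
      by (simp add: ennreal_mult[symmetric] poisson_weight_nonneg del: of_nat_Suc)
    then show "ennreal (poisson_weight r (Suc k)) * (ennreal (real (Suc k)) * G (Suc k)) = ennreal r * (ennreal (poisson_weight r k) * G (Suc k))"
      by (simp only: mult.assoc[symmetric])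
  qed
  finally show ?thesis by simp
qed

lemma (in prob_space) poisson_mean:
  fixes X :: "'a \<Rightarrow> real"
  assumes X[measurable]: "X \<in> borel_measurable M" and r: "0 \<le> r"
    and pois: "\<And>k::nat. prob {\<omega> \<in> space M. X \<omega> = real k} = poisson_weight r k"
  shows "(\<integral>\<^sup>+\<omega>. ennreal (X \<omega>) \<partial>M) = ennreal r"
proof -
  have "(\<integral>\<^sup>+\<omega>. ennreal (X \<omega>) \<partial>M) = (\<Sum>k. ennreal (poisson_weight r k) * (ennreal (real k) * 1))"
    using nn_integral_poisson[OF X r pois, of ennreal] by simp
  also have "\<dots> = ennreal r * (\<Sum>k. ennreal (poisson_weight r k) * 1)"
    by (rule suminf_poisson_mecke[OF r])
  also have "(\<Sum>k. ennreal (poisson_weight r k) * 1) = 1"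
    using poisson_weight_sums[of r] poisson_weight_nonneg[OF r]
    by (simp add: suminf_ennreal2 sums_iff)
  finally show ?thesis by simp
qed

lemma (in prob_space) nn_integral_indep_var:
  assumes ind: "indep_var S X T W" and h: "(\<lambda>(x, w). h x w) \<in> borel_measurable (S \<Otimes>\<^sub>M T)"
  shows "(\<integral>\<^sup>+\<omega>. h (X \<omega>) (W \<omega>) \<partial>M) = (\<integral>\<^sup>+\<omega>. (\<integral>\<^sup>+\<omega>'. h (X \<omega>) (W \<omega>') \<partial>M) \<partial>M)"
proof -
  have X[measurable]: "X \<in> measurable M S" and W[measurable]: "W \<in> measurable M T"
    using ind by (auto simp: indep_var_distribution_eq)
  note h[measurable]
  interpret T: prob_space "distr M T W" by (rule prob_space_distr) fact
  have "(\<integral>\<^sup>+\<omega>. h (X \<omega>) (W \<omega>) \<partial>M) = (\<integral>\<^sup>+z. (case z of (x, w) \<Rightarrow> h x w) \<partial>distr M (S \<Otimes>\<^sub>M T) (\<lambda>\<omega>. (X \<omega>, W \<omega>)))"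
    by (subst nn_integral_distr) auto
  also have "distr M (S \<Otimes>\<^sub>M T) (\<lambda>\<omega>. (X \<omega>, W \<omega>)) = distr M S X \<Otimes>\<^sub>M distr M T W"
    using ind by (simp add: indep_var_distribution_eq)
  also have "(\<integral>\<^sup>+z. (case z of (x, w) \<Rightarrow> h x w) \<partial>(distr M S X \<Otimes>\<^sub>M distr M T W))
     = (\<integral>\<^sup>+x. (\<integral>\<^sup>+w. h x w \<partial>distr M T W) \<partial>distr M S X)"
    by (subst T.nn_integral_fst[symmetric]) auto
  also have "\<dots> = (\<integral>\<^sup>+\<omega>. (\<integral>\<^sup>+w. h (X \<omega>) w \<partial>distr M T W) \<partial>M)"
    by (subst nn_integral_distr) auto
  also have "\<dots> = (\<integral>\<^sup>+\<omega>. (\<integral>\<^sup>+\<omega>'. h (X \<omega>) (W \<omega>') \<partial>M) \<partial>M)"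
    by (intro nn_integral_cong nn_integral_distr) (auto intro!: measurable_Pair2[where f = "case_prod h", simplified] measurable_space[OF X])
  finally show ?thesis .
qed

lemma (in prob_space) poisson_mecke:
  fixes X W :: "'a \<Rightarrow> real"
  assumes ind: "indep_var borel X borel W" and r: "0 \<le> r"
    and pois: "\<And>k::nat. prob {\<omega> \<in> space M. X \<omega> = real k} = poisson_weight r k"
    and g[measurable]: "g \<in> borel_measurable borel"
  shows "(\<integral>\<^sup>+\<omega>. ennreal (X \<omega>) * g (W \<omega> + c * X \<omega>) \<partial>M) = ennreal r * (\<integral>\<^sup>+\<omega>. g (W \<omega> + c * (X \<omega> + 1)) \<partial>M)"
proof -
  have X[measurable]: "X \<in> borel_measurable M" and W[measurable]: "W \<in> borel_measurable M"
    using ind by (auto simp: indep_var_distribution_eq)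
  have GM: "(\<lambda>x. \<integral>\<^sup>+\<omega>. g (W \<omega> + c * x) \<partial>M) \<in> borel_measurable borel"
    by (rule borel_measurable_nn_integral) measurable
  have GM1: "(\<lambda>x. \<integral>\<^sup>+\<omega>. g (W \<omega> + c * (x + 1)) \<partial>M) \<in> borel_measurable borel"
    by (rule borel_measurable_nn_integral) measurable
  have "(\<integral>\<^sup>+\<omega>. ennreal (X \<omega>) * g (W \<omega> + c * X \<omega>) \<partial>M)
     = (\<integral>\<^sup>+\<omega>. (\<integral>\<^sup>+\<omega>'. ennreal (X \<omega>) * g (W \<omega>' + c * X \<omega>) \<partial>M) \<partial>M)"
    by (rule nn_integral_indep_var[OF ind]) measurable
  also have "\<dots> = (\<integral>\<^sup>+\<omega>. ennreal (X \<omega>) * (\<integral>\<^sup>+\<omega>'. g (W \<omega>' + c * X \<omega>) \<partial>M) \<partial>M)"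
    by (intro nn_integral_cong nn_integral_cmult) measurable
  also have "\<dots> = (\<Sum>k. ennreal (poisson_weight r k) * (ennreal (real k) * (\<integral>\<^sup>+\<omega>'. g (W \<omega>' + c * real k) \<partial>M)))"
    using GM by (intro nn_integral_poisson[OF X r pois, of "\<lambda>x. ennreal x * (\<integral>\<^sup>+\<omega>'. g (W \<omega>' + c * x) \<partial>M)"]) measurable
  also have "\<dots> = ennreal r * (\<Sum>k. ennreal (poisson_weight r k) * (\<integral>\<^sup>+\<omega>'. g (W \<omega>' + c * real (Suc k)) \<partial>M))"
    by (rule suminf_poisson_mecke[OF r])
  also have "(\<Sum>k. ennreal (poisson_weight r k) * (\<integral>\<^sup>+\<omega>'. g (W \<omega>' + c * real (Suc k)) \<partial>M))
     = (\<integral>\<^sup>+\<omega>. (\<integral>\<^sup>+\<omega>'. g (W \<omega>' + c * (X \<omega> + 1)) \<partial>M) \<partial>M)"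
    using GM1 by (subst nn_integral_poisson[OF X r pois, of "\<lambda>x. \<integral>\<^sup>+\<omega>'. g (W \<omega>' + c * (x + 1)) \<partial>M"]) (auto simp: add.commute)
  also have "\<dots> = (\<integral>\<^sup>+\<omega>. g (W \<omega> + c * (X \<omega> + 1)) \<partial>M)"
    by (rule nn_integral_indep_var[OF ind, symmetric]) measurable
  finally show ?thesis .
qed

locale poisson_sum = prob_space +
  fixes I :: "'i set" and X :: "'i \<Rightarrow> 'a \<Rightarrow> real" and c r :: "'i \<Rightarrow> real"
  assumes fin: "finite I" and ind: "indep_vars (\<lambda>_. borel) X I"
    and X0: "\<And>i \<omega>. i \<in> I \<Longrightarrow> 0 \<le> X i \<omega>"
    and c0: "\<And>i. i \<in> I \<Longrightarrow> 0 \<le> c i" and r0: "\<And>i. i \<in> I \<Longrightarrow> 0 \<le> r i"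
    and pois: "\<And>i k. i \<in> I \<Longrightarrow> prob {\<omega> \<in> space M. X i \<omega> = real k} = poisson_weight (r i) k"
begin

definition Z :: "'a \<Rightarrow> real" where "Z \<omega> = (\<Sum>i\<in>I. c i * X i \<omega>)"

definition absmom :: "real \<Rightarrow> real" where "absmom q = (\<Sum>i\<in>I. c i powr q * r i)"

lemma X_measurable[measurable (raw)]: "i \<in> I \<Longrightarrow> X i \<in> borel_measurable M"
  using ind by (simp add: indep_vars_def)

lemma Z_measurable[measurable]: "Z \<in> borel_measurable M"
  unfolding Z_def[abs_def] by measurable

lemma Z_nonneg: "0 \<le> Z \<omega>"
  unfolding Z_def using X0 c0 by (intro sum_nonneg mult_nonneg_nonneg) auto

lemma absmom_nonneg: "0 \<le> absmom q"
  unfolding absmom_def using r0 by (intro sum_nonneg mult_nonneg_nonneg) auto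

lemma mecke_term:
  assumes i: "i \<in> I" and g[measurable]: "g \<in> borel_measurable borel"
  shows "ennreal (c i) * (\<integral>\<^sup>+\<omega>. ennreal (X i \<omega>) * g (Z \<omega>) \<partial>M) = ennreal (c i * r i) * (\<integral>\<^sup>+\<omega>. g (Z \<omega> + c i) \<partial>M)"
proof (cases "c i = 0")
  case True
  then show ?thesis by (simp only: mult_zero_left ennreal_0)
next
  case False
  define W where "W \<omega> = (\<Sum>j\<in>I - {i}. c j * X j \<omega>)" for \<omega>
  have "indep_vars (\<lambda>_. borel) (\<lambda>j \<omega>. c j * X j \<omega>) (insert i (I - {i}))"
    using indep_vars_compose2[OF ind, of "\<lambda>j x. c j * x" "\<lambda>_. borel"] i by (simp add: insert_absorb)
  from indep_vars_sum[OF _ _ this] fin have "indep_var borel (\<lambda>\<omega>. c i * X i \<omega>) borel W"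
    by (simp add: W_def[abs_def])
  then have "indep_var borel ((\<lambda>x. x / c i) \<circ> (\<lambda>\<omega>. c i * X i \<omega>)) borel ((\<lambda>x. x) \<circ> W)"
    by (rule indep_var_compose) measurable
  then have iv: "indep_var borel (X i) borel W" using False by (simp add: comp_def)
  have Z: "Z \<omega> = W \<omega> + c i * X i \<omega>" for \<omega>
    using sum.remove[OF fin i, of "\<lambda>j. c j * X j \<omega>"] by (simp add: Z_def W_def)
  have "ennreal (c i) * (\<integral>\<^sup>+\<omega>. ennreal (X i \<omega>) * g (Z \<omega>) \<partial>M)
     = ennreal (c i) * (ennreal (r i) * (\<integral>\<^sup>+\<omega>. g (W \<omega> + c i * (X i \<omega> + 1)) \<partial>M))"
    unfolding Z using poisson_mecke[OF iv r0[OF i] pois[OF i] g, of "c i"] by simp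
  also have "\<dots> = ennreal (c i * r i) * (\<integral>\<^sup>+\<omega>. g (Z \<omega> + c i) \<partial>M)"
    using c0[OF i] r0[OF i] by (simp add: Z ennreal_mult algebra_simps)
  finally show ?thesis .
qed

lemma mecke:
  assumes g[measurable]: "g \<in> borel_measurable borel"
  shows "(\<integral>\<^sup>+\<omega>. ennreal (Z \<omega>) * g (Z \<omega>) \<partial>M) = (\<Sum>i\<in>I. ennreal (c i * r i) * (\<integral>\<^sup>+\<omega>. g (Z \<omega> + c i) \<partial>M))"
proof -
  have "(\<integral>\<^sup>+\<omega>. ennreal (Z \<omega>) * g (Z \<omega>) \<partial>M) = (\<integral>\<^sup>+\<omega>. (\<Sum>i\<in>I. ennreal (c i) * (ennreal (X i \<omega>) * g (Z \<omega>))) \<partial>M)"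
  proof (rule nn_integral_cong)
    fix \<omega>
    have "ennreal (Z \<omega>) = (\<Sum>i\<in>I. ennreal (c i) * ennreal (X i \<omega>))"
      unfolding Z_def using c0 X0 by (subst sum_ennreal[symmetric]) (auto simp: ennreal_mult intro!: sum.cong)
    then show "ennreal (Z \<omega>) * g (Z \<omega>) = (\<Sum>i\<in>I. ennreal (c i) * (ennreal (X i \<omega>) * g (Z \<omega>)))"
      by (simp add: sum_distrib_right mult.assoc)
  qed
  also have "\<dots> = (\<Sum>i\<in>I. ennreal (c i) * (\<integral>\<^sup>+\<omega>. ennreal (X i \<omega>) * g (Z \<omega>) \<partial>M))"
    by (subst nn_integral_sum) (auto intro!: sum.cong nn_integral_cmult)
  also have "\<dots> = (\<Sum>i\<in>I. ennreal (c i * r i) * (\<integral>\<^sup>+\<omega>. g (Z \<omega> + c i) \<partial>M))"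
    by (intro sum.cong refl mecke_term) auto
  finally show ?thesis .
qed

lemma absmom_1: "absmom 1 = (\<Sum>i\<in>I. c i * r i)"
  unfolding absmom_def using c0 by (intro sum.cong) auto

lemma absmom_mult: "(\<Sum>i\<in>I. c i * r i * c i powr q) = absmom (q + 1)"
  unfolding absmom_def
proof (intro sum.cong refl)
  fix i assume i: "i \<in> I"
  show "c i * r i * c i powr q = c i powr (q + 1) * r i"
  proof (cases "c i = 0")
    case False
    then have "c i powr (q + 1) = c i powr q * c i" using c0[OF i] by (simp add: powr_add)
    then show ?thesis by (simp add: mult_ac)
  qed simp
qed

lemma first_moment: "(\<integral>\<^sup>+\<omega>. ennreal (Z \<omega>) \<partial>M) = ennreal (absmom 1)"
  using mecke[of "\<lambda>_. 1"] c0 r0 by (simp add: emeasure_space_1 absmom_1 sum_ennreal)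

lemma second_moment: "(\<integral>\<^sup>+\<omega>. ennreal ((Z \<omega>)\<^sup>2) \<partial>M) = ennreal ((absmom 1)\<^sup>2 + absmom 2)"
proof -
  have "(\<integral>\<^sup>+\<omega>. ennreal ((Z \<omega>)\<^sup>2) \<partial>M) = (\<integral>\<^sup>+\<omega>. ennreal (Z \<omega>) * ennreal (Z \<omega>) \<partial>M)"
    by (simp add: power2_eq_square ennreal_mult Z_nonneg)
  also have "\<dots> = (\<Sum>i\<in>I. ennreal (c i * r i) * (\<integral>\<^sup>+\<omega>. ennreal (Z \<omega> + c i) \<partial>M))"
    by (rule mecke) simp
  also have "\<dots> = (\<Sum>i\<in>I. ennreal (c i * r i) * ennreal (absmom 1 + c i))"
    using c0 by (intro sum.cong refl)
      (simp add: ennreal_plus Z_nonneg nn_integral_add first_moment emeasure_space_1 absmom_nonneg)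
  also have "\<dots> = (\<Sum>i\<in>I. ennreal (c i * r i * (absmom 1 + c i)))"
    using c0 r0 absmom_nonneg by (intro sum.cong refl ennreal_mult[symmetric]) auto
  also have "\<dots> = ennreal (\<Sum>i\<in>I. c i * r i * (absmom 1 + c i))"
    using c0 r0 absmom_nonneg by (intro sum_ennreal) auto
  also have "(\<Sum>i\<in>I. c i * r i * (absmom 1 + c i)) = (\<Sum>i\<in>I. c i * r i) * absmom 1 + (\<Sum>i\<in>I. c i * r i * c i powr 1)"
  proof -
    have "(\<Sum>i\<in>I. c i * r i * (absmom 1 + c i)) = (\<Sum>i\<in>I. c i * r i * absmom 1 + c i * r i * c i powr 1)"
      using c0 by (intro sum.cong refl) (simp add: distrib_left)
    then show ?thesis by (simp only: sum.distrib sum_distrib_right)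
  qed
  also have "\<dots> = (absmom 1)\<^sup>2 + absmom 2"
    using absmom_mult[of 1] by (simp add: absmom_1[symmetric] power2_eq_square)
  finally show ?thesis .
qed

lemma moment_le:
  assumes p: "2 \<le> p" "p \<le> 3"
  shows "(\<integral>\<^sup>+\<omega>. ennreal (Z \<omega> powr p) \<partial>M) \<le> ennreal (4 * (absmom 1 * (1 + ((absmom 1)\<^sup>2 + absmom 2)) + absmom p))"
proof -
  define T where "T = 1 + ((absmom 1)\<^sup>2 + absmom 2)"
  have T: "0 \<le> T" by (simp add: T_def absmom_nonneg add_nonneg_nonneg)
  have pw: "Z \<omega> powr p = Z \<omega> * Z \<omega> powr (p - 1)" for \<omega>
  proof (cases "Z \<omega> = 0")
    case False
    have "Z \<omega> powr (1 + (p - 1)) = Z \<omega> powr 1 * Z \<omega> powr (p - 1)" by (rule powr_add)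
    then show ?thesis using False Z_nonneg[of \<omega>] by simp
  qed simp
  have le4: "(2::real) powr (p - 1) \<le> 4"
    using p powr_mono[of "p - 1" 2 2] by simp
  have shift: "(\<integral>\<^sup>+\<omega>. ennreal ((Z \<omega> + a) powr (p - 1)) \<partial>M) \<le> ennreal (4 * (T + a powr (p - 1)))" if a: "0 \<le> a" for a
  proof -
    have "(Z \<omega> + a) powr (p - 1) \<le> 4 * ((1 + (Z \<omega>)\<^sup>2) + a powr (p - 1))" for \<omega>
    proof -
      have "(Z \<omega> + a) powr (p - 1) \<le> 2 powr (p - 1) * (Z \<omega> powr (p - 1) + a powr (p - 1))"
        using p a Z_nonneg by (intro powr_add_le) auto
      also have "\<dots> \<le> 4 * (Z \<omega> powr (p - 1) + a powr (p - 1))" by (intro mult_right_mono le4) auto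
      also have "Z \<omega> powr (p - 1) \<le> 1 + (Z \<omega>)\<^sup>2"
      proof (cases "Z \<omega> \<le> 1")
        case True
        then have "Z \<omega> powr (p - 1) \<le> 1 powr (p - 1)" using Z_nonneg p by (intro powr_mono2) auto
        then show ?thesis by (simp add: add_increasing2)
      next
        case False
        then have "Z \<omega> powr (p - 1) \<le> Z \<omega> powr 2" using p by (intro powr_mono) auto
        then show ?thesis using False by (simp add: powr_numeral)
      qed
      finally show ?thesis by simp
    qed
    note pointwise = this
    have "ennreal ((Z \<omega> + a) powr (p - 1)) \<le> ennreal (4 * (1 + a powr (p - 1))) + ennreal 4 * ennreal ((Z \<omega>)\<^sup>2)" for \<omega>
    proof -
      have "ennreal ((Z \<omega> + a) powr (p - 1)) \<le> ennreal (4 * (1 + a powr (p - 1)) + 4 * (Z \<omega>)\<^sup>2)"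
        using pointwise[of \<omega>] by (intro ennreal_leI) (simp add: algebra_simps)
      also have "\<dots> = ennreal (4 * (1 + a powr (p - 1))) + ennreal 4 * ennreal ((Z \<omega>)\<^sup>2)"
        by (subst ennreal_plus) (auto simp: ennreal_mult simp del: ennreal_numeral)
      finally show ?thesis .
    qed
    then have "(\<integral>\<^sup>+\<omega>. ennreal ((Z \<omega> + a) powr (p - 1)) \<partial>M) \<le> (\<integral>\<^sup>+\<omega>. ennreal (4 * (1 + a powr (p - 1))) + ennreal 4 * ennreal ((Z \<omega>)\<^sup>2) \<partial>M)"
      by (intro nn_integral_mono)
    also have "\<dots> = ennreal (4 * (1 + a powr (p - 1))) + ennreal 4 * ennreal ((absmom 1)\<^sup>2 + absmom 2)"
      by (simp add: nn_integral_add nn_integral_cmult second_moment emeasure_space_1 del: ennreal_numeral)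
    also have "\<dots> = ennreal (4 * (T + a powr (p - 1)))"
      by (simp add: T_def absmom_nonneg ennreal_mult[symmetric] ennreal_plus[symmetric] add_nonneg_nonneg algebra_simps del: ennreal_plus ennreal_numeral)
    finally show ?thesis .
  qed
  have "(\<integral>\<^sup>+\<omega>. ennreal (Z \<omega> powr p) \<partial>M) = (\<integral>\<^sup>+\<omega>. ennreal (Z \<omega>) * ennreal (Z \<omega> powr (p - 1)) \<partial>M)"
    by (simp add: pw ennreal_mult Z_nonneg)
  also have "\<dots> = (\<Sum>i\<in>I. ennreal (c i * r i) * (\<integral>\<^sup>+\<omega>. ennreal ((Z \<omega> + c i) powr (p - 1)) \<partial>M))"
    by (rule mecke) simp
  also have "\<dots> \<le> (\<Sum>i\<in>I. ennreal (c i * r i) * ennreal (4 * (T + c i powr (p - 1))))"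
    using c0 by (intro sum_mono mult_left_mono shift) auto
  also have "\<dots> = (\<Sum>i\<in>I. ennreal (c i * r i * (4 * (T + c i powr (p - 1)))))"
    using c0 r0 T by (intro sum.cong refl ennreal_mult[symmetric]) auto
  also have "\<dots> = ennreal (\<Sum>i\<in>I. c i * r i * (4 * (T + c i powr (p - 1))))"
    using c0 r0 T by (intro sum_ennreal) auto
  also have "(\<Sum>i\<in>I. c i * r i * (4 * (T + c i powr (p - 1)))) = 4 * ((\<Sum>i\<in>I. c i * r i) * T + (\<Sum>i\<in>I. c i * r i * c i powr (p - 1)))"
    by (simp add: sum_distrib_left sum_distrib_right sum.distrib[symmetric] algebra_simps)
  also have "\<dots> = 4 * (absmom 1 * T + absmom p)"
    using absmom_mult[of "p - 1"] by (simp add: absmom_1)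
  finally show ?thesis by (simp add: T_def)
qed

end

section \<open>Jump integrals over the cells of the grid\<close>

locale levy_noise =
  fixes M :: "'a measure" and F :: "real \<Rightarrow> 'a measure" and lam :: "real measure"
    and mu :: "'a \<Rightarrow> (real \<times> real \<times> real) measure"
  assumes filtered: "complete_filtered_prob_space M F" and levy: "levy_measure lam"
    and nontrivial: "emeasure lam UNIV \<noteq> 0"
    and jumps: "levy_noise_jumps M F lam mu"
    and moments: "\<And>p. 1 \<le> p \<Longrightarrow> p < 3 \<Longrightarrow> abs_moment lam p < \<infinity>"
begin

sublocale prob_space M
  using filtered by (simp add: complete_filtered_prob_space_def)

sublocale complete_measure M
  using filtered by (simp add: complete_filtered_prob_space_def)

lemma sets_lam[measurable_cong]: "sets lam = sets borel"
  using levy by (simp add: levy_measure_def)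

lemma space_lam: "space lam = UNIV"
  using sets_eq_imp_space_eq[OF sets_lam] by simp

lemma emeasure_lam_zero: "emeasure lam {0} = 0"
  using levy by (simp add: levy_measure_def)

lemma emeasure_lam_away:
  assumes "0 < e"
  shows "emeasure lam {z. e < \<bar>z\<bar>} < \<infinity>"
proof -
  have "ennreal e * emeasure lam {z. e < \<bar>z\<bar>} = (\<integral>\<^sup>+ z. ennreal e * indicator {z. e < \<bar>z\<bar>} z \<partial>lam)"
    by (rule nn_integral_cmult_indicator[symmetric]) (simp add: sets_lam)
  also have "\<dots> \<le> (\<integral>\<^sup>+ z. ennreal (\<bar>z\<bar> powr 1) \<partial>lam)"
    using assms by (intro nn_integral_mono) (auto simp: indicator_def intro!: ennreal_leI)
  also have "\<dots> < \<infinity>" using moments[of 1] by (simp add: abs_moment_def)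
  finally show ?thesis using assms by (auto simp: ennreal_mult_less_top less_top)
qed

lemma sigma_finite_lam: "sigma_finite_measure lam"
proof
  let ?A = "insert {0} (range (\<lambda>i::nat. {z. 1 / real (Suc i) < \<bar>z\<bar>}))"
  have "\<Union> ?A = space lam"
  proof -
    have "z \<in> \<Union> ?A" for z :: real
    proof (cases "z = 0")
      case False
      then obtain i where "1 / real (Suc i) < \<bar>z\<bar>" using nat_approx_posE[of "\<bar>z\<bar>"] by auto
      then show ?thesis by auto
    qed simp
    then show ?thesis by (auto simp: space_lam)
  qed
  moreover have "emeasure lam {z. 1 / real (Suc i) < \<bar>z\<bar>} \<noteq> \<infinity>" for i
    using emeasure_lam_away[of "1 / real (Suc i)"] by simp
  moreover have "?A \<subseteq> sets lam" by (auto simp: sets_lam)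
  ultimately show "\<exists>A. countable A \<and> A \<subseteq> sets lam \<and> \<Union> A = space lam \<and> (\<forall>a\<in>A. emeasure lam a \<noteq> \<infinity>)"
    by (intro exI[of _ ?A]) (auto simp: emeasure_lam_zero)
qed

lemma box_in_sets:
  assumes "S \<in> sets borel" "S \<subseteq> {0<..}" "Y \<in> sets borel" "Y \<subseteq> {0..1}" "A \<in> sets borel"
  shows "S \<times> Y \<times> A \<in> sets (noise_intensity lam)"
proof -
  have "S \<in> sets (restrict_space lborel {0<..})" "Y \<in> sets (restrict_space lborel {0..1})" "A \<in> sets lam"
    using assms by (auto simp: sets_restrict_space_iff sets_lam)
  then show ?thesis unfolding noise_intensity_def by auto
qed

lemma emeasure_box:
  assumes "S \<in> sets borel" "S \<subseteq> {0<..}" "Y \<in> sets borel" "Y \<subseteq> {0..1}" "A \<in> sets borel"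
  shows "emeasure (noise_intensity lam) (S \<times> Y \<times> A) = emeasure lborel S * (emeasure lborel Y * emeasure lam A)"
proof -
  interpret lam: sigma_finite_measure lam by (rule sigma_finite_lam)
  interpret R: sigma_finite_measure "restrict_space lborel {0..1::real}"
    by (rule sigma_finite_measure_restrict_space) (auto intro: lborel.sigma_finite_measure_axioms)
  interpret P: sigma_finite_measure "restrict_space lborel {0..1::real} \<Otimes>\<^sub>M lam"
    by (rule sigma_finite_pair_measure[OF R.sigma_finite_measure_axioms lam.sigma_finite_measure_axioms])
  have S: "S \<in> sets (restrict_space lborel {0<..})" and Y: "Y \<in> sets (restrict_space lborel {0..1})" and A: "A \<in> sets lam"
    using assms by (auto simp: sets_restrict_space_iff sets_lam)
  show ?thesis unfolding noise_intensity_def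
    using S Y A assms
    by (simp add: P.emeasure_pair_measure_Times lam.emeasure_pair_measure_Times emeasure_restrict_space)
qed

abbreviation "NI \<equiv> noise_intensity lam"

lemma sets_mu: "\<omega> \<in> space M \<Longrightarrow> sets (mu \<omega>) = sets NI"
  using jumps by (simp add: levy_noise_jumps_def poisson_random_measure_def)

lemma mu_measurable[measurable (raw)]: "B \<in> sets NI \<Longrightarrow> (\<lambda>\<omega>. emeasure (mu \<omega>) B) \<in> borel_measurable M"
  using jumps by (simp add: levy_noise_jumps_def poisson_random_measure_def)

definition count :: "(real \<times> real \<times> real) set \<Rightarrow> 'a \<Rightarrow> real" where
  "count B \<omega> = enn2real (emeasure (mu \<omega>) B)"

lemma count_nonneg: "0 \<le> count B \<omega>"
  by (simp add: count_def)

lemma count_measurable[measurable (raw)]: "B \<in> sets NI \<Longrightarrow> count B \<in> borel_measurable M"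
  unfolding count_def[abs_def] by measurable

lemma mu_poisson:
  assumes "B \<in> sets NI" "emeasure NI B < \<infinity>"
  shows "prob {\<omega> \<in> space M. emeasure (mu \<omega>) B = of_nat k} = poisson_weight (measure NI B) k"
  using jumps assms by (simp add: levy_noise_jumps_def poisson_random_measure_def poisson_weight_def)

lemma mu_finite:
  assumes B[measurable]: "B \<in> sets NI" and "emeasure NI B < \<infinity>"
  shows "AE \<omega> in M. emeasure (mu \<omega>) B < \<infinity>"
proof -
  define A where "A k = {\<omega> \<in> space M. emeasure (mu \<omega>) B = of_nat k}" for k
  have A: "A k \<in> events" for k unfolding A_def by measurable
  have disj: "disjoint_family A" by (auto simp: disjoint_family_on_def A_def)
  have "(\<lambda>k. prob (A k)) sums prob (\<Union>k. A k)"
    using disj A by (intro finite_measure_UNION) auto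
  moreover have "(\<lambda>k. prob (A k)) sums 1"
    using poisson_weight_sums[of "measure NI B"] by (simp add: A_def mu_poisson[OF assms])
  ultimately have "prob (\<Union>k. A k) = 1" by (rule sums_unique2)
  then have "AE \<omega> in M. \<omega> \<in> (\<Union>k. A k)"
    using A by (subst (asm) prob_eq_1) auto
  then show ?thesis
  proof eventually_elim
    case (elim \<omega>)
    then show ?case by (auto simp: A_def ennreal_of_nat_eq_real_of_nat)
  qed
qed

lemma count_eq:
  assumes "B \<in> sets NI" "emeasure NI B < \<infinity>"
  shows "AE \<omega> in M. emeasure (mu \<omega>) B = ennreal (count B \<omega>)"
  using mu_finite[OF assms] by eventually_elim (simp add: count_def)

lemma count_poisson:
  assumes B[measurable]: "B \<in> sets NI" and "emeasure NI B < \<infinity>"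
  shows "prob {\<omega> \<in> space M. count B \<omega> = real k} = poisson_weight (measure NI B) k"
proof -
  have "prob {\<omega> \<in> space M. count B \<omega> = real k} = prob {\<omega> \<in> space M. emeasure (mu \<omega>) B = of_nat k}"
  proof (rule prob_eq_AE)
    show "AE \<omega> in M. (count B \<omega> = real k) = (emeasure (mu \<omega>) B = of_nat k)"
      using count_eq[OF assms]
      by eventually_elim (simp add: ennreal_of_nat_eq_real_of_nat count_nonneg)
  qed measurable
  then show ?thesis by (simp add: mu_poisson[OF assms])
qed

lemma mu_mean:
  assumes B[measurable]: "B \<in> sets NI"
  shows "(\<integral>\<^sup>+\<omega>. emeasure (mu \<omega>) B \<partial>M) = emeasure NI B"
proof (cases "emeasure NI B < \<infinity>")
  case True
  have "(\<integral>\<^sup>+\<omega>. emeasure (mu \<omega>) B \<partial>M) = (\<integral>\<^sup>+\<omega>. ennreal (count B \<omega>) \<partial>M)"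
    using count_eq[OF B True] by (rule nn_integral_cong_AE)
  also have "\<dots> = ennreal (measure NI B)"
    by (rule poisson_mean) (use count_poisson[OF B True] in auto)
  also have "\<dots> = emeasure NI B" using True by (simp add: emeasure_eq_ennreal_measure)
  finally show ?thesis .
next
  case False
  then have "emeasure NI B = \<infinity>" unfolding infinity_ennreal_def by (metis top.not_eq_extremum)
  then have "AE \<omega> in M. emeasure (mu \<omega>) B = \<infinity>"
    using jumps B by (simp add: levy_noise_jumps_def poisson_random_measure_def)
  then have "(\<integral>\<^sup>+\<omega>. emeasure (mu \<omega>) B \<partial>M) = (\<integral>\<^sup>+\<omega>. \<infinity> \<partial>M)" by (rule nn_integral_cong_AE)
  then show ?thesis using \<open>emeasure NI B = \<infinity>\<close> by (simp add: emeasure_space_1)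
qed

lemma mu_null: "B \<in> sets NI \<Longrightarrow> emeasure NI B = 0 \<Longrightarrow> AE \<omega> in M. emeasure (mu \<omega>) B = 0"
  using mu_mean[of B] by (simp add: nn_integral_0_iff_AE)

lemma indep_mu:
  assumes "range B \<subseteq> sets NI" "disjoint_family B"
  shows "indep_vars (\<lambda>_. borel) (\<lambda>i \<omega>. emeasure (mu \<omega>) (B i)) (UNIV :: nat set)"
  using jumps assms unfolding levy_noise_jumps_def poisson_random_measure_def by blast

lemma indep_count:
  assumes "range B \<subseteq> sets NI" "disjoint_family B"
  shows "indep_vars (\<lambda>_. borel) (\<lambda>i. count (B i)) (I :: nat set)"
proof -
  have "indep_vars (\<lambda>_. borel) (\<lambda>i \<omega>. enn2real (emeasure (mu \<omega>) (B i))) UNIV"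
    by (rule indep_vars_compose2[OF indep_mu[OF assms]]) simp
  then have "indep_vars (\<lambda>_. borel) (\<lambda>i \<omega>. enn2real (emeasure (mu \<omega>) (B i))) I"
    by (rule indep_vars_subset) simp
  then show ?thesis by (simp add: count_def[abs_def])
qed

definition zint :: "(real \<times> real \<times> real) measure \<Rightarrow> real set \<Rightarrow> real set \<Rightarrow> real set \<Rightarrow> (real \<Rightarrow> ennreal) \<Rightarrow> ennreal" where
  "zint \<nu> S Y A f = (\<integral>\<^sup>+w. indicator (S \<times> Y \<times> A) w * f (snd (snd w)) \<partial>\<nu>)"

lemma measurable_jump_size[measurable]: "(\<lambda>w. snd (snd w)) \<in> measurable NI borel"
proof -
  have "(\<lambda>w. snd (snd w)) \<in> measurable NI lam"
    unfolding noise_intensity_def by (rule measurable_compose[OF measurable_snd measurable_snd])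
  then show ?thesis by (simp only: measurable_cong_sets[OF refl sets_lam])
qed

lemma zint_indicator:
  assumes box: "S \<in> sets borel" "S \<subseteq> {0<..}" "Y \<in> sets borel" "Y \<subseteq> {0..1}" "A \<in> sets borel"
    and \<nu>: "sets \<nu> = sets NI" and D: "D \<in> sets borel"
  shows "zint \<nu> S Y A (indicator D) = emeasure \<nu> (S \<times> Y \<times> (A \<inter> D))"
proof -
  have "zint \<nu> S Y A (indicator D) = (\<integral>\<^sup>+w. indicator (S \<times> Y \<times> (A \<inter> D)) w \<partial>\<nu>)"
    unfolding zint_def by (intro nn_integral_cong) (auto simp: indicator_def split: if_splits)
  also have "\<dots> = emeasure \<nu> (S \<times> Y \<times> (A \<inter> D))"
    using box D by (intro nn_integral_indicator) (simp add: \<nu> box_in_sets)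
  finally show ?thesis .
qed

lemma zint_aux:
  assumes box: "S \<in> sets borel" "S \<subseteq> {0<..}" "Y \<in> sets borel" "Y \<subseteq> {0..1}" "A \<in> sets borel"
    and \<nu>: "sets \<nu> = sets NI"
  shows "f \<in> borel_measurable borel \<Longrightarrow> zint \<nu> S Y A (\<lambda>z. c * f z) = c * zint \<nu> S Y A f"
    and "f \<in> borel_measurable borel \<Longrightarrow> g \<in> borel_measurable borel \<Longrightarrow>
      zint \<nu> S Y A (\<lambda>z. f z + g z) = zint \<nu> S Y A f + zint \<nu> S Y A g"
    and "(\<And>i. U i \<in> borel_measurable borel) \<Longrightarrow> incseq U \<Longrightarrow> zint \<nu> S Y A (SUP i. U i) = (SUP i::nat. zint \<nu> S Y A (U i))"
proof -
  have B[measurable]: "S \<times> Y \<times> A \<in> sets \<nu>" using box by (simp add: \<nu> box_in_sets)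
  have m[measurable]: "(\<lambda>w. snd (snd w)) \<in> measurable \<nu> borel"
    using measurable_jump_size by (simp add: measurable_cong_sets[OF \<nu> refl])
  show "zint \<nu> S Y A (\<lambda>z. c * f z) = c * zint \<nu> S Y A f" if [measurable]: "f \<in> borel_measurable borel"
    unfolding zint_def by (subst nn_integral_cmult[symmetric]) (auto simp: mult_ac)
  show "zint \<nu> S Y A (\<lambda>z. f z + g z) = zint \<nu> S Y A f + zint \<nu> S Y A g"
    if [measurable]: "f \<in> borel_measurable borel" "g \<in> borel_measurable borel"
    unfolding zint_def by (subst nn_integral_add[symmetric]) (auto simp: distrib_left)
  show "zint \<nu> S Y A (SUP i. U i) = (SUP i. zint \<nu> S Y A (U i))"
    if [measurable]: "\<And>i. U i \<in> borel_measurable borel" and inc: "incseq U"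
  proof -
    have "zint \<nu> S Y A (SUP i. U i) = (\<integral>\<^sup>+w. (SUP i. indicator (S \<times> Y \<times> A) w * U i (snd (snd w))) \<partial>\<nu>)"
      unfolding zint_def by (intro nn_integral_cong) (simp add: SUP_mult_left_ennreal image_comp)
    also have "\<dots> = (SUP i. zint \<nu> S Y A (U i))"
      unfolding zint_def using inc
      by (intro nn_integral_monotone_convergence_SUP) (auto simp: incseq_def le_fun_def intro!: mult_left_mono)
    finally show ?thesis .
  qed
qed

lemma zint_measurable:
  assumes box: "S \<in> sets borel" "S \<subseteq> {0<..}" "Y \<in> sets borel" "Y \<subseteq> {0..1}" "A \<in> sets borel"
    and G: "space G = space M"
    and cnt: "\<And>D. D \<in> sets borel \<Longrightarrow> (\<lambda>\<omega>. emeasure (mu \<omega>) (S \<times> Y \<times> (A \<inter> D))) \<in> borel_measurable G"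
    and f: "f \<in> borel_measurable borel"
  shows "(\<lambda>\<omega>. zint (mu \<omega>) S Y A f) \<in> borel_measurable G"
  using f
proof (induction f rule: borel_measurable_induct)
  case (cong f g)
  then have "f = g" by auto
  with cong show ?case by simp
next
  case (set D)
  have "(\<lambda>\<omega>. zint (mu \<omega>) S Y A (indicator D)) \<in> borel_measurable G \<longleftrightarrow>
      (\<lambda>\<omega>. emeasure (mu \<omega>) (S \<times> Y \<times> (A \<inter> D))) \<in> borel_measurable G"
    using set by (intro measurable_cong zint_indicator box sets_mu) (auto simp: G)
  then show ?case using cnt[OF set] by simp
next
  case (mult u c)
  have "(\<lambda>\<omega>. zint (mu \<omega>) S Y A (\<lambda>x. c * u x)) \<in> borel_measurable G \<longleftrightarrow> (\<lambda>\<omega>. c * zint (mu \<omega>) S Y A u) \<in> borel_measurable G"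
    using mult by (intro measurable_cong zint_aux box sets_mu) (auto simp: G)
  then show ?case using mult by simp
next
  case (add u v)
  have "(\<lambda>\<omega>. zint (mu \<omega>) S Y A (\<lambda>x. v x + u x)) \<in> borel_measurable G \<longleftrightarrow>
     (\<lambda>\<omega>. zint (mu \<omega>) S Y A v + zint (mu \<omega>) S Y A u) \<in> borel_measurable G"
    using add by (intro measurable_cong zint_aux box sets_mu) (auto simp: G)
  then show ?case using add by simp
next
  case (seq U)
  have "(\<lambda>\<omega>. zint (mu \<omega>) S Y A (SUP i. U i)) \<in> borel_measurable G \<longleftrightarrow> (\<lambda>\<omega>. SUP i. zint (mu \<omega>) S Y A (U i)) \<in> borel_measurable G"
    using seq by (intro measurable_cong zint_aux box sets_mu) (auto simp: G)
  moreover have "(\<lambda>\<omega>. SUP i. zint (mu \<omega>) S Y A (U i)) \<in> borel_measurable G"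
    using seq by (intro borel_measurable_SUP) auto
  ultimately show ?case by (simp only:)
qed

lemma zint_expectation:
  assumes box: "S \<in> sets borel" "S \<subseteq> {0<..}" "Y \<in> sets borel" "Y \<subseteq> {0..1}" "A \<in> sets borel"
    and A': "A' \<in> sets borel" and h[measurable]: "h \<in> borel_measurable M"
    and cnt: "\<And>D. D \<in> sets borel \<Longrightarrow> (\<integral>\<^sup>+\<omega>. h \<omega> * emeasure (mu \<omega>) (S \<times> Y \<times> (A \<inter> D)) \<partial>M) = k * emeasure lam (A' \<inter> D)"
    and f: "f \<in> borel_measurable borel"
  shows "(\<integral>\<^sup>+\<omega>. h \<omega> * zint (mu \<omega>) S Y A f \<partial>M) = k * (\<integral>\<^sup>+z. indicator A' z * f z \<partial>lam)"
proof -
  have A'L[measurable]: "A' \<in> sets lam" using A' by (simp add: sets_lam)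
  have zm[measurable]: "(\<lambda>\<omega>. zint (mu \<omega>) S Y A g) \<in> borel_measurable M" if "g \<in> borel_measurable borel" for g
  proof (rule zint_measurable[OF box refl _ that])
    fix D :: "real set" assume "D \<in> sets borel"
    then show "(\<lambda>\<omega>. emeasure (mu \<omega>) (S \<times> Y \<times> (A \<inter> D))) \<in> borel_measurable M"
      using box by (intro mu_measurable box_in_sets) auto
  qed
  have lm: "borel_measurable lam = (borel_measurable borel :: (real \<Rightarrow> ennreal) set)"
    by (rule measurable_cong_sets[OF sets_lam refl])
  show ?thesis using f
  proof (induction f rule: borel_measurable_induct)
    case (cong f g)
    then have "f = g" by auto
    with cong show ?case by simp
  next
    case (set D)
    have "(\<integral>\<^sup>+\<omega>. h \<omega> * zint (mu \<omega>) S Y A (indicator D) \<partial>M) = (\<integral>\<^sup>+\<omega>. h \<omega> * emeasure (mu \<omega>) (S \<times> Y \<times> (A \<inter> D)) \<partial>M)"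
      using set by (intro nn_integral_cong arg_cong2[where f = "(*)"] refl zint_indicator box sets_mu) auto
    also have "\<dots> = k * emeasure lam (A' \<inter> D)" by (rule cnt[OF set])
    also have "emeasure lam (A' \<inter> D) = (\<integral>\<^sup>+z. indicator (A' \<inter> D) z \<partial>lam)"
      using set A' by (intro nn_integral_indicator[symmetric]) (auto simp: sets_lam)
    also have "\<dots> = (\<integral>\<^sup>+z. indicator A' z * indicator D z \<partial>lam)"
      by (intro nn_integral_cong) (auto simp: indicator_def)
    finally show ?case .
  next
    case (mult u c)
    then have [measurable]: "u \<in> borel_measurable borel" by simp
    have [measurable]: "u \<in> borel_measurable lam" by (simp add: lm)
    have "(\<integral>\<^sup>+\<omega>. h \<omega> * zint (mu \<omega>) S Y A (\<lambda>x. c * u x) \<partial>M) = (\<integral>\<^sup>+\<omega>. c * (h \<omega> * zint (mu \<omega>) S Y A u) \<partial>M)"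
      by (intro nn_integral_cong) (simp add: zint_aux(1)[OF box sets_mu] mult_ac)
    also have "\<dots> = c * (k * (\<integral>\<^sup>+z. indicator A' z * u z \<partial>lam))"
      by (subst nn_integral_cmult) (auto simp: mult)
    also have "\<dots> = k * (\<integral>\<^sup>+z. c * (indicator A' z * u z) \<partial>lam)"
      by (subst nn_integral_cmult) (auto simp: mult_ac)
    finally show ?case by (simp add: mult_ac)
  next
    case (add u v)
    then have [measurable]: "u \<in> borel_measurable borel" "v \<in> borel_measurable borel" by simp_all
    have [measurable]: "u \<in> borel_measurable lam" "v \<in> borel_measurable lam" by (simp_all add: lm)
    have "(\<integral>\<^sup>+\<omega>. h \<omega> * zint (mu \<omega>) S Y A (\<lambda>x. v x + u x) \<partial>M)
       = (\<integral>\<^sup>+\<omega>. h \<omega> * zint (mu \<omega>) S Y A v + h \<omega> * zint (mu \<omega>) S Y A u \<partial>M)"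
      by (intro nn_integral_cong) (simp add: zint_aux(2)[OF box sets_mu] distrib_left)
    also have "\<dots> = k * (\<integral>\<^sup>+z. indicator A' z * v z \<partial>lam) + k * (\<integral>\<^sup>+z. indicator A' z * u z \<partial>lam)"
      by (subst nn_integral_add) (auto simp: add)
    also have "\<dots> = k * (\<integral>\<^sup>+z. indicator A' z * v z + indicator A' z * u z \<partial>lam)"
      by (subst nn_integral_add) (auto simp: distrib_left)
    finally show ?case by (simp add: distrib_left)
  next
    case (seq U)
    then have Um[measurable]: "\<And>i. U i \<in> borel_measurable borel" by simp
    have [measurable]: "\<And>i. U i \<in> borel_measurable lam" by (simp add: lm)
    have mono: "zint (mu \<omega>) S Y A (U i) \<le> zint (mu \<omega>) S Y A (U j)" if "i \<le> j" for i j \<omega>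
      unfolding zint_def using seq(3) that by (intro nn_integral_mono mult_left_mono) (auto simp: incseq_def le_fun_def)
    have "(\<integral>\<^sup>+\<omega>. h \<omega> * zint (mu \<omega>) S Y A (SUP i. U i) \<partial>M) = (\<integral>\<^sup>+\<omega>. (SUP i. h \<omega> * zint (mu \<omega>) S Y A (U i)) \<partial>M)"
      by (intro nn_integral_cong) (simp add: zint_aux(3)[OF box sets_mu] seq SUP_mult_left_ennreal)
    also have "\<dots> = (SUP i. \<integral>\<^sup>+\<omega>. h \<omega> * zint (mu \<omega>) S Y A (U i) \<partial>M)"
      using mono by (intro nn_integral_monotone_convergence_SUP) (auto simp: incseq_def le_fun_def intro!: mult_left_mono)
    also have "\<dots> = k * (SUP i. \<integral>\<^sup>+z. indicator A' z * U i z \<partial>lam)"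
      by (simp add: seq SUP_mult_left_ennreal)
    also have "(SUP i. \<integral>\<^sup>+z. indicator A' z * U i z \<partial>lam) = (\<integral>\<^sup>+z. (SUP i. indicator A' z * U i z) \<partial>lam)"
      using seq(3) by (intro nn_integral_monotone_convergence_SUP[symmetric]) (auto simp: incseq_def le_fun_def intro!: mult_left_mono)
    also have "\<dots> = (\<integral>\<^sup>+z. indicator A' z * (SUP i. U i) z \<partial>lam)"
      by (intro nn_integral_cong) (simp add: SUP_mult_left_ennreal image_comp)
    finally show ?case .
  qed
qed

lemma campbell:
  assumes box: "S \<in> sets borel" "S \<subseteq> {0<..}" "Y \<in> sets borel" "Y \<subseteq> {0..1}" "A \<in> sets borel"
    and f: "f \<in> borel_measurable borel"
  shows "(\<integral>\<^sup>+\<omega>. zint (mu \<omega>) S Y A f \<partial>M) = emeasure lborel S * emeasure lborel Y * (\<integral>\<^sup>+z. indicator A z * f z \<partial>lam)"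
proof -
  have "(\<integral>\<^sup>+\<omega>. 1 * zint (mu \<omega>) S Y A f \<partial>M) = emeasure lborel S * emeasure lborel Y * (\<integral>\<^sup>+z. indicator A z * f z \<partial>lam)"
    using box f by (intro zint_expectation) (auto simp: mu_mean box_in_sets emeasure_box mult.assoc)
  then show ?thesis by simp
qed

end

definition tcell :: "real \<Rightarrow> nat \<Rightarrow> real set" where
  "tcell \<tau> k = {real k * \<tau><..<real (k + 1) * \<tau>}"

definition scell :: "nat \<Rightarrow> nat \<Rightarrow> real set" where
  "scell n j = {real j / real n..<real (j + 1) / real n}"

lemma tcell_sets: "tcell \<tau> k \<in> sets borel" and scell_sets: "scell n j \<in> sets borel"
  by (simp_all add: tcell_def scell_def)

lemma tcell_pos:
  assumes "0 < \<tau>"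
  shows "tcell \<tau> k \<subseteq> {0<..}"
proof
  fix s assume "s \<in> tcell \<tau> k"
  moreover have "0 \<le> real k * \<tau>" using assms by simp
  ultimately show "s \<in> {0<..}" unfolding tcell_def greaterThanLessThan_iff greaterThan_iff by linarith
qed

lemma scell_unit:
  assumes "j < n"
  shows "scell n j \<subseteq> {0..1}"
proof -
  have "real (j + 1) / real n \<le> 1" using assms by simp
  moreover have "0 \<le> real j / real n" by simp
  ultimately show ?thesis unfolding scell_def by (meson atLeastAtMost_iff atLeastLessThan_iff less_imp_le order.trans subsetI)
qed

lemma scell_disjoint:
  assumes "0 < n" "y \<in> scell n j" "y \<in> scell n j'"
  shows "j = j'"
proof -
  have "real j \<le> real n * y \<and> real n * y < real j + 1" if "y \<in> scell n j" for j
    using that assms(1) by (auto simp: scell_def field_simps)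
  from this[OF assms(2)] this[OF assms(3)] show ?thesis by linarith
qed

lemma emeasure_tcell: "0 < \<tau> \<Longrightarrow> emeasure lborel (tcell \<tau> k) = ennreal \<tau>"
  by (simp add: tcell_def algebra_simps)

lemma emeasure_scell: "0 < n \<Longrightarrow> emeasure lborel (scell n j) = ennreal (1 / real n)"
  by (simp add: scell_def add_divide_distrib)

definition shell :: "int \<Rightarrow> real set" where
  "shell m = {z. 2 powr real_of_int m < \<bar>z\<bar> \<and> \<bar>z\<bar> \<le> 2 powr real_of_int (m + 1)}"

lemma shell_sets: "shell m \<in> sets borel"
  unfolding shell_def by measurable

lemma shell_cover:
  assumes "z \<noteq> 0"
  obtains m where "z \<in> shell m"
proof
  define m where "m = \<lceil>log 2 \<bar>z\<bar>\<rceil> - 1"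
  have "real_of_int m < log 2 \<bar>z\<bar>" "log 2 \<bar>z\<bar> \<le> real_of_int (m + 1)"
    using ceiling_correct[of "log 2 \<bar>z\<bar>"] by (auto simp: m_def)
  then show "z \<in> shell m"
    using assms by (simp add: shell_def less_log_iff log_le_iff)
qed

lemma shell_disjoint:
  assumes "z \<in> shell m" "z \<in> shell m'"
  shows "m = m'"
proof -
  have *: "m \<le> m'" if "z \<in> shell m" "z \<in> shell m'" for m m'
  proof -
    have "2 powr real_of_int m < \<bar>z\<bar>" "\<bar>z\<bar> \<le> 2 powr real_of_int (m' + 1)"
      using that unfolding shell_def by auto
    then have "2 powr real_of_int m < 2 powr real_of_int (m' + 1)" by linarith
    then have "real_of_int m < real_of_int (m' + 1)" by (subst (asm) powr_less_cancel_iff) auto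
    then show ?thesis by linarith
  qed
  show ?thesis using *[OF assms] *[OF assms(2,1)] by simp
qed

lemma shell_bounds:
  assumes "z \<in> shell m"
  shows "\<bar>z\<bar> \<le> 2 powr real_of_int (m + 1)" "2 powr real_of_int (m + 1) \<le> 2 * \<bar>z\<bar>"
  using assms by (auto simp: shell_def powr_add)

lemma SUP_ennreal_powr_le:
  fixes z :: "nat \<Rightarrow> real"
  assumes "0 \<le> x" "0 \<le> p" "\<And>i. 0 \<le> z i" "ennreal x \<le> (SUP i. ennreal (z i))"
  shows "ennreal (x powr p) \<le> ennreal (2 powr p) * (SUP i. ennreal (z i powr p))"
proof (cases "x = 0")
  case False
  then have "ennreal (x / 2) < ennreal x" using assms(1) by (intro ennreal_lessI) auto
  then have "ennreal (x / 2) < (SUP i. ennreal (z i))" using assms(4) by (rule order.strict_trans2)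
  then obtain i where "ennreal (x / 2) < ennreal (z i)" by (auto simp: less_SUP_iff)
  then have "x \<le> 2 * z i" using assms by (simp add: ennreal_less_iff)
  then have "x powr p \<le> (2 * z i) powr p" using assms by (intro powr_mono2) auto
  then have "ennreal (x powr p) \<le> ennreal (2 powr p) * ennreal (z i powr p)"
    by (simp add: powr_mult ennreal_mult[symmetric])
  also have "\<dots> \<le> ennreal (2 powr p) * (SUP i. ennreal (z i powr p))"
    by (intro mult_left_mono SUP_upper) auto
  finally show ?thesis .
qed simp

lemma powr_le_one_plus:
  fixes x :: real
  assumes "0 \<le> x" "0 \<le> q" "q \<le> p"
  shows "x powr q \<le> 1 + x powr p"
proof (cases "x \<le> 1")
  case True
  then have "x powr q \<le> 1 powr q" using assms by (intro powr_mono2) auto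
  then show ?thesis by (simp add: add_increasing2)
next
  case False
  then have "x powr q \<le> x powr p" using assms by (intro powr_mono) auto
  then show ?thesis by simp
qed

lemma avg_powr_le_2:
  assumes "0 < n" "0 \<le> q" "q \<le> p" "(\<Sum>j<n. \<bar>a j :: real\<bar> powr p) / real n \<le> 1"
  shows "(\<Sum>j<n. \<bar>a j\<bar> powr q) / real n \<le> 2"
proof -
  have "(\<Sum>j<n. \<bar>a j\<bar> powr q) \<le> (\<Sum>j<n. 1 + \<bar>a j\<bar> powr p)"
    using assms by (intro sum_mono powr_le_one_plus) auto
  also have "\<dots> = real n + (\<Sum>j<n. \<bar>a j\<bar> powr p)" by (simp add: sum.distrib)
  also have "\<dots> \<le> real n + real n" using assms by (simp add: pos_divide_le_eq)
  finally show ?thesis using assms by (simp add: pos_divide_le_eq)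
qed

context levy_noise
begin

definition lmom :: "real \<Rightarrow> real" where "lmom q = enn2real (abs_moment lam q)"

lemma lmom_nonneg: "0 \<le> lmom q" by (simp add: lmom_def)

lemma lmom_eq: "1 \<le> q \<Longrightarrow> q < 3 \<Longrightarrow> abs_moment lam q = ennreal (lmom q)"
  using moments[of q] by (simp add: lmom_def less_top)

definition cell :: "nat \<Rightarrow> real \<Rightarrow> nat \<Rightarrow> nat \<Rightarrow> real set \<Rightarrow> (real \<times> real \<times> real) set" where
  "cell n \<tau> k j A = tcell \<tau> k \<times> scell n j \<times> A"

lemma cell_box:
  assumes "0 < \<tau>" "j < n" "A \<in> sets borel"
  shows "tcell \<tau> k \<in> sets borel" "tcell \<tau> k \<subseteq> {0<..}" "scell n j \<in> sets borel" "scell n j \<subseteq> {0..1}" "A \<in> sets borel"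
  using assms tcell_sets scell_sets tcell_pos scell_unit by auto

lemma cell_in_sets:
  assumes "0 < \<tau>" "j < n" "A \<in> sets borel"
  shows "cell n \<tau> k j A \<in> sets NI"
  unfolding cell_def by (rule box_in_sets[OF cell_box[OF assms]])

lemma emeasure_cell:
  assumes "0 < \<tau>" "j < n" "A \<in> sets borel"
  shows "emeasure NI (cell n \<tau> k j A) = ennreal (\<tau> / real n) * emeasure lam A"
proof -
  have "emeasure NI (cell n \<tau> k j A) = ennreal \<tau> * (ennreal (1 / real n) * emeasure lam A)"
    using assms by (simp add: cell_def emeasure_box[OF cell_box[OF assms]] emeasure_tcell emeasure_scell)
  then show ?thesis using assms by (simp add: mult.assoc[symmetric] ennreal_mult[symmetric])
qed

definition czint :: "nat \<Rightarrow> real \<Rightarrow> nat \<Rightarrow> nat \<Rightarrow> real set \<Rightarrow> (real \<Rightarrow> ennreal) \<Rightarrow> 'a \<Rightarrow> ennreal" where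
  "czint n \<tau> k j A f \<omega> = zint (mu \<omega>) (tcell \<tau> k) (scell n j) A f"

lemma czint_campbell:
  assumes "0 < \<tau>" "j < n" "A \<in> sets borel" "f \<in> borel_measurable borel"
  shows "(\<integral>\<^sup>+\<omega>. czint n \<tau> k j A f \<omega> \<partial>M) = ennreal (\<tau> / real n) * (\<integral>\<^sup>+z. indicator A z * f z \<partial>lam)"
proof -
  have "ennreal \<tau> * ennreal (1 / real n) = ennreal (\<tau> / real n)"
    using assms by (simp add: ennreal_mult[symmetric])
  then show ?thesis
    using assms by (simp add: czint_def campbell[OF cell_box[OF assms(1-3)] assms(4)] emeasure_tcell emeasure_scell)
qed

lemma czint_measurable_gen:
  assumes "0 < \<tau>" "j < n" "A \<in> sets borel" "f \<in> borel_measurable borel" "space G = space M"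
    and "\<And>B. B \<in> sets NI \<Longrightarrow> B \<subseteq> tcell \<tau> k \<times> UNIV \<Longrightarrow> (\<lambda>\<omega>. emeasure (mu \<omega>) B) \<in> borel_measurable G"
  shows "czint n \<tau> k j A f \<in> borel_measurable G"
  unfolding czint_def[abs_def]
proof (rule zint_measurable[OF cell_box[OF assms(1-3)] assms(5) _ assms(4)])
  fix D :: "real set" assume "D \<in> sets borel"
  then have "cell n \<tau> k j (A \<inter> D) \<in> sets NI" using assms by (intro cell_in_sets) auto
  then show "(\<lambda>\<omega>. emeasure (mu \<omega>) (tcell \<tau> k \<times> scell n j \<times> (A \<inter> D))) \<in> borel_measurable G"
    by (intro assms(6)) (auto simp: cell_def)
qed

definition jump :: "nat \<Rightarrow> real \<Rightarrow> nat \<Rightarrow> nat \<Rightarrow> real set \<Rightarrow> 'a \<Rightarrow> real" where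
  "jump n \<tau> k j A \<omega> = enn2real (czint n \<tau> k j A (\<lambda>z. ennreal z) \<omega>) - enn2real (czint n \<tau> k j A (\<lambda>z. ennreal (- z)) \<omega>)"

lemma jump_measurable_gen:
  assumes "0 < \<tau>" "j < n" "A \<in> sets borel" "space G = space M"
    and "\<And>B. B \<in> sets NI \<Longrightarrow> B \<subseteq> tcell \<tau> k \<times> UNIV \<Longrightarrow> (\<lambda>\<omega>. emeasure (mu \<omega>) B) \<in> borel_measurable G"
  shows "jump n \<tau> k j A \<in> borel_measurable G"
proof -
  have [measurable]: "czint n \<tau> k j A (\<lambda>z. ennreal (s * z)) \<in> borel_measurable G" for s
    using assms by (intro czint_measurable_gen) auto
  from this[of 1] this[of "-1"] show ?thesis unfolding jump_def[abs_def] by simp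
qed

lemma jump_measurable:
  assumes "0 < \<tau>" "j < n" "A \<in> sets borel"
  shows "jump n \<tau> k j A \<in> borel_measurable M"
  using assms by (intro jump_measurable_gen) auto

lemma czint_abs:
  assumes "0 < \<tau>" "j < n" "A \<in> sets borel" "\<omega> \<in> space M"
  shows "czint n \<tau> k j A (\<lambda>z. ennreal \<bar>z\<bar>) \<omega>
    = czint n \<tau> k j A (\<lambda>z. ennreal z) \<omega> + czint n \<tau> k j A (\<lambda>z. ennreal (- z)) \<omega>"
proof -
  have "(\<lambda>z. ennreal \<bar>z\<bar>) = (\<lambda>z. ennreal z + ennreal (- z))"
    by (intro ext) (auto simp: abs_if ennreal_neg)
  then show ?thesis unfolding czint_def
    by (simp add: zint_aux(2)[OF cell_box[OF assms(1-3)] sets_mu[OF assms(4)]])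
qed

lemma abs_jump_le:
  assumes "0 < \<tau>" "j < n" "A \<in> sets borel" "\<omega> \<in> space M"
  shows "ennreal \<bar>jump n \<tau> k j A \<omega>\<bar> \<le> czint n \<tau> k j A (\<lambda>z. ennreal \<bar>z\<bar>) \<omega>"
proof -
  define x where "x = czint n \<tau> k j A (\<lambda>z. ennreal z) \<omega>"
  define y where "y = czint n \<tau> k j A (\<lambda>z. ennreal (- z)) \<omega>"
  have le: "ennreal (enn2real u) \<le> u" for u by (cases u) auto
  have "ennreal \<bar>enn2real x - enn2real y\<bar> \<le> ennreal (enn2real x + enn2real y)"
    using enn2real_nonneg[of x] enn2real_nonneg[of y] by (intro ennreal_leI) (auto simp: abs_if)
  also have "\<dots> = ennreal (enn2real x) + ennreal (enn2real y)" by (simp add: ennreal_plus)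
  also have "\<dots> \<le> x + y" by (intro add_mono le)
  finally show ?thesis unfolding czint_abs[OF assms] jump_def x_def y_def .
qed

lemma czint_abs_finite:
  assumes "0 < \<tau>" "j < n" "A \<in> sets borel"
  shows "(\<integral>\<^sup>+\<omega>. czint n \<tau> k j A (\<lambda>z. ennreal \<bar>z\<bar>) \<omega> \<partial>M) \<le> ennreal (\<tau> / real n * lmom 1)"
    and "AE \<omega> in M. czint n \<tau> k j A (\<lambda>z. ennreal \<bar>z\<bar>) \<omega> < \<infinity>"
proof -
  have "(\<integral>\<^sup>+\<omega>. czint n \<tau> k j A (\<lambda>z. ennreal \<bar>z\<bar>) \<omega> \<partial>M) \<le> ennreal (\<tau> / real n) * abs_moment lam 1"
    using assms by (subst czint_campbell) (auto simp: abs_moment_def indicator_def intro!: mult_left_mono nn_integral_mono)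
  also have "\<dots> = ennreal (\<tau> / real n * lmom 1)"
    using assms by (simp add: lmom_eq ennreal_mult[symmetric] lmom_nonneg)
  finally show *: "(\<integral>\<^sup>+\<omega>. czint n \<tau> k j A (\<lambda>z. ennreal \<bar>z\<bar>) \<omega> \<partial>M) \<le> ennreal (\<tau> / real n * lmom 1)" .
  have "czint n \<tau> k j A (\<lambda>z. ennreal \<bar>z\<bar>) \<in> borel_measurable M"
    using assms by (intro czint_measurable_gen) auto
  then have "AE \<omega> in M. czint n \<tau> k j A (\<lambda>z. ennreal \<bar>z\<bar>) \<omega> \<noteq> \<infinity>"
    using * by (intro nn_integral_PInf_AE) (auto simp: top_unique)
  then show "AE \<omega> in M. czint n \<tau> k j A (\<lambda>z. ennreal \<bar>z\<bar>) \<omega> < \<infinity>"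
    by eventually_elim (simp add: less_top)
qed

lemma lam_integrable: "integrable lam (\<lambda>z. z)"
proof (rule integrableI_bounded)
  show "(\<lambda>z. z) \<in> borel_measurable lam" by (simp add: measurable_cong_sets[OF sets_lam refl])
  show "(\<integral>\<^sup>+ z. ennreal (norm z) \<partial>lam) < \<infinity>" using moments[of 1] by (simp add: abs_moment_def)
qed

lemma jump_expectation:
  assumes cl: "0 < \<tau>" "j < n" and A': "A' \<in> sets borel" and E[measurable]: "E \<in> events" and c: "0 \<le> c"
    and cnt: "\<And>D. D \<in> sets borel \<Longrightarrow>
      (\<integral>\<^sup>+\<omega>. indicator E \<omega> * emeasure (mu \<omega>) (cell n \<tau> k j D) \<partial>M) = ennreal c * emeasure lam (A' \<inter> D)"
  shows "integrable M (\<lambda>\<omega>. indicator E \<omega> * jump n \<tau> k j UNIV \<omega>)"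
    and "(\<integral>\<omega>. indicator E \<omega> * jump n \<tau> k j UNIV \<omega> \<partial>M) = c * (LINT z:A'|lam. z)"
proof -
  let ?X = "\<lambda>s \<omega>. czint n \<tau> k j UNIV (\<lambda>z. ennreal (s * z)) \<omega>"
  have Xm[measurable]: "?X s \<in> borel_measurable M" for s
    using cl by (intro czint_measurable_gen) auto
  have A'L[measurable]: "A' \<in> sets lam" using A' by (simp add: sets_lam)
  have fm[measurable]: "(\<lambda>z. z) \<in> borel_measurable lam" by (simp add: measurable_cong_sets[OF sets_lam refl])
  have nnX: "(\<integral>\<^sup>+\<omega>. indicator E \<omega> * ?X s \<omega> \<partial>M) = ennreal c * (\<integral>\<^sup>+z. ennreal (s * (indicator A' z * z)) \<partial>lam)" for s
  proof -
    have "(\<integral>\<^sup>+\<omega>. indicator E \<omega> * ?X s \<omega> \<partial>M) = ennreal c * (\<integral>\<^sup>+z. indicator A' z * ennreal (s * z) \<partial>lam)"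
      unfolding czint_def
      using cnt by (intro zint_expectation[OF cell_box[OF cl, of UNIV] A']) (auto simp: cell_def)
    also have "(\<integral>\<^sup>+z. indicator A' z * ennreal (s * z) \<partial>lam) = (\<integral>\<^sup>+z. ennreal (s * (indicator A' z * z)) \<partial>lam)"
      by (intro nn_integral_cong) (auto simp: indicator_def)
    finally show ?thesis .
  qed
  have intA: "integrable lam (\<lambda>z. s * (indicator A' z * z))" for s
    using integrable_mult_indicator[OF A'L lam_integrable] by (intro integrable_mult_right) simp
  have finA: "(\<integral>\<^sup>+z. ennreal (s * (indicator A' z * z)) \<partial>lam) < \<infinity>" for s
    using integrableD(2)[OF intA[of s]] by (simp add: less_top)
  have real: "integrable M (\<lambda>\<omega>. indicator E \<omega> * enn2real (?X s \<omega>)) \<and>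
     (\<integral>\<omega>. indicator E \<omega> * enn2real (?X s \<omega>) \<partial>M) = c * enn2real (\<integral>\<^sup>+z. ennreal (s * (indicator A' z * z)) \<partial>lam)" for s
  proof -
    have fin: "(\<integral>\<^sup>+\<omega>. indicator E \<omega> * ?X s \<omega> \<partial>M) < \<infinity>"
      unfolding nnX using finA[of s] by (simp add: ennreal_mult_less_top)
    have "AE \<omega> in M. indicator E \<omega> * ?X s \<omega> \<noteq> \<infinity>"
      using fin by (intro nn_integral_PInf_AE) auto
    then have eq: "AE \<omega> in M. ennreal (indicator E \<omega> * enn2real (?X s \<omega>)) = indicator E \<omega> * ?X s \<omega>"
      by eventually_elim (auto simp: indicator_def less_top)
    have nn: "(\<integral>\<^sup>+\<omega>. ennreal (indicator E \<omega> * enn2real (?X s \<omega>)) \<partial>M) = (\<integral>\<^sup>+\<omega>. indicator E \<omega> * ?X s \<omega> \<partial>M)"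
      using eq by (rule nn_integral_cong_AE)
    have "integrable M (\<lambda>\<omega>. indicator E \<omega> * enn2real (?X s \<omega>))"
      using fin by (intro integrableI_nonneg) (auto simp: nn)
    moreover have "(\<integral>\<omega>. indicator E \<omega> * enn2real (?X s \<omega>) \<partial>M) = enn2real (\<integral>\<^sup>+\<omega>. indicator E \<omega> * ?X s \<omega> \<partial>M)"
      using nn by (subst integral_eq_nn_integral) auto
    ultimately show ?thesis using c by (simp add: nnX enn2real_mult)
  qed
  have eq: "indicator E \<omega> * jump n \<tau> k j UNIV \<omega> = indicator E \<omega> * enn2real (?X 1 \<omega>) - indicator E \<omega> * enn2real (?X (-1) \<omega>)" for \<omega>
    by (simp add: jump_def right_diff_distrib)
  show "integrable M (\<lambda>\<omega>. indicator E \<omega> * jump n \<tau> k j UNIV \<omega>)"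
    unfolding eq by (rule Bochner_Integration.integrable_diff[OF real[THEN conjunct1] real[THEN conjunct1]])
  have "(\<integral>\<omega>. indicator E \<omega> * jump n \<tau> k j UNIV \<omega> \<partial>M)
     = c * enn2real (\<integral>\<^sup>+z. ennreal (1 * (indicator A' z * z)) \<partial>lam) - c * enn2real (\<integral>\<^sup>+z. ennreal (-1 * (indicator A' z * z)) \<partial>lam)"
    unfolding eq using real[of 1] real[of "-1"] by (subst Bochner_Integration.integral_diff) auto
  also have "\<dots> = c * (LINT z:A'|lam. z)"
  proof -
    have "(LINT z:A'|lam. z) = (\<integral>z. 1 * (indicator A' z * z) \<partial>lam)"
      by (simp add: set_lebesgue_integral_def)
    also have "\<dots> = enn2real (\<integral>\<^sup>+z. ennreal (1 * (indicator A' z * z)) \<partial>lam) - enn2real (\<integral>\<^sup>+z. ennreal (- (1 * (indicator A' z * z))) \<partial>lam)"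
      by (rule real_lebesgue_integral_def[OF intA[of 1]])
    finally show ?thesis by (simp only: right_diff_distrib mult_minus_left)
  qed
  finally show "(\<integral>\<omega>. indicator E \<omega> * jump n \<tau> k j UNIV \<omega> \<partial>M) = c * (LINT z:A'|lam. z)" .
qed

lemma jump_mean:
  assumes cl: "0 < \<tau>" "j < n"
  shows "integrable M (jump n \<tau> k j UNIV)" and "(\<integral>\<omega>. jump n \<tau> k j UNIV \<omega> \<partial>M) = \<tau> / real n * (\<integral>z. z \<partial>lam)"
proof -
  have cnt: "(\<integral>\<^sup>+\<omega>. indicator (space M) \<omega> * emeasure (mu \<omega>) (cell n \<tau> k j D) \<partial>M) = ennreal (\<tau> / real n) * emeasure lam (UNIV \<inter> D)"
    if D: "D \<in> sets borel" for D
  proof -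
    have "(\<integral>\<^sup>+\<omega>. indicator (space M) \<omega> * emeasure (mu \<omega>) (cell n \<tau> k j D) \<partial>M) = (\<integral>\<^sup>+\<omega>. emeasure (mu \<omega>) (cell n \<tau> k j D) \<partial>M)"
      by (intro nn_integral_cong) simp
    then show ?thesis using cl D by (simp add: mu_mean cell_in_sets emeasure_cell)
  qed
  have 1: "integrable M (\<lambda>\<omega>. indicator (space M) \<omega> * jump n \<tau> k j UNIV \<omega>)"
    by (rule jump_expectation(1)[OF cl _ _ _ cnt]) (use cl in simp_all)
  have 2: "(\<integral>\<omega>. indicator (space M) \<omega> * jump n \<tau> k j UNIV \<omega> \<partial>M) = \<tau> / real n * (LINT z:UNIV|lam. z)"
    by (rule jump_expectation(2)[OF cl _ _ _ cnt]) (use cl in simp_all)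
  show "integrable M (jump n \<tau> k j UNIV)"
    using 1 by (subst Bochner_Integration.integrable_cong[OF refl, of _ _ "\<lambda>\<omega>. indicator (space M) \<omega> * jump n \<tau> k j UNIV \<omega>"]) auto
  have "(\<integral>\<omega>. jump n \<tau> k j UNIV \<omega> \<partial>M) = (\<integral>\<omega>. indicator (space M) \<omega> * jump n \<tau> k j UNIV \<omega> \<partial>M)"
    by (intro Bochner_Integration.integral_cong) auto
  then show "(\<integral>\<omega>. jump n \<tau> k j UNIV \<omega> \<partial>M) = \<tau> / real n * (\<integral>z. z \<partial>lam)"
    using 2 by (simp add: set_lebesgue_integral_def)
qed


definition dyadic_cell :: "nat \<Rightarrow> real \<Rightarrow> nat \<Rightarrow> nat \<Rightarrow> (real \<times> real \<times> real) set" where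
  "dyadic_cell n \<tau> k i = (case prod_decode i of (j, l) \<Rightarrow> if j < n then cell n \<tau> k j (shell (int_decode l)) else {})"

lemma dyadic_cell_sets: "0 < \<tau> \<Longrightarrow> dyadic_cell n \<tau> k i \<in> sets NI"
  by (auto simp: dyadic_cell_def split: prod.split intro!: cell_in_sets shell_sets)

lemma mem_dyadic_cell:
  "w \<in> dyadic_cell n \<tau> k i \<longleftrightarrow> fst (prod_decode i) < n \<and> fst w \<in> tcell \<tau> k \<and> fst (snd w) \<in> scell n (fst (prod_decode i))
     \<and> snd (snd w) \<in> shell (int_decode (snd (prod_decode i)))"
  by (auto simp: dyadic_cell_def cell_def mem_Times_iff split: prod.split)

lemma dyadic_cell_unique:
  assumes "w \<in> dyadic_cell n \<tau> k i" "w \<in> dyadic_cell n \<tau> k i'"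
  shows "i = i'"
proof -
  have 1: "fst (prod_decode i) = fst (prod_decode i')"
    using assms by (intro scell_disjoint[of n "fst (snd w)"]) (auto simp: mem_dyadic_cell)
  have "int_decode (snd (prod_decode i)) = int_decode (snd (prod_decode i'))"
    using assms by (intro shell_disjoint[of "snd (snd w)"]) (auto simp: mem_dyadic_cell)
  then have "snd (prod_decode i) = snd (prod_decode i')"
    by (metis int_decode_inverse)
  with 1 have "prod_decode i = prod_decode i'" by (simp add: prod_eq_iff)
  then show ?thesis by (metis prod_decode_inverse)
qed

lemma dyadic_cell_disjoint: "disjoint_family (dyadic_cell n \<tau> k)"
  using dyadic_cell_unique by (fastforce simp: disjoint_family_on_def)

lemma dyadic_cell_finite:
  assumes "0 < \<tau>"
  shows "emeasure NI (dyadic_cell n \<tau> k i) < \<infinity>"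
proof -
  have "emeasure lam (shell m) < \<infinity>" for m
  proof -
    have "emeasure lam (shell m) \<le> emeasure lam {z. 2 powr real_of_int m < \<bar>z\<bar>}"
      by (intro emeasure_mono) (auto simp: shell_def sets_lam)
    also have "\<dots> < \<infinity>" by (rule emeasure_lam_away) simp
    finally show ?thesis .
  qed
  then show ?thesis using assms
    by (auto simp: dyadic_cell_def emeasure_cell shell_sets ennreal_mult_less_top split: prod.split)
qed

definition dyadic_coeff :: "nat \<Rightarrow> (nat \<Rightarrow> real) \<Rightarrow> nat \<Rightarrow> real" where
  "dyadic_coeff n a i = \<bar>a (fst (prod_decode i))\<bar> * 2 powr real_of_int (int_decode (snd (prod_decode i)) + 1)"

lemma dyadic_coeff_nonneg: "0 \<le> dyadic_coeff n a i"
  by (simp add: dyadic_coeff_def)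

lemma zint_linear_comb:
  assumes "0 < \<tau>" "\<omega> \<in> space M" "f \<in> borel_measurable borel"
  shows "(\<Sum>j<n. c j * czint n \<tau> k j UNIV f \<omega>) = (\<integral>\<^sup>+w. (\<Sum>j<n. c j * (indicator (cell n \<tau> k j UNIV) w * f (snd (snd w)))) \<partial>mu \<omega>)"
proof -
  have m[measurable]: "(\<lambda>w. snd (snd w)) \<in> measurable (mu \<omega>) borel"
    using measurable_jump_size by (simp add: measurable_cong_sets[OF sets_mu[OF assms(2)] refl])
  note assms(3)[measurable]
  have [measurable]: "cell n \<tau> k j UNIV \<in> sets (mu \<omega>)" if "j < n" for j
    using assms that by (simp add: sets_mu cell_in_sets)
  show ?thesis
    by (subst nn_integral_sum) (auto simp: czint_def zint_def cell_def[symmetric] intro!: sum.cong nn_integral_cmult[symmetric])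
qed

lemma dyadic_upper:
  assumes \<tau>: "0 < \<tau>" and \<omega>: "\<omega> \<in> space M"
  shows "(\<Sum>j<n. ennreal \<bar>a j\<bar> * czint n \<tau> k j UNIV (\<lambda>z. ennreal \<bar>z\<bar>) \<omega>)
    \<le> (\<Sum>i. ennreal (dyadic_coeff n a i) * emeasure (mu \<omega>) (dyadic_cell n \<tau> k i))"
proof -
  have "(\<Sum>j<n. ennreal \<bar>a j\<bar> * czint n \<tau> k j UNIV (\<lambda>z. ennreal \<bar>z\<bar>) \<omega>)
     = (\<integral>\<^sup>+w. (\<Sum>j<n. ennreal \<bar>a j\<bar> * (indicator (cell n \<tau> k j UNIV) w * ennreal \<bar>snd (snd w)\<bar>)) \<partial>mu \<omega>)"
    by (rule zint_linear_comb[OF \<tau> \<omega>]) simp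
  also have "\<dots> \<le> (\<integral>\<^sup>+w. (\<Sum>i. ennreal (dyadic_coeff n a i) * indicator (dyadic_cell n \<tau> k i) w) \<partial>mu \<omega>)"
  proof (rule nn_integral_mono)
    fix w
    show "(\<Sum>j<n. ennreal \<bar>a j\<bar> * (indicator (cell n \<tau> k j UNIV) w * ennreal \<bar>snd (snd w)\<bar>))
       \<le> (\<Sum>i. ennreal (dyadic_coeff n a i) * indicator (dyadic_cell n \<tau> k i) w)"
    proof (cases "\<exists>j<n. w \<in> cell n \<tau> k j UNIV \<and> snd (snd w) \<noteq> 0")
      case False
      then have "(\<Sum>j<n. ennreal \<bar>a j\<bar> * (indicator (cell n \<tau> k j UNIV) w * ennreal \<bar>snd (snd w)\<bar>)) = 0"
        by (intro sum.neutral) (auto simp: indicator_def)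
      then show ?thesis by (rule ord_eq_le_trans) simp
    next
      case True
      then obtain j where j: "j < n" "w \<in> cell n \<tau> k j UNIV" "snd (snd w) \<noteq> 0" by auto
      obtain m where m: "snd (snd w) \<in> shell m" using shell_cover[OF j(3)] .
      define i where "i = prod_encode (j, int_encode m)"
      have i: "w \<in> dyadic_cell n \<tau> k i"
        using j m by (auto simp: mem_dyadic_cell i_def cell_def)
      have "(\<Sum>j'<n. ennreal \<bar>a j'\<bar> * (indicator (cell n \<tau> k j' UNIV) w * ennreal \<bar>snd (snd w)\<bar>))
        = (\<Sum>j'\<in>{j}. ennreal \<bar>a j'\<bar> * (indicator (cell n \<tau> k j' UNIV) w * ennreal \<bar>snd (snd w)\<bar>))"
      proof (rule sum.mono_neutral_right)
        show "\<forall>j'\<in>{..<n} - {j}. ennreal \<bar>a j'\<bar> * (indicator (cell n \<tau> k j' UNIV) w * ennreal \<bar>snd (snd w)\<bar>) = 0"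
          using j scell_disjoint[of n "fst (snd w)" j] by (auto simp: indicator_def cell_def)
      qed (use j in auto)
      also have "\<dots> = ennreal (\<bar>a j\<bar> * \<bar>snd (snd w)\<bar>)" using j by (simp add: ennreal_mult)
      also have "\<dots> \<le> ennreal (dyadic_coeff n a i)"
        using shell_bounds(1)[OF m] by (intro ennreal_leI) (auto simp: dyadic_coeff_def i_def intro!: mult_left_mono)
      also have "\<dots> = (\<Sum>i'\<in>{i}. ennreal (dyadic_coeff n a i') * indicator (dyadic_cell n \<tau> k i') w)" using i by simp
      also have "\<dots> \<le> (\<Sum>i. ennreal (dyadic_coeff n a i) * indicator (dyadic_cell n \<tau> k i) w)"
        by (rule sum_le_suminf) auto
      finally show ?thesis .
    qed
  qed
  also have "\<dots> = (\<Sum>i. ennreal (dyadic_coeff n a i) * emeasure (mu \<omega>) (dyadic_cell n \<tau> k i))"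
  proof -
    have [measurable]: "dyadic_cell n \<tau> k i \<in> sets (mu \<omega>)" for i using \<tau> \<omega> by (simp add: sets_mu dyadic_cell_sets)
    show ?thesis by (subst nn_integral_suminf) (auto simp: nn_integral_cmult_indicator)
  qed
  finally show ?thesis .
qed

lemma dyadic_lower:
  assumes \<tau>: "0 < \<tau>" and \<omega>: "\<omega> \<in> space M" and q: "0 \<le> q"
  shows "(\<Sum>i<N. ennreal (dyadic_coeff n a i powr q) * emeasure (mu \<omega>) (dyadic_cell n \<tau> k i))
    \<le> (\<Sum>j<n. ennreal (\<bar>a j\<bar> powr q * 2 powr q) * czint n \<tau> k j UNIV (\<lambda>z. ennreal (\<bar>z\<bar> powr q)) \<omega>)"
proof -
  have [measurable]: "dyadic_cell n \<tau> k i \<in> sets (mu \<omega>)" for i using \<tau> \<omega> by (simp add: sets_mu dyadic_cell_sets)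
  have "(\<Sum>i<N. ennreal (dyadic_coeff n a i powr q) * emeasure (mu \<omega>) (dyadic_cell n \<tau> k i))
     = (\<integral>\<^sup>+w. (\<Sum>i<N. ennreal (dyadic_coeff n a i powr q) * indicator (dyadic_cell n \<tau> k i) w) \<partial>mu \<omega>)"
    by (subst nn_integral_sum) (auto simp: nn_integral_cmult_indicator)
  also have "\<dots> \<le> (\<integral>\<^sup>+w. (\<Sum>j<n. ennreal (\<bar>a j\<bar> powr q * 2 powr q) * (indicator (cell n \<tau> k j UNIV) w * ennreal (\<bar>snd (snd w)\<bar> powr q))) \<partial>mu \<omega>)"
  proof (rule nn_integral_mono)
    fix w
    show "(\<Sum>i<N. ennreal (dyadic_coeff n a i powr q) * indicator (dyadic_cell n \<tau> k i) w)
       \<le> (\<Sum>j<n. ennreal (\<bar>a j\<bar> powr q * 2 powr q) * (indicator (cell n \<tau> k j UNIV) w * ennreal (\<bar>snd (snd w)\<bar> powr q)))"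
    proof (cases "\<exists>i<N. w \<in> dyadic_cell n \<tau> k i")
      case False
      then have "(\<Sum>i<N. ennreal (dyadic_coeff n a i powr q) * indicator (dyadic_cell n \<tau> k i) w) = 0"
        by (intro sum.neutral) (auto simp: indicator_def)
      then show ?thesis by (rule ord_eq_le_trans) simp
    next
      case True
      then obtain i where i: "i < N" "w \<in> dyadic_cell n \<tau> k i" by auto
      define j where "j = fst (prod_decode i)"
      define m where "m = int_decode (snd (prod_decode i))"
      have j: "j < n" "w \<in> cell n \<tau> k j UNIV" "snd (snd w) \<in> shell m"
        using i(2) by (auto simp: mem_dyadic_cell j_def m_def cell_def mem_Times_iff)
      have "(\<Sum>i'<N. ennreal (dyadic_coeff n a i' powr q) * indicator (dyadic_cell n \<tau> k i') w)
        = (\<Sum>i'\<in>{i}. ennreal (dyadic_coeff n a i' powr q) * indicator (dyadic_cell n \<tau> k i') w)"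
      proof (rule sum.mono_neutral_right)
        show "\<forall>i'\<in>{..<N} - {i}. ennreal (dyadic_coeff n a i' powr q) * indicator (dyadic_cell n \<tau> k i') w = 0"
          using dyadic_cell_unique[OF i(2)] by (auto simp: indicator_def)
      qed (use i in auto)
      also have "\<dots> = ennreal ((\<bar>a j\<bar> * 2 powr real_of_int (m + 1)) powr q)"
        using i by (simp add: dyadic_coeff_def j_def m_def)
      also have "\<dots> \<le> ennreal ((\<bar>a j\<bar> * (2 * \<bar>snd (snd w)\<bar>)) powr q)"
        using q shell_bounds(2)[OF j(3)] by (intro ennreal_leI powr_mono2 mult_left_mono) auto
      also have "\<dots> = ennreal (\<bar>a j\<bar> powr q * 2 powr q) * (indicator (cell n \<tau> k j UNIV) w * ennreal (\<bar>snd (snd w)\<bar> powr q))"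
        using j by (simp add: powr_mult ennreal_mult[symmetric] mult_ac)
      also have "\<dots> \<le> (\<Sum>j<n. ennreal (\<bar>a j\<bar> powr q * 2 powr q) * (indicator (cell n \<tau> k j UNIV) w * ennreal (\<bar>snd (snd w)\<bar> powr q)))"
        using j by (intro member_le_sum) auto
      finally show ?thesis .
    qed
  qed
  also have "\<dots> = (\<Sum>j<n. ennreal (\<bar>a j\<bar> powr q * 2 powr q) * czint n \<tau> k j UNIV (\<lambda>z. ennreal (\<bar>z\<bar> powr q)) \<omega>)"
    by (rule zint_linear_comb[OF \<tau> \<omega>, symmetric]) simp
  finally show ?thesis .
qed

lemma poisson_sum_dyadic:
  assumes "0 < \<tau>"
  shows "poisson_sum M {..<N} (\<lambda>i. count (dyadic_cell n \<tau> k i)) (dyadic_coeff n a) (\<lambda>i. measure NI (dyadic_cell n \<tau> k i))"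
proof -
  have sets: "range (dyadic_cell n \<tau> k) \<subseteq> sets NI" using assms dyadic_cell_sets by auto
  show ?thesis
  proof (intro poisson_sum.intro poisson_sum_axioms.intro prob_space_axioms)
    show "indep_vars (\<lambda>_. borel) (\<lambda>i. count (dyadic_cell n \<tau> k i)) {..<N}"
      using indep_count[OF sets dyadic_cell_disjoint] .
    show "prob {\<omega> \<in> space M. count (dyadic_cell n \<tau> k i) \<omega> = real m} = poisson_weight (measure NI (dyadic_cell n \<tau> k i)) m" for i m
      using assms by (intro count_poisson dyadic_cell_sets dyadic_cell_finite)
  qed (auto simp: count_nonneg dyadic_coeff_nonneg)
qed

lemma dyadic_absmom_le:
  assumes \<tau>: "0 < \<tau>" and q: "1 \<le> q" "q < 3" and n: "0 < n"
  shows "(\<Sum>i<N. dyadic_coeff n a i powr q * measure NI (dyadic_cell n \<tau> k i))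
    \<le> 2 powr q * lmom q * (\<tau> * ((\<Sum>j<n. \<bar>a j\<bar> powr q) / real n))"
proof -
  have "ennreal (\<Sum>i<N. dyadic_coeff n a i powr q * measure NI (dyadic_cell n \<tau> k i))
     = (\<Sum>i<N. ennreal (dyadic_coeff n a i powr q) * emeasure NI (dyadic_cell n \<tau> k i))"
  proof -
    have "emeasure NI (dyadic_cell n \<tau> k i) = ennreal (measure NI (dyadic_cell n \<tau> k i))" for i
      using dyadic_cell_finite[OF \<tau>, of n k i] by (intro emeasure_eq_ennreal_measure) auto
    then show ?thesis by (subst sum_ennreal[symmetric]) (auto simp: ennreal_mult)
  qed
  also have "\<dots> = (\<Sum>i<N. ennreal (dyadic_coeff n a i powr q) * (\<integral>\<^sup>+\<omega>. emeasure (mu \<omega>) (dyadic_cell n \<tau> k i) \<partial>M))"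
    by (intro sum.cong refl arg_cong2[where f = "(*)"] mu_mean[symmetric] dyadic_cell_sets \<tau>)
  also have "\<dots> = (\<integral>\<^sup>+\<omega>. (\<Sum>i<N. ennreal (dyadic_coeff n a i powr q) * emeasure (mu \<omega>) (dyadic_cell n \<tau> k i)) \<partial>M)"
  proof -
    have [measurable]: "(\<lambda>\<omega>. emeasure (mu \<omega>) (dyadic_cell n \<tau> k i)) \<in> borel_measurable M" for i
      by (intro mu_measurable dyadic_cell_sets \<tau>)
    show ?thesis by (simp add: nn_integral_sum nn_integral_cmult)
  qed
  also have "\<dots> \<le> (\<integral>\<^sup>+\<omega>. (\<Sum>j<n. ennreal (\<bar>a j\<bar> powr q * 2 powr q) * czint n \<tau> k j UNIV (\<lambda>z. ennreal (\<bar>z\<bar> powr q)) \<omega>) \<partial>M)"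
    using \<tau> q by (intro nn_integral_mono dyadic_lower) auto
  also have "\<dots> = (\<Sum>j<n. ennreal (\<bar>a j\<bar> powr q * 2 powr q) * (\<integral>\<^sup>+\<omega>. czint n \<tau> k j UNIV (\<lambda>z. ennreal (\<bar>z\<bar> powr q)) \<omega> \<partial>M))"
  proof -
    have [measurable]: "czint n \<tau> k j UNIV (\<lambda>z. ennreal (\<bar>z\<bar> powr q)) \<in> borel_measurable M" if "j < n" for j
      using \<tau> that by (intro czint_measurable_gen) auto
    show ?thesis by (subst nn_integral_sum) (auto intro!: sum.cong nn_integral_cmult)
  qed
  also have "\<dots> = (\<Sum>j<n. ennreal (\<bar>a j\<bar> powr q * 2 powr q) * ennreal (\<tau> / real n * lmom q))"
  proof (rule sum.cong[OF refl])
    fix j assume "j \<in> {..<n}"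
    then have "(\<integral>\<^sup>+\<omega>. czint n \<tau> k j UNIV (\<lambda>z. ennreal (\<bar>z\<bar> powr q)) \<omega> \<partial>M) = ennreal (\<tau> / real n) * abs_moment lam q"
      using \<tau> by (simp add: czint_campbell abs_moment_def)
    then show "ennreal (\<bar>a j\<bar> powr q * 2 powr q) * (\<integral>\<^sup>+\<omega>. czint n \<tau> k j UNIV (\<lambda>z. ennreal (\<bar>z\<bar> powr q)) \<omega> \<partial>M)
       = ennreal (\<bar>a j\<bar> powr q * 2 powr q) * ennreal (\<tau> / real n * lmom q)"
      using \<tau> q by (simp add: lmom_eq ennreal_mult[symmetric] lmom_nonneg)
  qed
  also have "\<dots> = (\<Sum>j<n. ennreal (\<bar>a j\<bar> powr q * 2 powr q * (\<tau> / real n * lmom q)))"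
    using \<tau> by (intro sum.cong refl ennreal_mult[symmetric]) (auto simp: lmom_nonneg)
  also have "\<dots> = ennreal (\<Sum>j<n. \<bar>a j\<bar> powr q * 2 powr q * (\<tau> / real n * lmom q))"
    using \<tau> by (intro sum_ennreal) (auto simp: lmom_nonneg)
  also have "(\<Sum>j<n. \<bar>a j\<bar> powr q * 2 powr q * (\<tau> / real n * lmom q)) = 2 powr q * lmom q * (\<tau> * ((\<Sum>j<n. \<bar>a j\<bar> powr q) / real n))"
    by (simp only: mult.assoc sum_distrib_right[symmetric]) (simp add: mult_ac)
  finally show ?thesis
    using \<tau> by (subst (asm) ennreal_le_iff) (auto intro!: mult_nonneg_nonneg divide_nonneg_nonneg sum_nonneg lmom_nonneg)
qed

lemma jump_comb_first_moment:
  assumes \<tau>: "0 < \<tau>" and n: "0 < n"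
  shows "(\<integral>\<^sup>+\<omega>. ennreal (\<Sum>j<n. \<bar>a j\<bar> * \<bar>jump n \<tau> k j UNIV \<omega>\<bar>) \<partial>M) \<le> ennreal (lmom 1 * (\<tau> * ((\<Sum>j<n. \<bar>a j\<bar>) / real n)))"
proof -
  have "(\<integral>\<^sup>+\<omega>. ennreal (\<Sum>j<n. \<bar>a j\<bar> * \<bar>jump n \<tau> k j UNIV \<omega>\<bar>) \<partial>M)
    = (\<integral>\<^sup>+\<omega>. (\<Sum>j<n. ennreal \<bar>a j\<bar> * ennreal \<bar>jump n \<tau> k j UNIV \<omega>\<bar>) \<partial>M)"
    by (intro nn_integral_cong) (auto simp: ennreal_mult sum_ennreal[symmetric])
  also have "\<dots> = (\<Sum>j<n. ennreal \<bar>a j\<bar> * (\<integral>\<^sup>+\<omega>. ennreal \<bar>jump n \<tau> k j UNIV \<omega>\<bar> \<partial>M))"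
    using jump_measurable[OF \<tau>, of _ n UNIV k]
    by (subst nn_integral_sum) (auto intro!: sum.cong nn_integral_cmult)
  also have "\<dots> \<le> (\<Sum>j<n. ennreal \<bar>a j\<bar> * ennreal (\<tau> / real n * lmom 1))"
  proof (intro sum_mono mult_left_mono)
    fix j assume j: "j \<in> {..<n}"
    have "(\<integral>\<^sup>+\<omega>. ennreal \<bar>jump n \<tau> k j UNIV \<omega>\<bar> \<partial>M) \<le> (\<integral>\<^sup>+\<omega>. czint n \<tau> k j UNIV (\<lambda>z. ennreal \<bar>z\<bar>) \<omega> \<partial>M)"
      using j \<tau> by (intro nn_integral_mono abs_jump_le) auto
    also have "\<dots> \<le> ennreal (\<tau> / real n * lmom 1)" using j \<tau> by (intro czint_abs_finite) auto
    finally show "(\<integral>\<^sup>+\<omega>. ennreal \<bar>jump n \<tau> k j UNIV \<omega>\<bar> \<partial>M) \<le> ennreal (\<tau> / real n * lmom 1)" .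
  qed auto
  also have "\<dots> = (\<Sum>j<n. ennreal (\<bar>a j\<bar> * (\<tau> / real n * lmom 1)))"
    using \<tau> by (intro sum.cong refl ennreal_mult[symmetric]) (auto simp: lmom_nonneg)
  also have "\<dots> = ennreal (\<Sum>j<n. \<bar>a j\<bar> * (\<tau> / real n * lmom 1))"
    using \<tau> by (intro sum_ennreal) (auto simp: lmom_nonneg)
  also have "(\<Sum>j<n. \<bar>a j\<bar> * (\<tau> / real n * lmom 1)) = lmom 1 * (\<tau> * ((\<Sum>j<n. \<bar>a j\<bar>) / real n))"
    by (simp only: sum_distrib_right[symmetric]) simp
  finally show ?thesis .
qed

lemma jump_comb_moment_normalized:
  assumes p: "2 \<le> p" "p < 3"
  obtains C where "0 \<le> C"
    and "\<And>n \<tau> k a. 0 < \<tau> \<Longrightarrow> \<tau> \<le> 1 \<Longrightarrow> 0 < n \<Longrightarrow> (\<Sum>j<n. \<bar>a j\<bar> powr p) / real n \<le> 1 \<Longrightarrow>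
      (\<integral>\<^sup>+\<omega>. ennreal ((\<Sum>j<n. \<bar>a j\<bar> * \<bar>jump n \<tau> k j UNIV \<omega>\<bar>) powr p) \<partial>M) \<le> ennreal (C * \<tau>)"
proof -
  define D where "D q = 2 powr q * lmom q * 2" for q
  have D0: "0 \<le> D q" for q by (simp add: D_def lmom_nonneg)
  define C where "C = 2 powr p * (4 * (D 1 * (1 + ((D 1)\<^sup>2 + D 2)) + D p))"
  show thesis
  proof (rule that)
    show "0 \<le> C" by (simp add: C_def D0 add_nonneg_nonneg)
  next
    fix n k :: nat and \<tau> :: real and a :: "nat \<Rightarrow> real"
    assume \<tau>: "0 < \<tau>" "\<tau> \<le> 1" and n: "0 < n" and a: "(\<Sum>j<n. \<bar>a j\<bar> powr p) / real n \<le> 1"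
    define Z where "Z N \<omega> = (\<Sum>i<N. dyadic_coeff n a i * count (dyadic_cell n \<tau> k i) \<omega>)" for N \<omega>
    have cm[measurable]: "count (dyadic_cell n \<tau> k i) \<in> borel_measurable M" for i
      using \<tau> by (intro count_measurable dyadic_cell_sets)
    have Zm[measurable]: "Z N \<in> borel_measurable M" for N unfolding Z_def[abs_def] by measurable
    have Z0: "0 \<le> Z N \<omega>" for N \<omega> unfolding Z_def by (intro sum_nonneg mult_nonneg_nonneg dyadic_coeff_nonneg count_nonneg)
    have absm: "(\<Sum>i<N. dyadic_coeff n a i powr q * measure NI (dyadic_cell n \<tau> k i)) \<le> D q * \<tau>"
      if q: "1 \<le> q" "q \<le> p" for q N
    proof -
      have "(\<Sum>i<N. dyadic_coeff n a i powr q * measure NI (dyadic_cell n \<tau> k i))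
        \<le> 2 powr q * lmom q * (\<tau> * ((\<Sum>j<n. \<bar>a j\<bar> powr q) / real n))"
        using \<tau> q p n by (intro dyadic_absmom_le) auto
      also have "\<dots> \<le> 2 powr q * lmom q * (\<tau> * 2)"
        using \<tau> q n by (intro mult_left_mono avg_powr_le_2[OF _ _ _ a]) (auto simp: lmom_nonneg)
      finally show ?thesis by (simp add: D_def mult_ac)
    qed
    have ZN: "(\<integral>\<^sup>+\<omega>. ennreal (Z N \<omega> powr p) \<partial>M) \<le> ennreal (4 * (D 1 * (1 + ((D 1)\<^sup>2 + D 2)) + D p) * \<tau>)" for N
    proof -
      interpret P: poisson_sum M "{..<N}" "\<lambda>i. count (dyadic_cell n \<tau> k i)" "dyadic_coeff n a" "\<lambda>i. measure NI (dyadic_cell n \<tau> k i)"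
        by (rule poisson_sum_dyadic[OF \<tau>(1)])
      have am: "P.absmom q \<le> D q * \<tau>" if "1 \<le> q" "q \<le> p" for q unfolding P.absmom_def by (rule absm[OF that])
      have le1: "P.absmom q \<le> D q" if "1 \<le> q" "q \<le> p" for q
      proof -
        have "D q * \<tau> \<le> D q * 1" using \<tau> D0 by (intro mult_left_mono) auto
        then show ?thesis using am[OF that] by simp
      qed
      have "(\<integral>\<^sup>+\<omega>. ennreal (Z N \<omega> powr p) \<partial>M) \<le> ennreal (4 * (P.absmom 1 * (1 + ((P.absmom 1)\<^sup>2 + P.absmom 2)) + P.absmom p))"
        using P.moment_le[OF p(1)] p unfolding P.Z_def Z_def by simp
      also have "\<dots> \<le> ennreal (4 * ((D 1 * \<tau>) * (1 + ((D 1)\<^sup>2 + D 2)) + D p * \<tau>))"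
        using am[of 1] am[of p] le1[of 1] le1[of 2] p P.absmom_nonneg D0 \<tau>
        by (intro ennreal_leI mult_left_mono add_mono mult_mono power_mono) (auto intro!: add_nonneg_nonneg)
      also have "4 * ((D 1 * \<tau>) * (1 + ((D 1)\<^sup>2 + D 2)) + D p * \<tau>) = 4 * (D 1 * (1 + ((D 1)\<^sup>2 + D 2)) + D p) * \<tau>"
        by (simp add: algebra_simps)
      finally show ?thesis .
    qed
    have AE: "AE \<omega> in M. \<forall>i. emeasure (mu \<omega>) (dyadic_cell n \<tau> k i) = ennreal (count (dyadic_cell n \<tau> k i) \<omega>)"
      unfolding AE_all_countable using \<tau> by (auto intro!: count_eq dyadic_cell_sets dyadic_cell_finite)
    have "AE \<omega> in M. ennreal ((\<Sum>j<n. \<bar>a j\<bar> * \<bar>jump n \<tau> k j UNIV \<omega>\<bar>) powr p) \<le> ennreal (2 powr p) * (SUP N. ennreal (Z N \<omega> powr p))"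
      using AE AE_space
    proof eventually_elim
      case (elim \<omega>)
      have "ennreal (\<Sum>j<n. \<bar>a j\<bar> * \<bar>jump n \<tau> k j UNIV \<omega>\<bar>) = (\<Sum>j<n. ennreal \<bar>a j\<bar> * ennreal \<bar>jump n \<tau> k j UNIV \<omega>\<bar>)"
        by (auto simp: ennreal_mult sum_ennreal[symmetric])
      also have "\<dots> \<le> (\<Sum>j<n. ennreal \<bar>a j\<bar> * czint n \<tau> k j UNIV (\<lambda>z. ennreal \<bar>z\<bar>) \<omega>)"
        using elim \<tau> by (intro sum_mono mult_left_mono abs_jump_le) auto
      also have "\<dots> \<le> (\<Sum>i. ennreal (dyadic_coeff n a i) * emeasure (mu \<omega>) (dyadic_cell n \<tau> k i))"
        using elim \<tau> by (intro dyadic_upper) auto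
      also have "\<dots> = (\<Sum>i. ennreal (dyadic_coeff n a i * count (dyadic_cell n \<tau> k i) \<omega>))"
        using elim by (intro suminf_cong) (simp add: ennreal_mult dyadic_coeff_nonneg count_nonneg)
      also have "\<dots> = (SUP N. ennreal (Z N \<omega>))"
        unfolding suminf_eq_SUP Z_def
        by (intro SUP_cong refl sum_ennreal) (simp add: dyadic_coeff_nonneg count_nonneg)
      finally show ?case
        using p Z0 by (intro SUP_ennreal_powr_le) (auto intro!: sum_nonneg)
    qed
    then have "(\<integral>\<^sup>+\<omega>. ennreal ((\<Sum>j<n. \<bar>a j\<bar> * \<bar>jump n \<tau> k j UNIV \<omega>\<bar>) powr p) \<partial>M)
       \<le> (\<integral>\<^sup>+\<omega>. ennreal (2 powr p) * (SUP N. ennreal (Z N \<omega> powr p)) \<partial>M)"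
      by (rule nn_integral_mono_AE)
    also have "\<dots> = ennreal (2 powr p) * (SUP N. \<integral>\<^sup>+\<omega>. ennreal (Z N \<omega> powr p) \<partial>M)"
    proof -
      have inc: "incseq (\<lambda>N \<omega>. ennreal (Z N \<omega> powr p))"
      proof (intro incseq_SucI le_funI ennreal_leI powr_mono2)
        show "Z N \<omega> \<le> Z (Suc N) \<omega>" for N \<omega> by (simp add: Z_def dyadic_coeff_nonneg count_nonneg)
      qed (use p Z0 in auto)
      show ?thesis
        by (subst nn_integral_cmult) (auto simp: nn_integral_monotone_convergence_SUP[OF inc])
    qed
    also have "\<dots> \<le> ennreal (2 powr p) * ennreal (4 * (D 1 * (1 + ((D 1)\<^sup>2 + D 2)) + D p) * \<tau>)"
      by (intro mult_left_mono SUP_least ZN) auto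
    also have "\<dots> = ennreal (C * \<tau>)"
      using \<tau> D0 by (subst ennreal_mult[symmetric]) (auto simp: C_def mult_ac intro!: mult_nonneg_nonneg add_nonneg_nonneg)
    finally show "(\<integral>\<^sup>+\<omega>. ennreal ((\<Sum>j<n. \<bar>a j\<bar> * \<bar>jump n \<tau> k j UNIV \<omega>\<bar>) powr p) \<partial>M) \<le> ennreal (C * \<tau>)" .
  qed
qed

end

section \<open>Conditioning, moments and nondegeneracy of the increments\<close>

lemma bernoulli_powr:
  fixes u p :: real
  assumes "0 \<le> u" "1 \<le> p"
  shows "1 + p * (u - 1) \<le> u powr p"
proof -
  consider "u = 0" | "u = 1" | "1 < u" | "0 < u" "u < 1" using assms by linarith
  then show ?thesis
  proof cases
    case 3
    have "\<exists>z>1. z < u \<and> u powr p - 1 powr p = (u - 1) * (p * z powr (p - 1))"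
      using 3 by (intro MVT2) (auto intro!: has_real_derivative_powr)
    then obtain z where z: "1 < z" "u powr p - 1 = (u - 1) * (p * z powr (p - 1))" by auto
    have "1 \<le> z powr (p - 1)" using z assms by (intro ge_one_powr_ge_zero) auto
    then have "(u - 1) * (p * 1) \<le> (u - 1) * (p * z powr (p - 1))"
      using 3 assms by (intro mult_left_mono) auto
    then show ?thesis using z by (simp add: mult.commute)
  next
    case 4
    have "\<exists>z>u. z < 1 \<and> 1 powr p - u powr p = (1 - u) * (p * z powr (p - 1))"
      using 4 by (intro MVT2) (auto intro!: has_real_derivative_powr)
    then obtain z where z: "u < z" "z < 1" "1 - u powr p = (1 - u) * (p * z powr (p - 1))" by auto
    have "z powr (p - 1) \<le> 1" using z 4 assms by (intro powr_le1) auto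
    then have "(1 - u) * (p * z powr (p - 1)) \<le> (1 - u) * (p * 1)"
      using 4 assms by (intro mult_left_mono) auto
    then show ?thesis using z by (simp add: algebra_simps)
  qed (use assms in auto)
qed

lemma powr_tangent:
  fixes x x0 p :: real
  assumes "0 \<le> x" "0 < x0" "1 \<le> p"
  shows "x0 powr p + p * x0 powr (p - 1) * (x - x0) \<le> x powr p"
proof -
  have x0: "x0 powr p = x0 powr (p - 1) * x0"
    using assms powr_add[of x0 "p - 1" 1] by simp
  have "x0 powr p * (1 + p * (x / x0 - 1)) \<le> x0 powr p * (x / x0) powr p"
    using assms by (intro mult_left_mono bernoulli_powr) auto
  also have "\<dots> = x powr p" using assms by (simp add: powr_mult[symmetric])
  also have "x0 powr p * (1 + p * (x / x0 - 1)) = x0 powr p + p * x0 powr (p - 1) * (x - x0)"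
    using assms unfolding x0 by (simp add: field_simps)
  finally show ?thesis .
qed

lemma abs_powr_tangent:
  fixes y p :: real
  assumes "1 \<le> p"
  shows "1 + p * y \<le> \<bar>1 + y\<bar> powr p"
proof (cases "-1 \<le> y")
  case True
  then show ?thesis using bernoulli_powr[of "1 + y" p] assms by simp
next
  case False
  have "p * y \<le> 1 * y" using False assms by (intro mult_right_mono_neg) auto
  then have "1 + p * y \<le> 0" using False by linarith
  then show ?thesis using powr_ge_zero[of "\<bar>1 + y\<bar>" p] by linarith
qed

lemma abs_powr_strict_growth:
  fixes p \<eta> :: real
  assumes p: "1 < p" and \<eta>: "0 < \<eta>" "\<eta> < 1"
  obtains c where "0 < c" "\<And>y. 1 + p * y + c * (\<bar>y\<bar> - \<eta>) \<le> \<bar>1 + y\<bar> powr p"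
proof -
  define c where "c = min (min (p * ((1 + \<eta>) powr (p - 1) - 1)) (p * (1 - (1 - \<eta>) powr (p - 1)))) (p - 1)"
  have "1 < (1 + \<eta>) powr (p - 1)" using p \<eta> by (intro gr_one_powr) auto
  moreover have "(1 - \<eta>) powr (p - 1) < 1"
    using powr_less_mono2[of "p - 1" "1 - \<eta>" 1] p \<eta> by simp
  ultimately have c: "0 < c" using p by (simp add: c_def)
  have c1: "c \<le> p * ((1 + \<eta>) powr (p - 1) - 1)" and c2: "c \<le> p * (1 - (1 - \<eta>) powr (p - 1))" and c3: "c \<le> p - 1"
    by (auto simp: c_def)
  show thesis
  proof (rule that[OF c])
    fix y :: real
    consider "\<bar>y\<bar> < \<eta>" | "\<eta> \<le> y" | "-1 \<le> y" "y \<le> -\<eta>" | "y < -1" by linarith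
    then show "1 + p * y + c * (\<bar>y\<bar> - \<eta>) \<le> \<bar>1 + y\<bar> powr p"
    proof cases
      case 1
      then have "c * (\<bar>y\<bar> - \<eta>) \<le> 0" using c by (simp add: mult_nonneg_nonpos)
      then show ?thesis using abs_powr_tangent[of p y] p by linarith
    next
      case 2
      have "(p + c) * (y - \<eta>) \<le> (p * (1 + \<eta>) powr (p - 1)) * (y - \<eta>)"
        using 2 c1 by (intro mult_right_mono) (auto simp: algebra_simps)
      then have "1 + p * y + c * (y - \<eta>) \<le> (1 + p * \<eta>) + p * (1 + \<eta>) powr (p - 1) * (1 + y - (1 + \<eta>))"
        by (simp add: algebra_simps)
      also have "\<dots> \<le> (1 + \<eta>) powr p + p * (1 + \<eta>) powr (p - 1) * (1 + y - (1 + \<eta>))"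
        using bernoulli_powr[of "1 + \<eta>" p] p \<eta> by simp
      also have "\<dots> \<le> (1 + y) powr p" using 2 p \<eta> by (intro powr_tangent) auto
      finally show ?thesis using 2 \<eta> by simp
    next
      case 3
      have "(p * (1 - \<eta>) powr (p - 1)) * (- y - \<eta>) \<le> (p - c) * (- y - \<eta>)"
        using 3 c2 by (intro mult_right_mono) (auto simp: algebra_simps)
      then have "1 + p * y + c * (- y - \<eta>) \<le> (1 + p * (- \<eta>)) + p * (1 - \<eta>) powr (p - 1) * (1 + y - (1 - \<eta>))"
        by (simp add: algebra_simps)
      also have "\<dots> \<le> (1 - \<eta>) powr p + p * (1 - \<eta>) powr (p - 1) * (1 + y - (1 - \<eta>))"
        using bernoulli_powr[of "1 - \<eta>" p] p \<eta> by simp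
      also have "\<dots> \<le> (1 + y) powr p" using 3 p \<eta> by (intro powr_tangent) auto
      finally show ?thesis using 3 \<eta> by simp
    next
      case 4
      have "(p - c) * y \<le> 1 * y" using 4 c3 by (intro mult_right_mono_neg) auto
      moreover have "0 \<le> c * \<eta>" using c \<eta> by simp
      ultimately have "1 + p * y + c * (- y - \<eta>) \<le> 0" using 4 by (simp add: algebra_simps)
      moreover have "\<bar>y\<bar> = - y" using 4 by simp
      ultimately show ?thesis using powr_ge_zero[of "\<bar>1 + y\<bar>" p] by (simp only:)
    qed
  qed
qed

lemma ennreal_integral_le:
  fixes g :: "'b \<Rightarrow> real"
  assumes "integrable M g"
  shows "ennreal (\<integral>x. g x \<partial>M) \<le> (\<integral>\<^sup>+x. ennreal (g x) \<partial>M)"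
proof -
  have i: "integrable M (\<lambda>x. max 0 (g x))" using assms by auto
  have "(\<integral>x. g x \<partial>M) \<le> (\<integral>x. max 0 (g x) \<partial>M)" using assms i by (intro integral_mono) auto
  then have "ennreal (\<integral>x. g x \<partial>M) \<le> ennreal (\<integral>x. max 0 (g x) \<partial>M)" by (rule ennreal_leI)
  also have "\<dots> = (\<integral>\<^sup>+x. ennreal (max 0 (g x)) \<partial>M)" using i by (intro nn_integral_eq_integral[symmetric]) auto
  also have "\<dots> = (\<integral>\<^sup>+x. ennreal (g x) \<partial>M)" by (intro nn_integral_cong) (auto simp: max_def ennreal_neg)
  finally show ?thesis .
qed

context levy_noise
begin

definition incr :: "real \<Rightarrow> nat \<Rightarrow> real \<Rightarrow> nat \<Rightarrow> nat \<Rightarrow> 'a \<Rightarrow> real" where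
  "incr b n \<tau> k j \<omega> = jump n \<tau> k j UNIV \<omega> + (b - (LINT z:{z. \<bar>z\<bar> \<le> 1}|lam. z)) * (\<tau> / real n)"

lemma incr_measurable_gen:
  assumes "0 < \<tau>" "j < n" "space G = space M"
    and "\<And>B. B \<in> sets NI \<Longrightarrow> B \<subseteq> tcell \<tau> k \<times> UNIV \<Longrightarrow> (\<lambda>\<omega>. emeasure (mu \<omega>) B) \<in> borel_measurable G"
  shows "incr b n \<tau> k j \<in> borel_measurable G"
  unfolding incr_def[abs_def] by (intro borel_measurable_add jump_measurable_gen assms) auto

lemma incr_measurable: "0 < \<tau> \<Longrightarrow> j < n \<Longrightarrow> incr b n \<tau> k j \<in> borel_measurable M"
  by (intro incr_measurable_gen) auto

lemma space_F: "space (F t) = space M"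
  using filtered by (simp add: complete_filtered_prob_space_def subalgebra_def)

lemma F_subset: "sets (F t) \<subseteq> sets M"
  using filtered by (simp add: complete_filtered_prob_space_def subalgebra_def)

lemma F_mono: "s \<le> t \<Longrightarrow> sets (F s) \<subseteq> sets (F t)"
  using filtered by (simp add: complete_filtered_prob_space_def filtration_def)

lemma measurable_F_mono: "s \<le> t \<Longrightarrow> f \<in> measurable (F s) N \<Longrightarrow> f \<in> measurable (F t) N"
  using F_mono[of s t] by (auto simp: measurable_def space_F)

lemma measurable_F_M: "f \<in> measurable (F t) N \<Longrightarrow> f \<in> measurable M N"
  using F_subset[of t] by (auto simp: measurable_def space_F)

definition future :: "real \<Rightarrow> 'a measure" where
  "future t = sigma (space M) {(\<lambda>\<omega>. emeasure (mu \<omega>) B) -` A \<inter> space M | A B.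
     A \<in> sets borel \<and> B \<in> sets NI \<and> B \<subseteq> {t<..} \<times> UNIV}"

lemma space_future: "space (future t) = space M"
  unfolding future_def by (rule space_measure_of) auto

lemma sets_future: "sets (future t) = sigma_sets (space M) {(\<lambda>\<omega>. emeasure (mu \<omega>) B) -` A \<inter> space M | A B.
     A \<in> sets borel \<and> B \<in> sets NI \<and> B \<subseteq> {t<..} \<times> UNIV}"
  unfolding future_def by (rule sets_measure_of) auto

lemma future_subset: "sets (future t) \<subseteq> sets M"
  unfolding sets_future
proof (rule sets.sigma_sets_subset, safe)
  fix A :: "ennreal set" and B assume "A \<in> sets borel" "B \<in> sets NI"
  then show "(\<lambda>\<omega>. emeasure (mu \<omega>) B) -` A \<inter> space M \<in> events"
    by (intro measurable_sets[OF mu_measurable])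
qed

lemma incr_measurable_F:
  assumes "0 < \<tau>" "j < n" "real (k + 1) * \<tau> \<le> t"
  shows "incr b n \<tau> k j \<in> borel_measurable (F t)"
proof (rule incr_measurable_gen[OF assms(1,2) space_F])
  fix B assume B: "B \<in> sets NI" "B \<subseteq> tcell \<tau> k \<times> UNIV"
  have "tcell \<tau> k \<subseteq> {0<..t}"
    using tcell_pos[OF assms(1), of k] assms(3) by (auto simp: tcell_def)
  with B have "B \<subseteq> {0<..t} \<times> UNIV" by blast
  moreover have "0 \<le> t" using assms by (auto intro: order.trans[OF _ assms(3)])
  ultimately show "(\<lambda>\<omega>. emeasure (mu \<omega>) B) \<in> borel_measurable (F t)"
    using jumps B by (simp add: levy_noise_jumps_def)
qed

lemma incr_measurable_future:
  assumes "0 < \<tau>" "j < n" "t \<le> real k * \<tau>"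
  shows "incr b n \<tau> k j \<in> borel_measurable (future t)"
proof (rule incr_measurable_gen[OF assms(1,2) space_future])
  fix B assume B: "B \<in> sets NI" "B \<subseteq> tcell \<tau> k \<times> UNIV"
  have "tcell \<tau> k \<subseteq> {t<..}" using assms(3) by (auto simp: tcell_def)
  with B have *: "B \<subseteq> {t<..} \<times> UNIV" by blast
  show "(\<lambda>\<omega>. emeasure (mu \<omega>) B) \<in> borel_measurable (future t)"
  proof (rule measurableI)
    fix A :: "ennreal set" assume "A \<in> sets borel"
    then show "(\<lambda>\<omega>. emeasure (mu \<omega>) B) -` A \<inter> space (future t) \<in> sets (future t)"
      unfolding space_future unfolding sets_future using B * by (intro sigma_sets.Basic) blast
  qed simp
qed

lemma nn_integral_F_future:
  assumes t: "0 \<le> t" and f: "(\<lambda>(\<omega>, \<omega>'). f \<omega> \<omega>') \<in> borel_measurable (F t \<Otimes>\<^sub>M future t)"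
  shows "(\<integral>\<^sup>+\<omega>. f \<omega> \<omega> \<partial>M) = (\<integral>\<^sup>+\<omega>. (\<integral>\<^sup>+\<omega>'. f \<omega> \<omega>' \<partial>M) \<partial>M)"
proof -
  have "(\<lambda>\<omega>. \<omega>) \<in> measurable M (F t)" using F_subset[of t] by (intro measurable_ident_sets measurableI) (auto simp: space_F)
  moreover have "(\<lambda>\<omega>. \<omega>) \<in> measurable M (future t)"
    using future_subset[of t] by (intro measurableI) (auto simp: space_future)
  moreover have "indep_set (sets (F t)) (sets (future t))"
    using jumps t by (simp add: levy_noise_jumps_def sets_future)
  moreover have "sigma_sets (space M) {(\<lambda>\<omega>. \<omega>) -` A \<inter> space M |A. A \<in> sets N} = sets N" if "space N = space M" for N :: "'a measure"
  proof -
    have "(\<lambda>\<omega>. \<omega>) -` A \<inter> space M = A" if "A \<in> sets N" for A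
      using sets.sets_into_space[OF that] \<open>space N = space M\<close> by auto
    then have "{(\<lambda>\<omega>. \<omega>) -` A \<inter> space M |A. A \<in> sets N} = sets N"
      unfolding Setcompr_eq_image by (simp cong: image_cong)
    then show ?thesis using sets.sigma_sets_eq[of N] that by simp
  qed
  ultimately have "indep_var (F t) (\<lambda>\<omega>. \<omega>) (future t) (\<lambda>\<omega>. \<omega>)"
    by (simp add: indep_var_eq space_F space_future)
  from nn_integral_indep_var[OF this f] show ?thesis .
qed

lemma incr_comb_moments:
  assumes p: "2 \<le> p" "p < 3"
  obtains C where "0 \<le> C"
    and "\<And>n \<tau> k a. 0 < \<tau> \<Longrightarrow> \<tau> \<le> 1 \<Longrightarrow> 0 < n \<Longrightarrow>
      (\<integral>\<^sup>+\<omega>. ennreal (\<Sum>j<n. \<bar>a j\<bar> * \<bar>incr b n \<tau> k j \<omega>\<bar>) \<partial>M) \<le> ennreal (C * \<tau> * ((\<Sum>j<n. \<bar>a j\<bar>) / real n))"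
    and "\<And>n \<tau> k a. 0 < \<tau> \<Longrightarrow> \<tau> \<le> 1 \<Longrightarrow> 0 < n \<Longrightarrow>
      (\<integral>\<^sup>+\<omega>. ennreal ((\<Sum>j<n. \<bar>a j\<bar> * \<bar>incr b n \<tau> k j \<omega>\<bar>) powr p) \<partial>M) \<le> ennreal (C * \<tau> * ((\<Sum>j<n. \<bar>a j\<bar> powr p) / real n))"
proof -
  define \<beta> where "\<beta> = \<bar>b - (LINT z:{z. \<bar>z\<bar> \<le> 1}|lam. z)\<bar>"
  obtain C0 where C0: "0 \<le> C0" and norm: "\<And>n \<tau> k a. 0 < \<tau> \<Longrightarrow> \<tau> \<le> 1 \<Longrightarrow> 0 < n \<Longrightarrow> (\<Sum>j<n. \<bar>a j\<bar> powr p) / real n \<le> 1 \<Longrightarrow>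
      (\<integral>\<^sup>+\<omega>. ennreal ((\<Sum>j<n. \<bar>a j\<bar> * \<bar>jump n \<tau> k j UNIV \<omega>\<bar>) powr p) \<partial>M) \<le> ennreal (C0 * \<tau>)"
    using jump_comb_moment_normalized[OF p] by blast
  define C1 where "C1 = lmom 1 + \<beta>"
  define C2 where "C2 = 2 powr p * (C0 + (2 * \<beta>) powr p)"
  have CC: "0 \<le> C1" "0 \<le> C2" "0 \<le> \<beta>" using C0 by (auto simp: C1_def C2_def \<beta>_def lmom_nonneg)
  have incr_le: "(\<Sum>j<n. \<bar>a j\<bar> * \<bar>incr b n \<tau> k j \<omega>\<bar>) \<le> (\<Sum>j<n. \<bar>a j\<bar> * \<bar>jump n \<tau> k j UNIV \<omega>\<bar>) + \<beta> * \<tau> * ((\<Sum>j<n. \<bar>a j\<bar>) / real n)"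
    if "0 < \<tau>" for a :: "nat \<Rightarrow> real" and n k \<tau> \<omega>
  proof -
    have "\<bar>incr b n \<tau> k j \<omega>\<bar> \<le> \<bar>jump n \<tau> k j UNIV \<omega>\<bar> + \<beta> * \<tau> / real n" for j
    proof -
      have "\<bar>incr b n \<tau> k j \<omega>\<bar> \<le> \<bar>jump n \<tau> k j UNIV \<omega>\<bar> + \<bar>(b - (LINT z:{z. \<bar>z\<bar> \<le> 1}|lam. z)) * (\<tau> / real n)\<bar>"
        unfolding incr_def by (rule abs_triangle_ineq)
      also have "\<bar>(b - (LINT z:{z. \<bar>z\<bar> \<le> 1}|lam. z)) * (\<tau> / real n)\<bar> = \<beta> * \<tau> / real n"
        using that by (simp add: abs_mult \<beta>_def)
      finally show ?thesis .
    qed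
    then have "(\<Sum>j<n. \<bar>a j\<bar> * \<bar>incr b n \<tau> k j \<omega>\<bar>) \<le> (\<Sum>j<n. \<bar>a j\<bar> * (\<bar>jump n \<tau> k j UNIV \<omega>\<bar> + \<beta> * \<tau> / real n))"
      by (intro sum_mono mult_left_mono) auto
    also have "\<dots> = (\<Sum>j<n. \<bar>a j\<bar> * \<bar>jump n \<tau> k j UNIV \<omega>\<bar>) + (\<Sum>j<n. \<bar>a j\<bar>) * (\<beta> * \<tau> / real n)"
      by (simp only: distrib_left sum.distrib sum_distrib_right)
    finally show ?thesis by (simp add: mult_ac)
  qed
  show thesis
  proof (rule that[of "C1 + C2"])
    show "0 \<le> C1 + C2" using CC by simp
  next
    fix n k :: nat and \<tau> :: real and a :: "nat \<Rightarrow> real"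
    assume \<tau>: "0 < \<tau>" "\<tau> \<le> 1" and n: "0 < n"
    have jm[measurable]: "j < n \<Longrightarrow> jump n \<tau> k j UNIV \<in> borel_measurable M" for j using \<tau> by (intro jump_measurable) auto
    define s where "s = (\<Sum>j<n. \<bar>a j\<bar>) / real n"
    have s: "0 \<le> s" by (simp add: s_def sum_nonneg)
    have "(\<integral>\<^sup>+\<omega>. ennreal (\<Sum>j<n. \<bar>a j\<bar> * \<bar>incr b n \<tau> k j \<omega>\<bar>) \<partial>M)
       \<le> (\<integral>\<^sup>+\<omega>. ennreal (\<Sum>j<n. \<bar>a j\<bar> * \<bar>jump n \<tau> k j UNIV \<omega>\<bar>) + ennreal (\<beta> * \<tau> * s) \<partial>M)"
      using incr_le[OF \<tau>(1)] s CC \<tau> unfolding s_def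
      by (intro nn_integral_mono) (subst ennreal_plus[symmetric], auto intro!: sum_nonneg ennreal_leI)
    also have "\<dots> = (\<integral>\<^sup>+\<omega>. ennreal (\<Sum>j<n. \<bar>a j\<bar> * \<bar>jump n \<tau> k j UNIV \<omega>\<bar>) \<partial>M) + ennreal (\<beta> * \<tau> * s)"
      by (subst nn_integral_add) (auto simp: emeasure_space_1)
    also have "\<dots> \<le> ennreal (lmom 1 * (\<tau> * s)) + ennreal (\<beta> * \<tau> * s)"
      unfolding s_def by (intro add_right_mono jump_comb_first_moment \<tau> n)
    also have "\<dots> = ennreal (C1 * \<tau> * s)"
      using s CC \<tau> by (subst ennreal_plus[symmetric]) (auto simp: C1_def lmom_nonneg algebra_simps)
    also have "\<dots> \<le> ennreal ((C1 + C2) * \<tau> * s)"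
      using s CC \<tau> by (intro ennreal_leI mult_right_mono) auto
    finally show "(\<integral>\<^sup>+\<omega>. ennreal (\<Sum>j<n. \<bar>a j\<bar> * \<bar>incr b n \<tau> k j \<omega>\<bar>) \<partial>M) \<le> ennreal ((C1 + C2) * \<tau> * ((\<Sum>j<n. \<bar>a j\<bar>) / real n))"
      by (simp only: s_def)
  next
    fix n k :: nat and \<tau> :: real and a :: "nat \<Rightarrow> real"
    assume \<tau>: "0 < \<tau>" "\<tau> \<le> 1" and n: "0 < n"
    have im[measurable]: "j < n \<Longrightarrow> incr b n \<tau> k j \<in> borel_measurable M" for j using \<tau> by (intro incr_measurable) auto
    have jm[measurable]: "j < n \<Longrightarrow> jump n \<tau> k j UNIV \<in> borel_measurable M" for j using \<tau> by (intro jump_measurable) auto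
    define s where "s = (\<Sum>j<n. \<bar>a j\<bar> powr p) / real n"
    have s0: "0 \<le> s" by (simp add: s_def sum_nonneg)
    show "(\<integral>\<^sup>+\<omega>. ennreal ((\<Sum>j<n. \<bar>a j\<bar> * \<bar>incr b n \<tau> k j \<omega>\<bar>) powr p) \<partial>M) \<le> ennreal ((C1 + C2) * \<tau> * ((\<Sum>j<n. \<bar>a j\<bar> powr p) / real n))"
    proof (cases "s = 0")
      case True
      then have "(\<Sum>j<n. \<bar>a j\<bar> powr p) = 0" using n by (simp add: s_def)
      then have "a j = 0" if "j < n" for j using that by (simp add: sum_nonneg_eq_0_iff)
      then have "(\<Sum>j<n. \<bar>a j\<bar> * \<bar>incr b n \<tau> k j \<omega>\<bar>) = 0" for \<omega> by simp
      then show ?thesis by simp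
    next
      case False
      with s0 have s: "0 < s" by simp
      define A where "A = s powr (1 / p)"
      have A: "0 < A" "A powr p = s" using s p by (auto simp: A_def powr_powr)
      define a' where "a' j = a j / A" for j
      have aa: "\<bar>a j\<bar> = A * \<bar>a' j\<bar>" for j using A by (simp add: a'_def)
      have "(\<Sum>j<n. \<bar>a j\<bar> powr p) = s * (\<Sum>j<n. \<bar>a' j\<bar> powr p)"
        unfolding sum_distrib_left aa using A by (intro sum.cong refl) (simp add: powr_mult)
      then have na: "(\<Sum>j<n. \<bar>a' j\<bar> powr p) / real n \<le> 1"
        using s n by (simp add: s_def field_simps)
      have n1: "(\<Sum>j<n. \<bar>a' j\<bar>) / real n \<le> 2"
        using avg_powr_le_2[of n 1 p a'] n p na by simp
      have "(\<Sum>j<n. \<bar>a j\<bar> * \<bar>incr b n \<tau> k j \<omega>\<bar>) powr p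
        \<le> s * (2 powr p * ((\<Sum>j<n. \<bar>a' j\<bar> * \<bar>jump n \<tau> k j UNIV \<omega>\<bar>) powr p + (2 * \<beta>) powr p * \<tau>))" for \<omega>
      proof -
        define J where "J = (\<Sum>j<n. \<bar>a' j\<bar> * \<bar>jump n \<tau> k j UNIV \<omega>\<bar>)"
        have J: "0 \<le> J" by (simp add: J_def sum_nonneg)
        have "(\<Sum>j<n. \<bar>a j\<bar> * \<bar>incr b n \<tau> k j \<omega>\<bar>) = A * (\<Sum>j<n. \<bar>a' j\<bar> * \<bar>incr b n \<tau> k j \<omega>\<bar>)"
          by (simp add: aa sum_distrib_left mult.assoc)
        also have "\<dots> powr p = s * (\<Sum>j<n. \<bar>a' j\<bar> * \<bar>incr b n \<tau> k j \<omega>\<bar>) powr p"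
          using A by (simp add: powr_mult)
        also have "\<dots> \<le> s * (J + \<beta> * \<tau> * ((\<Sum>j<n. \<bar>a' j\<bar>) / real n)) powr p"
          unfolding J_def using s p by (intro mult_left_mono powr_mono2 incr_le \<tau>) (auto intro!: sum_nonneg)
        also have "\<dots> \<le> s * (J + \<beta> * \<tau> * 2) powr p"
          using s p \<tau> CC J n1 by (intro mult_left_mono powr_mono2 add_left_mono) (auto intro!: add_nonneg_nonneg mult_nonneg_nonneg divide_nonneg_nonneg sum_nonneg)
        also have "\<dots> \<le> s * (2 powr p * (J powr p + (\<beta> * \<tau> * 2) powr p))"
          using s p \<tau> CC J by (intro mult_left_mono powr_add_le) auto
        also have "(\<beta> * \<tau> * 2) powr p = (2 * \<beta>) powr p * \<tau> powr p"
          by (simp add: powr_mult[symmetric] mult_ac)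
        also have "s * (2 powr p * (J powr p + (2 * \<beta>) powr p * \<tau> powr p)) \<le> s * (2 powr p * (J powr p + (2 * \<beta>) powr p * \<tau>))"
        proof (intro mult_left_mono add_left_mono)
          have "\<tau> powr p \<le> \<tau> powr 1" using \<tau> p by (intro powr_mono') auto
          then show "\<tau> powr p \<le> \<tau>" using \<tau> by simp
        qed (use s in auto)
        finally show ?thesis by (simp only: J_def)
      qed
      then have "(\<integral>\<^sup>+\<omega>. ennreal ((\<Sum>j<n. \<bar>a j\<bar> * \<bar>incr b n \<tau> k j \<omega>\<bar>) powr p) \<partial>M)
        \<le> (\<integral>\<^sup>+\<omega>. ennreal (s * 2 powr p) * (ennreal ((\<Sum>j<n. \<bar>a' j\<bar> * \<bar>jump n \<tau> k j UNIV \<omega>\<bar>) powr p) + ennreal ((2 * \<beta>) powr p * \<tau>)) \<partial>M)"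
        using s \<tau> by (intro nn_integral_mono) (simp add: ennreal_plus[symmetric] ennreal_mult[symmetric] mult.assoc ennreal_leI del: ennreal_plus)
      also have "\<dots> = ennreal (s * 2 powr p) * ((\<integral>\<^sup>+\<omega>. ennreal ((\<Sum>j<n. \<bar>a' j\<bar> * \<bar>jump n \<tau> k j UNIV \<omega>\<bar>) powr p) \<partial>M) + ennreal ((2 * \<beta>) powr p * \<tau>))"
        by (subst nn_integral_cmult) (auto simp: nn_integral_add emeasure_space_1)
      also have "\<dots> \<le> ennreal (s * 2 powr p) * (ennreal (C0 * \<tau>) + ennreal ((2 * \<beta>) powr p * \<tau>))"
        by (intro mult_left_mono add_right_mono norm \<tau> n na) auto
      also have "\<dots> = ennreal (C2 * \<tau> * s)"
        using s \<tau> C0 by (simp add: ennreal_plus[symmetric] ennreal_mult[symmetric] C2_def algebra_simps del: ennreal_plus)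
      also have "\<dots> \<le> ennreal ((C1 + C2) * \<tau> * s)"
        using s CC \<tau> by (intro ennreal_leI mult_right_mono) auto
      finally show ?thesis by (simp only: s_def)
    qed
  qed
qed


lemma one_sided_jump_set:
  obtains s e :: real where "s = 1 \<or> s = -1" "0 < e" "emeasure lam {z. e < s * z} \<noteq> 0" "emeasure lam {z. e < s * z} < \<infinity>"
proof -
  have "\<exists>s e. (s = 1 \<or> s = -1) \<and> 0 < e \<and> emeasure lam {z::real. e < s * z} \<noteq> 0"
  proof (rule ccontr)
    assume "\<not> ?thesis"
    then have null: "emeasure lam {z::real. e < s * z} = 0" if "s = 1 \<or> s = -1" "0 < e" for s e using that by blast
    have sub: "UNIV \<subseteq> {0} \<union> (\<Union>i::nat. {z::real. 1 / real (Suc i) < 1 * z} \<union> {z::real. 1 / real (Suc i) < -1 * z})"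
    proof
      fix z :: real
      show "z \<in> {0} \<union> (\<Union>i::nat. {z::real. 1 / real (Suc i) < 1 * z} \<union> {z::real. 1 / real (Suc i) < -1 * z})"
      proof (cases "z = 0")
        case False
        then obtain i where "1 / real (Suc i) < \<bar>z\<bar>" using nat_approx_posE[of "\<bar>z\<bar>"] by auto
        then show ?thesis by (auto simp: abs_if split: if_splits)
      qed simp
    qed
    have nul: "{0} \<union> (\<Union>i::nat. {z::real. 1 / real (Suc i) < 1 * z} \<union> {z::real. 1 / real (Suc i) < -1 * z}) \<in> null_sets lam"
      using emeasure_lam_zero null[of 1] null[of "-1"]
      by (intro null_sets.Un null_sets_UN) (auto simp: null_sets_def sets_lam)
    have "UNIV \<in> null_sets lam" by (rule null_sets_subset[OF nul _ sub]) (simp add: sets_lam)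
    then show False using nontrivial by auto
  qed
  then obtain s e where se: "s = 1 \<or> s = -1" "0 < e" "emeasure lam {z::real. e < s * z} \<noteq> 0" by blast
  have "emeasure lam {z. e < s * z} \<le> emeasure lam {z. e < \<bar>z\<bar>}"
    using se by (intro emeasure_mono) (auto simp: sets_lam)
  also have "\<dots> < \<infinity>" by (rule emeasure_lam_away[OF se(2)])
  finally show thesis using that se by blast
qed

lemma indep_void_count:
  assumes B0: "B0 \<in> sets NI" and B1: "B1 \<in> sets NI" and disj: "B0 \<inter> B1 = {}"
  shows "(\<integral>\<^sup>+\<omega>. indicator {\<omega> \<in> space M. emeasure (mu \<omega>) B0 = 0} \<omega> * emeasure (mu \<omega>) B1 \<partial>M)
    = ennreal (prob {\<omega> \<in> space M. emeasure (mu \<omega>) B0 = 0}) * emeasure NI B1"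
proof -
  define B where "B i = (if i = 0 then B0 else if i = 1 then B1 else {})" for i :: nat
  define g :: "nat \<Rightarrow> ennreal \<Rightarrow> ennreal" where "g i = (if i = 0 then indicator {0} else (\<lambda>x. x))" for i
  have "indep_vars (\<lambda>_. borel) (\<lambda>i \<omega>. emeasure (mu \<omega>) (B i)) UNIV"
    using B0 B1 disj by (intro indep_mu) (auto simp: B_def disjoint_family_on_def)
  then have "indep_vars (\<lambda>_. borel) (\<lambda>i \<omega>. g i (emeasure (mu \<omega>) (B i))) UNIV"
    by (rule indep_vars_compose2) (auto simp: g_def)
  then have ind: "indep_vars (\<lambda>_. borel) (\<lambda>i \<omega>. g i (emeasure (mu \<omega>) (B i))) {0, 1}"
    by (rule indep_vars_subset) simp
  have [measurable]: "{\<omega> \<in> space M. emeasure (mu \<omega>) B0 = 0} \<in> events" using B0 by measurable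
  have "(\<integral>\<^sup>+\<omega>. indicator {\<omega> \<in> space M. emeasure (mu \<omega>) B0 = 0} \<omega> * emeasure (mu \<omega>) B1 \<partial>M)
     = (\<integral>\<^sup>+\<omega>. (\<Prod>i\<in>{0, 1}. g i (emeasure (mu \<omega>) (B i))) \<partial>M)"
    by (intro nn_integral_cong) (simp add: g_def B_def indicator_def)
  also have "\<dots> = (\<Prod>i\<in>{0, 1}. \<integral>\<^sup>+\<omega>. g i (emeasure (mu \<omega>) (B i)) \<partial>M)"
    by (rule indep_vars_nn_integral[OF _ ind]) auto
  also have "\<dots> = (\<integral>\<^sup>+\<omega>. indicator {0} (emeasure (mu \<omega>) B0) \<partial>M) * (\<integral>\<^sup>+\<omega>. emeasure (mu \<omega>) B1 \<partial>M)"
    by (simp add: g_def B_def)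
  also have "(\<integral>\<^sup>+\<omega>. indicator {0} (emeasure (mu \<omega>) B0) \<partial>M) = (\<integral>\<^sup>+\<omega>. indicator {\<omega> \<in> space M. emeasure (mu \<omega>) B0 = 0} \<omega> \<partial>M)"
    by (intro nn_integral_cong) (simp add: indicator_def)
  also have "\<dots> = ennreal (prob {\<omega> \<in> space M. emeasure (mu \<omega>) B0 = 0})"
    by (simp add: emeasure_eq_measure)
  finally show ?thesis using B1 by (simp add: mu_mean)
qed

end

lemma (in prob_space) powr_mean_le:
  assumes Y: "integrable M (Y :: 'a \<Rightarrow> real)" and p: "1 \<le> p" and A: "0 \<le> A" "A \<le> (\<integral>\<omega>. \<bar>Y \<omega>\<bar> \<partial>M)"
  shows "ennreal (A powr p) \<le> (\<integral>\<^sup>+\<omega>. ennreal (\<bar>Y \<omega>\<bar> powr p) \<partial>M)"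
proof (cases "A = 0")
  case False
  then have A0: "0 < A" using A by simp
  define B where "B = p * A powr (p - 1)"
  have le: "A powr p + B * (\<bar>Y \<omega>\<bar> - A) \<le> \<bar>Y \<omega>\<bar> powr p" for \<omega>
    unfolding B_def by (rule powr_tangent) (use A0 p in auto)
  have i: "integrable M (\<lambda>\<omega>. A powr p + B * (\<bar>Y \<omega>\<bar> - A))" using Y by auto
  have "A powr p \<le> A powr p + B * ((\<integral>\<omega>. \<bar>Y \<omega>\<bar> \<partial>M) - A)" using A p by (simp add: B_def)
  also have "\<dots> = (\<integral>\<omega>. A powr p + B * (\<bar>Y \<omega>\<bar> - A) \<partial>M)" using Y by (simp add: prob_space)
  finally have "ennreal (A powr p) \<le> ennreal (\<integral>\<omega>. A powr p + B * (\<bar>Y \<omega>\<bar> - A) \<partial>M)" by (rule ennreal_leI)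
  also have "\<dots> \<le> (\<integral>\<^sup>+\<omega>. ennreal (A powr p + B * (\<bar>Y \<omega>\<bar> - A)) \<partial>M)" by (rule ennreal_integral_le[OF i])
  also have "\<dots> \<le> (\<integral>\<^sup>+\<omega>. ennreal (\<bar>Y \<omega>\<bar> powr p) \<partial>M)" by (intro nn_integral_mono ennreal_leI le)
  finally show ?thesis .
qed simp

locale centered_levy_noise = levy_noise +
  fixes b :: real
  assumes centered: "b = - (LINT z:{z. 1 < \<bar>z\<bar>}|lam. z)"
begin

lemma drift_compensates: "b - (LINT z:{z. \<bar>z\<bar> \<le> 1}|lam. z) = - (\<integral>z. z \<partial>lam)"
proof -
  have si: "set_integrable lam A (\<lambda>z. z)" if "A \<in> sets borel" for A
    unfolding set_integrable_def using that lam_integrable by (intro integrable_mult_indicator) (auto simp: sets_lam)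
  have "(LINT z:{z. \<bar>z\<bar> \<le> 1} \<union> {z. 1 < \<bar>z\<bar>}|lam. z) = (LINT z:{z. \<bar>z\<bar> \<le> 1}|lam. z) + (LINT z:{z. 1 < \<bar>z\<bar>}|lam. z)"
    by (intro set_integral_Un si) auto
  moreover have "{z::real. \<bar>z\<bar> \<le> 1} \<union> {z. 1 < \<bar>z\<bar>} = UNIV" by auto
  ultimately show ?thesis by (simp add: centered set_lebesgue_integral_def)
qed

lemma incr_centered:
  assumes "0 < \<tau>" "j < n"
  shows "integrable M (incr b n \<tau> k j)" "(\<integral>\<omega>. incr b n \<tau> k j \<omega> \<partial>M) = 0"
  unfolding incr_def[abs_def] drift_compensates using jump_mean[OF assms] by (simp_all add: prob_space)

lemma incr_comb_centered:
  assumes "0 < \<tau>"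
  shows "integrable M (\<lambda>\<omega>. \<Sum>j<n. a j * incr b n \<tau> k j \<omega>)" "(\<integral>\<omega>. (\<Sum>j<n. a j * incr b n \<tau> k j \<omega>) \<partial>M) = 0"
  using incr_centered[OF assms] by (auto simp: Bochner_Integration.integral_sum)

lemma incr_nondegenerate:
  assumes \<tau>: "0 < \<tau>" and n: "0 < n"
  obtains \<kappa> where "0 < \<kappa>"
    and "\<And>k a x i. i < n \<Longrightarrow> \<kappa> * \<bar>a i\<bar> \<le> (\<integral>\<omega>. \<bar>x + (\<Sum>j<n. a j * incr b n \<tau> k j \<omega>)\<bar> \<partial>M)"
proof -
  obtain s e :: real where se: "s = 1 \<or> s = -1" "0 < e" "emeasure lam {z. e < s * z} \<noteq> 0" "emeasure lam {z. e < s * z} < \<infinity>"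
    by (rule one_sided_jump_set)
  define A where "A = {z. e < s * z}"
  have A[measurable]: "A \<in> sets borel" unfolding A_def by measurable
  have A': "A \<in> sets lam" "- A \<in> sets borel" by (simp_all add: sets_lam)
  define v where "v = \<tau> / real n"
  have v: "0 < v" using \<tau> n by (simp add: v_def)
  define mA where "mA = measure lam A"
  have mA: "emeasure lam A = ennreal mA" "0 < mA"
  proof -
    show "emeasure lam A = ennreal mA" using se unfolding mA_def A_def by (intro emeasure_eq_ennreal_measure) auto
    then show "0 < mA" using se(3) unfolding A_def[symmetric] by (metis ennreal_eq_0_iff not_le)
  qed
  define \<pi> where "\<pi> = exp (- (v * mA))"
  have si: "set_integrable lam D (\<lambda>z. z)" if "D \<in> sets borel" for D
    unfolding set_integrable_def using that lam_integrable by (intro integrable_mult_indicator) (auto simp: sets_lam)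
  define m where "m = (LINT z:A|lam. z)"
  have m: "e * mA \<le> \<bar>m\<bar>"
  proof -
    have int1: "integrable lam (\<lambda>z. indicator A z * e)" using mA by (auto simp: sets_lam)
    have "e * mA = (\<integral>z. indicator A z * e \<partial>lam)" using A' by (simp add: mA_def mult.commute)
    also have "\<dots> \<le> (\<integral>z. s * (indicator A z * z) \<partial>lam)"
      using si[OF A] int1 by (intro integral_mono) (auto simp: set_integrable_def A_def indicator_def)
    also have "\<dots> = s * m" by (simp add: m_def set_lebesgue_integral_def)
    also have "\<dots> \<le> \<bar>m\<bar>" using se(1) by auto
    finally show ?thesis .
  qed
  define \<kappa> where "\<kappa> = \<pi> * v * (e * mA)"
  have \<kappa>: "0 < \<kappa>" using v se(2) mA by (simp add: \<kappa>_def \<pi>_def)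
  show thesis
  proof (rule that[OF \<kappa>])
    fix k i :: nat and a :: "nat \<Rightarrow> real" and x :: real
    assume i: "i < n"
    define E where "E = {\<omega> \<in> space M. emeasure (mu \<omega>) (cell n \<tau> k i A) = 0}"
    have cA: "cell n \<tau> k i A \<in> sets NI" using \<tau> i by (intro cell_in_sets) auto
    have E[measurable]: "E \<in> events" unfolding E_def using cA by measurable
    have cA_em: "emeasure NI (cell n \<tau> k i A) = ennreal (v * mA)"
      using \<tau> i v mA by (simp add: emeasure_cell v_def[symmetric] ennreal_mult)
    have PE: "prob E = \<pi>"
      using mu_poisson[OF cA, of 0] v mA by (simp add: E_def cA_em measure_def poisson_weight_def \<pi>_def)
    have cnt: "(\<integral>\<^sup>+\<omega>. indicator E \<omega> * emeasure (mu \<omega>) (cell n \<tau> k j D) \<partial>M) = ennreal (\<pi> * v) * emeasure lam ((if j = i then - A else UNIV) \<inter> D)"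
      if j: "j < n" and D: "D \<in> sets borel" for j D
    proof -
      let ?A = "if j = i then - A else UNIV"
      have sets: "cell n \<tau> k j (?A \<inter> D) \<in> sets NI" using \<tau> j D by (intro cell_in_sets) auto
      have disj: "cell n \<tau> k i A \<inter> cell n \<tau> k j (?A \<inter> D) = {}"
        using scell_disjoint[of n _ i j] n by (auto simp: cell_def)
      have "(\<integral>\<^sup>+\<omega>. indicator E \<omega> * emeasure (mu \<omega>) (cell n \<tau> k j D) \<partial>M) = (\<integral>\<^sup>+\<omega>. indicator E \<omega> * emeasure (mu \<omega>) (cell n \<tau> k j (?A \<inter> D)) \<partial>M)"
      proof (rule nn_integral_cong)
        fix \<omega> assume \<omega>: "\<omega> \<in> space M"
        show "indicator E \<omega> * emeasure (mu \<omega>) (cell n \<tau> k j D) = indicator E \<omega> * emeasure (mu \<omega>) (cell n \<tau> k j (?A \<inter> D))"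
        proof (cases "\<omega> \<in> E \<and> j = i")
          case True
          have s1: "cell n \<tau> k j (A \<inter> D) \<in> sets (mu \<omega>)" "cell n \<tau> k j (?A \<inter> D) \<in> sets (mu \<omega>)" "cell n \<tau> k i A \<in> sets (mu \<omega>)"
            using sets cA \<tau> j D \<omega> by (auto simp: sets_mu intro!: cell_in_sets)
          have "emeasure (mu \<omega>) (cell n \<tau> k j (A \<inter> D)) \<le> emeasure (mu \<omega>) (cell n \<tau> k i A)"
            using True s1 by (intro emeasure_mono) (auto simp: cell_def)
          then have z: "emeasure (mu \<omega>) (cell n \<tau> k j (A \<inter> D)) = 0" using True by (simp add: E_def)
          have "cell n \<tau> k j D = cell n \<tau> k j (A \<inter> D) \<union> cell n \<tau> k j (?A \<inter> D)" using True by (auto simp: cell_def)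
          moreover have "cell n \<tau> k j (A \<inter> D) \<inter> cell n \<tau> k j (?A \<inter> D) = {}" using True by (auto simp: cell_def)
          ultimately have "emeasure (mu \<omega>) (cell n \<tau> k j D) = emeasure (mu \<omega>) (cell n \<tau> k j (A \<inter> D)) + emeasure (mu \<omega>) (cell n \<tau> k j (?A \<inter> D))"
            using s1 by (simp add: plus_emeasure)
          then show ?thesis using z by simp
        qed auto
      qed
      also have "\<dots> = ennreal \<pi> * emeasure NI (cell n \<tau> k j (?A \<inter> D))"
        unfolding E_def using indep_void_count[OF cA sets disj] PE by (simp add: E_def)
      also have "emeasure NI (cell n \<tau> k j (?A \<inter> D)) = ennreal v * emeasure lam (?A \<inter> D)"
        unfolding v_def by (rule emeasure_cell[OF \<tau> j]) (use D in auto)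
      finally show ?thesis using v by (simp add: ennreal_mult mult.assoc \<pi>_def)
    qed
    define h where "h \<omega> = indicator E \<omega> - \<pi>" for \<omega>
    have hm[measurable]: "h \<in> borel_measurable M" unfolding h_def[abs_def] by measurable
    have \<pi>01: "0 < \<pi>" "\<pi> \<le> 1" using v mA by (auto simp: \<pi>_def)
    have h1: "\<bar>h \<omega>\<bar> \<le> 1" for \<omega> using \<pi>01 by (auto simp: h_def indicator_def)
    have EE: "E \<inter> space M = E" by (auto simp: E_def)
    have iE0: "integrable M (\<lambda>\<omega>. indicator E \<omega> :: real)"
      by (intro integrable_real_indicator E) (simp add: emeasure_eq_measure)
    have Eh: "(\<integral>\<omega>. h \<omega> \<partial>M) = 0"
      unfolding h_def using iE0 by (subst Bochner_Integration.integral_diff) (auto simp: PE EE prob_space)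
    have hI: "integrable M (\<lambda>\<omega>. h \<omega> * incr b n \<tau> k j \<omega>) \<and>
        (\<integral>\<omega>. h \<omega> * incr b n \<tau> k j \<omega> \<partial>M) = (if j = i then - (\<pi> * v * m) else 0)" if j: "j < n" for j
    proof -
      let ?A = "if j = i then - A else UNIV"
      have A'': "?A \<in> sets borel" by simp
      note je = jump_expectation[OF \<tau> j A'' E _ cnt[OF j]]
      have j1: "integrable M (\<lambda>\<omega>. indicator E \<omega> * jump n \<tau> k j UNIV \<omega>)"
        by (rule je(1)) (use v in \<open>simp_all add: \<pi>_def\<close>)
      have j2: "(\<integral>\<omega>. indicator E \<omega> * jump n \<tau> k j UNIV \<omega> \<partial>M) = \<pi> * v * (LINT z:?A|lam. z)"
        by (rule je(2)) (use v in \<open>simp_all add: \<pi>_def\<close>)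
      have eq: "h \<omega> * incr b n \<tau> k j \<omega> = indicator E \<omega> * jump n \<tau> k j UNIV \<omega> + indicator E \<omega> * (- (\<integral>z. z \<partial>lam) * v) - \<pi> * incr b n \<tau> k j \<omega>" for \<omega>
        unfolding h_def incr_def drift_compensates v_def by (simp add: algebra_simps add_divide_distrib diff_divide_distrib)
      have iE: "integrable M (\<lambda>\<omega>. indicator E \<omega> * (- (\<integral>z. z \<partial>lam) * v))"
        by (intro integrable_mult_left iE0)
      have "integrable M (\<lambda>\<omega>. h \<omega> * incr b n \<tau> k j \<omega>)"
        unfolding eq using j1 iE incr_centered(1)[OF \<tau> j] by (intro Bochner_Integration.integrable_diff Bochner_Integration.integrable_add) auto
      moreover have "(\<integral>\<omega>. h \<omega> * incr b n \<tau> k j \<omega> \<partial>M) = \<pi> * v * (LINT z:?A|lam. z) + \<pi> * (- (\<integral>z. z \<partial>lam) * v) - \<pi> * 0"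
        unfolding eq using j1 iE incr_centered[OF \<tau> j, of k]
        by (simp add: Bochner_Integration.integral_diff Bochner_Integration.integral_add j2 PE)
      moreover have "(LINT z:?A|lam. z) - (\<integral>z. z \<partial>lam) = (if j = i then - m else 0)"
      proof (cases "j = i")
        case True
        have "(LINT z:A \<union> - A|lam. z) = m + (LINT z:- A|lam. z)"
          unfolding m_def by (intro set_integral_Un si) (auto simp: A')
        then show ?thesis using True by (simp add: set_lebesgue_integral_def)
      qed (simp add: set_lebesgue_integral_def)
      then have "\<pi> * v * ((LINT z:?A|lam. z) - (\<integral>z. z \<partial>lam)) = (if j = i then - (\<pi> * v * m) else 0)"
        by (cases "j = i") simp_all
      ultimately show ?thesis by (simp add: algebra_simps)
    qed
    define Y where "Y \<omega> = x + (\<Sum>j<n. a j * incr b n \<tau> k j \<omega>)" for \<omega>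
    have Yi: "integrable M Y" unfolding Y_def[abs_def] using incr_comb_centered[OF \<tau>] by auto
    have hY: "h \<omega> * Y \<omega> = x * h \<omega> + (\<Sum>j<n. a j * (h \<omega> * incr b n \<tau> k j \<omega>))" for \<omega>
      by (simp add: Y_def distrib_left sum_distrib_left mult_ac)
    have hint: "integrable M h" using h1 by (intro integrable_const_bound[of _ 1]) auto
    have hYi: "integrable M (\<lambda>\<omega>. h \<omega> * Y \<omega>)" unfolding hY using hint hI
      by (intro Bochner_Integration.integrable_add integrable_mult_right Bochner_Integration.integrable_sum) auto
    have "(\<integral>\<omega>. h \<omega> * Y \<omega> \<partial>M) = x * (\<integral>\<omega>. h \<omega> \<partial>M) + (\<Sum>j<n. a j * (\<integral>\<omega>. h \<omega> * incr b n \<tau> k j \<omega> \<partial>M))"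
      unfolding hY using hint hI by (subst Bochner_Integration.integral_add) (auto simp: Bochner_Integration.integral_sum)
    also have "\<dots> = (\<Sum>j<n. a j * (if j = i then - (\<pi> * v * m) else 0))"
      using hI by (simp add: Eh)
    also have "\<dots> = (\<Sum>j<n. if j = i then a j * - (\<pi> * v * m) else 0)" by (intro sum.cong) auto
    also have "\<dots> = a i * - (\<pi> * v * m)" using i by (subst sum.delta) auto
    finally have EhY: "(\<integral>\<omega>. h \<omega> * Y \<omega> \<partial>M) = a i * - (\<pi> * v * m)" .
    have "\<kappa> * \<bar>a i\<bar> \<le> \<pi> * v * \<bar>m\<bar> * \<bar>a i\<bar>"
      unfolding \<kappa>_def using m v \<pi>01 by (intro mult_right_mono mult_left_mono) auto
    also have "\<dots> = \<bar>\<integral>\<omega>. h \<omega> * Y \<omega> \<partial>M\<bar>"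
      unfolding EhY using v \<pi>01 by (simp add: abs_mult mult_ac)
    also have "\<dots> \<le> (\<integral>\<omega>. \<bar>h \<omega> * Y \<omega>\<bar> \<partial>M)" by (rule integral_abs_bound)
    also have "\<dots> \<le> (\<integral>\<omega>. \<bar>Y \<omega>\<bar> \<partial>M)"
    proof (intro integral_mono integrable_abs hYi Yi)
      show "\<bar>h \<omega> * Y \<omega>\<bar> \<le> \<bar>Y \<omega>\<bar>" for \<omega>
        unfolding abs_mult by (intro mult_left_le_one_le h1) auto
    qed
    finally show "\<kappa> * \<bar>a i\<bar> \<le> (\<integral>\<omega>. \<bar>x + (\<Sum>j<n. a j * incr b n \<tau> k j \<omega>)\<bar> \<partial>M)" by (simp only: Y_def)
  qed
qed

lemma incr_moment_lower:
  assumes \<tau>: "0 < \<tau>" and p: "1 \<le> p"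
  shows "ennreal (\<bar>x\<bar> powr p) \<le> (\<integral>\<^sup>+\<omega>. ennreal (\<bar>x + (\<Sum>j<n. a j * incr b n \<tau> k j \<omega>)\<bar> powr p) \<partial>M)"
proof (cases "x = 0")
  case False
  define Y where "Y \<omega> = (\<Sum>j<n. a j * incr b n \<tau> k j \<omega>)" for \<omega>
  have Y: "integrable M Y" "(\<integral>\<omega>. Y \<omega> \<partial>M) = 0" unfolding Y_def[abs_def] using incr_comb_centered[OF \<tau>] by auto
  define c where "c = \<bar>x\<bar> powr p * p / x"
  have le: "\<bar>x\<bar> powr p + c * Y \<omega> \<le> \<bar>x + Y \<omega>\<bar> powr p" for \<omega>
  proof -
    have "\<bar>x\<bar> powr p * (1 + p * (Y \<omega> / x)) \<le> \<bar>x\<bar> powr p * \<bar>1 + Y \<omega> / x\<bar> powr p"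
      by (intro mult_left_mono abs_powr_tangent p) auto
    also have "\<dots> = \<bar>x + Y \<omega>\<bar> powr p"
      using False by (simp add: powr_mult[symmetric] abs_mult[symmetric] algebra_simps)
    finally show ?thesis by (simp add: c_def algebra_simps)
  qed
  have i: "integrable M (\<lambda>\<omega>. \<bar>x\<bar> powr p + c * Y \<omega>)" using Y by auto
  have "(\<integral>\<omega>. \<bar>x\<bar> powr p + c * Y \<omega> \<partial>M) = \<bar>x\<bar> powr p" using Y by (simp add: prob_space)
  then have "ennreal (\<bar>x\<bar> powr p) \<le> (\<integral>\<^sup>+\<omega>. ennreal (\<bar>x\<bar> powr p + c * Y \<omega>) \<partial>M)" using ennreal_integral_le[OF i] by simp
  also have "\<dots> \<le> (\<integral>\<^sup>+\<omega>. ennreal (\<bar>x + Y \<omega>\<bar> powr p) \<partial>M)" by (intro nn_integral_mono ennreal_leI le)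
  finally show ?thesis by (simp add: Y_def)
qed simp

lemma incr_moment_growth:
  assumes \<tau>: "0 < \<tau>" and n: "0 < n" and p: "1 < p" and J: "0 < J"
  obtains \<delta> where "0 < \<delta>"
    and "\<And>k a x. \<exists>i<n. J * \<bar>x\<bar> \<le> \<bar>a i\<bar> \<Longrightarrow>
      ennreal ((1 + \<delta>) * \<bar>x\<bar> powr p) \<le> (\<integral>\<^sup>+\<omega>. ennreal (\<bar>x + (\<Sum>j<n. a j * incr b n \<tau> k j \<omega>)\<bar> powr p) \<partial>M)"
proof -
  obtain \<kappa> where \<kappa>: "0 < \<kappa>" and nd: "\<And>k a x i. i < n \<Longrightarrow> \<kappa> * \<bar>a i\<bar> \<le> (\<integral>\<omega>. \<bar>x + (\<Sum>j<n. a j * incr b n \<tau> k j \<omega>)\<bar> \<partial>M)"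
    using incr_nondegenerate[OF \<tau> n] by blast
  define \<eta> where "\<eta> = min (\<kappa> * J / 2) (1 / 2)"
  have \<eta>: "0 < \<eta>" "\<eta> < 1" "\<eta> \<le> \<kappa> * J / 2" using \<kappa> J by (auto simp: \<eta>_def)
  obtain c where c: "0 < c" and grow: "\<And>y. 1 + p * y + c * (\<bar>y\<bar> - \<eta>) \<le> \<bar>1 + y\<bar> powr p"
    using abs_powr_strict_growth[OF p \<eta>(1,2)] by blast
  define \<delta> where "\<delta> = c * (\<kappa> * J / 2)"
  have \<delta>: "0 < \<delta>" using c \<kappa> J by (simp add: \<delta>_def)
  show thesis
  proof (rule that[OF \<delta>])
    fix k :: nat and a :: "nat \<Rightarrow> real" and x :: real
    assume "\<exists>i<n. J * \<bar>x\<bar> \<le> \<bar>a i\<bar>"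
    then obtain i where i: "i < n" "J * \<bar>x\<bar> \<le> \<bar>a i\<bar>" by blast
    show "ennreal ((1 + \<delta>) * \<bar>x\<bar> powr p) \<le> (\<integral>\<^sup>+\<omega>. ennreal (\<bar>x + (\<Sum>j<n. a j * incr b n \<tau> k j \<omega>)\<bar> powr p) \<partial>M)"
    proof (cases "x = 0")
      case False
      define Y where "Y \<omega> = (\<Sum>j<n. a j / x * incr b n \<tau> k j \<omega>)" for \<omega>
      have Y: "integrable M Y" "(\<integral>\<omega>. Y \<omega> \<partial>M) = 0"
        unfolding Y_def[abs_def] by (rule incr_comb_centered(1)[OF \<tau>], rule incr_comb_centered(2)[OF \<tau>])
      have "\<kappa> * J \<le> \<kappa> * \<bar>a i / x\<bar>" using i(2) False \<kappa> by (intro mult_left_mono) (auto simp: field_simps)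
      also have "\<dots> \<le> (\<integral>\<omega>. \<bar>Y \<omega>\<bar> \<partial>M)" using nd[OF i(1), of "\<lambda>j. a j / x" 0 k] by (simp add: Y_def)
      finally have EY: "\<kappa> * J \<le> (\<integral>\<omega>. \<bar>Y \<omega>\<bar> \<partial>M)" .
      define g where "g \<omega> = \<bar>x\<bar> powr p * (1 + p * Y \<omega> + c * (\<bar>Y \<omega>\<bar> - \<eta>))" for \<omega>
      have gi: "integrable M g" unfolding g_def[abs_def] using Y by auto
      have "(1 + \<delta>) * \<bar>x\<bar> powr p \<le> \<bar>x\<bar> powr p * (1 + c * ((\<integral>\<omega>. \<bar>Y \<omega>\<bar> \<partial>M) - \<eta>))"
      proof -
        have "\<kappa> * J / 2 \<le> (\<integral>\<omega>. \<bar>Y \<omega>\<bar> \<partial>M) - \<eta>" using EY \<eta>(3) by linarith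
        then have "\<delta> \<le> c * ((\<integral>\<omega>. \<bar>Y \<omega>\<bar> \<partial>M) - \<eta>)" unfolding \<delta>_def using c by (intro mult_left_mono) auto
        then have "\<bar>x\<bar> powr p * (1 + \<delta>) \<le> \<bar>x\<bar> powr p * (1 + c * ((\<integral>\<omega>. \<bar>Y \<omega>\<bar> \<partial>M) - \<eta>))"
          by (intro mult_left_mono) auto
        then show ?thesis by (simp add: mult.commute)
      qed
      also have "\<dots> = (\<integral>\<omega>. g \<omega> \<partial>M)" unfolding g_def using Y by (simp add: prob_space)
      finally have "ennreal ((1 + \<delta>) * \<bar>x\<bar> powr p) \<le> ennreal (\<integral>\<omega>. g \<omega> \<partial>M)" by (rule ennreal_leI)
      also have "\<dots> \<le> (\<integral>\<^sup>+\<omega>. ennreal (g \<omega>) \<partial>M)" by (rule ennreal_integral_le[OF gi])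
      also have "\<dots> \<le> (\<integral>\<^sup>+\<omega>. ennreal (\<bar>x + (\<Sum>j<n. a j * incr b n \<tau> k j \<omega>)\<bar> powr p) \<partial>M)"
      proof (intro nn_integral_mono ennreal_leI)
        fix \<omega>
        have "g \<omega> \<le> \<bar>x\<bar> powr p * \<bar>1 + Y \<omega>\<bar> powr p" unfolding g_def by (intro mult_left_mono grow) auto
        also have "\<dots> = \<bar>x * (1 + Y \<omega>)\<bar> powr p" by (simp add: powr_mult[symmetric] abs_mult[symmetric])
        also have "x * (1 + Y \<omega>) = x + (\<Sum>j<n. a j * incr b n \<tau> k j \<omega>)"
          using False by (simp add: Y_def distrib_left sum_distrib_left)
        finally show "g \<omega> \<le> \<bar>x + (\<Sum>j<n. a j * incr b n \<tau> k j \<omega>)\<bar> powr p" .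
      qed
      finally show ?thesis .
    qed simp
  qed
qed

end

section \<open>Noise integrals of step functions\<close>

lemma (in complete_measure) borel_measurable_AE_cong:
  fixes f g :: "'a \<Rightarrow> 'b :: topological_space"
  assumes g: "g \<in> borel_measurable M" and eq: "AE x in M. f x = g x"
  shows "f \<in> borel_measurable M"
proof (rule measurableI)
  fix A :: "'b set" assume "A \<in> sets borel"
  then have a: "g -` A \<inter> space M \<in> sets M" using g by (rule measurable_sets[rotated])
  have b: "AE x in M. x \<in> g -` A \<inter> space M \<longleftrightarrow> x \<in> f -` A \<inter> space M"
    using eq by eventually_elim auto
  show "f -` A \<inter> space M \<in> sets M" by (rule in_sets_AE[OF b a]) simp
qed simp

lemma (in prob_space) converges_in_probability_unique:
  assumes X: "converges_in_probability M X S Fl" and X': "converges_in_probability M X S' Fl" and nt: "Fl \<noteq> bot"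
  shows "AE \<omega> in M. S \<omega> = S' \<omega>"
proof -
  have Sm[measurable]: "S \<in> borel_measurable M" "S' \<in> borel_measurable M"
    using X X' by (auto simp: converges_in_probability_def)
  have ev: "\<forall>\<^sub>F i in Fl. X i \<in> borel_measurable M" using X by (simp add: converges_in_probability_def)
  have zero: "prob {\<omega> \<in> space M. 2 * \<delta> < norm (S \<omega> - S' \<omega>)} = 0" if \<delta>: "0 < \<delta>" for \<delta>
  proof -
    have "((\<lambda>i. prob {\<omega> \<in> space M. \<delta> < norm (X i \<omega> - S \<omega>)} + prob {\<omega> \<in> space M. \<delta> < norm (X i \<omega> - S' \<omega>)}) \<longlongrightarrow> 0 + 0) Fl"
      using X X' \<delta> by (intro tendsto_add) (auto simp: converges_in_probability_def)
    moreover have "\<forall>\<^sub>F i in Fl. prob {\<omega> \<in> space M. 2 * \<delta> < norm (S \<omega> - S' \<omega>)}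
       \<le> prob {\<omega> \<in> space M. \<delta> < norm (X i \<omega> - S \<omega>)} + prob {\<omega> \<in> space M. \<delta> < norm (X i \<omega> - S' \<omega>)}"
      using ev
    proof eventually_elim
      case (elim i)
      note elim[measurable]
      have "norm (S \<omega> - S' \<omega>) \<le> norm (X i \<omega> - S \<omega>) + norm (X i \<omega> - S' \<omega>)" for \<omega>
        using norm_triangle_ineq4[of "X i \<omega> - S' \<omega>" "X i \<omega> - S \<omega>"] by (simp add: algebra_simps)
      then have "prob {\<omega> \<in> space M. 2 * \<delta> < norm (S \<omega> - S' \<omega>)}
         \<le> prob ({\<omega> \<in> space M. \<delta> < norm (X i \<omega> - S \<omega>)} \<union> {\<omega> \<in> space M. \<delta> < norm (X i \<omega> - S' \<omega>)})"
        by (intro finite_measure_mono) (auto, smt (verit))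
      also have "\<dots> \<le> prob {\<omega> \<in> space M. \<delta> < norm (X i \<omega> - S \<omega>)} + prob {\<omega> \<in> space M. \<delta> < norm (X i \<omega> - S' \<omega>)}"
        by (rule measure_Un_le) auto
      finally show ?case .
    qed
    ultimately have "prob {\<omega> \<in> space M. 2 * \<delta> < norm (S \<omega> - S' \<omega>)} \<le> 0 + 0"
      using nt by (intro tendsto_lowerbound) auto
    then show ?thesis by (simp add: measure_le_0_iff)
  qed
  have "AE \<omega> in M. \<forall>m::nat. \<not> 2 * (1 / real (Suc m)) < norm (S \<omega> - S' \<omega>)"
    unfolding AE_all_countable
  proof
    fix m :: nat
    have "{\<omega> \<in> space M. 2 * (1 / real (Suc m)) < norm (S \<omega> - S' \<omega>)} \<in> null_sets M"
      using zero[of "1 / real (Suc m)"] by (intro null_setsI) (auto simp: emeasure_eq_measure)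
    then show "AE \<omega> in M. \<not> 2 * (1 / real (Suc m)) < norm (S \<omega> - S' \<omega>)"
      by (rule AE_I') auto
  qed
  then show ?thesis
  proof eventually_elim
    case (elim \<omega>)
    show ?case
    proof (rule ccontr)
      assume "S \<omega> \<noteq> S' \<omega>"
      then have "0 < norm (S \<omega> - S' \<omega>) / 2" by simp
      then obtain m where "1 / real (Suc m) < norm (S \<omega> - S' \<omega>) / 2" using nat_approx_posE by blast
      then have "2 * (1 / real (Suc m)) < norm (S \<omega> - S' \<omega>)" by simp
      then show False using elim by blast
    qed
  qed
qed

lemma (in prob_space) converges_in_probability_AE:
  fixes X :: "real \<Rightarrow> 'a \<Rightarrow> complex"
  assumes Xm: "\<And>e. 0 < e \<Longrightarrow> e < 1 \<Longrightarrow> X e \<in> borel_measurable M" and S[measurable]: "S \<in> borel_measurable M"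
    and conv: "\<And>e. (\<And>m. 0 < e m) \<Longrightarrow> (\<And>m. e m < 1) \<Longrightarrow> e \<longlonglongrightarrow> 0 \<Longrightarrow> AE \<omega> in M. (\<lambda>m::nat. X (e m) \<omega>) \<longlonglongrightarrow> S \<omega>"
  shows "converges_in_probability M X S (at_right 0)"
  unfolding converges_in_probability_def
proof (intro conjI allI impI S)
  show "\<forall>\<^sub>F e in at_right 0. X e \<in> borel_measurable M"
    using eventually_at_right_less[of 0] eventually_at_right_real[of 0 1] by (auto elim!: eventually_mono intro!: Xm)
next
  fix \<delta> :: real assume \<delta>: "0 < \<delta>"
  have "((\<lambda>e. prob {\<omega> \<in> space M. \<delta> < norm (X e \<omega> - S \<omega>)}) \<longlongrightarrow> 0) (at 0 within {0<..<1})"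
    unfolding tendsto_at_iff_sequentially
  proof (intro allI impI)
    fix e :: "nat \<Rightarrow> real" assume e: "\<forall>i. e i \<in> {0<..<1} - {0}" "e \<longlonglongrightarrow> 0"
    have [measurable]: "X (e m) \<in> borel_measurable M" for m using e(1) by (intro Xm) auto
    define A where "A m = {\<omega> \<in> space M. \<delta> < norm (X (e m) \<omega> - S \<omega>)}" for m
    have A[measurable]: "A m \<in> sets M" for m unfolding A_def by measurable
    have "(\<lambda>m. \<integral>\<omega>. indicator (A m) \<omega> \<partial>M) \<longlonglongrightarrow> (\<integral>\<omega>. (0::real) \<partial>M)"
    proof (rule integral_dominated_convergence[where w = "\<lambda>_. 1"])
      have "AE \<omega> in M. (\<lambda>m. X (e m) \<omega>) \<longlonglongrightarrow> S \<omega>" using e by (intro conv) auto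
      then show "AE \<omega> in M. (\<lambda>m. indicator (A m) \<omega> :: real) \<longlonglongrightarrow> 0"
      proof eventually_elim
        case (elim \<omega>)
        then have "\<forall>\<^sub>F m in sequentially. dist (X (e m) \<omega>) (S \<omega>) < \<delta>" using \<delta> by (rule tendstoD)
        then have "\<forall>\<^sub>F m in sequentially. indicator (A m) \<omega> = (0::real)"
          by eventually_elim (auto simp: A_def dist_norm)
        then show ?case by (rule tendsto_eventually)
      qed
    qed (auto simp: indicator_def)
    then show "((\<lambda>e. prob {\<omega> \<in> space M. \<delta> < norm (X e \<omega> - S \<omega>)}) \<circ> e) \<longlonglongrightarrow> 0"
      by (simp add: comp_def A_def[symmetric])
  qed
  then show "((\<lambda>e. prob {\<omega> \<in> space M. \<delta> < norm (X e \<omega> - S \<omega>)}) \<longlongrightarrow> 0) (at_right 0)"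
  proof -
    have "at 0 within {0<..<1} = at_right (0::real)"
      by (rule at_within_nhd[of _ "{..<1}"]) auto
    assume "((\<lambda>e. prob {\<omega> \<in> space M. \<delta> < norm (X e \<omega> - S \<omega>)}) \<longlongrightarrow> 0) (at 0 within {0<..<1})"
    then show ?thesis by (simp only: \<open>at 0 within {0<..<1} = at_right (0::real)\<close>)
  qed
qed

context levy_noise
begin

lemma cell_integral:
  assumes \<tau>: "0 < \<tau>" and j: "j < n" and A: "A \<in> sets borel" and \<omega>: "\<omega> \<in> space M"
    and fin: "czint n \<tau> k j UNIV (\<lambda>z. ennreal \<bar>z\<bar>) \<omega> < \<infinity>"
  shows "integrable (mu \<omega>) (\<lambda>w. indicator (cell n \<tau> k j A) w * snd (snd w))"
    and "(\<integral>w. indicator (cell n \<tau> k j A) w * snd (snd w) \<partial>mu \<omega>) = jump n \<tau> k j A \<omega>"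
proof -
  have m[measurable]: "(\<lambda>w. snd (snd w)) \<in> measurable (mu \<omega>) borel"
    using measurable_jump_size by (simp add: measurable_cong_sets[OF sets_mu[OF \<omega>] refl])
  have c[measurable]: "cell n \<tau> k j A \<in> sets (mu \<omega>)" using \<tau> j A \<omega> by (simp add: sets_mu cell_in_sets)
  have "(\<integral>\<^sup>+w. ennreal (norm (indicator (cell n \<tau> k j A) w * snd (snd w))) \<partial>mu \<omega>) \<le> czint n \<tau> k j UNIV (\<lambda>z. ennreal \<bar>z\<bar>) \<omega>"
    unfolding czint_def zint_def by (intro nn_integral_mono) (auto simp: indicator_def cell_def)
  also have "\<dots> < \<infinity>" by (rule fin)
  finally show int: "integrable (mu \<omega>) (\<lambda>w. indicator (cell n \<tau> k j A) w * snd (snd w))"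
    by (intro integrableI_bounded) auto
  have "czint n \<tau> k j A (\<lambda>z. ennreal z) \<omega> = (\<integral>\<^sup>+w. ennreal (indicator (cell n \<tau> k j A) w * snd (snd w)) \<partial>mu \<omega>)"
    "czint n \<tau> k j A (\<lambda>z. ennreal (- z)) \<omega> = (\<integral>\<^sup>+w. ennreal (- (indicator (cell n \<tau> k j A) w * snd (snd w))) \<partial>mu \<omega>)"
    unfolding czint_def zint_def cell_def by (auto intro!: nn_integral_cong simp: indicator_def)
  then show "(\<integral>w. indicator (cell n \<tau> k j A) w * snd (snd w) \<partial>mu \<omega>) = jump n \<tau> k j A \<omega>"
    unfolding jump_def real_lebesgue_integral_def[OF int] by simp
qed

lemma jump_union:
  assumes \<tau>: "0 < \<tau>" and j: "j < n" and A: "A \<in> sets borel" and B: "B \<in> sets borel" "A \<inter> B = {}" "A \<union> B = UNIV" and \<omega>: "\<omega> \<in> space M"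
    and fin: "czint n \<tau> k j UNIV (\<lambda>z. ennreal \<bar>z\<bar>) \<omega> < \<infinity>"
  shows "jump n \<tau> k j UNIV \<omega> = jump n \<tau> k j A \<omega> + jump n \<tau> k j B \<omega>"
proof -
  note ci = cell_integral[OF \<tau> j _ \<omega> fin]
  have eq: "indicator (cell n \<tau> k j UNIV) w * snd (snd w) = indicator (cell n \<tau> k j A) w * snd (snd w) + indicator (cell n \<tau> k j B) w * snd (snd w)" for w
    using B by (auto simp: cell_def indicator_def)
  have "jump n \<tau> k j UNIV \<omega> = (\<integral>w. indicator (cell n \<tau> k j UNIV) w * snd (snd w) \<partial>mu \<omega>)" by (rule ci(2)[symmetric]) simp
  also have "\<dots> = jump n \<tau> k j A \<omega> + jump n \<tau> k j B \<omega>"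
    unfolding eq using ci[OF A] ci[OF B(1)] by (subst Bochner_Integration.integral_add) auto
  finally show ?thesis .
qed

lemma jump_limit:
  assumes \<tau>: "0 < \<tau>" and j: "j < n" and \<omega>: "\<omega> \<in> space M"
    and fin: "czint n \<tau> k j UNIV (\<lambda>z. ennreal \<bar>z\<bar>) \<omega> < \<infinity>"
    and e: "\<And>m::nat. 0 < e m" "e \<longlonglongrightarrow> 0"
  shows "(\<lambda>m. jump n \<tau> k j {z. e m < \<bar>z\<bar> \<and> \<bar>z\<bar> \<le> 1} \<omega>) \<longlonglongrightarrow> jump n \<tau> k j {z. \<bar>z\<bar> \<le> 1} \<omega>"
proof -
  note ci = cell_integral[OF \<tau> j _ \<omega> fin]
  have b: "{z::real. e m < \<bar>z\<bar> \<and> \<bar>z\<bar> \<le> 1} \<in> sets borel" "{z::real. \<bar>z\<bar> \<le> 1} \<in> sets borel" for m by measurable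
  have "(\<lambda>m. \<integral>w. indicator (cell n \<tau> k j {z. e m < \<bar>z\<bar> \<and> \<bar>z\<bar> \<le> 1}) w * snd (snd w) \<partial>mu \<omega>)
    \<longlonglongrightarrow> (\<integral>w. indicator (cell n \<tau> k j {z. \<bar>z\<bar> \<le> 1}) w * snd (snd w) \<partial>mu \<omega>)"
  proof (rule integral_dominated_convergence[where w = "\<lambda>w. \<bar>indicator (cell n \<tau> k j UNIV) w * snd (snd w)\<bar>"])
    show "integrable (mu \<omega>) (\<lambda>w. \<bar>indicator (cell n \<tau> k j UNIV) w * snd (snd w)\<bar>)" using ci(1)[of UNIV] by (intro integrable_abs) simp
    show "AE w in mu \<omega>. (\<lambda>m. indicator (cell n \<tau> k j {z. e m < \<bar>z\<bar> \<and> \<bar>z\<bar> \<le> 1}) w * snd (snd w))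
        \<longlonglongrightarrow> indicator (cell n \<tau> k j {z. \<bar>z\<bar> \<le> 1}) w * snd (snd w)"
    proof (rule AE_I2)
      fix w :: "real \<times> real \<times> real"
      show "(\<lambda>m. indicator (cell n \<tau> k j {z. e m < \<bar>z\<bar> \<and> \<bar>z\<bar> \<le> 1}) w * snd (snd w))
        \<longlonglongrightarrow> indicator (cell n \<tau> k j {z. \<bar>z\<bar> \<le> 1}) w * snd (snd w)"
      proof (cases "snd (snd w) = 0")
        case False
        then have "\<forall>\<^sub>F m in sequentially. e m < \<bar>snd (snd w)\<bar>" using e(2) by (intro order_tendstoD) auto
        then have "\<forall>\<^sub>F m in sequentially. indicator (cell n \<tau> k j {z. e m < \<bar>z\<bar> \<and> \<bar>z\<bar> \<le> 1}) w * snd (snd w)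
           = indicator (cell n \<tau> k j {z. \<bar>z\<bar> \<le> 1}) w * snd (snd w)"
          by eventually_elim (auto simp: cell_def indicator_def)
        then show ?thesis by (rule tendsto_eventually)
      qed simp
    qed
    show "AE w in mu \<omega>. norm (indicator (cell n \<tau> k j {z. e m < \<bar>z\<bar> \<and> \<bar>z\<bar> \<le> 1}) w * snd (snd w)) \<le> \<bar>indicator (cell n \<tau> k j UNIV) w * snd (snd w)\<bar>" for m
      by (rule AE_I2) (auto simp: cell_def indicator_def)
  qed (use ci(1)[OF b(1)] ci(1)[OF b(2)] in auto)
  then show ?thesis by (simp add: ci(2)[OF b(1)] ci(2)[OF b(2)])
qed

lemma lam_limit:
  assumes e: "\<And>m::nat. 0 < e m" "e \<longlonglongrightarrow> 0"
  shows "(\<lambda>m. LINT z:{z. e m < \<bar>z\<bar> \<and> \<bar>z\<bar> \<le> 1}|lam. z) \<longlonglongrightarrow> (LINT z:{z. \<bar>z\<bar> \<le> 1}|lam. z)"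
  unfolding set_lebesgue_integral_def
proof (rule integral_dominated_convergence[where w = "\<lambda>z. \<bar>z\<bar>"])
  have fm[measurable]: "(\<lambda>z. z) \<in> borel_measurable lam" by (simp add: measurable_cong_sets[OF sets_lam refl])
  have s[measurable]: "{z. e m < \<bar>z\<bar> \<and> \<bar>z\<bar> \<le> 1} \<in> sets lam" "{z. \<bar>z\<bar> \<le> 1} \<in> sets lam" for m by (simp_all add: sets_lam)
  show "(\<lambda>z. indicator {z. e m < \<bar>z\<bar> \<and> \<bar>z\<bar> \<le> 1} z *\<^sub>R z) \<in> borel_measurable lam" for m by measurable
  show "(\<lambda>z. indicator {z. \<bar>z\<bar> \<le> 1} z *\<^sub>R z) \<in> borel_measurable lam" by measurable
  show "integrable lam (\<lambda>z. \<bar>z\<bar>)" using lam_integrable by (rule integrable_abs)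
  show "AE z in lam. (\<lambda>m. indicator {z. e m < \<bar>z\<bar> \<and> \<bar>z\<bar> \<le> 1} z *\<^sub>R z) \<longlonglongrightarrow> indicator {z. \<bar>z\<bar> \<le> 1} z *\<^sub>R z"
  proof (rule AE_I2)
    fix z :: real
    show "(\<lambda>m. indicator {z. e m < \<bar>z\<bar> \<and> \<bar>z\<bar> \<le> 1} z *\<^sub>R z) \<longlonglongrightarrow> indicator {z. \<bar>z\<bar> \<le> 1} z *\<^sub>R z"
    proof (cases "z = 0")
      case False
      then have "\<forall>\<^sub>F m in sequentially. e m < \<bar>z\<bar>" using e(2) by (intro order_tendstoD) auto
      then have "\<forall>\<^sub>F m in sequentially. indicator {z. e m < \<bar>z\<bar> \<and> \<bar>z\<bar> \<le> 1} z *\<^sub>R z = indicator {z. \<bar>z\<bar> \<le> 1} z *\<^sub>R z"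
        by eventually_elim (auto simp: indicator_def)
      then show ?thesis by (rule tendsto_eventually)
    qed simp
  qed
  show "AE z in lam. norm (indicator {z. e m < \<bar>z\<bar> \<and> \<bar>z\<bar> \<le> 1} z *\<^sub>R z) \<le> \<bar>z\<bar>" for m
    by (rule AE_I2) (auto simp: indicator_def)
qed

end

definition lcell :: "real \<Rightarrow> nat \<Rightarrow> real set" where
  "lcell \<tau> k = {real k * \<tau>..<real (k + 1) * \<tau>}"

lemma lcell_cover:
  assumes "0 < \<tau>" "s \<in> {0<..real i * \<tau>}"
  obtains k where "k \<le> i" "s \<in> lcell \<tau> k"
proof
  define m where "m = \<lfloor>s / \<tau>\<rfloor>"
  have m: "of_int m \<le> s / \<tau>" "s / \<tau> < of_int m + 1" "0 \<le> m"
    using assms by (auto simp: m_def)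
  have "s / \<tau> \<le> real i" using assms by (simp add: pos_divide_le_eq)
  then have "m \<le> int i" using m by linarith
  then show "nat m \<le> i" using m by simp
  have "real_of_int m * \<tau> \<le> s" "s < (real_of_int m + 1) * \<tau>"
    using m assms by (simp_all add: pos_le_divide_eq pos_divide_less_eq)
  then show "s \<in> lcell \<tau> (nat m)" using m by (simp add: lcell_def algebra_simps)
qed

lemma lcell_unique:
  assumes "0 < \<tau>" "s \<in> lcell \<tau> k" "s \<in> lcell \<tau> k'"
  shows "k = k'"
proof -
  have "real k \<le> s / \<tau> \<and> s / \<tau> < real k + 1" if "s \<in> lcell \<tau> k" for k
    using that assms(1) by (auto simp: lcell_def pos_le_divide_eq pos_divide_less_eq algebra_simps)
  from this[OF assms(2)] this[OF assms(3)] show ?thesis by linarith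
qed

lemma scell_cover:
  assumes "0 < n" "y \<in> {0..1}"
  obtains j where "j \<le> n" "y \<in> scell n j"
proof
  define m where "m = \<lfloor>real n * y\<rfloor>"
  have m: "of_int m \<le> real n * y" "real n * y < of_int m + 1" "0 \<le> m"
    using assms by (auto simp: m_def)
  have "real n * y \<le> real n" using assms by (simp add: mult_left_le)
  then have "m \<le> int n" using m by linarith
  then show "nat m \<le> n" using m by simp
  show "y \<in> scell n (nat m)" using m assms by (simp add: scell_def pos_divide_le_eq pos_less_divide_eq mult.commute add.commute)
qed

lemma integral_step_function:
  fixes f :: "'c \<Rightarrow> complex" and \<zeta> :: "'c \<Rightarrow> real" and c :: "'p \<Rightarrow> complex"
  assumes f: "\<And>w. w \<in> space \<nu> \<Longrightarrow> f w = (\<Sum>p\<in>P. indicator (A p) w *\<^sub>R (\<zeta> w *\<^sub>R c p))"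
    and A: "\<And>p. p \<in> P \<Longrightarrow> A p \<in> sets \<nu>" and \<zeta>[measurable]: "\<zeta> \<in> borel_measurable \<nu>"
    and eq: "AE w in \<nu>. f w = (\<Sum>p\<in>P'. indicator (B p) w *\<^sub>R (\<zeta> w *\<^sub>R c p))"
    and int: "\<And>p. p \<in> P' \<Longrightarrow> integrable \<nu> (\<lambda>w. indicator (B p) w * \<zeta> w)"
  shows "integrable \<nu> f" and "(\<integral>w. f w \<partial>\<nu>) = (\<Sum>p\<in>P'. (\<integral>w. indicator (B p) w * \<zeta> w \<partial>\<nu>) *\<^sub>R c p)"
proof -
  define g where "g w = (\<Sum>p\<in>P'. (indicator (B p) w * \<zeta> w) *\<^sub>R c p)" for w
  have gi: "integrable \<nu> g" unfolding g_def[abs_def] using int by (intro Bochner_Integration.integrable_sum integrable_scaleR_left) auto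
  have "(\<lambda>w. \<Sum>p\<in>P. indicator (A p) w *\<^sub>R (\<zeta> w *\<^sub>R c p)) \<in> borel_measurable \<nu>"
    using A by (intro borel_measurable_sum borel_measurable_scaleR borel_measurable_indicator) auto
  then have fm: "f \<in> borel_measurable \<nu>" using f by (subst measurable_cong) auto
  have ae: "AE w in \<nu>. f w = g w" using eq by (simp add: g_def)
  show "integrable \<nu> f" using gi ae fm borel_measurable_integrable[OF gi] by (subst integrable_cong_AE) auto
  have "(\<integral>w. f w \<partial>\<nu>) = (\<integral>w. g w \<partial>\<nu>)" using ae fm borel_measurable_integrable[OF gi] by (intro integral_cong_AE) auto
  also have "\<dots> = (\<Sum>p\<in>P'. (\<integral>w. indicator (B p) w * \<zeta> w \<partial>\<nu>) *\<^sub>R c p)"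
    unfolding g_def[abs_def] using int by (subst Bochner_Integration.integral_sum) auto
  finally show "(\<integral>w. f w \<partial>\<nu>) = (\<Sum>p\<in>P'. (\<integral>w. indicator (B p) w * \<zeta> w \<partial>\<nu>) *\<^sub>R c p)" .
qed

lemma step_function_eq:
  fixes H :: "real \<Rightarrow> real \<Rightarrow> complex"
  assumes \<tau>: "0 < \<tau>" and n: "0 < n" and sy: "s \<in> {0<..real i * \<tau>}" "y \<in> {0..1}"
    and H: "\<And>k j. k \<le> i \<Longrightarrow> j \<le> n \<Longrightarrow> s \<in> lcell \<tau> k \<Longrightarrow> y \<in> scell n j \<Longrightarrow> H s y = c (k, j)"
  shows "H s y = (\<Sum>p\<in>{..i} \<times> {..n}. (indicator (lcell \<tau> (fst p)) s * indicator (scell n (snd p)) y) *\<^sub>R c p)"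
    and "(\<And>k. k \<le> i \<Longrightarrow> s \<noteq> real k * \<tau>) \<Longrightarrow> y \<noteq> 1 \<Longrightarrow>
      H s y = (\<Sum>p\<in>{..<i} \<times> {..<n}. (indicator (tcell \<tau> (fst p)) s * indicator (scell n (snd p)) y) *\<^sub>R c p)"
proof -
  obtain k where k: "k \<le> i" "s \<in> lcell \<tau> k" using lcell_cover[OF \<tau> sy(1)] .
  obtain j where j: "j \<le> n" "y \<in> scell n j" using scell_cover[OF n sy(2)] .
  have Hc: "H s y = c (k, j)" by (rule H[OF k(1) j(1) k(2) j(2)])
  have "(\<Sum>p\<in>{..i} \<times> {..n}. (indicator (lcell \<tau> (fst p)) s * indicator (scell n (snd p)) y) *\<^sub>R c p)
     = (\<Sum>p\<in>{(k, j)}. (indicator (lcell \<tau> (fst p)) s * indicator (scell n (snd p)) y) *\<^sub>R c p)"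
  proof (rule sum.mono_neutral_right)
    show "\<forall>p\<in>{..i} \<times> {..n} - {(k, j)}. (indicator (lcell \<tau> (fst p)) s * indicator (scell n (snd p)) y) *\<^sub>R c p = 0"
      using lcell_unique[OF \<tau> k(2)] scell_disjoint[OF n j(2)] by (auto simp: indicator_def)
  qed (use k j in auto)
  also have "\<dots> = c (k, j)" using k j by simp
  finally show "H s y = (\<Sum>p\<in>{..i} \<times> {..n}. (indicator (lcell \<tau> (fst p)) s * indicator (scell n (snd p)) y) *\<^sub>R c p)"
    using Hc by simp
  assume ns: "\<And>k. k \<le> i \<Longrightarrow> s \<noteq> real k * \<tau>" and y1: "y \<noteq> 1"
  have tk: "s \<in> tcell \<tau> k" using k ns[OF k(1)] by (auto simp: tcell_def lcell_def)
  have tl: "tcell \<tau> k' \<subseteq> lcell \<tau> k'" for k' by (auto simp: tcell_def lcell_def)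
  have ki: "k < i"
  proof (rule ccontr)
    assume "\<not> k < i"
    then have "k = i" using k by simp
    then show False using tk sy by (simp add: tcell_def)
  qed
  have jn: "j < n"
  proof (rule ccontr)
    assume "\<not> j < n"
    then have "j = n" using j by simp
    then show False using j(2) sy y1 n by (simp add: scell_def)
  qed
  have "(\<Sum>p\<in>{..<i} \<times> {..<n}. (indicator (tcell \<tau> (fst p)) s * indicator (scell n (snd p)) y) *\<^sub>R c p)
     = (\<Sum>p\<in>{(k, j)}. (indicator (tcell \<tau> (fst p)) s * indicator (scell n (snd p)) y) *\<^sub>R c p)"
  proof (rule sum.mono_neutral_right)
    show "\<forall>p\<in>{..<i} \<times> {..<n} - {(k, j)}. (indicator (tcell \<tau> (fst p)) s * indicator (scell n (snd p)) y) *\<^sub>R c p = 0"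
      using lcell_unique[OF \<tau> k(2)] tl scell_disjoint[OF n j(2)] by (fastforce simp: indicator_def)
  qed (use ki jn in auto)
  also have "\<dots> = c (k, j)" using tk j by simp
  finally show "H s y = (\<Sum>p\<in>{..<i} \<times> {..<n}. (indicator (tcell \<tau> (fst p)) s * indicator (scell n (snd p)) y) *\<^sub>R c p)"
    using Hc by simp
qed

lemma lborel_lines_null:
  "AE w in (lborel :: (real \<times> real) measure). fst w \<noteq> a" "AE w in (lborel :: (real \<times> real) measure). snd w \<noteq> b"
proof -
  have 1: "{a} \<times> (UNIV :: real set) \<in> null_sets lborel"
    unfolding lborel_prod[symmetric]
    by (intro null_setsI) (auto simp: lborel.emeasure_pair_measure_Times)
  have 2: "(UNIV :: real set) \<times> {b} \<in> null_sets lborel"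
    unfolding lborel_prod[symmetric]
    by (intro null_setsI) (auto simp: lborel.emeasure_pair_measure_Times)
  show "AE w in (lborel :: (real \<times> real) measure). fst w \<noteq> a" by (rule AE_I'[OF 1]) (auto simp: mem_Times_iff)
  show "AE w in (lborel :: (real \<times> real) measure). snd w \<noteq> b" by (rule AE_I'[OF 2]) (auto simp: mem_Times_iff)
qed

lemma cell_area:
  assumes "0 < \<tau>" "0 < n"
  shows "integrable lborel (\<lambda>w. indicator (tcell \<tau> k \<times> scell n j) w * (1 :: real))"
    and "(\<integral>w. indicator (tcell \<tau> k \<times> scell n j) w * 1 \<partial>lborel) = \<tau> / real n"
proof -
  have s: "tcell \<tau> k \<times> scell n j \<in> sets (lborel :: (real \<times> real) measure)"
    unfolding lborel_prod[symmetric] using tcell_sets scell_sets by (intro pair_measureI) auto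
  have e: "emeasure lborel (tcell \<tau> k \<times> scell n j) = ennreal (\<tau> / real n)"
    unfolding lborel_prod[symmetric] using assms tcell_sets scell_sets
    by (simp add: lborel.emeasure_pair_measure_Times emeasure_tcell emeasure_scell ennreal_mult[symmetric])
  show "integrable lborel (\<lambda>w. indicator (tcell \<tau> k \<times> scell n j) w * (1 :: real))"
    using s e by (simp add: integrable_real_indicator)
  show "(\<integral>w. indicator (tcell \<tau> k \<times> scell n j) w * 1 \<partial>lborel) = \<tau> / real n"
    using e assms by (simp add: measure_def)
qed

lemma drift_integral_step:
  fixes H :: "real \<Rightarrow> real \<Rightarrow> 'a \<Rightarrow> complex"
  assumes \<tau>: "0 < \<tau>" and n: "0 < n"
    and H: "\<And>k j s y. k \<le> i \<Longrightarrow> j \<le> n \<Longrightarrow> s \<in> lcell \<tau> k \<Longrightarrow> y \<in> scell n j \<Longrightarrow> H s y \<omega> = h k j \<omega>"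
  shows "set_integrable lborel ({0<..real i * \<tau>} \<times> {0..1}) (\<lambda>(s, y). H s y \<omega>)"
    and "drift_integral (real i * \<tau>) H \<omega> = (\<Sum>p\<in>{..<i} \<times> {..<n}. (\<tau> / real n) *\<^sub>R h (fst p) (snd p) \<omega>)"
proof -
  define c where "c p = h (fst p) (snd p) \<omega>" for p
  let ?D = "{0<..real i * \<tau>} \<times> {0..1 :: real}"
  define f where "f w = indicator ?D w *\<^sub>R (case w of (s, y) \<Rightarrow> H s y \<omega>)" for w
  define A where "A p = (lcell \<tau> (fst p) \<inter> {0<..real i * \<tau>}) \<times> (scell n (snd p) \<inter> {0..1})" for p :: "nat \<times> nat"
  define B where "B p = tcell \<tau> (fst p) \<times> scell n (snd p)" for p :: "nat \<times> nat"
  have Hc: "k \<le> i \<Longrightarrow> j \<le> n \<Longrightarrow> s \<in> lcell \<tau> k \<Longrightarrow> y \<in> scell n j \<Longrightarrow> (\<lambda>s y. H s y \<omega>) s y = c (k, j)" for k j s y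
    using H by (simp add: c_def)
  have 1: "f w = (\<Sum>p\<in>{..i} \<times> {..n}. indicator (A p) w *\<^sub>R (1 *\<^sub>R c p))" for w
  proof (cases "w \<in> ?D")
    case True
    obtain s y where w: "w = (s, y)" by (cases w)
    show ?thesis using True step_function_eq(1)[of \<tau> n s i y "\<lambda>s y. H s y \<omega>" c, OF \<tau> n _ _ Hc]
      unfolding f_def w by (auto simp: A_def indicator_def intro!: sum.cong)
  next
    case False
    then have "w \<notin> A p" for p unfolding A_def by auto
    then show ?thesis using False by (simp add: f_def)
  qed
  have Am: "A p \<in> sets lborel" for p
    unfolding lborel_prod[symmetric] A_def using scell_sets by (intro pair_measureI) (auto simp: lcell_def)
  have "AE w in (lborel :: (real \<times> real) measure). (\<forall>k\<in>{..i}. fst w \<noteq> real k * \<tau>) \<and> snd w \<noteq> 1"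
    by (intro AE_conjI AE_finite_allI lborel_lines_null) auto
  then have 2: "AE w in lborel. f w = (\<Sum>p\<in>{..<i} \<times> {..<n}. indicator (B p) w *\<^sub>R (1 *\<^sub>R c p))"
  proof eventually_elim
    case (elim w)
    obtain s y where w: "w = (s, y)" by (cases w)
    show ?case
    proof (cases "w \<in> ?D")
      case True
      then show ?thesis using elim step_function_eq(2)[of \<tau> n s i y "\<lambda>s y. H s y \<omega>" c, OF \<tau> n _ _ Hc]
        unfolding f_def w by (auto simp: B_def indicator_times intro!: sum.cong)
    next
      case False
      have "w \<notin> B p" if "p \<in> {..<i} \<times> {..<n}" for p
      proof
        assume "w \<in> B p"
        moreover have "tcell \<tau> (fst p) \<subseteq> {0<..real i * \<tau>}"
        proof
          fix s assume s: "s \<in> tcell \<tau> (fst p)"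
          have "real (fst p + 1) * \<tau> \<le> real i * \<tau>" using that \<tau> by (intro mult_right_mono) auto
          then show "s \<in> {0<..real i * \<tau>}" using s tcell_pos[OF \<tau>, of "fst p"] by (auto simp: tcell_def)
        qed
        moreover have "scell n (snd p) \<subseteq> {0..1}" using that by (intro scell_unit) auto
        ultimately show False using False unfolding B_def by blast
      qed
      then show ?thesis using False by (simp add: f_def)
    qed
  qed
  have 3: "integrable lborel (\<lambda>w. indicator (B p) w * (1::real))" for p unfolding B_def by (rule cell_area[OF \<tau> n])
  note * = integral_step_function[where P = "{..i} \<times> {..n}" and P' = "{..<i} \<times> {..<n}" and \<nu> = lborel
    and f = f and A = A and \<zeta> = "\<lambda>_. 1" and c = c and B = B, OF 1 Am _ 2 3]
  show "set_integrable lborel ?D (\<lambda>(s, y). H s y \<omega>)"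
    using *(1) unfolding set_integrable_def f_def[abs_def] by simp
  have "(\<integral>w. f w \<partial>lborel) = (\<Sum>p\<in>{..<i} \<times> {..<n}. (\<integral>w. indicator (B p) w * 1 \<partial>lborel) *\<^sub>R c p)"
    by (rule *(2)) auto
  then show "drift_integral (real i * \<tau>) H \<omega> = (\<Sum>p\<in>{..<i} \<times> {..<n}. (\<tau> / real n) *\<^sub>R h (fst p) (snd p) \<omega>)"
    unfolding drift_integral_def set_lebesgue_integral_def f_def[abs_def] B_def cell_area(2)[OF \<tau> n] c_def by simp
qed

context levy_noise
begin

text \<open>The integrands are constant on cells closed on the left, while the integral extends over \<open>(0, T]\<close>;
  almost surely the boundary slabs carry no jumps.\<close>

definition regular_path :: "nat \<Rightarrow> real \<Rightarrow> nat \<Rightarrow> 'a \<Rightarrow> bool" where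
  "regular_path n \<tau> i \<omega> \<longleftrightarrow> \<omega> \<in> space M \<and>
     (\<forall>p\<in>{..<i} \<times> {..<n}. czint n \<tau> (fst p) (snd p) UNIV (\<lambda>z. ennreal \<bar>z\<bar>) \<omega> < \<infinity>) \<and>
     (\<forall>k\<in>{1..i}. emeasure (mu \<omega>) ({real k * \<tau>} \<times> {0..1} \<times> UNIV) = 0) \<and>
     emeasure (mu \<omega>) ({0<..} \<times> {1} \<times> UNIV) = 0"

lemma AE_regular_path:
  assumes \<tau>: "0 < \<tau>"
  shows "AE \<omega> in M. regular_path n \<tau> i \<omega>"
  unfolding regular_path_def
proof (intro AE_conjI AE_finite_allI AE_space)
  fix p assume "p \<in> {..<i} \<times> {..<n}"
  then show "AE \<omega> in M. czint n \<tau> (fst p) (snd p) UNIV (\<lambda>z. ennreal \<bar>z\<bar>) \<omega> < \<infinity>"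
    using \<tau> by (intro czint_abs_finite) auto
next
  fix k assume "k \<in> {1..i}"
  then have s: "{real k * \<tau>} \<subseteq> {0<..}" using \<tau> by auto
  show "AE \<omega> in M. emeasure (mu \<omega>) ({real k * \<tau>} \<times> {0..1} \<times> UNIV) = 0"
  proof (rule mu_null)
    show "{real k * \<tau>} \<times> {0..1} \<times> UNIV \<in> sets NI" using s by (intro box_in_sets) auto
    show "emeasure NI ({real k * \<tau>} \<times> {0..1} \<times> UNIV) = 0" using s by (subst emeasure_box) auto
  qed
next
  show "AE \<omega> in M. emeasure (mu \<omega>) ({0<..} \<times> {1} \<times> UNIV) = 0"
  proof (rule mu_null)
    show "{0<..} \<times> {1} \<times> UNIV \<in> sets NI" by (intro box_in_sets) auto
    show "emeasure NI ({0<..} \<times> {1} \<times> UNIV) = 0" by (subst emeasure_box) auto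
  qed
qed auto

lemma jump_integral_step:
  fixes H :: "real \<Rightarrow> real \<Rightarrow> 'a \<Rightarrow> complex"
  assumes \<tau>: "0 < \<tau>" and n: "0 < n" and Z: "Z \<in> sets borel" and reg: "regular_path n \<tau> i \<omega>"
    and H: "\<And>k j s y. k \<le> i \<Longrightarrow> j \<le> n \<Longrightarrow> s \<in> lcell \<tau> k \<Longrightarrow> y \<in> scell n j \<Longrightarrow> H s y \<omega> = h k j \<omega>"
  shows "jump_integrable mu (real i * \<tau>) Z H \<omega>"
    and "jump_integral mu (real i * \<tau>) Z H \<omega> = (\<Sum>p\<in>{..<i} \<times> {..<n}. jump n \<tau> (fst p) (snd p) Z \<omega> *\<^sub>R h (fst p) (snd p) \<omega>)"
proof -
  have \<omega>: "\<omega> \<in> space M" using reg by (simp add: regular_path_def)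
  have fin: "czint n \<tau> (fst p) (snd p) UNIV (\<lambda>z. ennreal \<bar>z\<bar>) \<omega> < \<infinity>" if "p \<in> {..<i} \<times> {..<n}" for p
    using reg that unfolding regular_path_def by blast
  define c where "c p = h (fst p) (snd p) \<omega>" for p
  let ?D = "{0<..real i * \<tau>} \<times> {0..1 :: real} \<times> Z"
  define f where "f w = indicator ?D w *\<^sub>R (case w of (s, y, z) \<Rightarrow> z *\<^sub>R H s y \<omega>)" for w
  define A where "A p = (lcell \<tau> (fst p) \<inter> {0<..real i * \<tau>}) \<times> (scell n (snd p) \<inter> {0..1}) \<times> Z" for p :: "nat \<times> nat"
  define B where "B p = cell n \<tau> (fst p) (snd p) Z" for p :: "nat \<times> nat"
  have Hc: "k \<le> i \<Longrightarrow> j \<le> n \<Longrightarrow> s \<in> lcell \<tau> k \<Longrightarrow> y \<in> scell n j \<Longrightarrow> (\<lambda>s y. H s y \<omega>) s y = c (k, j)" for k j s y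
    using H by (simp add: c_def)
  have 1: "f w = (\<Sum>p\<in>{..i} \<times> {..n}. indicator (A p) w *\<^sub>R (snd (snd w) *\<^sub>R c p))" for w
  proof (cases "w \<in> ?D")
    case True
    obtain s y z where w: "w = (s, y, z)" by (cases w)
    have "H s y \<omega> = (\<Sum>p\<in>{..i} \<times> {..n}. (indicator (lcell \<tau> (fst p)) s * indicator (scell n (snd p)) y) *\<^sub>R c p)"
      using True w by (intro step_function_eq(1)[of \<tau> n s i y "\<lambda>s y. H s y \<omega>" c, OF \<tau> n _ _ Hc]) auto
    then have "f w = (\<Sum>p\<in>{..i} \<times> {..n}. z *\<^sub>R ((indicator (lcell \<tau> (fst p)) s * indicator (scell n (snd p)) y) *\<^sub>R c p))"
      using True unfolding f_def w by (simp add: scaleR_sum_right)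
    also have "\<dots> = (\<Sum>p\<in>{..i} \<times> {..n}. indicator (A p) w *\<^sub>R (snd (snd w) *\<^sub>R c p))"
      using True by (intro sum.cong refl) (auto simp: w A_def indicator_def)
    finally show ?thesis .
  next
    case False
    then have "w \<notin> A p" for p unfolding A_def by auto
    then show ?thesis using False by (simp add: f_def)
  qed
  have Am: "A p \<in> sets (mu \<omega>)" for p
    unfolding sets_mu[OF \<omega>] A_def using scell_sets Z by (intro box_in_sets) (auto simp: lcell_def)
  have \<zeta>m: "(\<lambda>w. snd (snd w)) \<in> borel_measurable (mu \<omega>)"
    using measurable_jump_size by (simp add: measurable_cong_sets[OF sets_mu[OF \<omega>] refl])
  have spc: "space (mu \<omega>) \<subseteq> {0<..} \<times> {0..1} \<times> UNIV"
    using sets_eq_imp_space_eq[OF sets_mu[OF \<omega>]]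
    by (auto simp: noise_intensity_def space_pair_measure space_restrict_space)
  have n1: "AE w in mu \<omega>. fst w \<noteq> real k * \<tau>" if "k \<in> {..i}" for k
  proof (cases "k = 0")
    case True
    then show ?thesis using spc by (intro AE_I2) auto
  next
    case False
    then have "k \<in> {1..i}" using that by auto
    then have "emeasure (mu \<omega>) ({real k * \<tau>} \<times> {0..1} \<times> UNIV) = 0" using reg unfolding regular_path_def by blast
    moreover have "{real k * \<tau>} \<times> {0..1} \<times> UNIV \<in> sets (mu \<omega>)"
      unfolding sets_mu[OF \<omega>] using False \<tau> by (intro box_in_sets) auto
    ultimately have "{real k * \<tau>} \<times> {0..1} \<times> UNIV \<in> null_sets (mu \<omega>)" by auto
    then show ?thesis by (rule AE_I') (use spc in auto)
  qed
  have n2: "AE w in mu \<omega>. fst (snd w) \<noteq> 1"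
  proof -
    have "emeasure (mu \<omega>) ({0<..} \<times> {1} \<times> UNIV) = 0" using reg unfolding regular_path_def by blast
    moreover have "{0<..} \<times> {1} \<times> UNIV \<in> sets (mu \<omega>)"
      unfolding sets_mu[OF \<omega>] by (intro box_in_sets) auto
    ultimately have "{0<..} \<times> {1} \<times> UNIV \<in> null_sets (mu \<omega>)" by auto
    then show ?thesis by (rule AE_I') (use spc in auto)
  qed
  have "AE w in mu \<omega>. (\<forall>k\<in>{..i}. fst w \<noteq> real k * \<tau>) \<and> fst (snd w) \<noteq> 1"
    by (intro AE_conjI AE_finite_allI n1 n2) auto
  then have 2: "AE w in mu \<omega>. f w = (\<Sum>p\<in>{..<i} \<times> {..<n}. indicator (B p) w *\<^sub>R (snd (snd w) *\<^sub>R c p))"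
  proof eventually_elim
    case (elim w)
    obtain s y z where w: "w = (s, y, z)" by (cases w)
    show ?case
    proof (cases "w \<in> ?D")
      case True
      have "H s y \<omega> = (\<Sum>p\<in>{..<i} \<times> {..<n}. (indicator (tcell \<tau> (fst p)) s * indicator (scell n (snd p)) y) *\<^sub>R c p)"
        using True w elim by (intro step_function_eq(2)[of \<tau> n s i y "\<lambda>s y. H s y \<omega>" c, OF \<tau> n _ _ Hc]) auto
      then have "f w = (\<Sum>p\<in>{..<i} \<times> {..<n}. z *\<^sub>R ((indicator (tcell \<tau> (fst p)) s * indicator (scell n (snd p)) y) *\<^sub>R c p))"
        using True unfolding f_def w by (simp add: scaleR_sum_right)
      also have "\<dots> = (\<Sum>p\<in>{..<i} \<times> {..<n}. indicator (B p) w *\<^sub>R (snd (snd w) *\<^sub>R c p))"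
        using True by (intro sum.cong refl) (auto simp: w B_def cell_def indicator_def)
      finally show ?thesis .
    next
      case False
      have "w \<notin> B p" if "p \<in> {..<i} \<times> {..<n}" for p
      proof
        assume "w \<in> B p"
        moreover have "tcell \<tau> (fst p) \<subseteq> {0<..real i * \<tau>}"
        proof
          fix s assume s: "s \<in> tcell \<tau> (fst p)"
          have "real (fst p + 1) * \<tau> \<le> real i * \<tau>" using that \<tau> by (intro mult_right_mono) auto
          then show "s \<in> {0<..real i * \<tau>}" using s tcell_pos[OF \<tau>, of "fst p"] by (auto simp: tcell_def)
        qed
        moreover have "scell n (snd p) \<subseteq> {0..1}" using that by (intro scell_unit) auto
        ultimately show False using False unfolding B_def cell_def by blast
      qed
      then show ?thesis using False by (simp add: f_def)
    qed
  qed
  have 3: "integrable (mu \<omega>) (\<lambda>w. indicator (B p) w * snd (snd w))" if "p \<in> {..<i} \<times> {..<n}" for p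
    unfolding B_def using that by (intro cell_integral[OF \<tau> _ Z \<omega> fin]) auto
  have B3: "(\<integral>w. indicator (B p) w * snd (snd w) \<partial>mu \<omega>) = jump n \<tau> (fst p) (snd p) Z \<omega>" if "p \<in> {..<i} \<times> {..<n}" for p
    unfolding B_def using that by (intro cell_integral[OF \<tau> _ Z \<omega> fin]) auto
  note * = integral_step_function[where P = "{..i} \<times> {..n}" and P' = "{..<i} \<times> {..<n}" and \<nu> = "mu \<omega>"
    and f = f and A = A and \<zeta> = "\<lambda>w. snd (snd w)" and c = c and B = B, OF 1 Am \<zeta>m 2 3]
  show "jump_integrable mu (real i * \<tau>) Z H \<omega>"
    using *(1) unfolding jump_integrable_def set_integrable_def f_def[abs_def] by simp
  have "(\<integral>w. f w \<partial>mu \<omega>) = (\<Sum>p\<in>{..<i} \<times> {..<n}. (\<integral>w. indicator (B p) w * snd (snd w) \<partial>mu \<omega>) *\<^sub>R c p)"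
    by (rule *(2)) auto
  also have "\<dots> = (\<Sum>p\<in>{..<i} \<times> {..<n}. jump n \<tau> (fst p) (snd p) Z \<omega> *\<^sub>R c p)"
    by (intro sum.cong refl arg_cong2[where f = "(*\<^sub>R)"] B3)
  finally show "jump_integral mu (real i * \<tau>) Z H \<omega> = (\<Sum>p\<in>{..<i} \<times> {..<n}. jump n \<tau> (fst p) (snd p) Z \<omega> *\<^sub>R h (fst p) (snd p) \<omega>)"
    unfolding jump_integral_def set_lebesgue_integral_def f_def[abs_def] c_def .
qed

lemma has_noise_integral_step:
  fixes H :: "real \<Rightarrow> real \<Rightarrow> 'a \<Rightarrow> complex"
  assumes \<tau>: "0 < \<tau>" and n: "0 < n"
    and H: "\<And>k j s y \<omega>. k \<le> i \<Longrightarrow> j \<le> n \<Longrightarrow> s \<in> lcell \<tau> k \<Longrightarrow> y \<in> scell n j \<Longrightarrow> H s y \<omega> = h k j \<omega>"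
    and h: "\<And>k j. k < i \<Longrightarrow> j < n \<Longrightarrow> h k j \<in> borel_measurable M"
  shows "has_noise_integral M lam mu b H (real i * \<tau>) I \<longleftrightarrow>
    (AE \<omega> in M. I \<omega> = (\<Sum>k<i. \<Sum>j<n. of_real (incr b n \<tau> k j \<omega>) * h k j \<omega>))"
proof -
  define Q where "Q = {..<i} \<times> {..<n}"
  define Ze where "Ze e = {z::real. e < \<bar>z\<bar> \<and> \<bar>z\<bar> \<le> 1}" for e
  define Z0 where "Z0 = {z::real. \<bar>z\<bar> \<le> 1}"
  define Z1 where "Z1 = {z::real. 1 < \<bar>z\<bar>}"
  define h' where "h' p = h (fst p) (snd p)" for p
  define J where "J Z p \<omega> = jump n \<tau> (fst p) (snd p) Z \<omega>" for Z p \<omega>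
  define v where "v = \<tau> / real n"
  define S where "S \<omega> = (\<Sum>p\<in>Q. (J Z0 p \<omega> - (LINT z:Z0|lam. z) * v) *\<^sub>R h' p \<omega>)" for \<omega>
  define X where "X e \<omega> = jump_integral mu (real i * \<tau>) (Ze e) H \<omega> - (LINT z:Ze e|lam. z) *\<^sub>R drift_integral (real i * \<tau>) H \<omega>" for e \<omega>
  have Zb: "Ze e \<in> sets borel" "Z0 \<in> sets borel" "Z1 \<in> sets borel" for e unfolding Ze_def Z0_def Z1_def by measurable
  have h'm[measurable]: "h' p \<in> borel_measurable M" if "p \<in> Q" for p using that h by (auto simp: h'_def Q_def)
  have Jm[measurable]: "J Z p \<in> borel_measurable M" if "p \<in> Q" "Z \<in> sets borel" for Z p
    using that \<tau> by (auto simp: J_def[abs_def] Q_def intro!: jump_measurable)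
  note reg = AE_regular_path[OF \<tau>, of n i]
  have ji: "jump_integrable mu (real i * \<tau>) Z H \<omega>" and jint: "jump_integral mu (real i * \<tau>) Z H \<omega> = (\<Sum>p\<in>Q. J Z p \<omega> *\<^sub>R h' p \<omega>)"
    if "regular_path n \<tau> i \<omega>" "Z \<in> sets borel" for Z \<omega>
    unfolding Q_def J_def h'_def
    by (rule jump_integral_step(1)[OF \<tau> n that(2,1)], rule H, assumption+,
        rule jump_integral_step(2)[OF \<tau> n that(2,1)], rule H, assumption+)
  have di: "set_integrable lborel ({0<..real i * \<tau>} \<times> {0..1}) (\<lambda>(s, y). H s y \<omega>)"
    and dint: "drift_integral (real i * \<tau>) H \<omega> = (\<Sum>p\<in>Q. v *\<^sub>R h' p \<omega>)" for \<omega>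
    unfolding Q_def v_def h'_def
    by (rule drift_integral_step(1)[OF \<tau> n], rule H, assumption+,
        rule drift_integral_step(2)[OF \<tau> n], rule H, assumption+)
  have X_eq: "AE \<omega> in M. X e \<omega> = (\<Sum>p\<in>Q. (J (Ze e) p \<omega> - (LINT z:Ze e|lam. z) * v) *\<^sub>R h' p \<omega>)" for e
    using reg
  proof eventually_elim
    case (elim \<omega>)
    show ?case unfolding X_def jint[OF elim Zb(1)] dint
      by (simp add: scaleR_sum_right sum_subtractf[symmetric] scaleR_left_diff_distrib)
  qed
  have Sm[measurable]: "S \<in> borel_measurable M"
    unfolding S_def[abs_def] using Jm[OF _ Zb(2)] by (intro borel_measurable_sum borel_measurable_scaleR borel_measurable_diff) auto
  have Xm: "X e \<in> borel_measurable M" for e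
  proof (rule borel_measurable_AE_cong[OF _ X_eq])
    show "(\<lambda>\<omega>. \<Sum>p\<in>Q. (J (Ze e) p \<omega> - (LINT z:Ze e|lam. z) * v) *\<^sub>R h' p \<omega>) \<in> borel_measurable M"
      using Jm[OF _ Zb(1)] by (intro borel_measurable_sum borel_measurable_scaleR borel_measurable_diff) auto
  qed
  have conv: "converges_in_probability M X S (at_right 0)"
  proof (rule converges_in_probability_AE[OF Xm Sm])
    fix e :: "nat \<Rightarrow> real" assume e: "\<And>m. 0 < e m" "e \<longlonglongrightarrow> 0"
    have "AE \<omega> in M. \<forall>m. X (e m) \<omega> = (\<Sum>p\<in>Q. (J (Ze (e m)) p \<omega> - (LINT z:Ze (e m)|lam. z) * v) *\<^sub>R h' p \<omega>)"
      unfolding AE_all_countable using X_eq by blast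
    then show "AE \<omega> in M. (\<lambda>m. X (e m) \<omega>) \<longlonglongrightarrow> S \<omega>"
      using reg
    proof eventually_elim
      case (elim \<omega>)
      have "(\<lambda>m. J (Ze (e m)) p \<omega>) \<longlonglongrightarrow> J Z0 p \<omega>" if "p \<in> Q" for p
        unfolding J_def Ze_def Z0_def using elim(2) that e \<tau>
        by (intro jump_limit) (auto simp: regular_path_def Q_def)
      moreover have "(\<lambda>m. LINT z:Ze (e m)|lam. z) \<longlonglongrightarrow> (LINT z:Z0|lam. z)"
        unfolding Ze_def Z0_def by (rule lam_limit[OF e])
      ultimately have "(\<lambda>m. \<Sum>p\<in>Q. (J (Ze (e m)) p \<omega> - (LINT z:Ze (e m)|lam. z) * v) *\<^sub>R h' p \<omega>) \<longlonglongrightarrow> S \<omega>"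
        unfolding S_def by (intro tendsto_sum tendsto_scaleR tendsto_diff tendsto_mult tendsto_const) auto
      then show ?case using elim(1) by simp
    qed
  qed
  have total: "AE \<omega> in M. b *\<^sub>R drift_integral (real i * \<tau>) H \<omega> + S \<omega> + jump_integral mu (real i * \<tau>) Z1 H \<omega>
      = (\<Sum>k<i. \<Sum>j<n. of_real (incr b n \<tau> k j \<omega>) * h k j \<omega>)"
    using reg
  proof eventually_elim
    case (elim \<omega>)
    have "incr b n \<tau> (fst p) (snd p) \<omega> = b * v + (J Z0 p \<omega> - (LINT z:Z0|lam. z) * v) + J Z1 p \<omega>" if "p \<in> Q" for p
    proof -
      have "jump n \<tau> (fst p) (snd p) UNIV \<omega> = J Z0 p \<omega> + J Z1 p \<omega>"
        unfolding J_def using elim that \<tau> Zb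
        by (intro jump_union) (auto simp: regular_path_def Q_def Z0_def Z1_def)
      then show ?thesis by (simp add: incr_def Z0_def v_def algebra_simps)
    qed
    then have "(\<Sum>p\<in>Q. of_real (incr b n \<tau> (fst p) (snd p) \<omega>) * h' p \<omega>)
      = (\<Sum>p\<in>Q. (b * v) *\<^sub>R h' p \<omega> + (J Z0 p \<omega> - (LINT z:Z0|lam. z) * v) *\<^sub>R h' p \<omega> + J Z1 p \<omega> *\<^sub>R h' p \<omega>)"
      by (intro sum.cong refl) (simp add: scaleR_conv_of_real distrib_right)
    also have "\<dots> = b *\<^sub>R drift_integral (real i * \<tau>) H \<omega> + S \<omega> + jump_integral mu (real i * \<tau>) Z1 H \<omega>"
      unfolding jint[OF elim Zb(3)] dint S_def by (simp add: sum.distrib scaleR_sum_right)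
    finally show ?case by (simp add: Q_def h'_def sum.cartesian_product split_def)
  qed
  show ?thesis
  proof
    assume "has_noise_integral M lam mu b H (real i * \<tau>) I"
    then obtain S' where S': "converges_in_probability M X S' (at_right 0)"
      and I: "AE \<omega> in M. I \<omega> = b *\<^sub>R drift_integral (real i * \<tau>) H \<omega> + S' \<omega> + jump_integral mu (real i * \<tau>) Z1 H \<omega>"
      unfolding has_noise_integral_def X_def[abs_def] Ze_def Z1_def by blast
    have "AE \<omega> in M. S' \<omega> = S \<omega>" by (rule converges_in_probability_unique[OF S' conv]) simp
    with I total show "AE \<omega> in M. I \<omega> = (\<Sum>k<i. \<Sum>j<n. of_real (incr b n \<tau> k j \<omega>) * h k j \<omega>)"
      by eventually_elim simp
  next
    assume I: "AE \<omega> in M. I \<omega> = (\<Sum>k<i. \<Sum>j<n. of_real (incr b n \<tau> k j \<omega>) * h k j \<omega>)"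
    show "has_noise_integral M lam mu b H (real i * \<tau>) I"
      unfolding has_noise_integral_def
    proof (intro conjI ballI exI[of _ S])
      show "AE \<omega> in M. set_integrable lborel ({0<..real i * \<tau>} \<times> {0..1}) (\<lambda>(s, y). H s y \<omega>)" using di by simp
      show "AE \<omega> in M. jump_integrable mu (real i * \<tau>) {z. 1 < \<bar>z\<bar>} H \<omega>"
        using reg by eventually_elim (rule ji, auto simp: Zb(3)[unfolded Z1_def])
      show "AE \<omega> in M. jump_integrable mu (real i * \<tau>) {z. e < \<bar>z\<bar> \<and> \<bar>z\<bar> \<le> 1} H \<omega>" for e
        using reg by eventually_elim (rule ji, auto simp: Zb(1)[unfolded Ze_def])
      show "converges_in_probability M (\<lambda>e \<omega>. jump_integral mu (real i * \<tau>) {z. e < \<bar>z\<bar> \<and> \<bar>z\<bar> \<le> 1} H \<omega>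
                   - (LINT z:{z. e < \<bar>z\<bar> \<and> \<bar>z\<bar> \<le> 1}|lam. z) *\<^sub>R drift_integral (real i * \<tau>) H \<omega>) S (at_right 0)"
        using conv unfolding X_def[abs_def] Ze_def .
      show "AE \<omega> in M. I \<omega> = b *\<^sub>R drift_integral (real i * \<tau>) H \<omega> + S \<omega> + jump_integral mu (real i * \<tau>) {z. 1 < \<bar>z\<bar>} H \<omega>"
        using I total unfolding Z1_def by eventually_elim simp
    qed
  qed
qed

end

section \<open>The mild equation as a recursion\<close>

definition kern1 :: "real \<Rightarrow> nat \<Rightarrow> real \<Rightarrow> nat \<Rightarrow> real \<Rightarrow> nat \<Rightarrow> real" where
  "kern1 \<theta> n \<tau> k x j = Re (G1 \<theta> n \<tau> (real k * \<tau>) x (real j / real n))"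

definition kern2 :: "real \<Rightarrow> nat \<Rightarrow> real \<Rightarrow> nat \<Rightarrow> real \<Rightarrow> nat \<Rightarrow> real" where
  "kern2 \<theta> n \<tau> k x j = Re (G2 \<theta> n \<tau> (real k * \<tau>) x (real j / real n))"

lemma lambda_disc_symmetric:
  assumes "0 < n" "l \<le> n"
  shows "lambda_disc n (n - l) = lambda_disc n l"
proof -
  have "real (n - l) * pi / real n = pi - real l * pi / real n"
    using assms by (simp add: of_nat_diff field_simps)
  then show ?thesis by (simp add: lambda_disc_def)
qed

text \<open>The spectrum is symmetric under \<open>l \<mapsto> n - l\<close>, which conjugates the Fourier modes on the grid.\<close>

lemma real_spectral_sum:
  fixes w :: "nat \<Rightarrow> real"
  assumes n: "0 < n" and sym: "\<And>l. 0 < l \<Longrightarrow> l < n \<Longrightarrow> w (n - l) = w l"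
  shows "of_real (Re (\<Sum>l<n. of_real (w l) * e_fun l (real q / real n) * cnj (e_fun l (real j / real n))))
     = (\<Sum>l<n. of_real (w l) * e_fun l (real q / real n) * cnj (e_fun l (real j / real n)))"
proof -
  define t where "t l = of_real (w l) * e_fun l (real q / real n) * cnj (e_fun l (real j / real n))" for l
  have refl_mode: "e_fun (n - l) (real m / real n) = cnj (e_fun l (real m / real n))" if "l \<le> n" for l m
  proof -
    have "e_fun (n - l) (real m / real n) * e_fun l (real m / real n) = e_fun 1 (real m / real n) ^ (n - l + l)"
      unfolding power_add by (subst (1 2) e_fun_power) (rule refl)
    also have "\<dots> = 1" using that e_fun_grid_power[OF n, of m] by simp
    finally have "e_fun (n - l) (real m / real n) * (e_fun l (real m / real n) * cnj (e_fun l (real m / real n))) = cnj (e_fun l (real m / real n))"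
      by (simp add: mult.assoc[symmetric])
    then show ?thesis by (simp add: complex_norm_square[symmetric])
  qed
  have split0: "(\<Sum>l<n. f l) = f 0 + (\<Sum>l\<in>{1..<n}. f l)" for f :: "nat \<Rightarrow> complex"
    using n by (simp add: lessThan_atLeast0 sum.atLeast_Suc_lessThan)
  have "cnj (\<Sum>l<n. t l) = (\<Sum>l<n. cnj (t l))" by simp
  also have "\<dots> = cnj (t 0) + (\<Sum>l\<in>{1..<n}. cnj (t l))" by (rule split0)
  also have "cnj (t 0) = t 0" by (simp add: t_def e_fun_def)
  also have "(\<Sum>l\<in>{1..<n}. cnj (t l)) = (\<Sum>l\<in>{1..<n}. t (n - l))"
    using sym by (intro sum.cong refl) (auto simp: t_def refl_mode)
  also have "\<dots> = (\<Sum>l\<in>{1..<n}. t l)"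
    by (rule sum.reindex_bij_witness[of _ "\<lambda>l. n - l" "\<lambda>l. n - l"]) auto
  also have "t 0 + (\<Sum>l\<in>{1..<n}. t l) = (\<Sum>l<n. t l)" by (rule split0[symmetric])
  finally have "Im (\<Sum>l<n. t l) = 0" by (metis Reals_cnj_iff complex_is_Real_iff)
  then show ?thesis unfolding t_def by (simp add: complex_eq_iff)
qed

lemma kern1_real:
  assumes "0 < n" "0 < \<tau>" "x \<in> {0..1}"
  shows "G1 \<theta> n \<tau> (real k * \<tau>) x (real j / real n) = of_real (kern1 \<theta> n \<tau> k x j)"
proof -
  obtain q where q: "kappa_space n x = real q / real n" using kappa_space_eq_grid[OF assms(1,3)] by blast
  show ?thesis unfolding kern1_def G1_grid[OF assms(1,2)] q
    by (rule real_spectral_sum[symmetric]) (use assms in \<open>auto simp: R1_def R2_def lambda_disc_symmetric\<close>)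
qed

lemma kern2_real:
  assumes "0 < n" "0 < \<tau>" "x \<in> {0..1}"
  shows "G2 \<theta> n \<tau> (real k * \<tau>) x (real j / real n) = of_real (kern2 \<theta> n \<tau> k x j)"
proof -
  obtain q where q: "kappa_space n x = real q / real n" using kappa_space_eq_grid[OF assms(1,3)] by blast
  show ?thesis unfolding kern2_def G2_grid[OF assms(1,2)] q
    by (rule real_spectral_sum[symmetric]) (use assms in \<open>auto simp: R1_def R2_def lambda_disc_symmetric\<close>)
qed

lemma kappa_space_scell:
  assumes "0 < n" "y \<in> scell n j"
  shows "kappa_space n y = real j / real n"
proof -
  have "real j \<le> real n * y" "real n * y < real j + 1"
    using assms by (auto simp: scell_def field_simps)
  then have "\<lfloor>real n * y\<rfloor> = int j" by linarith
  then show ?thesis by (simp add: kappa_space_def)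
qed

lemma kappa_time_lcell:
  assumes "0 < \<tau>" "s \<in> lcell \<tau> k"
  shows "kappa_time \<tau> s = real k * \<tau>"
proof -
  have "real k \<le> s / \<tau>" "s / \<tau> < real k + 1"
    using assms by (auto simp: lcell_def pos_le_divide_eq pos_divide_less_eq algebra_simps)
  then have "\<lfloor>s / \<tau>\<rfloor> = int k" by linarith
  then show ?thesis by (simp add: kappa_time_def)
qed

definition initial_part :: "real \<Rightarrow> nat \<Rightarrow> real \<Rightarrow> (real \<Rightarrow> real) \<Rightarrow> nat \<Rightarrow> real \<Rightarrow> real" where
  "initial_part \<theta> n \<tau> u0 i x = (\<Sum>j<n. kern1 \<theta> n \<tau> i x j * u0 (real j / real n)) / real n"

lemma initial_integral:
  assumes n: "0 < n" and \<tau>: "0 < \<tau>" and x: "x \<in> {0..1}"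
  shows "(LINT y:{0..1}|lborel. G1 \<theta> n \<tau> (real i * \<tau>) x y * of_real (u0 (kappa_space n y)))
    = of_real (initial_part \<theta> n \<tau> u0 i x)"
proof -
  define c where "c j = G1 \<theta> n \<tau> (real i * \<tau>) x (real j / real n) * of_real (u0 (real j / real n))" for j
  define f where "f y = indicator {0..1} y *\<^sub>R (G1 \<theta> n \<tau> (real i * \<tau>) x y * of_real (u0 (kappa_space n y)))" for y
  have fc: "f y = c j" if "y \<in> {0..1}" "y \<in> scell n j" for y j
    using that n kappa_space_scell[OF n that(2)] by (simp add: f_def c_def G1_def)
  have single: "(\<Sum>j'\<in>P. indicator (B j') y *\<^sub>R (1 *\<^sub>R c j')) = c j"
    if "j \<in> P" "finite P" "\<And>j'. j' \<in> P \<Longrightarrow> y \<in> B j' \<longleftrightarrow> j' = j" for P j B and y :: real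
  proof -
    have "(\<Sum>j'\<in>P. indicator (B j') y *\<^sub>R (1 *\<^sub>R c j')) = (\<Sum>j'\<in>{j}. indicator (B j') y *\<^sub>R (1 *\<^sub>R c j'))"
      by (rule sum.mono_neutral_right) (use that in \<open>auto simp: indicator_def\<close>)
    then show ?thesis using that by simp
  qed
  have 1: "f y = (\<Sum>j\<in>{..n}. indicator (scell n j \<inter> {0..1}) y *\<^sub>R (1 *\<^sub>R c j))" for y
  proof (cases "y \<in> {0..1}")
    case True
    obtain j where j: "j \<le> n" "y \<in> scell n j" using scell_cover[OF n True] .
    have "(\<Sum>j\<in>{..n}. indicator (scell n j \<inter> {0..1}) y *\<^sub>R (1 *\<^sub>R c j)) = c j"
    proof (rule single)
      show "y \<in> scell n j' \<inter> {0..1} \<longleftrightarrow> j' = j" for j'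
        using scell_disjoint[OF n j(2), of j'] j(2) True by blast
    qed (use j in auto)
    then show ?thesis using fc[OF True j(2)] by simp
  qed (simp add: f_def)
  have "AE y in lborel. y \<noteq> (1 :: real)" by (rule AE_lborel_singleton)
  then have 2: "AE y in lborel. f y = (\<Sum>j\<in>{..<n}. indicator (scell n j) y *\<^sub>R (1 *\<^sub>R c j))"
  proof eventually_elim
    case (elim y)
    show ?case
    proof (cases "y \<in> {0..1}")
      case True
      obtain j where j: "j \<le> n" "y \<in> scell n j" using scell_cover[OF n True] .
      have jn: "j < n"
      proof (rule ccontr)
        assume "\<not> j < n"
        then have "j = n" using j by simp
        then show False using j(2) True elim n by (simp add: scell_def)
      qed
      have "(\<Sum>j\<in>{..<n}. indicator (scell n j) y *\<^sub>R (1 *\<^sub>R c j)) = c j"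
      proof (rule single)
        show "y \<in> scell n j' \<longleftrightarrow> j' = j" for j'
          using scell_disjoint[OF n j(2), of j'] j(2) by blast
      qed (use jn in auto)
      then show ?thesis using fc[OF True j(2)] by simp
    next
      case False
      then have "y \<notin> scell n j" if "j < n" for j using scell_unit[OF that] by auto
      then show ?thesis using False by (simp add: f_def)
    qed
  qed
  have 3: "integrable lborel (\<lambda>y. indicator (scell n j) y * (1::real))" for j
    using scell_sets[of n j] emeasure_scell[OF n, of j] by (simp add: integrable_real_indicator)
  have 4: "(\<integral>y. indicator (scell n j) y * (1::real) \<partial>lborel) = 1 / real n" for j
    using emeasure_scell[OF n, of j] by (simp add: measure_def)
  have "(\<integral>y. f y \<partial>lborel) = (\<Sum>j\<in>{..<n}. (\<integral>y. indicator (scell n j) y * 1 \<partial>lborel) *\<^sub>R c j)"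
    by (rule integral_step_function(2)[OF 1 _ _ 2 3]) (auto simp: scell_sets)
  also have "\<dots> = of_real (initial_part \<theta> n \<tau> u0 i x)"
    unfolding 4 c_def kern1_real[OF n \<tau> x]
    by (simp add: initial_part_def sum_divide_distrib scaleR_conv_of_real)
  finally show ?thesis unfolding set_lebesgue_integral_def f_def .
qed

context levy_noise
begin

definition scheme_rhs :: "real \<Rightarrow> (real \<Rightarrow> real) \<Rightarrow> (real \<Rightarrow> real) \<Rightarrow> real \<Rightarrow> nat \<Rightarrow> real \<Rightarrow> nat \<Rightarrow> nat \<Rightarrow> real
    \<Rightarrow> (nat \<Rightarrow> nat \<Rightarrow> 'a \<Rightarrow> real) \<Rightarrow> 'a \<Rightarrow> real" where
  "scheme_rhs b \<sigma> u0 \<theta> n \<tau> i m x V \<omega> = initial_part \<theta> n \<tau> u0 i x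
     + (\<Sum>k<m. \<Sum>j<n. (kern2 \<theta> n \<tau> (i - Suc k) x j * \<sigma> (V k j \<omega>)) * incr b n \<tau> k j \<omega>)"

lemma mild_solution_iff:
  assumes n: "0 < n" and \<tau>: "0 < \<tau>" and \<sigma>: "\<sigma> \<in> borel_measurable borel"
  shows "mild_solution M F lam mu b \<sigma> u0 \<theta> n \<tau> u \<longleftrightarrow>
     (\<forall>i::nat. \<forall>x\<in>{0..1}. u (real i * \<tau>) x \<in> borel_measurable (F (real i * \<tau>))) \<and>
     (\<forall>x\<in>{0..<1}. AE \<omega> in M. u 0 x \<omega> = u0 (kappa_space n x)) \<and>
     (AE \<omega> in M. u 0 1 \<omega> = u0 0) \<and>
     (\<forall>i\<ge>1. \<forall>x\<in>{0..1}. AE \<omega> in M. u (real i * \<tau>) x \<omega>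
        = scheme_rhs b \<sigma> u0 \<theta> n \<tau> i i x (\<lambda>k j. u (real k * \<tau>) (real j / real n)) \<omega>)"
    (is "_ \<longleftrightarrow> ?A \<and> ?B \<and> ?C \<and> ?D")
proof -
  have key: "(\<exists>I. has_noise_integral M lam mu b
              (\<lambda>s y \<omega>. G2 \<theta> n \<tau> (real i * \<tau> - kappa_time \<tau> s - \<tau>) x y
                 * of_real (\<sigma> (u (kappa_time \<tau> s) (kappa_space n y) \<omega>))) (real i * \<tau>) I \<and>
            (AE \<omega> in M. complex_of_real (u (real i * \<tau>) x \<omega>) =
               (LINT y:{0..1}|lborel. G1 \<theta> n \<tau> (real i * \<tau>) x y * of_real (u0 (kappa_space n y))) + I \<omega>))
     \<longleftrightarrow> (AE \<omega> in M. u (real i * \<tau>) x \<omega> = scheme_rhs b \<sigma> u0 \<theta> n \<tau> i i x (\<lambda>k j. u (real k * \<tau>) (real j / real n)) \<omega>)"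
    if A: ?A and i: "1 \<le> i" and x: "x \<in> {0..1}" for i x
  proof -
    define H where "H = (\<lambda>s y \<omega>. G2 \<theta> n \<tau> (real i * \<tau> - kappa_time \<tau> s - \<tau>) x y
                 * of_real (\<sigma> (u (kappa_time \<tau> s) (kappa_space n y) \<omega>)))"
    define h where "h = (\<lambda>k j \<omega>. G2 \<theta> n \<tau> (real i * \<tau> - real k * \<tau> - \<tau>) x (real j / real n)
                 * of_real (\<sigma> (u (real k * \<tau>) (real j / real n) \<omega>)))"
    define I0 where "I0 \<omega> = (\<Sum>k<i. \<Sum>j<n. of_real (incr b n \<tau> k j \<omega>) * h k j \<omega>)" for \<omega>
    have Hh: "H s y \<omega> = h k j \<omega>" if "s \<in> lcell \<tau> k" "y \<in> scell n j" for k j s y \<omega>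
      using n kappa_time_lcell[OF \<tau> that(1)] kappa_space_scell[OF n that(2)] by (simp add: H_def h_def G2_def)
    have hm: "h k j \<in> borel_measurable M" if "k < i" "j < n" for k j
    proof -
      have "u (real k * \<tau>) (real j / real n) \<in> borel_measurable (F (real k * \<tau>))" using A that by auto
      then have [measurable]: "u (real k * \<tau>) (real j / real n) \<in> borel_measurable M" by (rule measurable_F_M)
      note \<sigma>[measurable]
      show ?thesis unfolding h_def by measurable
    qed
    have noise: "has_noise_integral M lam mu b H (real i * \<tau>) I \<longleftrightarrow> (AE \<omega> in M. I \<omega> = I0 \<omega>)" for I
      unfolding I0_def by (rule has_noise_integral_step[OF \<tau> n Hh hm])
    have I0: "I0 \<omega> = of_real (\<Sum>k<i. \<Sum>j<n. (kern2 \<theta> n \<tau> (i - Suc k) x j * \<sigma> (u (real k * \<tau>) (real j / real n) \<omega>)) * incr b n \<tau> k j \<omega>)" for \<omega>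
      unfolding I0_def of_real_sum
    proof (intro sum.cong refl)
      fix k j assume k: "k \<in> {..<i}"
      have "real i * \<tau> - real k * \<tau> - \<tau> = real (i - Suc k) * \<tau>"
        using k by (simp add: of_nat_diff algebra_simps)
      then show "of_real (incr b n \<tau> k j \<omega>) * h k j \<omega>
        = of_real ((kern2 \<theta> n \<tau> (i - Suc k) x j * \<sigma> (u (real k * \<tau>) (real j / real n) \<omega>)) * incr b n \<tau> k j \<omega>)"
        by (simp add: h_def kern2_real[OF n \<tau> x])
    qed
    have "(\<exists>I. has_noise_integral M lam mu b H (real i * \<tau>) I \<and>
            (AE \<omega> in M. complex_of_real (u (real i * \<tau>) x \<omega>) = of_real (initial_part \<theta> n \<tau> u0 i x) + I \<omega>))
      \<longleftrightarrow> (AE \<omega> in M. complex_of_real (u (real i * \<tau>) x \<omega>) = of_real (initial_part \<theta> n \<tau> u0 i x) + I0 \<omega>)"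
    proof
      assume "\<exists>I. has_noise_integral M lam mu b H (real i * \<tau>) I \<and>
            (AE \<omega> in M. complex_of_real (u (real i * \<tau>) x \<omega>) = of_real (initial_part \<theta> n \<tau> u0 i x) + I \<omega>)"
      then obtain I where "AE \<omega> in M. I \<omega> = I0 \<omega>"
        "AE \<omega> in M. complex_of_real (u (real i * \<tau>) x \<omega>) = of_real (initial_part \<theta> n \<tau> u0 i x) + I \<omega>"
        using noise by blast
      then show "AE \<omega> in M. complex_of_real (u (real i * \<tau>) x \<omega>) = of_real (initial_part \<theta> n \<tau> u0 i x) + I0 \<omega>"
        by eventually_elim simp
    next
      assume "AE \<omega> in M. complex_of_real (u (real i * \<tau>) x \<omega>) = of_real (initial_part \<theta> n \<tau> u0 i x) + I0 \<omega>"
      then show "\<exists>I. has_noise_integral M lam mu b H (real i * \<tau>) I \<and>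
            (AE \<omega> in M. complex_of_real (u (real i * \<tau>) x \<omega>) = of_real (initial_part \<theta> n \<tau> u0 i x) + I \<omega>)"
        using noise by (intro exI[of _ I0]) simp
    qed
    also have "\<dots> \<longleftrightarrow> (AE \<omega> in M. u (real i * \<tau>) x \<omega> = scheme_rhs b \<sigma> u0 \<theta> n \<tau> i i x (\<lambda>k j. u (real k * \<tau>) (real j / real n)) \<omega>)"
      unfolding I0 scheme_rhs_def of_real_add[symmetric] of_real_eq_iff ..
    finally show ?thesis unfolding initial_integral[OF n \<tau> x] H_def .
  qed
  show ?thesis unfolding mild_solution_def Let_def using key by (intro iffI; elim conjE; intro conjI) auto
qed

end

lemma course_of_values_recursion:
  fixes \<Phi> :: "nat \<Rightarrow> (nat \<Rightarrow> 'b) \<Rightarrow> 'b"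
  assumes "\<And>i f g. (\<And>k. k < i \<Longrightarrow> f k = g k) \<Longrightarrow> \<Phi> i f = \<Phi> i g"
  obtains U where "\<And>i. U i = \<Phi> i U"
proof
  define U where "U = wfrec less_than (\<lambda>f i. \<Phi> i f)"
  fix i
  have "U i = \<Phi> i (cut U less_than i)" unfolding U_def by (rule wfrec) simp
  also have "\<dots> = \<Phi> i U" by (rule assms) (simp add: cut_apply)
  finally show "U i = \<Phi> i U" .
qed

context levy_noise
begin

lemma scheme_rhs_measurable:
  assumes "0 < n" "0 < \<tau>" "\<sigma> \<in> borel_measurable borel"
    and V: "\<And>k j. k < m \<Longrightarrow> j < n \<Longrightarrow> V k j \<in> borel_measurable (F (real k * \<tau>))"
  shows "scheme_rhs b \<sigma> u0 \<theta> n \<tau> i m x V \<in> borel_measurable (F (real m * \<tau>))"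
  unfolding scheme_rhs_def[abs_def]
proof (intro borel_measurable_add borel_measurable_const borel_measurable_sum borel_measurable_times)
  fix k j assume k: "k \<in> {..<m}" and j: "j \<in> {..<n}"
  have le: "real (k + 1) * \<tau> \<le> real m * \<tau>" using k assms by (intro mult_right_mono) auto
  have "real k * \<tau> \<le> real m * \<tau>" using k assms by (intro mult_right_mono) auto
  then have "V k j \<in> borel_measurable (F (real m * \<tau>))" by (rule measurable_F_mono) (use V[of k j] k j in auto)
  then show "(\<lambda>\<omega>. \<sigma> (V k j \<omega>)) \<in> borel_measurable (F (real m * \<tau>))" using assms(3) by (rule measurable_compose)
  show "incr b n \<tau> k j \<in> borel_measurable (F (real m * \<tau>))" using assms j le by (intro incr_measurable_F) auto
qed

lemma mild_solution_exists:
  assumes n: "0 < n" and \<tau>: "0 < \<tau>" and \<sigma>: "\<sigma> \<in> borel_measurable borel"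
  obtains u where "mild_solution M F lam mu b \<sigma> u0 \<theta> n \<tau> u"
proof -
  define \<Phi> where "\<Phi> i (U :: nat \<Rightarrow> real \<Rightarrow> 'a \<Rightarrow> real) = (\<lambda>x. if i = 0 then (\<lambda>\<omega>. if x = 1 then u0 0 else u0 (kappa_space n x))
     else scheme_rhs b \<sigma> u0 \<theta> n \<tau> i i x (\<lambda>k j. U k (real j / real n)))" for i U
  have "\<Phi> i f = \<Phi> i g" if "\<And>k. k < i \<Longrightarrow> f k = g k" for i f g
    using that by (auto simp: \<Phi>_def scheme_rhs_def fun_eq_iff intro!: sum.cong)
  then obtain U where U: "\<And>i. U i = \<Phi> i U" using course_of_values_recursion[of \<Phi>] by blast
  have U0: "U 0 x = (\<lambda>\<omega>. if x = 1 then u0 0 else u0 (kappa_space n x))" for x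
    by (subst U) (simp add: \<Phi>_def)
  have US: "U i x = scheme_rhs b \<sigma> u0 \<theta> n \<tau> i i x (\<lambda>k j. U k (real j / real n))" if "1 \<le> i" for i x
    using that by (subst U) (simp add: \<Phi>_def)
  define u where "u t = U (nat \<lfloor>t / \<tau>\<rfloor>)" for t
  have u_grid: "u (real i * \<tau>) = U i" for i using \<tau> by (simp add: u_def)
  have u0': "u 0 = U 0" by (simp add: u_def)
  have meas: "U i x \<in> borel_measurable (F (real i * \<tau>))" for i x
  proof (induction i arbitrary: x rule: less_induct)
    case (less i)
    show ?case
    proof (cases "i = 0")
      case False
      have "scheme_rhs b \<sigma> u0 \<theta> n \<tau> i i x (\<lambda>k j. U k (real j / real n)) \<in> borel_measurable (F (real i * \<tau>))"
        by (rule scheme_rhs_measurable[OF n \<tau> \<sigma> less])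
      then show ?thesis using False by (subst US) auto
    qed (simp add: U0)
  qed
  show thesis
  proof (rule that[of u])
    show "mild_solution M F lam mu b \<sigma> u0 \<theta> n \<tau> u"
      unfolding mild_solution_iff[OF n \<tau> \<sigma>] using meas US by (auto simp: u_grid u0' U0)
  qed
qed

lemma mild_solution_unique:
  assumes n: "0 < n" and \<tau>: "0 < \<tau>" and \<sigma>: "\<sigma> \<in> borel_measurable borel"
    and u: "mild_solution M F lam mu b \<sigma> u0 \<theta> n \<tau> u" and v: "mild_solution M F lam mu b \<sigma> u0 \<theta> n \<tau> v"
    and x: "x \<in> {0..1}"
  shows "AE \<omega> in M. v (real i * \<tau>) x \<omega> = u (real i * \<tau>) x \<omega>"
  using x
proof (induction i arbitrary: x rule: less_induct)
  case (less i)
  note u' = u[unfolded mild_solution_iff[OF n \<tau> \<sigma>]] and v' = v[unfolded mild_solution_iff[OF n \<tau> \<sigma>]]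
  show ?case
  proof (cases "i = 0")
    case True
    show ?thesis
    proof (cases "x = 1")
      case x1: True
      have "AE \<omega> in M. u 0 1 \<omega> = u0 0" using u' by (elim conjE)
      moreover have "AE \<omega> in M. v 0 1 \<omega> = u0 0" using v' by (elim conjE)
      ultimately have "AE \<omega> in M. v 0 1 \<omega> = u 0 1 \<omega>" by eventually_elim simp
      then show ?thesis using True x1 by simp
    next
      case False
      then have "x \<in> {0..<1}" using less.prems by simp
      then have "AE \<omega> in M. u 0 x \<omega> = u0 (kappa_space n x)" using u' by (elim conjE) (erule bspec)
      moreover have "AE \<omega> in M. v 0 x \<omega> = u0 (kappa_space n x)" using v' \<open>x \<in> {0..<1}\<close> by (elim conjE) (erule bspec)
      ultimately have "AE \<omega> in M. v 0 x \<omega> = u 0 x \<omega>" by eventually_elim simp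
      then show ?thesis using True by simp
    qed
  next
    case False
    then have i: "1 \<le> i" by simp
    have "AE \<omega> in M. u (real i * \<tau>) x \<omega> = scheme_rhs b \<sigma> u0 \<theta> n \<tau> i i x (\<lambda>k j. u (real k * \<tau>) (real j / real n)) \<omega>"
      "AE \<omega> in M. v (real i * \<tau>) x \<omega> = scheme_rhs b \<sigma> u0 \<theta> n \<tau> i i x (\<lambda>k j. v (real k * \<tau>) (real j / real n)) \<omega>"
      using conjunct2[OF conjunct2[OF conjunct2[OF u']]] conjunct2[OF conjunct2[OF conjunct2[OF v']]] i less.prems by simp_all
    moreover have "AE \<omega> in M. \<forall>p\<in>{..<i} \<times> {..<n}. v (real (fst p) * \<tau>) (real (snd p) / real n) \<omega> = u (real (fst p) * \<tau>) (real (snd p) / real n) \<omega>"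
      by (intro AE_finite_allI less.IH) auto
    ultimately show ?thesis
    proof eventually_elim
      case (elim \<omega>)
      have "scheme_rhs b \<sigma> u0 \<theta> n \<tau> i i x (\<lambda>k j. v (real k * \<tau>) (real j / real n)) \<omega>
        = scheme_rhs b \<sigma> u0 \<theta> n \<tau> i i x (\<lambda>k j. u (real k * \<tau>) (real j / real n)) \<omega>"
        unfolding scheme_rhs_def using elim(3) by (intro arg_cong2[where f = "(+)"] sum.cong refl) auto
      then show ?case using elim by simp
    qed
  qed
qed

end

section \<open>The moment bound\<close>

lemma powr_add_expand:
  fixes x y p :: real
  assumes "0 \<le> x" "0 \<le> y" "2 \<le> p" "p \<le> 3"
  shows "(x + y) powr p \<le> x powr p + 16 * (x powr (p - 1) * y + y powr p)"
proof (cases "y \<le> x")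
  case True
  show ?thesis
  proof (cases "x + y = 0")
    case False
    then have pos: "0 < x + y" using assms by linarith
    have "(x + y) powr p + p * (x + y) powr (p - 1) * (x - (x + y)) \<le> x powr p"
      by (rule powr_tangent) (use assms pos in auto)
    then have "(x + y) powr p \<le> x powr p + p * ((x + y) powr (p - 1) * y)" by (simp add: mult.assoc)
    also have "p * ((x + y) powr (p - 1) * y) \<le> 3 * (4 * x powr (p - 1) * y)"
    proof (intro mult_mono)
      have "(x + y) powr (p - 1) \<le> (2 * x) powr (p - 1)" using True assms by (intro powr_mono2) auto
      also have "\<dots> = 2 powr (p - 1) * x powr (p - 1)" by (simp add: powr_mult)
      also have "\<dots> \<le> 4 * x powr (p - 1)"
        using assms powr_mono[of "p - 1" 2 2] by (intro mult_right_mono) auto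
      finally show "(x + y) powr (p - 1) \<le> 4 * x powr (p - 1)" .
    qed (use assms in auto)
    also have "3 * (4 * x powr (p - 1) * y) \<le> 16 * (x powr (p - 1) * y + y powr p)"
    proof -
      define A B where "A = x powr (p - 1) * y" and "B = y powr p"
      have "0 \<le> A" "0 \<le> B" using assms by (auto simp: A_def B_def)
      then have "3 * (4 * A) \<le> 16 * (A + B)" unfolding distrib_left by linarith
      then show ?thesis by (simp only: A_def B_def mult.assoc)
    qed
    finally show ?thesis by simp
  qed (use assms in auto)
next
  case False
  have "(x + y) powr p \<le> (2 * y) powr p" using False assms by (intro powr_mono2) auto
  also have "\<dots> = 2 powr p * y powr p" by (simp add: powr_mult)
  also have "\<dots> \<le> 8 * y powr p" using assms powr_mono[of p 3 2] by (intro mult_right_mono) (auto simp: powr_numeral)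
  also have "\<dots> \<le> x powr p + 16 * (x powr (p - 1) * y + y powr p)"
  proof -
    define A B C where "A = x powr (p - 1) * y" and "B = y powr p" and "C = x powr p"
    have "0 \<le> A" "0 \<le> B" "0 \<le> C" using assms by (auto simp: A_def B_def C_def)
    then have "8 * B \<le> C + 16 * (A + B)" unfolding distrib_left by linarith
    then show ?thesis by (simp only: A_def B_def C_def)
  qed
  finally show ?thesis .
qed

lemma powr_young:
  fixes x y p :: real
  assumes "0 \<le> x" "0 \<le> y" "1 \<le> p"
  shows "x powr (p - 1) * y \<le> x powr p + y powr p"
proof (cases "x = 0 \<or> y = 0")
  case False
  then have x: "0 < x" "0 < y" using assms by auto
  have e: "a powr p = a powr (p - 1) * a" if "0 < a" for a :: real
    using that powr_add[of a "p - 1" 1] by simp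
  show ?thesis
  proof (cases "x \<le> y")
    case True
    then have "x powr (p - 1) * y \<le> y powr (p - 1) * y" using assms by (intro mult_right_mono powr_mono2) auto
    then show ?thesis using e[OF x(2)] powr_ge_zero[of x p] by linarith
  next
    case False
    then have "x powr (p - 1) * y \<le> x powr (p - 1) * x" by (intro mult_left_mono) auto
    then show ?thesis using e[OF x(1)] powr_ge_zero[of y p] by linarith
  qed
qed auto

lemma lipschitz_moment:
  fixes \<sigma> :: "real \<Rightarrow> real" and L p :: real
  assumes L: "L-lipschitz_on UNIV \<sigma>" and p: "1 \<le> p"
  obtains c where "0 < c" and "\<And>x. \<bar>\<sigma> x\<bar> powr p \<le> c * (1 + \<bar>x\<bar> powr p)"
proof -
  define B where "B = \<bar>\<sigma> 0\<bar> + L + 1"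
  have L0: "0 \<le> L" using L by (rule lipschitz_on_nonneg)
  show thesis
  proof (rule that[of "B powr p * 2 powr p"])
    show "0 < B powr p * 2 powr p" using L0 by (simp add: B_def)
  next
    fix x
    have "\<bar>\<sigma> x - \<sigma> 0\<bar> \<le> L * \<bar>x\<bar>" using lipschitz_onD[OF L, of x 0] by (simp add: dist_real_def)
    then have "\<bar>\<sigma> x\<bar> \<le> \<bar>\<sigma> 0\<bar> + L * \<bar>x\<bar>" by linarith
    also have "\<dots> \<le> B * (1 + \<bar>x\<bar>)"
    proof -
      have "0 \<le> \<bar>\<sigma> 0\<bar> * \<bar>x\<bar>" by simp
      then show ?thesis using L0 by (simp add: B_def algebra_simps)
    qed
    finally have "\<bar>\<sigma> x\<bar> powr p \<le> (B * (1 + \<bar>x\<bar>)) powr p" using p by (intro powr_mono2) auto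
    also have "\<dots> = B powr p * (1 + \<bar>x\<bar>) powr p" by (simp add: powr_mult)
    also have "\<dots> \<le> B powr p * (2 powr p * (1 powr p + \<bar>x\<bar> powr p))"
      using p by (intro mult_left_mono powr_add_le) auto
    finally show "\<bar>\<sigma> x\<bar> powr p \<le> B powr p * 2 powr p * (1 + \<bar>x\<bar> powr p)" by (simp add: mult.assoc)
  qed
qed


lemma abs_kern2_le: "\<bar>kern2 \<theta> n \<tau> k x j\<bar> \<le> norm (G2 \<theta> n \<tau> (real k * \<tau>) x (real j / real n))"
  unfolding kern2_def by (rule abs_Re_le_cmod)

lemma abs_kern1_le: "\<bar>kern1 \<theta> n \<tau> k x j\<bar> \<le> norm (G1 \<theta> n \<tau> (real k * \<tau>) x (real j / real n))"
  unfolding kern1_def by (rule abs_Re_le_cmod)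

lemma initial_part_le:
  assumes n: "0 < n" and B: "0 \<le> B" "\<forall>y\<in>{0..1}. \<bar>u0 y\<bar> \<le> B"
  shows "\<bar>initial_part \<theta> n \<tau> u0 i x\<bar> \<le> B * ((\<Sum>j<n. norm (G1 \<theta> n \<tau> (real i * \<tau>) x (real j / real n))) / real n)"
proof -
  have "\<bar>initial_part \<theta> n \<tau> u0 i x\<bar> \<le> (\<Sum>j<n. \<bar>kern1 \<theta> n \<tau> i x j * u0 (real j / real n)\<bar>) / real n"
    unfolding initial_part_def by (simp add: divide_right_mono)
  also have "\<dots> \<le> (\<Sum>j<n. norm (G1 \<theta> n \<tau> (real i * \<tau>) x (real j / real n)) * B) / real n"
    unfolding abs_mult using n by (intro divide_right_mono sum_mono mult_mono abs_kern1_le B(2)[rule_format]) auto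
  finally show ?thesis by (simp add: sum_distrib_left[symmetric] sum_distrib_right[symmetric] mult.commute)
qed

context levy_noise
begin

lemma conditional_step:
  assumes \<tau>: "0 < \<tau>" and n: "0 < n"
    and S: "S \<in> borel_measurable (F (real k * \<tau>))" and a: "\<And>j. j < n \<Longrightarrow> a j \<in> borel_measurable (F (real k * \<tau>))"
  shows "(\<integral>\<^sup>+\<omega>. ennreal (\<bar>S \<omega> + (\<Sum>j<n. a j \<omega> * incr b n \<tau> k j \<omega>)\<bar> powr p) \<partial>M)
    = (\<integral>\<^sup>+\<omega>. (\<integral>\<^sup>+\<omega>'. ennreal (\<bar>S \<omega> + (\<Sum>j<n. a j \<omega> * incr b n \<tau> k j \<omega>')\<bar> powr p) \<partial>M) \<partial>M)"
proof -
  let ?P = "F (real k * \<tau>) \<Otimes>\<^sub>M future (real k * \<tau>)"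
  have [measurable]: "(\<lambda>z. S (fst z)) \<in> borel_measurable ?P" using S by (rule measurable_compose[OF measurable_fst])
  have [measurable]: "(\<lambda>z. a j (fst z)) \<in> borel_measurable ?P" if "j < n" for j
    using a[OF that] by (rule measurable_compose[OF measurable_fst])
  have [measurable]: "(\<lambda>z. incr b n \<tau> k j (snd z)) \<in> borel_measurable ?P" if "j < n" for j
    using \<tau> that by (intro measurable_compose[OF measurable_snd] incr_measurable_future) auto
  show ?thesis
  proof (rule nn_integral_F_future)
    show "(\<lambda>(\<omega>, \<omega>'). ennreal (\<bar>S \<omega> + (\<Sum>j<n. a j \<omega> * incr b n \<tau> k j \<omega>')\<bar> powr p)) \<in> borel_measurable ?P"
      unfolding split_beta by measurable
  qed (use \<tau> in simp)
qed

lemma incr_step_deterministic: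
  assumes p: "2 \<le> p" "p < 3"
  obtains C where "0 < C"
    and "\<And>n \<tau> k g c s. 0 < \<tau> \<Longrightarrow> \<tau> \<le> 1 \<Longrightarrow> 0 < n \<Longrightarrow>
      (\<integral>\<^sup>+\<omega>. ennreal (\<bar>s + (\<Sum>j<n. (g j * c j) * incr b n \<tau> k j \<omega>)\<bar> powr p) \<partial>M)
      \<le> ennreal (\<bar>s\<bar> powr p) + ennreal (C * \<tau>) * (\<Sum>j<n. ennreal ((1 + \<bar>g j\<bar> powr p) / real n) * (ennreal (\<bar>s\<bar> powr p) + ennreal (\<bar>c j\<bar> powr p)))"
proof -
  obtain C0 where C0: "0 \<le> C0"
    and m1: "\<And>n \<tau> k a. 0 < \<tau> \<Longrightarrow> \<tau> \<le> 1 \<Longrightarrow> 0 < n \<Longrightarrow>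
      (\<integral>\<^sup>+\<omega>. ennreal (\<Sum>j<n. \<bar>a j\<bar> * \<bar>incr b n \<tau> k j \<omega>\<bar>) \<partial>M) \<le> ennreal (C0 * \<tau> * ((\<Sum>j<n. \<bar>a j\<bar>) / real n))"
    and mp: "\<And>n \<tau> k a. 0 < \<tau> \<Longrightarrow> \<tau> \<le> 1 \<Longrightarrow> 0 < n \<Longrightarrow>
      (\<integral>\<^sup>+\<omega>. ennreal ((\<Sum>j<n. \<bar>a j\<bar> * \<bar>incr b n \<tau> k j \<omega>\<bar>) powr p) \<partial>M) \<le> ennreal (C0 * \<tau> * ((\<Sum>j<n. \<bar>a j\<bar> powr p) / real n))"
    using incr_comb_moments[OF p] by blast
  show thesis
  proof (rule that[of "32 * C0 + 1"])
    show "0 < 32 * C0 + 1" using C0 by simp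
  next
    fix n k :: nat and \<tau> s :: real and g c :: "nat \<Rightarrow> real"
    assume \<tau>: "0 < \<tau>" "\<tau> \<le> 1" and n: "0 < n"
    define a where "a j = g j * c j" for j
    define D where "D \<omega> = (\<Sum>j<n. \<bar>a j\<bar> * \<bar>incr b n \<tau> k j \<omega>\<bar>)" for \<omega>
    have im[measurable]: "j < n \<Longrightarrow> incr b n \<tau> k j \<in> borel_measurable M" for j using \<tau> by (intro incr_measurable) auto
    have Dm[measurable]: "D \<in> borel_measurable M" unfolding D_def[abs_def] by measurable
    have D0: "0 \<le> D \<omega>" for \<omega> by (simp add: D_def sum_nonneg)
    define E where "E = (\<Sum>j<n. (1 + \<bar>g j\<bar> powr p) / real n * (\<bar>s\<bar> powr p + \<bar>c j\<bar> powr p))"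
    have E0: "0 \<le> E" unfolding E_def by (intro sum_nonneg mult_nonneg_nonneg divide_nonneg_nonneg add_nonneg_nonneg) auto
    have pt: "\<bar>s + (\<Sum>j<n. a j * incr b n \<tau> k j \<omega>)\<bar> powr p \<le> \<bar>s\<bar> powr p + 16 * (\<bar>s\<bar> powr (p - 1) * D \<omega> + D \<omega> powr p)" for \<omega>
    proof -
      have "\<bar>\<Sum>j<n. a j * incr b n \<tau> k j \<omega>\<bar> \<le> D \<omega>"
        unfolding D_def by (rule order.trans[OF sum_abs]) (simp add: abs_mult)
      then have "\<bar>s + (\<Sum>j<n. a j * incr b n \<tau> k j \<omega>)\<bar> \<le> \<bar>s\<bar> + D \<omega>" by linarith
      then have "\<bar>s + (\<Sum>j<n. a j * incr b n \<tau> k j \<omega>)\<bar> powr p \<le> (\<bar>s\<bar> + D \<omega>) powr p" using p by (intro powr_mono2) auto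
      also have "\<dots> \<le> \<bar>s\<bar> powr p + 16 * (\<bar>s\<bar> powr (p - 1) * D \<omega> + D \<omega> powr p)"
        using p D0 by (intro powr_add_expand) auto
      finally show ?thesis .
    qed
    have s1: "\<bar>s\<bar> powr (p - 1) * ((\<Sum>j<n. \<bar>a j\<bar>) / real n) \<le> E"
      unfolding sum_divide_distrib sum_distrib_left E_def
    proof (rule sum_mono)
      fix j
      have "\<bar>g j\<bar> powr 1 \<le> 1 + \<bar>g j\<bar> powr p" using p by (intro powr_le_one_plus) auto
      moreover have "\<bar>s\<bar> powr (p - 1) * \<bar>c j\<bar> \<le> \<bar>s\<bar> powr p + \<bar>c j\<bar> powr p" using p by (intro powr_young) auto
      ultimately have "\<bar>g j\<bar> * (\<bar>s\<bar> powr (p - 1) * \<bar>c j\<bar>) \<le> (1 + \<bar>g j\<bar> powr p) * (\<bar>s\<bar> powr p + \<bar>c j\<bar> powr p)"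
        by (intro mult_mono) (auto intro: add_nonneg_nonneg)
      then have "\<bar>g j\<bar> * (\<bar>s\<bar> powr (p - 1) * \<bar>c j\<bar>) / real n \<le> (1 + \<bar>g j\<bar> powr p) * (\<bar>s\<bar> powr p + \<bar>c j\<bar> powr p) / real n"
        by (rule divide_right_mono) simp
      then show "\<bar>s\<bar> powr (p - 1) * (\<bar>a j\<bar> / real n) \<le> (1 + \<bar>g j\<bar> powr p) / real n * (\<bar>s\<bar> powr p + \<bar>c j\<bar> powr p)"
        by (simp add: a_def abs_mult mult_ac)
    qed
    have s2: "(\<Sum>j<n. \<bar>a j\<bar> powr p) / real n \<le> E"
      unfolding sum_divide_distrib E_def
    proof (rule sum_mono)
      fix j
      have "\<bar>g j\<bar> powr p * \<bar>c j\<bar> powr p \<le> (1 + \<bar>g j\<bar> powr p) * (\<bar>s\<bar> powr p + \<bar>c j\<bar> powr p)"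
        by (intro mult_mono) auto
      then have "\<bar>g j\<bar> powr p * \<bar>c j\<bar> powr p / real n \<le> (1 + \<bar>g j\<bar> powr p) * (\<bar>s\<bar> powr p + \<bar>c j\<bar> powr p) / real n"
        by (rule divide_right_mono) simp
      then show "\<bar>a j\<bar> powr p / real n \<le> (1 + \<bar>g j\<bar> powr p) / real n * (\<bar>s\<bar> powr p + \<bar>c j\<bar> powr p)"
        by (simp add: a_def abs_mult powr_mult)
    qed
    have "(\<integral>\<^sup>+\<omega>. ennreal (\<bar>s + (\<Sum>j<n. a j * incr b n \<tau> k j \<omega>)\<bar> powr p) \<partial>M)
      \<le> (\<integral>\<^sup>+\<omega>. ennreal (\<bar>s\<bar> powr p) + (ennreal (16 * \<bar>s\<bar> powr (p - 1)) * ennreal (D \<omega>) + ennreal 16 * ennreal (D \<omega> powr p)) \<partial>M)"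
    proof (rule nn_integral_mono)
      fix \<omega>
      have "ennreal (\<bar>s + (\<Sum>j<n. a j * incr b n \<tau> k j \<omega>)\<bar> powr p) \<le> ennreal (\<bar>s\<bar> powr p + (16 * \<bar>s\<bar> powr (p - 1) * D \<omega> + 16 * D \<omega> powr p))"
        using pt[of \<omega>] by (intro ennreal_leI) (simp add: algebra_simps)
      also have "\<dots> = ennreal (\<bar>s\<bar> powr p) + (ennreal (16 * \<bar>s\<bar> powr (p - 1)) * ennreal (D \<omega>) + ennreal 16 * ennreal (D \<omega> powr p))"
        using D0[of \<omega>] by (simp add: ennreal_plus ennreal_mult del: ennreal_numeral)
      finally show "ennreal (\<bar>s + (\<Sum>j<n. a j * incr b n \<tau> k j \<omega>)\<bar> powr p)
        \<le> ennreal (\<bar>s\<bar> powr p) + (ennreal (16 * \<bar>s\<bar> powr (p - 1)) * ennreal (D \<omega>) + ennreal 16 * ennreal (D \<omega> powr p))" .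
    qed
    also have "\<dots> = ennreal (\<bar>s\<bar> powr p) + (ennreal (16 * \<bar>s\<bar> powr (p - 1)) * (\<integral>\<^sup>+\<omega>. ennreal (D \<omega>) \<partial>M) + ennreal 16 * (\<integral>\<^sup>+\<omega>. ennreal (D \<omega> powr p) \<partial>M))"
      by (simp add: nn_integral_add nn_integral_cmult emeasure_space_1 del: ennreal_numeral)
    also have "\<dots> \<le> ennreal (\<bar>s\<bar> powr p) + (ennreal (16 * \<bar>s\<bar> powr (p - 1)) * ennreal (C0 * \<tau> * ((\<Sum>j<n. \<bar>a j\<bar>) / real n))
        + ennreal 16 * ennreal (C0 * \<tau> * ((\<Sum>j<n. \<bar>a j\<bar> powr p) / real n)))"
      unfolding D_def by (intro add_left_mono add_mono mult_left_mono m1 mp \<tau> n) auto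
    also have "\<dots> = ennreal (\<bar>s\<bar> powr p) + ennreal (16 * \<bar>s\<bar> powr (p - 1) * (C0 * \<tau> * ((\<Sum>j<n. \<bar>a j\<bar>) / real n)) + 16 * (C0 * \<tau> * ((\<Sum>j<n. \<bar>a j\<bar> powr p) / real n)))"
    proof -
      have e: "ennreal x * ennreal y + ennreal z * ennreal w = ennreal (x * y + z * w)"
        if "0 \<le> x" "0 \<le> y" "0 \<le> z" "0 \<le> w" for x y z w
        using that by (simp add: ennreal_plus ennreal_mult)
      show ?thesis using C0 \<tau> by (subst e) (auto simp: sum_nonneg)
    qed
    also have "\<dots> \<le> ennreal (\<bar>s\<bar> powr p) + ennreal ((32 * C0 + 1) * \<tau> * E)"
    proof (intro add_left_mono ennreal_leI)
      have "16 * C0 * \<tau> * (\<bar>s\<bar> powr (p - 1) * ((\<Sum>j<n. \<bar>a j\<bar>) / real n)) \<le> 16 * C0 * \<tau> * E"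
        using C0 \<tau> by (intro mult_left_mono s1) auto
      moreover have "16 * C0 * \<tau> * ((\<Sum>j<n. \<bar>a j\<bar> powr p) / real n) \<le> 16 * C0 * \<tau> * E"
        using C0 \<tau> by (intro mult_left_mono s2) auto
      moreover have "(32 * C0 + 1) * \<tau> * E = 16 * C0 * \<tau> * E + 16 * C0 * \<tau> * E + \<tau> * E" by (simp add: algebra_simps)
      moreover have "0 \<le> \<tau> * E" using \<tau> E0 by simp
      moreover have "16 * \<bar>s\<bar> powr (p - 1) * (C0 * \<tau> * ((\<Sum>j<n. \<bar>a j\<bar>) / real n)) = 16 * C0 * \<tau> * (\<bar>s\<bar> powr (p - 1) * ((\<Sum>j<n. \<bar>a j\<bar>) / real n))"
        by simp
      moreover have "16 * (C0 * \<tau> * ((\<Sum>j<n. \<bar>a j\<bar> powr p) / real n)) = 16 * C0 * \<tau> * ((\<Sum>j<n. \<bar>a j\<bar> powr p) / real n)" by simp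
      ultimately show "16 * \<bar>s\<bar> powr (p - 1) * (C0 * \<tau> * ((\<Sum>j<n. \<bar>a j\<bar>) / real n)) + 16 * (C0 * \<tau> * ((\<Sum>j<n. \<bar>a j\<bar> powr p) / real n)) \<le> (32 * C0 + 1) * \<tau> * E"
        by linarith
    qed
    also have "ennreal ((32 * C0 + 1) * \<tau> * E) = ennreal ((32 * C0 + 1) * \<tau>) * ennreal E"
      using C0 \<tau> E0 by (intro ennreal_mult) auto
    also have "ennreal E = (\<Sum>j<n. ennreal ((1 + \<bar>g j\<bar> powr p) / real n) * (ennreal (\<bar>s\<bar> powr p) + ennreal (\<bar>c j\<bar> powr p)))"
      unfolding E_def
      by (subst sum_ennreal[symmetric]) (auto intro!: sum.cong simp: ennreal_plus[symmetric] ennreal_mult[symmetric] simp del: ennreal_plus)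
    finally show "(\<integral>\<^sup>+\<omega>. ennreal (\<bar>s + (\<Sum>j<n. (g j * c j) * incr b n \<tau> k j \<omega>)\<bar> powr p) \<partial>M)
      \<le> ennreal (\<bar>s\<bar> powr p) + ennreal ((32 * C0 + 1) * \<tau>) * (\<Sum>j<n. ennreal ((1 + \<bar>g j\<bar> powr p) / real n) * (ennreal (\<bar>s\<bar> powr p) + ennreal (\<bar>c j\<bar> powr p)))"
      by (simp only: a_def)
  qed
qed

lemma scheme_rhs_Suc:
  "scheme_rhs b \<sigma> u0 \<theta> n \<tau> i (Suc m) x V \<omega> = scheme_rhs b \<sigma> u0 \<theta> n \<tau> i m x V \<omega>
     + (\<Sum>j<n. (kern2 \<theta> n \<tau> (i - Suc m) x j * \<sigma> (V m j \<omega>)) * incr b n \<tau> m j \<omega>)"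
  by (simp add: scheme_rhs_def)

lemma scheme_rhs_moment_step:
  fixes b \<theta> \<rho> \<epsilon> p L :: real and \<sigma> :: "real \<Rightarrow> real"
  assumes \<theta>: "0 \<le> \<theta>" "\<theta> \<le> 1" and p: "2 \<le> p" "p < 3" and L: "L-lipschitz_on UNIV \<sigma>"
  obtains c where "0 < c"
    and "\<And>n \<tau> u0 i m x V A \<Phi>. step_size_condition \<theta> \<rho> \<epsilon> n \<tau> \<Longrightarrow> m < i \<Longrightarrow> 0 \<le> A \<Longrightarrow> 0 \<le> \<Phi> \<Longrightarrow>
      (\<And>k j. k \<le> m \<Longrightarrow> j < n \<Longrightarrow> V k j \<in> borel_measurable (F (real k * \<tau>))) \<Longrightarrow>
      (\<And>j. j < n \<Longrightarrow> 1 + (\<integral>\<^sup>+\<omega>. ennreal (\<bar>V m j \<omega>\<bar> powr p) \<partial>M) \<le> ennreal A) \<Longrightarrow>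
      (\<integral>\<^sup>+\<omega>. ennreal (\<bar>scheme_rhs b \<sigma> u0 \<theta> n \<tau> i m x V \<omega>\<bar> powr p) \<partial>M) \<le> ennreal \<Phi> \<Longrightarrow>
      (\<integral>\<^sup>+\<omega>. ennreal (\<bar>scheme_rhs b \<sigma> u0 \<theta> n \<tau> i (Suc m) x V \<omega>\<bar> powr p) \<partial>M)
        \<le> ennreal ((1 + c * (\<tau> * (1 + (real (i - m) * \<tau>) powr (- ((p - 1) / 2))))) * \<Phi>
             + c * (\<tau> * (1 + (real (i - m) * \<tau>) powr (- ((p - 1) / 2)))) * A)"
proof -
  obtain Ck where Ck: "0 < Ck" and lp: "\<And>n \<tau> k x. step_size_condition \<theta> \<rho> \<epsilon> n \<tau> \<Longrightarrow>
      (\<Sum>j<n. norm (G2 \<theta> n \<tau> (real k * \<tau>) x (real j / real n)) powr p) / real n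
        \<le> Ck * (1 + (real (k + 1) * \<tau>) powr (- ((p - 1) / 2)))"
    using kernel_lp_bound[OF \<theta> p(1), where \<rho> = \<rho> and \<epsilon> = \<epsilon>] by metis
  obtain C where C: "0 < C" and step: "\<And>n \<tau> k g c s. 0 < \<tau> \<Longrightarrow> \<tau> \<le> 1 \<Longrightarrow> 0 < n \<Longrightarrow>
      (\<integral>\<^sup>+\<omega>. ennreal (\<bar>s + (\<Sum>j<n. (g j * c j) * incr b n \<tau> k j \<omega>)\<bar> powr p) \<partial>M)
      \<le> ennreal (\<bar>s\<bar> powr p) + ennreal (C * \<tau>) * (\<Sum>j<n. ennreal ((1 + \<bar>g j\<bar> powr p) / real n) * (ennreal (\<bar>s\<bar> powr p) + ennreal (\<bar>c j\<bar> powr p)))"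
    by (rule incr_step_deterministic[OF p, where b = b]) (rule that)
  obtain c\<sigma> where c\<sigma>: "0 < c\<sigma>" and lip: "\<And>x. \<bar>\<sigma> x\<bar> powr p \<le> c\<sigma> * (1 + \<bar>x\<bar> powr p)"
    using lipschitz_moment[OF L, of p] p by auto
  have \<sigma>[measurable]: "\<sigma> \<in> borel_measurable borel"
    using lipschitz_on_continuous_on[OF L] by (rule borel_measurable_continuous_onI)
  show thesis
  proof (rule that[of "C * (1 + Ck) * (1 + c\<sigma>)"])
    show "0 < C * (1 + Ck) * (1 + c\<sigma>)" using C Ck c\<sigma> by simp
  next
    fix n i m :: nat and \<tau> x A \<Phi> :: real and u0 :: "real \<Rightarrow> real" and V :: "nat \<Rightarrow> nat \<Rightarrow> 'a \<Rightarrow> real"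
    assume S: "step_size_condition \<theta> \<rho> \<epsilon> n \<tau>" and m: "m < i" and A: "0 \<le> A" and \<Phi>: "0 \<le> \<Phi>"
      and V: "\<And>k j. k \<le> m \<Longrightarrow> j < n \<Longrightarrow> V k j \<in> borel_measurable (F (real k * \<tau>))"
      and VA: "\<And>j. j < n \<Longrightarrow> 1 + (\<integral>\<^sup>+\<omega>. ennreal (\<bar>V m j \<omega>\<bar> powr p) \<partial>M) \<le> ennreal A"
      and S\<Phi>: "(\<integral>\<^sup>+\<omega>. ennreal (\<bar>scheme_rhs b \<sigma> u0 \<theta> n \<tau> i m x V \<omega>\<bar> powr p) \<partial>M) \<le> ennreal \<Phi>"
    have n: "0 < n" and \<tau>: "0 < \<tau>" "\<tau> \<le> 1" using S by (auto simp: step_size_condition_def)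
    define g where "g j = kern2 \<theta> n \<tau> (i - Suc m) x j" for j
    define w where "w j = (1 + \<bar>g j\<bar> powr p) / real n" for j
    have w0: "0 \<le> w j" for j by (simp add: w_def add_nonneg_nonneg)
    define r where "r = 1 + (real (i - m) * \<tau>) powr (- ((p - 1) / 2))"
    have r: "1 \<le> r" by (simp add: r_def)
    have W: "(\<Sum>j<n. w j) \<le> (1 + Ck) * r"
    proof -
      have "(\<Sum>j<n. w j) = 1 + (\<Sum>j<n. \<bar>g j\<bar> powr p) / real n"
        using n by (simp add: w_def sum_divide_distrib[symmetric] sum.distrib add_divide_distrib)
      also have "(\<Sum>j<n. \<bar>g j\<bar> powr p) / real n \<le> (\<Sum>j<n. norm (G2 \<theta> n \<tau> (real (i - Suc m) * \<tau>) x (real j / real n)) powr p) / real n"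
        unfolding g_def using p by (intro divide_right_mono sum_mono powr_mono2 abs_kern2_le) auto
      also have "\<dots> \<le> Ck * r" using lp[OF S, of "i - Suc m" x] m by (simp add: r_def Suc_diff_Suc)
      finally show ?thesis using r by (simp add: algebra_simps)
    qed
    define Y where "Y = scheme_rhs b \<sigma> u0 \<theta> n \<tau> i m x V"
    have YF: "Y \<in> borel_measurable (F (real m * \<tau>))"
      unfolding Y_def by (rule scheme_rhs_measurable[OF n \<tau>(1) \<sigma>]) (use V in auto)
    have VF: "V m j \<in> borel_measurable (F (real m * \<tau>))" if "j < n" for j using V that by simp
    have [measurable]: "Y \<in> borel_measurable M" using YF by (rule measurable_F_M)
    have [measurable]: "V m j \<in> borel_measurable M" if "j < n" for j using VF[OF that] by (rule measurable_F_M)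
    have aF: "(\<lambda>\<omega>. g j * \<sigma> (V m j \<omega>)) \<in> borel_measurable (F (real m * \<tau>))" if "j < n" for j
    proof -
      note VF[OF that, measurable]
      show ?thesis by measurable
    qed
    have \<sigma>A: "(\<integral>\<^sup>+\<omega>. ennreal (\<bar>\<sigma> (V m j \<omega>)\<bar> powr p) \<partial>M) \<le> ennreal (c\<sigma> * A)" if j: "j < n" for j
    proof -
      have "(\<integral>\<^sup>+\<omega>. ennreal (\<bar>\<sigma> (V m j \<omega>)\<bar> powr p) \<partial>M) \<le> (\<integral>\<^sup>+\<omega>. ennreal c\<sigma> * (1 + ennreal (\<bar>V m j \<omega>\<bar> powr p)) \<partial>M)"
      proof (rule nn_integral_mono)
        fix \<omega>
        have "ennreal (\<bar>\<sigma> (V m j \<omega>)\<bar> powr p) \<le> ennreal (c\<sigma> * (1 + \<bar>V m j \<omega>\<bar> powr p))" by (intro ennreal_leI lip)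
        also have "\<dots> = ennreal c\<sigma> * (1 + ennreal (\<bar>V m j \<omega>\<bar> powr p))"
          using c\<sigma> by (simp add: ennreal_mult ennreal_plus)
        finally show "ennreal (\<bar>\<sigma> (V m j \<omega>)\<bar> powr p) \<le> ennreal c\<sigma> * (1 + ennreal (\<bar>V m j \<omega>\<bar> powr p))" .
      qed
      also have "\<dots> = ennreal c\<sigma> * (1 + (\<integral>\<^sup>+\<omega>. ennreal (\<bar>V m j \<omega>\<bar> powr p) \<partial>M))"
        using j by (simp add: nn_integral_cmult nn_integral_add emeasure_space_1)
      also have "\<dots> \<le> ennreal c\<sigma> * ennreal A" by (intro mult_left_mono VA j) simp
      also have "\<dots> = ennreal (c\<sigma> * A)" using c\<sigma> A by (simp add: ennreal_mult)
      finally show ?thesis .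
    qed
    have "(\<integral>\<^sup>+\<omega>. ennreal (\<bar>scheme_rhs b \<sigma> u0 \<theta> n \<tau> i (Suc m) x V \<omega>\<bar> powr p) \<partial>M)
      = (\<integral>\<^sup>+\<omega>. ennreal (\<bar>Y \<omega> + (\<Sum>j<n. (g j * \<sigma> (V m j \<omega>)) * incr b n \<tau> m j \<omega>)\<bar> powr p) \<partial>M)"
      by (simp only: scheme_rhs_Suc Y_def g_def)
    also have "\<dots> = (\<integral>\<^sup>+\<omega>. (\<integral>\<^sup>+\<omega>'. ennreal (\<bar>Y \<omega> + (\<Sum>j<n. (g j * \<sigma> (V m j \<omega>)) * incr b n \<tau> m j \<omega>')\<bar> powr p) \<partial>M) \<partial>M)"
      by (rule conditional_step[OF \<tau>(1) n YF aF])
    also have "\<dots> \<le> (\<integral>\<^sup>+\<omega>. ennreal (\<bar>Y \<omega>\<bar> powr p) + ennreal (C * \<tau>) * (\<Sum>j<n. ennreal (w j) * (ennreal (\<bar>Y \<omega>\<bar> powr p) + ennreal (\<bar>\<sigma> (V m j \<omega>)\<bar> powr p))) \<partial>M)"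
      unfolding w_def by (intro nn_integral_mono step \<tau> n)
    also have "\<dots> = (\<integral>\<^sup>+\<omega>. ennreal (\<bar>Y \<omega>\<bar> powr p) \<partial>M) + ennreal (C * \<tau>) * (\<integral>\<^sup>+\<omega>. (\<Sum>j<n. ennreal (w j) * (ennreal (\<bar>Y \<omega>\<bar> powr p) + ennreal (\<bar>\<sigma> (V m j \<omega>)\<bar> powr p))) \<partial>M)"
    proof -
      have Z: "(\<lambda>\<omega>. \<Sum>j<n. ennreal (w j) * (ennreal (\<bar>Y \<omega>\<bar> powr p) + ennreal (\<bar>\<sigma> (V m j \<omega>)\<bar> powr p))) \<in> borel_measurable M"
        by measurable
      show ?thesis by (simp only: nn_integral_cmult[OF Z, symmetric]) (rule nn_integral_add; use Z in measurable)
    qed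
    also have "(\<integral>\<^sup>+\<omega>. (\<Sum>j<n. ennreal (w j) * (ennreal (\<bar>Y \<omega>\<bar> powr p) + ennreal (\<bar>\<sigma> (V m j \<omega>)\<bar> powr p))) \<partial>M)
      = (\<Sum>j<n. ennreal (w j) * ((\<integral>\<^sup>+\<omega>. ennreal (\<bar>Y \<omega>\<bar> powr p) \<partial>M) + (\<integral>\<^sup>+\<omega>. ennreal (\<bar>\<sigma> (V m j \<omega>)\<bar> powr p) \<partial>M)))"
      by (subst nn_integral_sum) (auto simp: nn_integral_cmult nn_integral_add intro!: sum.cong)
    also have "(\<integral>\<^sup>+\<omega>. ennreal (\<bar>Y \<omega>\<bar> powr p) \<partial>M) + ennreal (C * \<tau>) * (\<Sum>j<n. ennreal (w j) * ((\<integral>\<^sup>+\<omega>. ennreal (\<bar>Y \<omega>\<bar> powr p) \<partial>M) + (\<integral>\<^sup>+\<omega>. ennreal (\<bar>\<sigma> (V m j \<omega>)\<bar> powr p) \<partial>M)))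
      \<le> ennreal \<Phi> + ennreal (C * \<tau>) * (\<Sum>j<n. ennreal (w j) * (ennreal \<Phi> + ennreal (c\<sigma> * A)))"
      by (intro add_mono mult_left_mono sum_mono S\<Phi>[folded Y_def] \<sigma>A) auto
    also have "\<dots> = ennreal (\<Phi> + C * \<tau> * ((\<Sum>j<n. w j) * (\<Phi> + c\<sigma> * A)))"
    proof -
      have "(\<Sum>j<n. ennreal (w j) * (ennreal \<Phi> + ennreal (c\<sigma> * A))) = (\<Sum>j<n. ennreal (w j * (\<Phi> + c\<sigma> * A)))"
        using \<Phi> c\<sigma> A w0 by (intro sum.cong refl) (simp add: ennreal_mult ennreal_plus)
      also have "\<dots> = ennreal ((\<Sum>j<n. w j) * (\<Phi> + c\<sigma> * A))"
        using \<Phi> c\<sigma> A w0 by (subst sum_ennreal) (auto simp: sum_distrib_right)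
      finally show ?thesis using \<Phi> c\<sigma> A w0 C \<tau> by (simp add: ennreal_mult ennreal_plus sum_nonneg)
    qed
    also have "\<dots> \<le> ennreal ((1 + C * (1 + Ck) * (1 + c\<sigma>) * (\<tau> * r)) * \<Phi> + C * (1 + Ck) * (1 + c\<sigma>) * (\<tau> * r) * A)"
    proof (rule ennreal_leI)
      have "(\<Sum>j<n. w j) * (\<Phi> + c\<sigma> * A) \<le> ((1 + Ck) * r) * ((1 + c\<sigma>) * (\<Phi> + A))"
      proof (intro mult_mono W)
        show "\<Phi> + c\<sigma> * A \<le> (1 + c\<sigma>) * (\<Phi> + A)" using c\<sigma> A \<Phi> by (simp add: algebra_simps)
      qed (use Ck r \<Phi> c\<sigma> A in auto)
      then have "C * \<tau> * ((\<Sum>j<n. w j) * (\<Phi> + c\<sigma> * A)) \<le> C * \<tau> * (((1 + Ck) * r) * ((1 + c\<sigma>) * (\<Phi> + A)))"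
        using C \<tau> by (intro mult_left_mono) auto
      then show "\<Phi> + C * \<tau> * ((\<Sum>j<n. w j) * (\<Phi> + c\<sigma> * A))
        \<le> (1 + C * (1 + Ck) * (1 + c\<sigma>) * (\<tau> * r)) * \<Phi> + C * (1 + Ck) * (1 + c\<sigma>) * (\<tau> * r) * A"
        by (simp add: algebra_simps)
    qed
    finally show "(\<integral>\<^sup>+\<omega>. ennreal (\<bar>scheme_rhs b \<sigma> u0 \<theta> n \<tau> i (Suc m) x V \<omega>\<bar> powr p) \<partial>M)
        \<le> ennreal ((1 + C * (1 + Ck) * (1 + c\<sigma>) * (\<tau> * (1 + (real (i - m) * \<tau>) powr (- ((p - 1) / 2))))) * \<Phi>
             + C * (1 + Ck) * (1 + c\<sigma>) * (\<tau> * (1 + (real (i - m) * \<tau>) powr (- ((p - 1) / 2)))) * A)"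
      unfolding r_def .
  qed
qed

lemma moment_bound_ge_2:
  fixes b \<theta> \<rho> \<epsilon> p L B :: real and \<sigma> u0 :: "real \<Rightarrow> real"
  assumes \<theta>: "0 \<le> \<theta>" "\<theta> \<le> 1" and p: "2 \<le> p" "p < 3" and L: "L-lipschitz_on UNIV \<sigma>"
    and B: "0 \<le> B" "\<forall>y\<in>{0..1}. \<bar>u0 y\<bar> \<le> B"
  obtains Q \<beta> where "0 < Q" "0 < \<beta>"
    and "\<And>n \<tau> u i x. step_size_condition \<theta> \<rho> \<epsilon> n \<tau> \<Longrightarrow> mild_solution M F lam mu b \<sigma> u0 \<theta> n \<tau> u \<Longrightarrow> x \<in> {0..1} \<Longrightarrow>
      1 + (\<integral>\<^sup>+\<omega>. ennreal (\<bar>u (real i * \<tau>) x \<omega>\<bar> powr p) \<partial>M) \<le> ennreal (Q * exp (\<beta> * (real i * \<tau>)))"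
proof -
  define \<alpha> where "\<alpha> = (p - 1) / 2"
  have \<alpha>: "0 < \<alpha>" "\<alpha> < 1" using p by (auto simp: \<alpha>_def)
  obtain c where c: "0 < c" and step: "\<And>n \<tau> u0 i m x V A \<Phi>. step_size_condition \<theta> \<rho> \<epsilon> n \<tau> \<Longrightarrow> m < i \<Longrightarrow> 0 \<le> A \<Longrightarrow> 0 \<le> \<Phi> \<Longrightarrow>
      (\<And>k j. k \<le> m \<Longrightarrow> j < n \<Longrightarrow> V k j \<in> borel_measurable (F (real k * \<tau>))) \<Longrightarrow>
      (\<And>j. j < n \<Longrightarrow> 1 + (\<integral>\<^sup>+\<omega>. ennreal (\<bar>V m j \<omega>\<bar> powr p) \<partial>M) \<le> ennreal A) \<Longrightarrow>
      (\<integral>\<^sup>+\<omega>. ennreal (\<bar>scheme_rhs b \<sigma> u0 \<theta> n \<tau> i m x V \<omega>\<bar> powr p) \<partial>M) \<le> ennreal \<Phi> \<Longrightarrow>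
      (\<integral>\<^sup>+\<omega>. ennreal (\<bar>scheme_rhs b \<sigma> u0 \<theta> n \<tau> i (Suc m) x V \<omega>\<bar> powr p) \<partial>M)
        \<le> ennreal ((1 + c * (\<tau> * (1 + (real (i - m) * \<tau>) powr (- \<alpha>)))) * \<Phi>
             + c * (\<tau> * (1 + (real (i - m) * \<tau>) powr (- \<alpha>))) * A)"
    using scheme_rhs_moment_step[OF \<theta> p L, where b = b and \<rho> = \<rho> and \<epsilon> = \<epsilon>, folded \<alpha>_def] by blast
  obtain C1 where C1: "0 < C1" and l1: "\<And>n \<tau> k x. step_size_condition \<theta> \<rho> \<epsilon> n \<tau> \<Longrightarrow> x \<in> {0..1} \<Longrightarrow>
      (\<Sum>j<n. norm (G1 \<theta> n \<tau> (real (k + 1) * \<tau>) x (real j / real n))) / real n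
        \<le> C1 * exp (C1 * (real (k + 1) * \<tau>))"
    by (rule kernel_l1_bound_uniform[OF \<theta>, where \<rho> = \<rho> and \<epsilon> = \<epsilon>]) (rule that)
  define D where "D = max ((B * C1) powr p) (p * C1) + 1"
  have D: "0 < D" "(B * C1) powr p \<le> D" "p * C1 \<le> D"
    using p C1 unfolding D_def by (auto simp: max_def intro: add_nonneg_pos)
  obtain Q \<beta> where Q: "0 < Q" "0 < \<beta>" "1 + B powr p \<le> Q"
    and vol: "\<And>\<tau> i \<Phi>. 0 < \<tau> \<Longrightarrow> 0 \<le> \<Phi> 0 \<Longrightarrow> \<Phi> 0 \<le> D * exp (D * (real i * \<tau>)) \<Longrightarrow>
      (\<And>m. m < i \<Longrightarrow> \<Phi> (Suc m) \<le> (1 + c * (\<tau> * (1 + (real (i - m) * \<tau>) powr (- \<alpha>)))) * \<Phi> m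
          + c * (\<tau> * (1 + (real (i - m) * \<tau>) powr (- \<alpha>))) * (Q * exp (\<beta> * (real m * \<tau>)))) \<Longrightarrow>
      1 + \<Phi> i \<le> Q * exp (\<beta> * (real i * \<tau>))"
    using volterra_bound[OF \<alpha> c D(1), where ?Q0.0 = "1 + B powr p"] by blast
  have \<sigma>: "\<sigma> \<in> borel_measurable borel"
    using lipschitz_on_continuous_on[OF L] by (rule borel_measurable_continuous_onI)
  show thesis
  proof (rule that[OF Q(1,2)])
    fix n i :: nat and \<tau> x :: real and u
    assume S: "step_size_condition \<theta> \<rho> \<epsilon> n \<tau>" and u: "mild_solution M F lam mu b \<sigma> u0 \<theta> n \<tau> u" and x: "x \<in> {0..1}"
    have n: "0 < n" and \<tau>: "0 < \<tau>" using S by (auto simp: step_size_condition_def)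
    note u' = u[unfolded mild_solution_iff[OF n \<tau> \<sigma>]]
    show "1 + (\<integral>\<^sup>+\<omega>. ennreal (\<bar>u (real i * \<tau>) x \<omega>\<bar> powr p) \<partial>M) \<le> ennreal (Q * exp (\<beta> * (real i * \<tau>)))"
      using x
    proof (induction i arbitrary: x rule: less_induct)
      case (less i)
      show ?case
      proof (cases "i = 0")
        case True
        have "AE \<omega> in M. \<bar>u 0 x \<omega>\<bar> \<le> B"
        proof (cases "x = 1")
          case x1: True
          have "AE \<omega> in M. u 0 1 \<omega> = u0 0" using u' by (elim conjE)
          moreover have "\<bar>u0 0\<bar> \<le> B" by (rule B(2)[rule_format]) simp
          ultimately show ?thesis unfolding x1 by (auto elim: eventually_mono)
        next
          case False
          then have "x \<in> {0..<1}" using less.prems by simp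
          then have "AE \<omega> in M. u 0 x \<omega> = u0 (kappa_space n x)" using u' by (elim conjE) (erule bspec)
          moreover have "\<bar>u0 (kappa_space n x)\<bar> \<le> B"
            by (intro B(2)[rule_format] kappa_space_unit[OF n less.prems])
          ultimately show ?thesis by (auto elim: eventually_mono)
        qed
        then have "(\<integral>\<^sup>+\<omega>. ennreal (\<bar>u 0 x \<omega>\<bar> powr p) \<partial>M) \<le> (\<integral>\<^sup>+\<omega>. ennreal (B powr p) \<partial>M)"
          using p by (intro nn_integral_mono_AE) (auto elim!: eventually_mono intro!: ennreal_leI powr_mono2)
        also have "\<dots> = ennreal (B powr p)" by (simp add: emeasure_space_1)
        finally have "1 + (\<integral>\<^sup>+\<omega>. ennreal (\<bar>u 0 x \<omega>\<bar> powr p) \<partial>M) \<le> 1 + ennreal (B powr p)" by (rule add_left_mono)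
        also have "\<dots> = ennreal (1 + B powr p)" by simp
        also have "\<dots> \<le> ennreal Q" using Q by (intro ennreal_leI)
        finally show ?thesis using True by simp
      next
        case False
        define V where "V k j = u (real k * \<tau>) (real j / real n)" for k j
        have VF: "V k j \<in> borel_measurable (F (real k * \<tau>))" if "j < n" for k j
          using u' that by (auto simp: V_def)
        have VA: "1 + (\<integral>\<^sup>+\<omega>. ennreal (\<bar>V m j \<omega>\<bar> powr p) \<partial>M) \<le> ennreal (Q * exp (\<beta> * (real m * \<tau>)))"
          if "m < i" "j < n" for m j
          unfolding V_def using that by (intro less.IH) auto
        define \<Phi> where "\<Phi> = rec_nat (D * exp (D * (real i * \<tau>))) (\<lambda>m f. (1 + c * (\<tau> * (1 + (real (i - m) * \<tau>) powr (- \<alpha>)))) * f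
          + c * (\<tau> * (1 + (real (i - m) * \<tau>) powr (- \<alpha>))) * (Q * exp (\<beta> * (real m * \<tau>))))"
        have \<Phi>0: "\<Phi> 0 = D * exp (D * (real i * \<tau>))" by (simp add: \<Phi>_def)
        have \<Phi>S: "\<Phi> (Suc m) = (1 + c * (\<tau> * (1 + (real (i - m) * \<tau>) powr (- \<alpha>)))) * \<Phi> m
          + c * (\<tau> * (1 + (real (i - m) * \<tau>) powr (- \<alpha>))) * (Q * exp (\<beta> * (real m * \<tau>)))" for m
          by (simp add: \<Phi>_def)
        have \<Phi>nn: "0 \<le> \<Phi> m" for m
          using D c \<tau> Q by (induction m) (auto simp: \<Phi>0 \<Phi>S intro!: add_nonneg_nonneg mult_nonneg_nonneg)
        have init: "\<bar>initial_part \<theta> n \<tau> u0 i x\<bar> powr p \<le> \<Phi> 0"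
        proof -
          obtain k where k: "i = k + 1" using False by (metis Suc_eq_plus1 not0_implies_Suc)
          have "\<bar>initial_part \<theta> n \<tau> u0 i x\<bar> \<le> B * ((\<Sum>j<n. norm (G1 \<theta> n \<tau> (real i * \<tau>) x (real j / real n))) / real n)"
            by (rule initial_part_le[OF n B])
          also have "\<dots> \<le> B * (C1 * exp (C1 * (real i * \<tau>)))"
            unfolding k by (intro mult_left_mono l1 S less.prems B)
          finally have "\<bar>initial_part \<theta> n \<tau> u0 i x\<bar> \<le> B * C1 * exp (C1 * (real i * \<tau>))" by (simp add: mult.assoc)
          then have "\<bar>initial_part \<theta> n \<tau> u0 i x\<bar> powr p \<le> (B * C1 * exp (C1 * (real i * \<tau>))) powr p"
            using p by (intro powr_mono2) auto
          also have "\<dots> = (B * C1) powr p * exp (p * C1 * (real i * \<tau>))"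
            using B C1 by (simp add: powr_mult exp_powr_real mult_ac)
          also have "\<dots> \<le> D * exp (D * (real i * \<tau>))"
            using D \<tau> by (intro mult_mono) (auto intro!: mult_right_mono)
          finally show ?thesis unfolding \<Phi>0 .
        qed
        have SB: "(\<integral>\<^sup>+\<omega>. ennreal (\<bar>scheme_rhs b \<sigma> u0 \<theta> n \<tau> i m x V \<omega>\<bar> powr p) \<partial>M) \<le> ennreal (\<Phi> m)" if "m \<le> i" for m
          using that
        proof (induction m)
          case 0
          then show ?case using init by (simp add: scheme_rhs_def emeasure_space_1 ennreal_leI)
        next
          case (Suc m)
          show ?case unfolding \<Phi>S
            by (rule step[OF S]) (use Suc \<Phi>nn VF VA Q in auto)
        qed
        have "1 + (\<integral>\<^sup>+\<omega>. ennreal (\<bar>u (real i * \<tau>) x \<omega>\<bar> powr p) \<partial>M)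
          = 1 + (\<integral>\<^sup>+\<omega>. ennreal (\<bar>scheme_rhs b \<sigma> u0 \<theta> n \<tau> i i x V \<omega>\<bar> powr p) \<partial>M)"
        proof -
          have "AE \<omega> in M. u (real i * \<tau>) x \<omega> = scheme_rhs b \<sigma> u0 \<theta> n \<tau> i i x V \<omega>"
            using conjunct2[OF conjunct2[OF conjunct2[OF u']]] False less.prems by (simp add: V_def[abs_def])
          then show ?thesis by (intro arg_cong[where f = "(+) 1"] nn_integral_cong_AE) (auto elim!: eventually_mono)
        qed
        also have "\<dots> \<le> 1 + ennreal (\<Phi> i)" by (intro add_left_mono SB) simp
        also have "\<dots> = ennreal (1 + \<Phi> i)" using \<Phi>nn by simp
        also have "\<dots> \<le> ennreal (Q * exp (\<beta> * (real i * \<tau>)))"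
          by (intro ennreal_leI vol \<tau>) (auto simp: \<Phi>S \<Phi>nn \<Phi>0[symmetric])
        finally show ?thesis .
      qed
    qed
  qed
qed

lemma moment_bound:
  fixes b \<theta> \<rho> \<epsilon> p L B :: real and \<sigma> u0 :: "real \<Rightarrow> real"
  assumes \<theta>: "0 \<le> \<theta>" "\<theta> \<le> 1" and p: "1 \<le> p" "p < 3" and L: "L-lipschitz_on UNIV \<sigma>"
    and B: "0 \<le> B" "\<forall>y\<in>{0..1}. \<bar>u0 y\<bar> \<le> B"
  obtains C where "0 < C"
    and "\<And>n \<tau> u i. step_size_condition \<theta> \<rho> \<epsilon> n \<tau> \<Longrightarrow> mild_solution M F lam mu b \<sigma> u0 \<theta> n \<tau> u \<Longrightarrow>
      (SUP x\<in>{0..1}. moment M u p (real i * \<tau>) (kappa_space n x)) \<le> ennreal (C * exp (C * (real i * \<tau>)))"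
proof -
  define p' where "p' = max 2 p"
  have p': "2 \<le> p'" "p' < 3" "p \<le> p'" using p by (auto simp: p'_def)
  obtain Q \<beta> where Q: "0 < Q" "0 < \<beta>"
    and bd: "\<And>n \<tau> u i x. step_size_condition \<theta> \<rho> \<epsilon> n \<tau> \<Longrightarrow> mild_solution M F lam mu b \<sigma> u0 \<theta> n \<tau> u \<Longrightarrow> x \<in> {0..1} \<Longrightarrow>
      1 + (\<integral>\<^sup>+\<omega>. ennreal (\<bar>u (real i * \<tau>) x \<omega>\<bar> powr p') \<partial>M) \<le> ennreal (Q * exp (\<beta> * (real i * \<tau>)))"
    using moment_bound_ge_2[OF \<theta> p'(1,2) L B, where b = b and \<rho> = \<rho> and \<epsilon> = \<epsilon>] by blast
  have \<sigma>: "\<sigma> \<in> borel_measurable borel"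
    using lipschitz_on_continuous_on[OF L] by (rule borel_measurable_continuous_onI)
  show thesis
  proof (rule that[of "max Q \<beta>"])
    show "0 < max Q \<beta>" using Q by simp
  next
    fix n i :: nat and \<tau> :: real and u
    assume S: "step_size_condition \<theta> \<rho> \<epsilon> n \<tau>" and u: "mild_solution M F lam mu b \<sigma> u0 \<theta> n \<tau> u"
    have n: "0 < n" and \<tau>: "0 < \<tau>" using S by (auto simp: step_size_condition_def)
    have "moment M u p (real i * \<tau>) (kappa_space n x) \<le> ennreal (max Q \<beta> * exp (max Q \<beta> * (real i * \<tau>)))" if x: "x \<in> {0..1}" for x
    proof -
      have y: "kappa_space n x \<in> {0..1}" by (rule kappa_space_unit[OF n x])
      have "u (real i * \<tau>) (kappa_space n x) \<in> borel_measurable (F (real i * \<tau>))"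
        using u y unfolding mild_solution_def by blast
      then have [measurable]: "u (real i * \<tau>) (kappa_space n x) \<in> borel_measurable M" by (rule measurable_F_M)
      have "moment M u p (real i * \<tau>) (kappa_space n x) \<le> (\<integral>\<^sup>+\<omega>. 1 + ennreal (\<bar>u (real i * \<tau>) (kappa_space n x) \<omega>\<bar> powr p') \<partial>M)"
        unfolding moment_def
      proof (rule nn_integral_mono)
        fix \<omega>
        have "ennreal (\<bar>u (real i * \<tau>) (kappa_space n x) \<omega>\<bar> powr p) \<le> ennreal (1 + \<bar>u (real i * \<tau>) (kappa_space n x) \<omega>\<bar> powr p')"
          using p p' by (intro ennreal_leI powr_le_one_plus) auto
        then show "ennreal (\<bar>u (real i * \<tau>) (kappa_space n x) \<omega>\<bar> powr p) \<le> 1 + ennreal (\<bar>u (real i * \<tau>) (kappa_space n x) \<omega>\<bar> powr p')" by simp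
      qed
      also have "\<dots> = 1 + (\<integral>\<^sup>+\<omega>. ennreal (\<bar>u (real i * \<tau>) (kappa_space n x) \<omega>\<bar> powr p') \<partial>M)"
        by (simp add: nn_integral_add emeasure_space_1)
      also have "\<dots> \<le> ennreal (Q * exp (\<beta> * (real i * \<tau>)))" by (rule bd[OF S u y])
      also have "\<dots> \<le> ennreal (max Q \<beta> * exp (max Q \<beta> * (real i * \<tau>)))"
        using Q \<tau> by (intro ennreal_leI mult_mono) (auto intro!: mult_right_mono)
      finally show ?thesis .
    qed
    then show "(SUP x\<in>{0..1}. moment M u p (real i * \<tau>) (kappa_space n x)) \<le> ennreal (max Q \<beta> * exp (max Q \<beta> * (real i * \<tau>)))"
      by (rule SUP_least)
  qed
qed

end

section \<open>Intermittency\<close>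

lemma e_fun_zero [simp]: "e_fun 0 x = 1"
  by (simp add: e_fun_def)

lemma sum_e_fun_grid:
  assumes "0 < n" "l < n"
  shows "(\<Sum>j<n. e_fun l (real j / real n)) = (if l = 0 then of_nat n else 0)"
  using sum_e_fun_orthogonal[OF assms(1,2,1)] by simp

lemma R1_zero [simp]: "R1 \<theta> n \<tau> 0 = 1" and R2_zero [simp]: "R2 \<theta> n \<tau> 0 = 1"
  by (simp_all add: R1_def R2_def lambda_disc_def)

lemma sum_kern2:
  assumes n: "0 < n" and \<tau>: "0 < \<tau>"
  shows "(\<Sum>q<n. kern2 \<theta> n \<tau> k (real q / real n) j) = real n"
proof -
  define w where "w l = (R1 \<theta> n \<tau> l * R2 \<theta> n \<tau> l) ^ k * R1 \<theta> n \<tau> l" for l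
  have "(\<Sum>q<n. G2 \<theta> n \<tau> (real k * \<tau>) (real q / real n) (real j / real n))
    = (\<Sum>l<n. of_real (w l) * cnj (e_fun l (real j / real n)) * (\<Sum>q<n. e_fun l (real q / real n)))"
    unfolding G2_grid[OF n \<tau>] kappa_space_grid[OF n] w_def
    by (subst sum.swap) (auto intro!: sum.cong simp: sum_distrib_left sum_distrib_right mult_ac)
  also have "\<dots> = (\<Sum>l<n. if l = 0 then of_nat n else 0)"
    by (intro sum.cong refl) (auto simp: sum_e_fun_grid[OF n] w_def)
  also have "\<dots> = of_nat n" using n by simp
  finally have "Re (\<Sum>q<n. G2 \<theta> n \<tau> (real k * \<tau>) (real q / real n) (real j / real n)) = real n" by simp
  then show ?thesis by (simp add: kern2_def)
qed

lemma initial_part_const: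
  assumes n: "0 < n" and \<tau>: "0 < \<tau>" and c: "\<forall>y\<in>{0..1}. u0 y = c"
  shows "initial_part \<theta> n \<tau> u0 i x = c"
proof -
  define w where "w l = (R1 \<theta> n \<tau> l * R2 \<theta> n \<tau> l) ^ i" for l
  have "(\<Sum>j<n. G1 \<theta> n \<tau> (real i * \<tau>) x (real j / real n))
    = (\<Sum>l<n. of_real (w l) * e_fun l (kappa_space n x) * cnj (\<Sum>j<n. e_fun l (real j / real n)))"
    unfolding G1_grid[OF n \<tau>] w_def
    by (subst sum.swap) (auto intro!: sum.cong simp: sum_distrib_left)
  also have "\<dots> = (\<Sum>l<n. if l = 0 then of_nat n else 0)"
    by (intro sum.cong refl) (auto simp: sum_e_fun_grid[OF n] w_def)
  also have "\<dots> = of_nat n" using n by simp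
  finally have "Re (\<Sum>j<n. G1 \<theta> n \<tau> (real i * \<tau>) x (real j / real n)) = real n" by simp
  then have k: "(\<Sum>j<n. kern1 \<theta> n \<tau> i x j) = real n" by (simp add: kern1_def)
  have "initial_part \<theta> n \<tau> u0 i x = (\<Sum>j<n. kern1 \<theta> n \<tau> i x j * c) / real n"
    unfolding initial_part_def by (intro arg_cong2[where f = "(/)"] sum.cong refl) (auto simp: c)
  then show ?thesis using n k by (simp add: sum_distrib_right[symmetric])
qed

lemma kern2_eventually_ge_half:
  assumes \<theta>: "0 \<le> \<theta>" "\<theta> \<le> 1" and S: "step_size_condition \<theta> \<rho> \<epsilon> n \<tau>"
  obtains k where "\<And>x j. 1 / 2 \<le> kern2 \<theta> n \<tau> k x j"
proof -
  obtain K c e where K: "1 \<le> K" "0 < c" and dec: "\<And>n \<tau> l k. step_size_condition \<theta> \<rho> \<epsilon> n \<tau> \<Longrightarrow>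
      \<bar>R1 \<theta> n \<tau> l * R2 \<theta> n \<tau> l\<bar> ^ k * R1 \<theta> n \<tau> l
        \<le> K / (1 + c * real (k + 1) * (- (\<tau> * lambda_disc n l)))"
    using multiplier_decay[OF \<theta>, of \<rho> \<epsilon>] by metis
  have n: "0 < n" and \<tau>: "0 < \<tau>" using S by (auto simp: step_size_condition_def)
  obtain k where k: "2 * real n * K / (16 * c * \<tau>) < real k" using reals_Archimedean2 by blast
  have k': "2 * real n * K \<le> 16 * c * \<tau> * real (k + 1)"
  proof -
    have "0 < 16 * c * \<tau>" using K \<tau> by simp
    then have "2 * real n * K < real k * (16 * c * \<tau>)" using k by (simp only: pos_divide_less_eq)
    moreover have "real k * (16 * c * \<tau>) \<le> real (k + 1) * (16 * c * \<tau>)" using K \<tau> by (intro mult_right_mono) auto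
    moreover have "real (k + 1) * (16 * c * \<tau>) = 16 * c * \<tau> * real (k + 1)" by (rule mult.commute)
    ultimately show ?thesis by linarith
  qed
  have pos: "0 < 16 * c * \<tau> * real (k + 1)" using K \<tau> by simp
  show thesis
  proof (rule that[of k])
    fix x j
    define t where "t l = of_real ((R1 \<theta> n \<tau> l * R2 \<theta> n \<tau> l) ^ k * R1 \<theta> n \<tau> l) * e_fun l (kappa_space n x)
       * cnj (e_fun l (real j / real n))" for l
    have small: "norm (t l) \<le> 1 / (2 * real n)" if l: "l \<in> {1..<n}" for l
    proof -
      have "norm (t l) = \<bar>R1 \<theta> n \<tau> l * R2 \<theta> n \<tau> l\<bar> ^ k * R1 \<theta> n \<tau> l"
        using R1_bounds(1)[OF \<theta>(1), of \<tau> n l] \<tau>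
        by (simp add: t_def norm_mult norm_power norm_e_fun power_abs[symmetric] abs_mult)
      also have "\<dots> \<le> K / (1 + c * real (k + 1) * (- (\<tau> * lambda_disc n l)))" by (rule dec[OF S])
      also have "\<dots> \<le> K / (16 * c * \<tau> * real (k + 1))"
      proof -
        have "16 * 1 \<le> 16 * (real (min l (n - l)))\<^sup>2" using l by (intro mult_left_mono) auto
        also have "\<dots> \<le> - lambda_disc n l" by (rule neg_lambda_disc_ge) (use n l in auto)
        finally have "c * real (k + 1) * \<tau> * 16 \<le> c * real (k + 1) * \<tau> * (- lambda_disc n l)"
          using K \<tau> by (intro mult_left_mono) auto
        then have "16 * c * \<tau> * real (k + 1) \<le> 1 + c * real (k + 1) * (- (\<tau> * lambda_disc n l))" by (simp add: mult_ac)
        note den = this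
        show ?thesis
          by (rule divide_left_mono[OF den _ mult_pos_pos[OF less_le_trans[OF pos den] pos]]) (use K in simp)
      qed
      also have "\<dots> \<le> 1 / (2 * real n)"
      proof -
        have "K / A \<le> 1 / N" if "N * K \<le> A" "0 < A" "0 < N" for A N :: real
          using that by (simp add: field_simps)
        then show ?thesis using k' pos n by simp
      qed
      finally show ?thesis .
    qed
    have "(\<Sum>l<n. t l) = t 0 + (\<Sum>l\<in>{1..<n}. t l)"
      using n by (simp add: lessThan_atLeast0 sum.atLeast_Suc_lessThan)
    moreover have "t 0 = 1" by (simp add: t_def e_fun_def)
    moreover have "norm (\<Sum>l\<in>{1..<n}. t l) \<le> 1 / 2"
    proof -
      have "norm (\<Sum>l\<in>{1..<n}. t l) \<le> (\<Sum>l\<in>{1..<n}. 1 / (2 * real n))" by (rule sum_norm_le) (rule small)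
      also have "\<dots> \<le> 1 / 2" using n by (simp add: field_simps of_nat_diff)
      finally show ?thesis .
    qed
    moreover have "kern2 \<theta> n \<tau> k x j = Re (\<Sum>l<n. t l)" unfolding kern2_def G2_grid[OF n \<tau>] t_def ..
    ultimately show "1 / 2 \<le> kern2 \<theta> n \<tau> k x j"
      using abs_Re_le_cmod[of "\<Sum>l\<in>{1..<n}. t l"] by simp
  qed
qed

lemma ln_ennreal_lower: "0 < r \<Longrightarrow> ennreal r \<le> a \<Longrightarrow> ereal (ln r) \<le> ln_ennreal a"
proof (cases a)
  case (real s)
  assume "0 < r" "ennreal r \<le> a"
  then show ?thesis using real by (auto simp: ln_ennreal_def)
qed (auto simp: ln_ennreal_def)

lemma ln_ennreal_upper: "0 < r \<Longrightarrow> a \<le> ennreal r \<Longrightarrow> ln_ennreal a \<le> ereal (ln r)"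
proof (cases a)
  case (real s)
  assume "0 < r" "a \<le> ennreal r"
  then show ?thesis using real by (auto simp: ln_ennreal_def)
qed (auto simp: ln_ennreal_def top_unique)

lemma weakly_intermittentI:
  assumes \<tau>: "0 < \<tau>" and pos: "0 < a" "0 < g" "0 < C"
    and upper: "\<And>i. (SUP x\<in>{0..1}. moment M u p (real i * \<tau>) (kappa_space n x)) \<le> ennreal (C * exp (C * (real i * \<tau>)))"
    and lower: "\<And>i x. K \<le> i \<Longrightarrow> x \<in> {0..1} \<Longrightarrow> ennreal (a * exp (g * (real i * \<tau>))) \<le> moment M u p (real i * \<tau>) (kappa_space n x)"
  shows "weakly_intermittent M u n \<tau> p"
proof -
  define lo where "lo i = (INF x\<in>{0..1}. ln_ennreal (moment M u p (real i * \<tau>) (kappa_space n x))) / ereal (real i * \<tau>)" for i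
  define up where "up i = (SUP x\<in>{0..1}. ln_ennreal (moment M u p (real i * \<tau>) (kappa_space n x))) / ereal (real i * \<tau>)" for i
  have lo_def': "lower_moment_exponent M u n \<tau> p = liminf lo" and up_def': "upper_moment_exponent M u n \<tau> p = limsup up"
    by (simp_all add: lo_def[abs_def] up_def[abs_def] lower_moment_exponent_def upper_moment_exponent_def)
  have "\<forall>\<^sub>F i in sequentially. - ln a / (real i * \<tau>) < g / 2"
  proof (rule order_tendstoD)
    have "filterlim (\<lambda>i. \<tau> * real i) at_top sequentially"
      by (rule filterlim_tendsto_pos_mult_at_top[OF tendsto_const \<tau> filterlim_real_sequentially])
    then show "(\<lambda>i. - ln a / (real i * \<tau>)) \<longlonglongrightarrow> 0"
      by (intro real_tendsto_divide_at_top[OF tendsto_const]) (simp add: mult.commute)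
  qed (use pos in simp)
  then have "\<forall>\<^sub>F i in sequentially. ereal (g / 2) \<le> lo i"
    using eventually_ge_at_top[of "max K 1"]
  proof eventually_elim
    case (elim i)
    have t: "0 < real i * \<tau>" using elim \<tau> by simp
    have "ereal (ln (a * exp (g * (real i * \<tau>)))) \<le> (INF x\<in>{0..1}. ln_ennreal (moment M u p (real i * \<tau>) (kappa_space n x)))"
      using elim pos by (intro INF_greatest ln_ennreal_lower lower) auto
    then have "ereal (ln (a * exp (g * (real i * \<tau>)))) / ereal (real i * \<tau>) \<le> lo i"
      unfolding lo_def using t by (intro ereal_divide_right_mono) auto
    moreover have "g / 2 \<le> ln (a * exp (g * (real i * \<tau>))) / (real i * \<tau>)"
      using elim(1) pos t by (simp add: ln_mult field_simps)
    ultimately show ?case using t by (metis ereal_less_eq(3) order.trans ereal_divide less_irrefl)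
  qed
  then have "ereal (g / 2) \<le> liminf lo" by (rule Liminf_bounded)
  then have 1: "0 < liminf lo" using pos by (metis ereal_less(2) half_gt_zero less_le_trans)
  have "\<forall>\<^sub>F i in sequentially. up i \<le> ereal (\<bar>ln C\<bar> / \<tau> + C)"
    using eventually_ge_at_top[of 1]
  proof eventually_elim
    case (elim i)
    have t: "0 < real i * \<tau>" using elim \<tau> by simp
    have "(SUP x\<in>{0..1}. ln_ennreal (moment M u p (real i * \<tau>) (kappa_space n x))) \<le> ereal (ln (C * exp (C * (real i * \<tau>))))"
    proof (intro SUP_least ln_ennreal_upper)
      fix x :: real assume "x \<in> {0..1}"
      then have "moment M u p (real i * \<tau>) (kappa_space n x) \<le> (SUP x\<in>{0..1}. moment M u p (real i * \<tau>) (kappa_space n x))"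
        by (rule SUP_upper)
      then show "moment M u p (real i * \<tau>) (kappa_space n x) \<le> ennreal (C * exp (C * (real i * \<tau>)))"
        using upper by (rule order.trans)
    qed (use pos in simp)
    then have "up i \<le> ereal (ln (C * exp (C * (real i * \<tau>)))) / ereal (real i * \<tau>)"
      unfolding up_def using t by (intro ereal_divide_right_mono) auto
    moreover have "ln (C * exp (C * (real i * \<tau>))) / (real i * \<tau>) \<le> \<bar>ln C\<bar> / \<tau> + C"
    proof -
      have "ln (C * exp (C * s)) / s = ln C / s + C" if "0 < s" for s
        using pos that by (simp add: ln_mult add_divide_distrib)
      then have "ln (C * exp (C * (real i * \<tau>))) / (real i * \<tau>) = ln C / (real i * \<tau>) + C" using t .
      also have "\<dots> \<le> \<bar>ln C\<bar> / (real i * \<tau>) + C" using t by (intro add_right_mono divide_right_mono) auto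
      also have "\<dots> \<le> \<bar>ln C\<bar> / \<tau> + C" using elim \<tau> t by (intro add_right_mono divide_left_mono) auto
      finally show ?thesis .
    qed
    ultimately show ?case using t by (metis ereal_less_eq(3) order.trans ereal_divide less_irrefl)
  qed
  then have "limsup up \<le> ereal (\<bar>ln C\<bar> / \<tau> + C)" by (rule Limsup_bounded)
  then have 2: "limsup up < \<infinity>" by (metis ereal_infty_less(1) ereal_infty_less_eq(1) PInfty_neq_ereal(1))
  have "\<forall>\<^sub>F i in sequentially. lo i \<le> up i"
    using eventually_ge_at_top[of 1]
  proof eventually_elim
    case (elim i)
    have t: "0 < real i * \<tau>" using elim \<tau> by simp
    show ?case unfolding lo_def up_def
      using t by (intro ereal_divide_right_mono INF_le_SUP) auto
  qed
  then have "liminf lo \<le> liminf up" by (rule Liminf_mono)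
  also have "\<dots> \<le> limsup up" by (rule Liminf_le_Limsup) simp
  finally show ?thesis using 1 2 unfolding weakly_intermittent_def lo_def' up_def' by blast
qed

lemma J_const_le: "J_const \<sigma> * \<bar>x\<bar> \<le> \<bar>\<sigma> x\<bar>"
proof (cases "x = 0")
  case False
  have "J_const \<sigma> \<le> \<bar>\<sigma> x / x\<bar>"
    unfolding J_const_def by (rule cINF_lower) (use False in \<open>auto intro!: bdd_belowI2[of _ 0]\<close>)
  then show ?thesis using False by (simp add: pos_le_divide_eq)
qed simp

lemma exists_ge_average:
  fixes f :: "nat \<Rightarrow> real"
  assumes "0 < n"
  obtains j where "j < n" "\<bar>(\<Sum>j<n. f j) / real n\<bar> \<le> \<bar>f j\<bar>"
proof (rule ccontr)
  assume "\<not> thesis"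
  then have "\<And>j. j < n \<Longrightarrow> \<bar>f j\<bar> < \<bar>(\<Sum>j<n. f j) / real n\<bar>" using that by force
  then have "(\<Sum>j<n. \<bar>f j\<bar>) < (\<Sum>j<n. \<bar>(\<Sum>j<n. f j) / real n\<bar>)"
    using assms by (intro sum_strict_mono) auto
  also have "\<dots> = \<bar>\<Sum>j<n. f j\<bar>" using assms by simp
  finally show False using sum_abs[of f "{..<n}"] by linarith
qed

context levy_noise
begin

definition total_mass :: "real \<Rightarrow> (real \<Rightarrow> real) \<Rightarrow> real \<Rightarrow> nat \<Rightarrow> real \<Rightarrow> nat \<Rightarrow> (nat \<Rightarrow> nat \<Rightarrow> 'a \<Rightarrow> real) \<Rightarrow> 'a \<Rightarrow> real" where
  "total_mass b \<sigma> c n \<tau> m V \<omega> = c + (\<Sum>k<m. \<Sum>j<n. \<sigma> (V k j \<omega>) * incr b n \<tau> k j \<omega>)"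

lemma total_mass_measurable:
  assumes "0 < \<tau>" "\<sigma> \<in> borel_measurable borel"
    and V: "\<And>k j. k < m \<Longrightarrow> j < n \<Longrightarrow> V k j \<in> borel_measurable (F (real k * \<tau>))"
  shows "total_mass b \<sigma> c n \<tau> m V \<in> borel_measurable (F (real m * \<tau>))"
  unfolding total_mass_def[abs_def]
proof (intro borel_measurable_add borel_measurable_const borel_measurable_sum borel_measurable_times)
  fix k j assume k: "k \<in> {..<m}" and j: "j \<in> {..<n}"
  have le: "real (k + 1) * \<tau> \<le> real m * \<tau>" using k assms by (intro mult_right_mono) auto
  have "real k * \<tau> \<le> real m * \<tau>" using k assms by (intro mult_right_mono) auto
  then have "V k j \<in> borel_measurable (F (real m * \<tau>))" by (rule measurable_F_mono) (use V[of k j] k j in auto)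
  then show "(\<lambda>\<omega>. \<sigma> (V k j \<omega>)) \<in> borel_measurable (F (real m * \<tau>))" using assms(2) by (rule measurable_compose)
  show "incr b n \<tau> k j \<in> borel_measurable (F (real m * \<tau>))" using assms j le by (intro incr_measurable_F) auto
qed

lemma total_mass_eq_average:
  assumes S: "step_size_condition \<theta> \<rho> \<epsilon> n \<tau>" and \<sigma>: "\<sigma> \<in> borel_measurable borel"
    and c: "\<forall>y\<in>{0..1}. u0 y = c" and u: "mild_solution M F lam mu b \<sigma> u0 \<theta> n \<tau> u"
  shows "AE \<omega> in M. total_mass b \<sigma> c n \<tau> i (\<lambda>k j. u (real k * \<tau>) (real j / real n)) \<omega>
    = (\<Sum>q<n. u (real i * \<tau>) (real q / real n) \<omega>) / real n"
proof -
  have n: "0 < n" and \<tau>: "0 < \<tau>" using S by (auto simp: step_size_condition_def)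
  note u' = u[unfolded mild_solution_iff[OF n \<tau> \<sigma>]]
  show ?thesis
  proof (cases "i = 0")
    case True
    have "AE \<omega> in M. \<forall>q\<in>{..<n}. u 0 (real q / real n) \<omega> = c"
    proof (rule AE_finite_allI)
      fix q assume q: "q \<in> {..<n}"
      then have "real q / real n \<in> {0..<1}" by simp
      then have "AE \<omega> in M. u 0 (real q / real n) \<omega> = u0 (kappa_space n (real q / real n))"
        using u' by (elim conjE) (erule bspec)
      moreover have "u0 (kappa_space n (real q / real n)) = c" using n q by (simp add: c)
      ultimately show "AE \<omega> in M. u 0 (real q / real n) \<omega> = c" by simp
    qed simp
    then show ?thesis
    proof eventually_elim
      case (elim \<omega>)
      then show ?case using n True by (simp add: total_mass_def)
    qed
  next
    case False
    define V where "V k j = u (real k * \<tau>) (real j / real n)" for k j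
    have "AE \<omega> in M. \<forall>q\<in>{..<n}. u (real i * \<tau>) (real q / real n) \<omega> = scheme_rhs b \<sigma> u0 \<theta> n \<tau> i i (real q / real n) V \<omega>"
    proof (rule AE_finite_allI)
      fix q assume "q \<in> {..<n}"
      then have "real q / real n \<in> {0..1}" by simp
      then show "AE \<omega> in M. u (real i * \<tau>) (real q / real n) \<omega> = scheme_rhs b \<sigma> u0 \<theta> n \<tau> i i (real q / real n) V \<omega>"
        using conjunct2[OF conjunct2[OF conjunct2[OF u']]] False by (simp add: V_def[abs_def])
    qed simp
    then have "AE \<omega> in M. total_mass b \<sigma> c n \<tau> i V \<omega> = (\<Sum>q<n. u (real i * \<tau>) (real q / real n) \<omega>) / real n"
    proof eventually_elim
      case (elim \<omega>)
      have "(\<Sum>q<n. u (real i * \<tau>) (real q / real n) \<omega>) = (\<Sum>q<n. scheme_rhs b \<sigma> u0 \<theta> n \<tau> i i (real q / real n) V \<omega>)"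
        using elim by (intro sum.cong) auto
      also have "\<dots> = real n * c + (\<Sum>q<n. \<Sum>k<i. \<Sum>j<n. (kern2 \<theta> n \<tau> (i - Suc k) (real q / real n) j * \<sigma> (V k j \<omega>)) * incr b n \<tau> k j \<omega>)"
        by (simp add: scheme_rhs_def sum.distrib initial_part_const[OF n \<tau> c])
      also have "(\<Sum>q<n. \<Sum>k<i. \<Sum>j<n. (kern2 \<theta> n \<tau> (i - Suc k) (real q / real n) j * \<sigma> (V k j \<omega>)) * incr b n \<tau> k j \<omega>)
        = (\<Sum>k<i. \<Sum>j<n. \<Sum>q<n. (kern2 \<theta> n \<tau> (i - Suc k) (real q / real n) j * \<sigma> (V k j \<omega>)) * incr b n \<tau> k j \<omega>)"
        by (subst sum.swap) (intro sum.cong refl sum.swap)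
      also have "\<dots> = (\<Sum>k<i. \<Sum>j<n. real n * (\<sigma> (V k j \<omega>) * incr b n \<tau> k j \<omega>))"
        unfolding mult.assoc by (simp add: sum_distrib_right[symmetric] sum_kern2[OF n \<tau>])
      also have "\<dots> = real n * (\<Sum>k<i. \<Sum>j<n. \<sigma> (V k j \<omega>) * incr b n \<tau> k j \<omega>)"
        by (simp add: sum_distrib_left)
      finally show ?case using n by (simp add: total_mass_def add_divide_distrib)
    qed
    then show ?thesis by (simp add: V_def[abs_def])
  qed
qed

end

context centered_levy_noise
begin

lemma intermittency_lower_bound:
  fixes c :: real and \<sigma> u0 :: "real \<Rightarrow> real"
  assumes \<theta>: "0 \<le> \<theta>" "\<theta> \<le> 1" and S: "step_size_condition \<theta> \<rho> \<epsilon> n \<tau>" and \<sigma>: "\<sigma> \<in> borel_measurable borel"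
    and J: "0 < J_const \<sigma>" and c: "0 < c" "\<forall>y\<in>{0..1}. u0 y = c"
    and u: "mild_solution M F lam mu b \<sigma> u0 \<theta> n \<tau> u" and p: "1 < p"
  obtains a g K where "0 < a" "0 < g"
    and "\<And>i x. K \<le> i \<Longrightarrow> x \<in> {0..1} \<Longrightarrow> ennreal (a * exp (g * (real i * \<tau>))) \<le> (\<integral>\<^sup>+\<omega>. ennreal (\<bar>u (real i * \<tau>) x \<omega>\<bar> powr p) \<partial>M)"
proof -
  have n: "0 < n" and \<tau>: "0 < \<tau>" using S by (auto simp: step_size_condition_def)
  note u' = u[unfolded mild_solution_iff[OF n \<tau> \<sigma>]]
  define J where "J = J_const \<sigma>"
  have J0: "0 < J" and J\<sigma>: "J * \<bar>x\<bar> \<le> \<bar>\<sigma> x\<bar>" for x using J J_const_le by (auto simp: J_def)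
  define V where "V k j = u (real k * \<tau>) (real j / real n)" for k j
  have VF: "V k j \<in> borel_measurable (F (real k * \<tau>))" if "j < n" for k j
    using u' that by (auto simp: V_def)
  have \<sigma>VF: "(\<lambda>\<omega>. g * \<sigma> (V k j \<omega>)) \<in> borel_measurable (F (real k * \<tau>))" if "j < n" for k j g
  proof -
    note VF[OF that, measurable] \<sigma>[measurable]
    show ?thesis by measurable
  qed
  define Z where "Z m = total_mass b \<sigma> c n \<tau> m V" for m
  have ZF: "Z m \<in> borel_measurable (F (real m * \<tau>))" for m
    unfolding Z_def by (rule total_mass_measurable[OF \<tau> \<sigma>]) (use VF in auto)
  have big: "AE \<omega> in M. \<exists>j<n. J * \<bar>Z m \<omega>\<bar> \<le> \<bar>\<sigma> (V m j \<omega>)\<bar>" for m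
  proof -
    have "AE \<omega> in M. Z m \<omega> = (\<Sum>q<n. V m q \<omega>) / real n"
      unfolding Z_def V_def[abs_def] by (rule total_mass_eq_average[OF S \<sigma> c(2) u])
    then show ?thesis
    proof eventually_elim
      case (elim \<omega>)
      obtain j where j: "j < n" "\<bar>(\<Sum>q<n. V m q \<omega>) / real n\<bar> \<le> \<bar>V m j \<omega>\<bar>"
        using exists_ge_average[OF n, of "\<lambda>j. V m j \<omega>"] by blast
      have "J * \<bar>Z m \<omega>\<bar> \<le> J * \<bar>V m j \<omega>\<bar>" using j elim J0 by (intro mult_left_mono) auto
      then show ?case using j J\<sigma>[of "V m j \<omega>"] by (intro exI[of _ j]) linarith
    qed
  qed
  obtain \<kappa> where \<kappa>: "0 < \<kappa>" and nd: "\<And>k a x i. i < n \<Longrightarrow> \<kappa> * \<bar>a i\<bar> \<le> (\<integral>\<omega>. \<bar>x + (\<Sum>j<n. a j * incr b n \<tau> k j \<omega>)\<bar> \<partial>M)"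
    using incr_nondegenerate[OF \<tau> n] by blast
  obtain \<delta> where \<delta>: "0 < \<delta>" and grow: "\<And>k a x. \<exists>i<n. J * \<bar>x\<bar> \<le> \<bar>a i\<bar> \<Longrightarrow>
      ennreal ((1 + \<delta>) * \<bar>x\<bar> powr p) \<le> (\<integral>\<^sup>+\<omega>. ennreal (\<bar>x + (\<Sum>j<n. a j * incr b n \<tau> k j \<omega>)\<bar> powr p) \<partial>M)"
    using incr_moment_growth[OF \<tau> n p J0] by blast
  obtain K where K: "\<And>x j. 1 / 2 \<le> kern2 \<theta> n \<tau> K x j" using kern2_eventually_ge_half[OF \<theta> S] by blast
  have mass: "ennreal ((1 + \<delta>) ^ m * c powr p) \<le> (\<integral>\<^sup>+\<omega>. ennreal (\<bar>Z m \<omega>\<bar> powr p) \<partial>M)" for m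
  proof (induction m)
    case 0
    show ?case using c by (simp add: Z_def total_mass_def[abs_def] emeasure_space_1)
  next
    case (Suc m)
    have [measurable]: "Z m \<in> borel_measurable M" using ZF by (rule measurable_F_M)
    have "ennreal ((1 + \<delta>) ^ Suc m * c powr p) = ennreal (1 + \<delta>) * ennreal ((1 + \<delta>) ^ m * c powr p)"
      using \<delta> by (subst ennreal_mult[symmetric]) (auto simp: mult.assoc)
    also have "\<dots> \<le> ennreal (1 + \<delta>) * (\<integral>\<^sup>+\<omega>. ennreal (\<bar>Z m \<omega>\<bar> powr p) \<partial>M)" by (intro mult_left_mono Suc) simp
    also have "\<dots> = (\<integral>\<^sup>+\<omega>. ennreal ((1 + \<delta>) * \<bar>Z m \<omega>\<bar> powr p) \<partial>M)"
      using \<delta> by (subst nn_integral_cmult[symmetric]) (auto simp: ennreal_mult)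
    also have "\<dots> \<le> (\<integral>\<^sup>+\<omega>. (\<integral>\<^sup>+\<omega>'. ennreal (\<bar>Z m \<omega> + (\<Sum>j<n. (1 * \<sigma> (V m j \<omega>)) * incr b n \<tau> m j \<omega>')\<bar> powr p) \<partial>M) \<partial>M)"
      using big[of m] by (intro nn_integral_mono_AE) (auto elim!: eventually_mono intro!: grow)
    also have "\<dots> = (\<integral>\<^sup>+\<omega>. ennreal (\<bar>Z m \<omega> + (\<Sum>j<n. (1 * \<sigma> (V m j \<omega>)) * incr b n \<tau> m j \<omega>)\<bar> powr p) \<partial>M)"
      by (rule conditional_step[OF \<tau> n ZF \<sigma>VF, symmetric])
    also have "\<dots> = (\<integral>\<^sup>+\<omega>. ennreal (\<bar>Z (Suc m) \<omega>\<bar> powr p) \<partial>M)"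
      by (simp add: Z_def total_mass_def add.assoc)
    finally show ?case .
  qed
  define h where "h = \<kappa> * (J / 2)"
  have h: "0 < h" using \<kappa> J0 by (simp add: h_def)
  have low: "ennreal (h powr p * ((1 + \<delta>) ^ k * c powr p)) \<le> (\<integral>\<^sup>+\<omega>. ennreal (\<bar>u (real i * \<tau>) x \<omega>\<bar> powr p) \<partial>M)"
    if i: "i = Suc (K + k)" and x: "x \<in> {0..1}" for i k x
  proof -
    define Y where "Y m = scheme_rhs b \<sigma> u0 \<theta> n \<tau> i m x V" for m
    have YF: "Y m \<in> borel_measurable (F (real m * \<tau>))" for m
      unfolding Y_def by (rule scheme_rhs_measurable[OF n \<tau> \<sigma>]) (use VF in auto)
    have YSuc: "(\<integral>\<^sup>+\<omega>. ennreal (\<bar>Y (Suc m) \<omega>\<bar> powr p) \<partial>M)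
      = (\<integral>\<^sup>+\<omega>. (\<integral>\<^sup>+\<omega>'. ennreal (\<bar>Y m \<omega> + (\<Sum>j<n. (kern2 \<theta> n \<tau> (i - Suc m) x j * \<sigma> (V m j \<omega>)) * incr b n \<tau> m j \<omega>')\<bar> powr p) \<partial>M) \<partial>M)" for m
      by (subst conditional_step[OF \<tau> n YF \<sigma>VF, symmetric]) (simp_all only: Y_def scheme_rhs_Suc)
    have mono: "(\<integral>\<^sup>+\<omega>. ennreal (\<bar>Y (Suc k) \<omega>\<bar> powr p) \<partial>M) \<le> (\<integral>\<^sup>+\<omega>. ennreal (\<bar>Y (Suc k + r) \<omega>\<bar> powr p) \<partial>M)" for r
    proof (induction r)
      case (Suc r)
      also have "(\<integral>\<^sup>+\<omega>. ennreal (\<bar>Y (Suc k + r) \<omega>\<bar> powr p) \<partial>M) \<le> (\<integral>\<^sup>+\<omega>. ennreal (\<bar>Y (Suc (Suc k + r)) \<omega>\<bar> powr p) \<partial>M)"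
        unfolding YSuc using p by (intro nn_integral_mono incr_moment_lower[OF \<tau>]) auto
      finally show ?case by (simp only: add_Suc_right)
    qed simp
    have [measurable]: "Z k \<in> borel_measurable M" using ZF by (rule measurable_F_M)
    have "ennreal (h powr p * ((1 + \<delta>) ^ k * c powr p)) = ennreal (h powr p) * ennreal ((1 + \<delta>) ^ k * c powr p)"
      using \<delta> by (intro ennreal_mult) auto
    also have "\<dots> \<le> ennreal (h powr p) * (\<integral>\<^sup>+\<omega>. ennreal (\<bar>Z k \<omega>\<bar> powr p) \<partial>M)" by (intro mult_left_mono mass) simp
    also have "\<dots> = (\<integral>\<^sup>+\<omega>. ennreal ((h * \<bar>Z k \<omega>\<bar>) powr p) \<partial>M)"
      using h by (subst nn_integral_cmult[symmetric]) (auto simp: ennreal_mult powr_mult)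
    also have "\<dots> \<le> (\<integral>\<^sup>+\<omega>. ennreal (\<bar>Y (Suc k) \<omega>\<bar> powr p) \<partial>M)"
      unfolding YSuc
    proof (rule nn_integral_mono_AE)
      show "AE \<omega> in M. ennreal ((h * \<bar>Z k \<omega>\<bar>) powr p)
        \<le> (\<integral>\<^sup>+\<omega>'. ennreal (\<bar>Y k \<omega> + (\<Sum>j<n. (kern2 \<theta> n \<tau> (i - Suc k) x j * \<sigma> (V k j \<omega>)) * incr b n \<tau> k j \<omega>')\<bar> powr p) \<partial>M)"
        using big[of k]
      proof eventually_elim
        case (elim \<omega>)
        then obtain q where q: "q < n" "J * \<bar>Z k \<omega>\<bar> \<le> \<bar>\<sigma> (V k q \<omega>)\<bar>" by blast
        define a where "a j = kern2 \<theta> n \<tau> (i - Suc k) x j * \<sigma> (V k j \<omega>)" for j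
        have "1 / 2 * (J * \<bar>Z k \<omega>\<bar>) \<le> \<bar>kern2 \<theta> n \<tau> K x q\<bar> * \<bar>\<sigma> (V k q \<omega>)\<bar>"
          using q J0 K[of x q] by (intro mult_mono) auto
        then have "J / 2 * \<bar>Z k \<omega>\<bar> \<le> \<bar>a q\<bar>" using i by (simp add: a_def abs_mult)
        then have "\<kappa> * (J / 2 * \<bar>Z k \<omega>\<bar>) \<le> \<kappa> * \<bar>a q\<bar>" using \<kappa> by (intro mult_left_mono) auto
        then have "h * \<bar>Z k \<omega>\<bar> \<le> \<kappa> * \<bar>a q\<bar>" by (simp add: h_def mult.assoc)
        also have "\<dots> \<le> (\<integral>\<omega>'. \<bar>Y k \<omega> + (\<Sum>j<n. a j * incr b n \<tau> k j \<omega>')\<bar> \<partial>M)" by (rule nd[OF q(1)])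
        finally have "ennreal ((h * \<bar>Z k \<omega>\<bar>) powr p) \<le> (\<integral>\<^sup>+\<omega>'. ennreal (\<bar>Y k \<omega> + (\<Sum>j<n. a j * incr b n \<tau> k j \<omega>')\<bar> powr p) \<partial>M)"
          using incr_comb_centered(1)[OF \<tau>] h p by (intro powr_mean_le) auto
        then show ?case by (simp only: a_def)
      qed
    qed
    also have "\<dots> \<le> (\<integral>\<^sup>+\<omega>. ennreal (\<bar>Y i \<omega>\<bar> powr p) \<partial>M)" using mono[of K] i by (simp add: add.commute)
    also have "\<dots> = (\<integral>\<^sup>+\<omega>. ennreal (\<bar>u (real i * \<tau>) x \<omega>\<bar> powr p) \<partial>M)"
    proof -
      have "1 \<le> i" using i by simp
      then have "AE \<omega> in M. u (real i * \<tau>) x \<omega> = Y i \<omega>"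
        using conjunct2[OF conjunct2[OF conjunct2[OF u']]] x by (simp add: V_def[abs_def] Y_def)
      then show ?thesis by (intro nn_integral_cong_AE) (auto elim!: eventually_mono)
    qed
    finally show ?thesis .
  qed
  show thesis
  proof (rule that[of "h powr p * c powr p / (1 + \<delta>) ^ Suc K" "ln (1 + \<delta>) / \<tau>" "Suc K"])
    show "0 < h powr p * c powr p / (1 + \<delta>) ^ Suc K" using h c \<delta> by simp
    show "0 < ln (1 + \<delta>) / \<tau>" using \<delta> \<tau> by simp
  next
    fix i x assume i: "Suc K \<le> i" and x: "x \<in> {0..1 :: real}"
    have "ln (1 + \<delta>) / \<tau> * (real i * \<tau>) = real i * ln (1 + \<delta>)" using \<tau> by simp
    then have "exp (ln (1 + \<delta>) / \<tau> * (real i * \<tau>)) = (1 + \<delta>) ^ i" using \<delta> by (simp only: exp_of_nat_mult) simp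
    moreover have "(1 + \<delta>) ^ i = (1 + \<delta>) ^ (i - Suc K) * (1 + \<delta>) ^ Suc K"
      using i by (simp only: power_add[symmetric] le_add_diff_inverse2)
    ultimately have "h powr p * c powr p / (1 + \<delta>) ^ Suc K * exp (ln (1 + \<delta>) / \<tau> * (real i * \<tau>))
      = h powr p * ((1 + \<delta>) ^ (i - Suc K) * c powr p)"
      using \<delta> by simp
    then show "ennreal (h powr p * c powr p / (1 + \<delta>) ^ Suc K * exp (ln (1 + \<delta>) / \<tau> * (real i * \<tau>)))
      \<le> (\<integral>\<^sup>+\<omega>. ennreal (\<bar>u (real i * \<tau>) x \<omega>\<bar> powr p) \<partial>M)"
      using low[of i "i - Suc K" x] i x by simp
  qed
qed

end

theorem theorem3p3:
  fixes M :: "'a measure" and F :: "real \<Rightarrow> 'a measure"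
    and lam :: "real measure" and mu :: "'a \<Rightarrow> (real \<times> real \<times> real) measure"
    and b \<theta> \<rho> \<epsilon> :: real and \<sigma> u0 :: "real \<Rightarrow> real"
  assumes "complete_filtered_prob_space M F"
    and "levy_measure lam" and "emeasure lam UNIV \<noteq> 0"
    and "levy_noise_jumps M F lam mu"
    and "\<exists>L. L-lipschitz_on UNIV \<sigma>"
    and "u0 \<in> borel_measurable (restrict_space borel {0..1})"
    and "\<forall>x\<in>{0..1}. 0 \<le> u0 x" and "\<exists>B. \<forall>x\<in>{0..1}. u0 x \<le> B"
    and "0 \<le> \<theta>" and "\<theta> \<le> 1"
    and "\<forall>p\<in>{1..<3}. abs_moment lam p < \<infinity>"
  shows
    "(\<forall>n \<tau>. step_size_condition \<theta> \<rho> \<epsilon> n \<tau> \<longrightarrow>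
        (\<exists>u. mild_solution M F lam mu b \<sigma> u0 \<theta> n \<tau> u \<and>
           (\<forall>v. mild_solution M F lam mu b \<sigma> u0 \<theta> n \<tau> v \<longrightarrow>
              (\<forall>i::nat. \<forall>x\<in>{0..1}. AE \<omega> in M. v (real i * \<tau>) x \<omega> = u (real i * \<tau>) x \<omega>))))
     \<and> (\<forall>p\<in>{1..<3}. \<exists>C>0. \<forall>n \<tau> u.
          step_size_condition \<theta> \<rho> \<epsilon> n \<tau> \<longrightarrow> mild_solution M F lam mu b \<sigma> u0 \<theta> n \<tau> u \<longrightarrow>
          (\<forall>i::nat. i \<ge> 1 \<longrightarrow>
             (SUP x\<in>{0..1}. moment M u p (real i * \<tau>) (kappa_space n x))
               \<le> ennreal (C * exp (C * (real i * \<tau>)))))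
     \<and> (L_const \<sigma> > 0 \<longrightarrow> J_const \<sigma> > 0 \<longrightarrow> (\<exists>c>0. \<forall>x\<in>{0..1}. u0 x = c) \<longrightarrow>
        b = - (LINT z:{z. 1 < \<bar>z\<bar>}|lam. z) \<longrightarrow>
        (\<forall>n \<tau> u. step_size_condition \<theta> \<rho> \<epsilon> n \<tau> \<longrightarrow>
           mild_solution M F lam mu b \<sigma> u0 \<theta> n \<tau> u \<longrightarrow>
           (\<forall>p\<in>{1<..<3}. weakly_intermittent M u n \<tau> p)))"
proof -
  interpret levy_noise M F lam mu
    using assms by unfold_locales auto
  obtain L where L: "L-lipschitz_on UNIV \<sigma>" using assms(5) by blast
  have \<sigma>: "\<sigma> \<in> borel_measurable borel"
    using lipschitz_on_continuous_on[OF L] by (rule borel_measurable_continuous_onI)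
  obtain B0 where B0: "\<forall>x\<in>{0..1}. u0 x \<le> B0" using assms(8) by blast
  have B: "0 \<le> max B0 0" "\<forall>y\<in>{0..1}. \<bar>u0 y\<bar> \<le> max B0 0" using B0 assms(7) by (auto simp: le_max_iff_disj)
  show ?thesis
  proof (intro conjI allI impI ballI)
    fix n \<tau> assume "step_size_condition \<theta> \<rho> \<epsilon> n \<tau>"
    then have n: "0 < n" and \<tau>: "0 < \<tau>" by (auto simp: step_size_condition_def)
    obtain u where "mild_solution M F lam mu b \<sigma> u0 \<theta> n \<tau> u" using mild_solution_exists[OF n \<tau> \<sigma>] by blast
    then show "\<exists>u. mild_solution M F lam mu b \<sigma> u0 \<theta> n \<tau> u \<and>
           (\<forall>v. mild_solution M F lam mu b \<sigma> u0 \<theta> n \<tau> v \<longrightarrow>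
              (\<forall>i::nat. \<forall>x\<in>{0..1}. AE \<omega> in M. v (real i * \<tau>) x \<omega> = u (real i * \<tau>) x \<omega>))"
      using mild_solution_unique[OF n \<tau> \<sigma>] by blast
  next
    fix p :: real assume "p \<in> {1..<3}"
    then have p: "1 \<le> p" "p < 3" by auto
    obtain C where "0 < C" and "\<And>n \<tau> u i. step_size_condition \<theta> \<rho> \<epsilon> n \<tau> \<Longrightarrow> mild_solution M F lam mu b \<sigma> u0 \<theta> n \<tau> u \<Longrightarrow>
      (SUP x\<in>{0..1}. moment M u p (real i * \<tau>) (kappa_space n x)) \<le> ennreal (C * exp (C * (real i * \<tau>)))"
      using moment_bound[OF assms(9,10) p L B, where b = b and \<rho> = \<rho> and \<epsilon> = \<epsilon>] by blast
    then show "\<exists>C>0. \<forall>n \<tau> u.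
          step_size_condition \<theta> \<rho> \<epsilon> n \<tau> \<longrightarrow> mild_solution M F lam mu b \<sigma> u0 \<theta> n \<tau> u \<longrightarrow>
          (\<forall>i::nat. i \<ge> 1 \<longrightarrow>
             (SUP x\<in>{0..1}. moment M u p (real i * \<tau>) (kappa_space n x))
               \<le> ennreal (C * exp (C * (real i * \<tau>))))"
      by blast
  next
    fix n \<tau> u and p :: real
    assume J: "0 < J_const \<sigma>" and c: "\<exists>c>0. \<forall>x\<in>{0..1}. u0 x = c" and b: "b = - (LINT z:{z. 1 < \<bar>z\<bar>}|lam. z)"
      and S: "step_size_condition \<theta> \<rho> \<epsilon> n \<tau>" and u: "mild_solution M F lam mu b \<sigma> u0 \<theta> n \<tau> u" and p: "p \<in> {1<..<3}"
    interpret centered_levy_noise M F lam mu b using b by unfold_locales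
    have n: "0 < n" and \<tau>: "0 < \<tau>" using S by (auto simp: step_size_condition_def)
    have p': "1 \<le> p" "p < 3" "1 < p" using p by auto
    obtain c where c: "0 < c" "\<forall>y\<in>{0..1}. u0 y = c" using c by blast
    obtain C where "0 < C" and "\<And>n \<tau> u i. step_size_condition \<theta> \<rho> \<epsilon> n \<tau> \<Longrightarrow> mild_solution M F lam mu b \<sigma> u0 \<theta> n \<tau> u \<Longrightarrow>
      (SUP x\<in>{0..1}. moment M u p (real i * \<tau>) (kappa_space n x)) \<le> ennreal (C * exp (C * (real i * \<tau>)))"
      using moment_bound[OF assms(9,10) p'(1,2) L B, where b = b and \<rho> = \<rho> and \<epsilon> = \<epsilon>] by blast
    note upper = this
    obtain a g K where "0 < a" "0 < g"
      and "\<And>i x. K \<le> i \<Longrightarrow> x \<in> {0..1} \<Longrightarrow> ennreal (a * exp (g * (real i * \<tau>))) \<le> (\<integral>\<^sup>+\<omega>. ennreal (\<bar>u (real i * \<tau>) x \<omega>\<bar> powr p) \<partial>M)"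
      using intermittency_lower_bound[OF assms(9,10) S \<sigma> J c u p'(3)] by blast
    note lower = this
    show "weakly_intermittent M u n \<tau> p"
    proof (rule weakly_intermittentI[OF \<tau> lower(1,2) upper(1)])
      show "(SUP x\<in>{0..1}. moment M u p (real i * \<tau>) (kappa_space n x)) \<le> ennreal (C * exp (C * (real i * \<tau>)))" for i
        by (rule upper(2)[OF S u])
      show "ennreal (a * exp (g * (real i * \<tau>))) \<le> moment M u p (real i * \<tau>) (kappa_space n x)" if "K \<le> i" "x \<in> {0..1}" for i x
        unfolding moment_def by (rule lower(3)[OF that(1) kappa_space_unit[OF n that(2)]])
    qed
  qed
qed

end
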